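(* Let $\pi$ be a cut-free DR-net of conclusion $A$, and fix a swap-sensitive model of linear logic with linear category $\mathcal L$. Then $\pi$ is in $\mathbf{L^3}$ if and only if $[\![\pi]\!]$ is a morphism of $\mathrm{Inv}(\mathcal L)$ from $(1,(id_1)_{k\in\mathbb Z})$ to $[\![A^+]\!]$.
   Context: Nets/DR-nets: linear logic proof structures extended with a self-dual modality $\S$, built from links axiom ($\to A^\bot,A$), cut, one, bottom, tensor, par, flat ($A\to\flat A$), pax ($\flat A\to\flat A$), why not ($\flat A,\ldots,\flat A\to ?A$), of course ($A\to !A$), paragraph ($A\to\S A$) and boxes (an of course link plus pax links bordering a subnet); a DR-net is a net all of whose switchings (keep one premise of each par/why not link, collapse outermost boxes) are acyclic, recursively in boxes, with no $\flat$-formula conclusion. An exponential indexing: $I$: edges $\to\mathbb Z$, equal indices on axiom conclusions, on cut premises, on premises and conclusion of tensor, par, flat, pax links; each premise of paragraph, of course, why not links indexed one more than the conclusion; all conclusions equally indexed. $\mathbf{L^3}$ is the set of DR-nets admitting one. A model of linear logic: $\ast$-autonomous $(\mathcal L,\otimes,1,\bot)$ with products, Cartesian $\mathcal M$ and a symmetric monoidal adjunction $L\dashv M$; it interprets formulas and proofs in $\mathcal L$; non-trivial if two proofs of some formula get different interpretations, which yields an object $\Xi$ with $\gamma_{\Xi,\Xi}\neq id_{\Xi\otimes\Xi}$ ($\gamma$ the symmetry). $\mathrm{Inv}(\mathcal L)$: objects $(A,s)$, $s=(s_k)_{k\in\mathbb Z}$ involutive automorphisms of $A$; morphisms $(A,s)\to(B,t)$: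 $f:A\to B$ with $t_kfs_k=f$ for all $k$; it is a model with componentwise induced structure, and $\S(A,s)=(A,(s_{k-1})_k)$ (identity on morphisms) interprets the paragraph. Default assignment: every atom $\mapsto(\Xi\otimes\Xi,\xi)$ with $\xi_0=\gamma_{\Xi,\Xi}$, $\xi_k=id$ for $k\neq0$; $[\![\cdot]\!]$ the resulting interpretation; a DR-net $\pi$ of conclusion $A$ is interpreted (paragraph links acting as identities) by an arrow $1\to$ underlying object of $[\![A]\!]$. $A^+$ replaces each $!$ by $!\S$ and each $?$ by $?\S$. Syntactic category $\mathbf{PN}$: objects formulas, morphisms $A\to B$ cut-free $\eta$-expanded DR-nets of conclusions $A^\bot,B$, composition by cut and cut-elimination. $\mathcal X:\mathbf{PN}\to\mathcal L$ is the functor given by the model's interpretation under the assignment sending every atom to $\Xi$. For a fixed atom $X$, $id_{X\otimes X}$ is the net of two axioms on $X$ whose $X^\bot$'s enter a par and $X$'s enter a tensor, the first axiom feeding both left premises; $\gamma_{X,X}$ is the same with the first axiom feeding the left premise of the tensor and the right premise of the par. For nets $\pi',\pi$: $\pi'\prec\pi$ iff $\pi'$ is obtained from $\pi$ by replacing a non-null number of subnets $id_{X\otimes X}$ by $\gamma_{X,X}$. The model is swap-sensitive if it is non-trivial and for every cut-free $\eta$-expanded DR-net $\pi$, $\pi'\prec\pi$ implies $\mathcal X(\pi')\neq\mathcal X(\pi)$.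
   Formalization: It is additionally assumed that every axiom link of π introduces a formula containing an atom; otherwise the claim fails: an axiom on ⊥,1 with a paragraph link on ⊥ and a par link (conclusion §⊥⅋1) is not in L³, yet its interpretation is a morphism of Inv(L). *)

theory Defs
  imports Main "HOL-Library.FSet"
begin

section \<open>Formulas and nets\<close>

datatype form =
    Atom nat | NAtom nat
  | One | Bot
  | Tens form form | Par form form
  | OfCourse form | WhyNot form
  | Para form

primrec neg :: "form \<Rightarrow> form" where
  "neg (Atom x) = NAtom x"
| "neg (NAtom x) = Atom x"
| "neg One = Bot"
| "neg Bot = One"
| "neg (Tens A B) = Par (neg A) (neg B)"
| "neg (Par A B) = Tens (neg A) (neg B)"
| "neg (OfCourse A) = WhyNot (neg A)"
| "neg (WhyNot A) = OfCourse (neg A)"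
| "neg (Para A) = Para (neg A)"

primrec atoms :: "form \<Rightarrow> nat set" where
  "atoms (Atom x) = {x}"
| "atoms (NAtom x) = {x}"
| "atoms One = {}"
| "atoms Bot = {}"
| "atoms (Tens A B) = atoms A \<union> atoms B"
| "atoms (Par A B) = atoms A \<union> atoms B"
| "atoms (OfCourse A) = atoms A"
| "atoms (WhyNot A) = atoms A"
| "atoms (Para A) = atoms A"

primrec plus_form :: "form \<Rightarrow> form" where
  "plus_form (Atom x) = Atom x"
| "plus_form (NAtom x) = NAtom x"
| "plus_form One = One"
| "plus_form Bot = Bot"
| "plus_form (Tens A B) = Tens (plus_form A) (plus_form B)"
| "plus_form (Par A B) = Par (plus_form A) (plus_form B)"
| "plus_form (OfCourse A) = OfCourse (Para (plus_form A))"
| "plus_form (WhyNot A) = WhyNot (Para (plus_form A))"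
| "plus_form (Para A) = Para (plus_form A)"

text \<open>Edges carry a formula or a flat formula; \<open>\<flat>\<close> cannot be nested in formulas.\<close>

datatype label = Fm form | Flat form

type_synonym edge = nat

text \<open>In every link the premises come first and the conclusion last. \<open>BoxL S p c P\<close> is a whole
  box: the of course link with premise \<open>p\<close> and conclusion \<open>c\<close>, a pax link with premise \<open>x\<close> and
  conclusion \<open>y\<close> for every \<open>(x, y)\<close> in \<open>P\<close>, and the subnet \<open>S\<close> that they border, whose
  conclusions are \<open>p\<close> and the premises of the pax links. Seen from outside it is a link without
  premises, which is what collapsing it in a switching means. Names of edges are unique through
  all depths, so that labels and indexings are functions on edges.\<close>

datatype link =
    AxL edge edge
  | CutL edge edge
  | OneL edge
  | BotL edge
  | TensL edge edge edge
  | ParL edge edge edge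
  | FlatL edge edge
  | WhyNotL "edge fset" edge
  | ParaL edge edge
  | BoxL "link fset" edge edge "(edge \<times> edge) fset"

record net =
  links :: "link fset"
  label :: "edge \<Rightarrow> label"

fun prems :: "link \<Rightarrow> edge set" where
  "prems (AxL a b) = {}"
| "prems (CutL a b) = {a, b}"
| "prems (OneL c) = {}"
| "prems (BotL c) = {}"
| "prems (TensL a b c) = {a, b}"
| "prems (ParL a b c) = {a, b}"
| "prems (FlatL a c) = {a}"
| "prems (WhyNotL E c) = fset E"
| "prems (ParaL a c) = {a}"
| "prems (BoxL S p c P) = {}"

fun concls :: "link \<Rightarrow> edge set" where
  "concls (AxL a b) = {a, b}"
| "concls (CutL a b) = {}"
| "concls (OneL c) = {c}"
| "concls (BotL c) = {c}"
| "concls (TensL a b c) = {c}"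
| "concls (ParL a b c) = {c}"
| "concls (FlatL a c) = {c}"
| "concls (WhyNotL E c) = {c}"
| "concls (ParaL a c) = {c}"
| "concls (BoxL S p c P) = insert c (snd ` fset P)"

fun link_typed :: "(edge \<Rightarrow> label) \<Rightarrow> link \<Rightarrow> bool" where
  "link_typed lab (AxL a b) \<longleftrightarrow> a \<noteq> b \<and> (\<exists>A. lab a = Fm (neg A) \<and> lab b = Fm A)"
| "link_typed lab (CutL a b) \<longleftrightarrow> a \<noteq> b \<and> (\<exists>A. lab a = Fm A \<and> lab b = Fm (neg A))"
| "link_typed lab (OneL c) \<longleftrightarrow> lab c = Fm One"
| "link_typed lab (BotL c) \<longleftrightarrow> lab c = Fm Bot"
| "link_typed lab (TensL a b c) \<longleftrightarrow>
     a \<noteq> b \<and> (\<exists>A B. lab a = Fm A \<and> lab b = Fm B \<and> lab c = Fm (Tens A B))"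
| "link_typed lab (ParL a b c) \<longleftrightarrow>
     a \<noteq> b \<and> (\<exists>A B. lab a = Fm A \<and> lab b = Fm B \<and> lab c = Fm (Par A B))"
| "link_typed lab (FlatL a c) \<longleftrightarrow> (\<exists>A. lab a = Fm A \<and> lab c = Flat A)"
| "link_typed lab (WhyNotL E c) \<longleftrightarrow> (\<exists>A. (\<forall>e\<in>fset E. lab e = Flat A) \<and> lab c = Fm (WhyNot A))"
| "link_typed lab (ParaL a c) \<longleftrightarrow> (\<exists>A. lab a = Fm A \<and> lab c = Fm (Para A))"
| "link_typed lab (BoxL S p c P) \<longleftrightarrow>
     (\<exists>A. lab p = Fm A \<and> lab c = Fm (OfCourse A)) \<and>
     inj_on fst (fset P) \<and> inj_on snd (fset P) \<and>
     (\<forall>(x, y)\<in>fset P. \<exists>B. lab x = Flat B \<and> lab y = Flat B)"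

inductive edge_in :: "edge \<Rightarrow> link \<Rightarrow> bool" where
  "e \<in> concls l \<Longrightarrow> edge_in e l"
| "l |\<in>| S \<Longrightarrow> edge_in e l \<Longrightarrow> edge_in e (BoxL S p c P)"

definition conclusions :: "link fset \<Rightarrow> edge set" where
  "conclusions R = (\<Union>l\<in>fset R. concls l) - (\<Union>l\<in>fset R. prems l)"

inductive well_formed :: "(edge \<Rightarrow> label) \<Rightarrow> link fset \<Rightarrow> bool" for lab where
  "\<lbrakk> \<forall>l. l |\<in>| R \<longrightarrow> link_typed lab l \<and> prems l \<subseteq> (\<Union>l'\<in>fset R. concls l');
     \<forall>l l'. l |\<in>| R \<longrightarrow> l' |\<in>| R \<longrightarrow> l \<noteq> l' \<longrightarrow>
       prems l \<inter> prems l' = {} \<and> (\<forall>e. \<not> (edge_in e l \<and> edge_in e l'));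
     \<forall>S p c P. BoxL S p c P |\<in>| R \<longrightarrow>
       well_formed lab S \<and> conclusions S = insert p (fst ` fset P) \<and>
       (\<forall>l e. l |\<in>| S \<longrightarrow> edge_in e l \<longrightarrow> e \<notin> concls (BoxL S p c P)) \<rbrakk>
   \<Longrightarrow> well_formed lab R"

definition is_net :: "net \<Rightarrow> bool" where
  "is_net \<pi> \<longleftrightarrow> well_formed (label \<pi>) (links \<pi>)"

text \<open>\<open>level R S\<close>: \<open>S\<close> is \<open>R\<close> itself or the content of a box of \<open>R\<close>, at any depth.\<close>

inductive level :: "link fset \<Rightarrow> link fset \<Rightarrow> bool" where
  "level R R"
| "BoxL S p c P |\<in>| R \<Longrightarrow> level S T \<Longrightarrow> level R T"

definition all_links :: "net \<Rightarrow> link set" where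
  "all_links \<pi> = {l. \<exists>S. level (links \<pi>) S \<and> l |\<in>| S}"

definition has_conclusion :: "net \<Rightarrow> form \<Rightarrow> bool" where
  "has_conclusion \<pi> A \<longleftrightarrow> (\<exists>c. conclusions (links \<pi>) = {c} \<and> label \<pi> c = Fm A)"

section \<open>Correctness\<close>

definition switching :: "link fset \<Rightarrow> (link \<Rightarrow> edge) \<Rightarrow> bool" where
  "switching R \<sigma> \<longleftrightarrow>
     (\<forall>a b c. ParL a b c |\<in>| R \<longrightarrow> \<sigma> (ParL a b c) \<in> {a, b}) \<and>
     (\<forall>E c. WhyNotL E c |\<in>| R \<longrightarrow> E \<noteq> {||} \<longrightarrow> \<sigma> (WhyNotL E c) |\<in>| E)"

fun kept :: "(link \<Rightarrow> edge) \<Rightarrow> link \<Rightarrow> edge set" where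
  "kept \<sigma> (ParL a b c) = {\<sigma> (ParL a b c)}"
| "kept \<sigma> (WhyNotL E c) = fset E \<inter> {\<sigma> (WhyNotL E c)}"
| "kept \<sigma> l = prems l"

definition joins :: "link fset \<Rightarrow> (link \<Rightarrow> edge) \<Rightarrow> edge \<Rightarrow> link \<Rightarrow> link \<Rightarrow> bool" where
  "joins R \<sigma> e l l' \<longleftrightarrow> l |\<in>| R \<and> l' |\<in>| R \<and>
     (e \<in> concls l \<and> e \<in> kept \<sigma> l' \<or> e \<in> concls l' \<and> e \<in> kept \<sigma> l)"

text \<open>A cycle of the undirected multigraph whose vertices are the links of \<open>R\<close>.\<close>

definition cyclic :: "link fset \<Rightarrow> (link \<Rightarrow> edge) \<Rightarrow> bool" where
  "cyclic R \<sigma> \<longleftrightarrow> (\<exists>es ls. es \<noteq> [] \<and> length ls = length es \<and> distinct es \<and> distinct ls \<and>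
     (\<forall>i<length es. joins R \<sigma> (es ! i) (ls ! i) (ls ! (Suc i mod length es))))"

definition DR_net :: "net \<Rightarrow> bool" where
  "DR_net \<pi> \<longleftrightarrow> is_net \<pi> \<and>
     (\<forall>S \<sigma>. level (links \<pi>) S \<longrightarrow> switching S \<sigma> \<longrightarrow> \<not> cyclic S \<sigma>) \<and>
     (\<forall>e\<in>conclusions (links \<pi>). \<exists>A. label \<pi> e = Fm A)"

definition cut_free :: "net \<Rightarrow> bool" where
  "cut_free \<pi> \<longleftrightarrow> (\<forall>a b. CutL a b \<notin> all_links \<pi>)"

definition eta_expanded :: "net \<Rightarrow> bool" where
  "eta_expanded \<pi> \<longleftrightarrow>
     (\<forall>a b. AxL a b \<in> all_links \<pi> \<longrightarrow> (\<exists>x. label \<pi> b \<in> {Fm (Atom x), Fm (NAtom x)}))"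

fun index_ok :: "(edge \<Rightarrow> int) \<Rightarrow> link \<Rightarrow> bool" where
  "index_ok I (AxL a b) \<longleftrightarrow> I a = I b"
| "index_ok I (CutL a b) \<longleftrightarrow> I a = I b"
| "index_ok I (OneL c) \<longleftrightarrow> True"
| "index_ok I (BotL c) \<longleftrightarrow> True"
| "index_ok I (TensL a b c) \<longleftrightarrow> I a = I c \<and> I b = I c"
| "index_ok I (ParL a b c) \<longleftrightarrow> I a = I c \<and> I b = I c"
| "index_ok I (FlatL a c) \<longleftrightarrow> I a = I c"
| "index_ok I (WhyNotL E c) \<longleftrightarrow> (\<forall>e\<in>fset E. I e = I c + 1)"
| "index_ok I (ParaL a c) \<longleftrightarrow> I a = I c + 1"
| "index_ok I (BoxL S p c P) \<longleftrightarrow> I p = I c + 1 \<and> (\<forall>(x, y)\<in>fset P. I x = I y)"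

definition exponential_indexing :: "net \<Rightarrow> (edge \<Rightarrow> int) \<Rightarrow> bool" where
  "exponential_indexing \<pi> I \<longleftrightarrow> (\<forall>l\<in>all_links \<pi>. index_ok I l) \<and>
     (\<forall>e\<in>conclusions (links \<pi>). \<forall>e'\<in>conclusions (links \<pi>). I e = I e')"

definition in_L3 :: "net \<Rightarrow> bool" where
  "in_L3 \<pi> \<longleftrightarrow> DR_net \<pi> \<and> (\<exists>I. exponential_indexing \<pi> I)"

text \<open>One replacement of a subnet \<open>id\<^bsub>X\<otimes>X\<^esub>\<close> by \<open>\<gamma>\<^bsub>X,X\<^esub>\<close>: with the edges named as here, the two nets
  differ in the order of the premises of the par link. Either order of the conclusions of an
  axiom link is possible. A replacement creates no further subnet \<open>id\<^bsub>X\<otimes>X\<^esub>\<close>, so iterating it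
  replaces several of the subnets present initially.\<close>

definition atomic_axiom :: "nat \<Rightarrow> (edge \<Rightarrow> label) \<Rightarrow> link fset \<Rightarrow> edge \<Rightarrow> edge \<Rightarrow> bool" where
  "atomic_axiom X lab R a b \<longleftrightarrow>
     (AxL a b |\<in>| R \<or> AxL b a |\<in>| R) \<and> lab a = Fm (NAtom X) \<and> lab b = Fm (Atom X)"

inductive swap_step :: "nat \<Rightarrow> (edge \<Rightarrow> label) \<Rightarrow> link fset \<Rightarrow> link fset \<Rightarrow> bool" for X lab where
  here: "\<lbrakk> atomic_axiom X lab R a b; atomic_axiom X lab R a' b';
     ParL a a' c |\<in>| R; TensL b b' d |\<in>| R \<rbrakk>
   \<Longrightarrow> swap_step X lab R (finsert (ParL a' a c) (R |-| {|ParL a a' c|}))"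
| inside: "\<lbrakk> BoxL S p c P |\<in>| R; swap_step X lab S S' \<rbrakk>
   \<Longrightarrow> swap_step X lab R (finsert (BoxL S' p c P) (R |-| {|BoxL S p c P|}))"

definition precedes :: "nat \<Rightarrow> net \<Rightarrow> net \<Rightarrow> bool" where
  "precedes X \<pi>' \<pi> \<longleftrightarrow> label \<pi>' = label \<pi> \<and> (swap_step X (label \<pi>))\<^sup>+\<^sup>+ (links \<pi>) (links \<pi>')"

section \<open>Symmetric monoidal categories\<close>

text \<open>Hom-sets need not be disjoint; operations on arrows are only constrained on composable
  arrows between objects.\<close>

record ('o, 'a) mcat =
  Obj :: "'o set"
  Hom :: "'o \<Rightarrow> 'o \<Rightarrow> 'a set"
  Id :: "'o \<Rightarrow> 'a"
  Comp :: "'a \<Rightarrow> 'a \<Rightarrow> 'a" (infixr "\<cdot>\<index>" 55)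
  Ten :: "'o \<Rightarrow> 'o \<Rightarrow> 'o" (infixr "\<otimes>\<index>" 60)
  Tena :: "'a \<Rightarrow> 'a \<Rightarrow> 'a" (infixr "\<odot>\<index>" 60)
  Unit :: "'o"
  Assoc :: "'o \<Rightarrow> 'o \<Rightarrow> 'o \<Rightarrow> 'a"
  LUnit :: "'o \<Rightarrow> 'a"
  RUnit :: "'o \<Rightarrow> 'a"
  Sym :: "'o \<Rightarrow> 'o \<Rightarrow> 'a"

definition is_inverse :: "('o, 'a) mcat \<Rightarrow> 'o \<Rightarrow> 'o \<Rightarrow> 'a \<Rightarrow> 'a \<Rightarrow> bool" where
  "is_inverse C a b f g \<longleftrightarrow>
     f \<in> Hom C a b \<and> g \<in> Hom C b a \<and> g \<cdot>\<^bsub>C\<^esub> f = Id C a \<and> f \<cdot>\<^bsub>C\<^esub> g = Id C b"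

definition is_iso :: "('o, 'a) mcat \<Rightarrow> 'o \<Rightarrow> 'o \<Rightarrow> 'a \<Rightarrow> bool" where
  "is_iso C a b f \<longleftrightarrow> (\<exists>g. is_inverse C a b f g)"

definition iso_inv :: "('o, 'a) mcat \<Rightarrow> 'o \<Rightarrow> 'o \<Rightarrow> 'a \<Rightarrow> 'a" where
  "iso_inv C a b f = (THE g. is_inverse C a b f g)"

definition category :: "('o, 'a) mcat \<Rightarrow> bool" where
  "category C \<longleftrightarrow>
     (\<forall>a\<in>Obj C. Id C a \<in> Hom C a a) \<and>
     (\<forall>a\<in>Obj C. \<forall>b\<in>Obj C. \<forall>f\<in>Hom C a b. f \<cdot>\<^bsub>C\<^esub> Id C a = f \<and> Id C b \<cdot>\<^bsub>C\<^esub> f = f) \<and>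
     (\<forall>a\<in>Obj C. \<forall>b\<in>Obj C. \<forall>c\<in>Obj C. \<forall>f\<in>Hom C a b. \<forall>g\<in>Hom C b c. g \<cdot>\<^bsub>C\<^esub> f \<in> Hom C a c) \<and>
     (\<forall>a\<in>Obj C. \<forall>b\<in>Obj C. \<forall>c\<in>Obj C. \<forall>d\<in>Obj C.
        \<forall>f\<in>Hom C a b. \<forall>g\<in>Hom C b c. \<forall>h\<in>Hom C c d. (h \<cdot>\<^bsub>C\<^esub> g) \<cdot>\<^bsub>C\<^esub> f = h \<cdot>\<^bsub>C\<^esub> (g \<cdot>\<^bsub>C\<^esub> f))"

definition tensor_bifunctor :: "('o, 'a) mcat \<Rightarrow> bool" where
  "tensor_bifunctor C \<longleftrightarrow>
     Unit C \<in> Obj C \<and>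
     (\<forall>a\<in>Obj C. \<forall>b\<in>Obj C. a \<otimes>\<^bsub>C\<^esub> b \<in> Obj C \<and> Id C a \<odot>\<^bsub>C\<^esub> Id C b = Id C (a \<otimes>\<^bsub>C\<^esub> b)) \<and>
     (\<forall>a\<in>Obj C. \<forall>b\<in>Obj C. \<forall>a'\<in>Obj C. \<forall>b'\<in>Obj C. \<forall>f\<in>Hom C a b. \<forall>f'\<in>Hom C a' b'.
        f \<odot>\<^bsub>C\<^esub> f' \<in> Hom C (a \<otimes>\<^bsub>C\<^esub> a') (b \<otimes>\<^bsub>C\<^esub> b')) \<and>
     (\<forall>a\<in>Obj C. \<forall>b\<in>Obj C. \<forall>c\<in>Obj C. \<forall>a'\<in>Obj C. \<forall>b'\<in>Obj C. \<forall>c'\<in>Obj C.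
        \<forall>f\<in>Hom C a b. \<forall>g\<in>Hom C b c. \<forall>f'\<in>Hom C a' b'. \<forall>g'\<in>Hom C b' c'.
        (g \<cdot>\<^bsub>C\<^esub> f) \<odot>\<^bsub>C\<^esub> (g' \<cdot>\<^bsub>C\<^esub> f') = (g \<odot>\<^bsub>C\<^esub> g') \<cdot>\<^bsub>C\<^esub> (f \<odot>\<^bsub>C\<^esub> f'))"

definition symmetric_monoidal :: "('o, 'a) mcat \<Rightarrow> bool" where
  "symmetric_monoidal C \<longleftrightarrow> category C \<and> tensor_bifunctor C \<and>
     (\<forall>a\<in>Obj C. is_iso C (Unit C \<otimes>\<^bsub>C\<^esub> a) a (LUnit C a) \<and> is_iso C (a \<otimes>\<^bsub>C\<^esub> Unit C) a (RUnit C a)) \<and>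
     (\<forall>a\<in>Obj C. \<forall>b\<in>Obj C. Sym C a b \<in> Hom C (a \<otimes>\<^bsub>C\<^esub> b) (b \<otimes>\<^bsub>C\<^esub> a) \<and>
        Sym C b a \<cdot>\<^bsub>C\<^esub> Sym C a b = Id C (a \<otimes>\<^bsub>C\<^esub> b)) \<and>
     (\<forall>a\<in>Obj C. \<forall>b\<in>Obj C. \<forall>c\<in>Obj C.
        is_iso C ((a \<otimes>\<^bsub>C\<^esub> b) \<otimes>\<^bsub>C\<^esub> c) (a \<otimes>\<^bsub>C\<^esub> (b \<otimes>\<^bsub>C\<^esub> c)) (Assoc C a b c)) \<and>
     \<comment> \<open>naturality\<close>
     (\<forall>a\<in>Obj C. \<forall>b\<in>Obj C. \<forall>f\<in>Hom C a b.
        LUnit C b \<cdot>\<^bsub>C\<^esub> (Id C (Unit C) \<odot>\<^bsub>C\<^esub> f) = f \<cdot>\<^bsub>C\<^esub> LUnit C a \<and>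
        RUnit C b \<cdot>\<^bsub>C\<^esub> (f \<odot>\<^bsub>C\<^esub> Id C (Unit C)) = f \<cdot>\<^bsub>C\<^esub> RUnit C a) \<and>
     (\<forall>a\<in>Obj C. \<forall>b\<in>Obj C. \<forall>a'\<in>Obj C. \<forall>b'\<in>Obj C. \<forall>f\<in>Hom C a b. \<forall>f'\<in>Hom C a' b'.
        Sym C b b' \<cdot>\<^bsub>C\<^esub> (f \<odot>\<^bsub>C\<^esub> f') = (f' \<odot>\<^bsub>C\<^esub> f) \<cdot>\<^bsub>C\<^esub> Sym C a a') \<and>
     (\<forall>a\<in>Obj C. \<forall>b\<in>Obj C. \<forall>a'\<in>Obj C. \<forall>b'\<in>Obj C. \<forall>a''\<in>Obj C. \<forall>b''\<in>Obj C.
        \<forall>f\<in>Hom C a b. \<forall>f'\<in>Hom C a' b'. \<forall>f''\<in>Hom C a'' b''.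
        Assoc C b b' b'' \<cdot>\<^bsub>C\<^esub> ((f \<odot>\<^bsub>C\<^esub> f') \<odot>\<^bsub>C\<^esub> f'') = (f \<odot>\<^bsub>C\<^esub> (f' \<odot>\<^bsub>C\<^esub> f'')) \<cdot>\<^bsub>C\<^esub> Assoc C a a' a'') \<and>
     \<comment> \<open>pentagon, triangle, hexagon\<close>
     (\<forall>a\<in>Obj C. \<forall>b\<in>Obj C. \<forall>c\<in>Obj C. \<forall>d\<in>Obj C.
        Assoc C a b (c \<otimes>\<^bsub>C\<^esub> d) \<cdot>\<^bsub>C\<^esub> Assoc C (a \<otimes>\<^bsub>C\<^esub> b) c d =
        (Id C a \<odot>\<^bsub>C\<^esub> Assoc C b c d) \<cdot>\<^bsub>C\<^esub> Assoc C a (b \<otimes>\<^bsub>C\<^esub> c) d \<cdot>\<^bsub>C\<^esub> (Assoc C a b c \<odot>\<^bsub>C\<^esub> Id C d)) \<and>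
     (\<forall>a\<in>Obj C. \<forall>b\<in>Obj C.
        (Id C a \<odot>\<^bsub>C\<^esub> LUnit C b) \<cdot>\<^bsub>C\<^esub> Assoc C a (Unit C) b = RUnit C a \<odot>\<^bsub>C\<^esub> Id C b) \<and>
     (\<forall>a\<in>Obj C. \<forall>b\<in>Obj C. \<forall>c\<in>Obj C.
        Assoc C b c a \<cdot>\<^bsub>C\<^esub> Sym C a (b \<otimes>\<^bsub>C\<^esub> c) \<cdot>\<^bsub>C\<^esub> Assoc C a b c =
        (Id C b \<odot>\<^bsub>C\<^esub> Sym C a c) \<cdot>\<^bsub>C\<^esub> Assoc C b a c \<cdot>\<^bsub>C\<^esub> (Sym C a b \<odot>\<^bsub>C\<^esub> Id C c))"

definition terminal :: "('o, 'a) mcat \<Rightarrow> 'o \<Rightarrow> bool" where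
  "terminal C t \<longleftrightarrow> t \<in> Obj C \<and> (\<forall>a\<in>Obj C. \<exists>!f. f \<in> Hom C a t)"

definition is_product :: "('o, 'a) mcat \<Rightarrow> 'o \<Rightarrow> 'o \<Rightarrow> 'o \<Rightarrow> 'a \<Rightarrow> 'a \<Rightarrow> bool" where
  "is_product C a b p p1 p2 \<longleftrightarrow> p \<in> Obj C \<and> p1 \<in> Hom C p a \<and> p2 \<in> Hom C p b \<and>
     (\<forall>c\<in>Obj C. \<forall>f\<in>Hom C c a. \<forall>g\<in>Hom C c b.
        \<exists>!h. h \<in> Hom C c p \<and> p1 \<cdot>\<^bsub>C\<^esub> h = f \<and> p2 \<cdot>\<^bsub>C\<^esub> h = g)"

definition has_finite_products :: "('o, 'a) mcat \<Rightarrow> bool" where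
  "has_finite_products C \<longleftrightarrow> (\<exists>t. terminal C t) \<and>
     (\<forall>a\<in>Obj C. \<forall>b\<in>Obj C. \<exists>p p1 p2. is_product C a b p p1 p2)"

definition to_unit :: "('o, 'a) mcat \<Rightarrow> 'o \<Rightarrow> 'a" where
  "to_unit C a = (THE f. f \<in> Hom C a (Unit C))"

definition proj1 :: "('o, 'a) mcat \<Rightarrow> 'o \<Rightarrow> 'o \<Rightarrow> 'a" where
  "proj1 C a b = RUnit C a \<cdot>\<^bsub>C\<^esub> (Id C a \<odot>\<^bsub>C\<^esub> to_unit C b)"

definition proj2 :: "('o, 'a) mcat \<Rightarrow> 'o \<Rightarrow> 'o \<Rightarrow> 'a" where
  "proj2 C a b = LUnit C b \<cdot>\<^bsub>C\<^esub> (to_unit C a \<odot>\<^bsub>C\<^esub> Id C b)"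

definition diagonal :: "('o, 'a) mcat \<Rightarrow> 'o \<Rightarrow> 'a" where
  "diagonal C a = (THE d. d \<in> Hom C a (a \<otimes>\<^bsub>C\<^esub> a) \<and>
     proj1 C a a \<cdot>\<^bsub>C\<^esub> d = Id C a \<and> proj2 C a a \<cdot>\<^bsub>C\<^esub> d = Id C a)"

text \<open>A Cartesian category is presented through the symmetric monoidal structure given by its
  finite products.\<close>

definition cartesian :: "('o, 'a) mcat \<Rightarrow> bool" where
  "cartesian C \<longleftrightarrow> symmetric_monoidal C \<and> terminal C (Unit C) \<and>
     (\<forall>a\<in>Obj C. \<forall>b\<in>Obj C. is_product C a b (a \<otimes>\<^bsub>C\<^esub> b) (proj1 C a b) (proj2 C a b))"

definition symmetric_monoidal_functor ::
    "('o, 'a) mcat \<Rightarrow> ('p, 'b) mcat \<Rightarrow> ('o \<Rightarrow> 'p) \<Rightarrow> ('a \<Rightarrow> 'b) \<Rightarrow> ('o \<Rightarrow> 'o \<Rightarrow> 'b) \<Rightarrow> 'b \<Rightarrow> bool" where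
  "symmetric_monoidal_functor C D Fo Fa Ft Fu \<longleftrightarrow>
     (\<forall>a\<in>Obj C. Fo a \<in> Obj D \<and> Fa (Id C a) = Id D (Fo a)) \<and>
     (\<forall>a\<in>Obj C. \<forall>b\<in>Obj C. \<forall>f\<in>Hom C a b. Fa f \<in> Hom D (Fo a) (Fo b)) \<and>
     (\<forall>a\<in>Obj C. \<forall>b\<in>Obj C. \<forall>c\<in>Obj C. \<forall>f\<in>Hom C a b. \<forall>g\<in>Hom C b c.
        Fa (g \<cdot>\<^bsub>C\<^esub> f) = Fa g \<cdot>\<^bsub>D\<^esub> Fa f) \<and>
     Fu \<in> Hom D (Unit D) (Fo (Unit C)) \<and>
     (\<forall>a\<in>Obj C. \<forall>b\<in>Obj C. Ft a b \<in> Hom D (Fo a \<otimes>\<^bsub>D\<^esub> Fo b) (Fo (a \<otimes>\<^bsub>C\<^esub> b))) \<and>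
     (\<forall>a\<in>Obj C. \<forall>b\<in>Obj C. \<forall>a'\<in>Obj C. \<forall>b'\<in>Obj C. \<forall>f\<in>Hom C a b. \<forall>f'\<in>Hom C a' b'.
        Ft b b' \<cdot>\<^bsub>D\<^esub> (Fa f \<odot>\<^bsub>D\<^esub> Fa f') = Fa (f \<odot>\<^bsub>C\<^esub> f') \<cdot>\<^bsub>D\<^esub> Ft a a') \<and>
     (\<forall>a\<in>Obj C. \<forall>b\<in>Obj C. \<forall>c\<in>Obj C.
        Fa (Assoc C a b c) \<cdot>\<^bsub>D\<^esub> Ft (a \<otimes>\<^bsub>C\<^esub> b) c \<cdot>\<^bsub>D\<^esub> (Ft a b \<odot>\<^bsub>D\<^esub> Id D (Fo c)) =
        Ft a (b \<otimes>\<^bsub>C\<^esub> c) \<cdot>\<^bsub>D\<^esub> (Id D (Fo a) \<odot>\<^bsub>D\<^esub> Ft b c) \<cdot>\<^bsub>D\<^esub> Assoc D (Fo a) (Fo b) (Fo c)) \<and>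
     (\<forall>a\<in>Obj C.
        Fa (LUnit C a) \<cdot>\<^bsub>D\<^esub> Ft (Unit C) a \<cdot>\<^bsub>D\<^esub> (Fu \<odot>\<^bsub>D\<^esub> Id D (Fo a)) = LUnit D (Fo a) \<and>
        Fa (RUnit C a) \<cdot>\<^bsub>D\<^esub> Ft a (Unit C) \<cdot>\<^bsub>D\<^esub> (Id D (Fo a) \<odot>\<^bsub>D\<^esub> Fu) = RUnit D (Fo a)) \<and>
     (\<forall>a\<in>Obj C. \<forall>b\<in>Obj C. Fa (Sym C a b) \<cdot>\<^bsub>D\<^esub> Ft a b = Ft b a \<cdot>\<^bsub>D\<^esub> Sym D (Fo a) (Fo b))"

section \<open>Models of linear logic\<close>

text \<open>
  The category \<open>lin\<close> is closed (\<open>Imp\<close>, \<open>Ev\<close>, \<open>Cur\<close>) with dualizing object \<open>Dbot\<close>;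
  \<open>car\<close> is the Cartesian category. Acyclicity of switchings alone validates the mix rules, for
  which a \<open>*\<close>-autonomous category needs in addition an isomorphism from \<open>1\<close> to \<open>\<bottom>\<close>: the field
  \<open>Mix\<close> is this isomorphism, if the model has one. Without it only nets that are sequentializable
  without mix receive an interpretation.\<close>

record ('o, 'a, 'p, 'b) llmodel =
  lin :: "('o, 'a) mcat"
  Imp :: "'o \<Rightarrow> 'o \<Rightarrow> 'o"
  Ev :: "'o \<Rightarrow> 'o \<Rightarrow> 'a"
  Cur :: "'o \<Rightarrow> 'o \<Rightarrow> 'o \<Rightarrow> 'a \<Rightarrow> 'a"
  Dbot :: "'o"
  Mix :: "'a option"
  car :: "('p, 'b) mcat"
  Lo :: "'p \<Rightarrow> 'o"
  La :: "'b \<Rightarrow> 'a"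
  Lm :: "'p \<Rightarrow> 'p \<Rightarrow> 'a"
  Lu :: "'a"
  Mo :: "'o \<Rightarrow> 'p"
  Ma :: "'a \<Rightarrow> 'b"
  Mm :: "'o \<Rightarrow> 'o \<Rightarrow> 'b"
  Mu :: "'b"
  Eta :: "'p \<Rightarrow> 'b"
  Eps :: "'o \<Rightarrow> 'a"

definition closed :: "('o, 'a, 'p, 'b) llmodel \<Rightarrow> bool" where
  "closed M \<longleftrightarrow> (let C = lin M in
     (\<forall>a\<in>Obj C. \<forall>b\<in>Obj C. Imp M a b \<in> Obj C \<and> Ev M a b \<in> Hom C (Imp M a b \<otimes>\<^bsub>C\<^esub> a) b) \<and>
     (\<forall>a\<in>Obj C. \<forall>b\<in>Obj C. \<forall>c\<in>Obj C. \<forall>f\<in>Hom C (c \<otimes>\<^bsub>C\<^esub> a) b.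
        Cur M c a b f \<in> Hom C c (Imp M a b) \<and>
        Ev M a b \<cdot>\<^bsub>C\<^esub> (Cur M c a b f \<odot>\<^bsub>C\<^esub> Id C a) = f \<and>
        (\<forall>h\<in>Hom C c (Imp M a b). Ev M a b \<cdot>\<^bsub>C\<^esub> (h \<odot>\<^bsub>C\<^esub> Id C a) = f \<longrightarrow> h = Cur M c a b f)))"

definition dual :: "('o, 'a, 'p, 'b) llmodel \<Rightarrow> 'o \<Rightarrow> 'o" where
  "dual M a = Imp M a (Dbot M)"

definition name :: "('o, 'a, 'p, 'b) llmodel \<Rightarrow> 'o \<Rightarrow> 'o \<Rightarrow> 'a \<Rightarrow> 'a" where
  "name M c a f = Cur M c a (Dbot M) f"

definition ev :: "('o, 'a, 'p, 'b) llmodel \<Rightarrow> 'o \<Rightarrow> 'a" where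
  "ev M a = Ev M a (Dbot M)"

definition star_autonomous :: "('o, 'a, 'p, 'b) llmodel \<Rightarrow> bool" where
  "star_autonomous M \<longleftrightarrow> symmetric_monoidal (lin M) \<and> closed M \<and> Dbot M \<in> Obj (lin M) \<and>
     (\<forall>a\<in>Obj (lin M). is_iso (lin M) a (dual M (dual M a))
        (name M a (dual M a) (ev M a \<cdot>\<^bsub>lin M\<^esub> Sym (lin M) a (dual M a))))"

definition monoidal_adjunction :: "('o, 'a, 'p, 'b) llmodel \<Rightarrow> bool" where
  "monoidal_adjunction M \<longleftrightarrow> (let C = lin M; D = car M in
     symmetric_monoidal_functor D C (Lo M) (La M) (Lm M) (Lu M) \<and>
     symmetric_monoidal_functor C D (Mo M) (Ma M) (Mm M) (Mu M) \<and>
     (\<forall>x\<in>Obj D. Eta M x \<in> Hom D x (Mo M (Lo M x))) \<and>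
     (\<forall>a\<in>Obj C. Eps M a \<in> Hom C (Lo M (Mo M a)) a) \<and>
     (\<forall>x\<in>Obj D. \<forall>y\<in>Obj D. \<forall>f\<in>Hom D x y. Eta M y \<cdot>\<^bsub>D\<^esub> f = Ma M (La M f) \<cdot>\<^bsub>D\<^esub> Eta M x) \<and>
     (\<forall>a\<in>Obj C. \<forall>b\<in>Obj C. \<forall>f\<in>Hom C a b. Eps M b \<cdot>\<^bsub>C\<^esub> La M (Ma M f) = f \<cdot>\<^bsub>C\<^esub> Eps M a) \<and>
     (\<forall>x\<in>Obj D. Eps M (Lo M x) \<cdot>\<^bsub>C\<^esub> La M (Eta M x) = Id C (Lo M x)) \<and>
     (\<forall>a\<in>Obj C. Ma M (Eps M a) \<cdot>\<^bsub>D\<^esub> Eta M (Mo M a) = Id D (Mo M a)) \<and>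
     \<comment> \<open>unit and counit are monoidal\<close>
     (\<forall>x\<in>Obj D. \<forall>y\<in>Obj D. Ma M (Lm M x y) \<cdot>\<^bsub>D\<^esub> Mm M (Lo M x) (Lo M y) \<cdot>\<^bsub>D\<^esub> (Eta M x \<odot>\<^bsub>D\<^esub> Eta M y) =
        Eta M (x \<otimes>\<^bsub>D\<^esub> y)) \<and>
     Ma M (Lu M) \<cdot>\<^bsub>D\<^esub> Mu M = Eta M (Unit D) \<and>
     (\<forall>a\<in>Obj C. \<forall>b\<in>Obj C. Eps M (a \<otimes>\<^bsub>C\<^esub> b) \<cdot>\<^bsub>C\<^esub> La M (Mm M a b) \<cdot>\<^bsub>C\<^esub> Lm M (Mo M a) (Mo M b) =
        Eps M a \<odot>\<^bsub>C\<^esub> Eps M b) \<and>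
     Eps M (Unit C) \<cdot>\<^bsub>C\<^esub> La M (Mu M) \<cdot>\<^bsub>C\<^esub> Lu M = Id C (Unit C))"

definition is_model :: "('o, 'a, 'p, 'b) llmodel \<Rightarrow> bool" where
  "is_model M \<longleftrightarrow> star_autonomous M \<and> has_finite_products (lin M) \<and> cartesian (car M) \<and>
     monoidal_adjunction M \<and>
     (\<forall>m. Mix M = Some m \<longrightarrow> is_iso (lin M) (Unit (lin M)) (Dbot M) m)"

section \<open>Interpretation of formulas\<close>

definition bang :: "('o, 'a, 'p, 'b) llmodel \<Rightarrow> 'o \<Rightarrow> 'o" where
  "bang M a = Lo M (Mo M a)"

definition banga :: "('o, 'a, 'p, 'b) llmodel \<Rightarrow> 'a \<Rightarrow> 'a" where
  "banga M f = La M (Ma M f)"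

text \<open>The parameter \<open>pg\<close> is the action on objects of the functor interpreting the paragraph.\<close>

primrec fobj :: "('o, 'a, 'p, 'b) llmodel \<Rightarrow> ('o \<Rightarrow> 'o) \<Rightarrow> (nat \<Rightarrow> 'o) \<Rightarrow> form \<Rightarrow> 'o" where
  "fobj M pg v (Atom x) = v x"
| "fobj M pg v (NAtom x) = dual M (v x)"
| "fobj M pg v One = Unit (lin M)"
| "fobj M pg v Bot = Dbot M"
| "fobj M pg v (Tens A B) = fobj M pg v A \<otimes>\<^bsub>lin M\<^esub> fobj M pg v B"
| "fobj M pg v (Par A B) = dual M (dual M (fobj M pg v A) \<otimes>\<^bsub>lin M\<^esub> dual M (fobj M pg v B))"
| "fobj M pg v (OfCourse A) = bang M (fobj M pg v A)"
| "fobj M pg v (WhyNot A) = dual M (bang M (dual M (fobj M pg v A)))"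
| "fobj M pg v (Para A) = pg (fobj M pg v A)"

abbreviation obj :: "('o, 'a, 'p, 'b) llmodel \<Rightarrow> (nat \<Rightarrow> 'o) \<Rightarrow> form \<Rightarrow> 'o" where
  "obj M v A \<equiv> fobj M (\<lambda>a. a) v A"

section \<open>Interpretation of nets\<close>

text \<open>
  A net with conclusions \<open>A\<^sub>1, \<dots>, A\<^sub>n\<close> is interpreted through its sequentializations, by an
  arrow from the tensor product of the interpretations of the negations of the \<open>A\<^sub>i\<close> to \<open>\<bottom>\<close>; the
  transposed arrows \<open>1 \<rightarrow> A\<close> and \<open>A \<rightarrow> B\<close> are recovered below for conclusions \<open>A\<close> and \<open>A\<^sup>\<bottom>, B\<close>.
  A flat formula \<open>\<flat>A\<close> is interpreted as \<open>?A\<close>.\<close>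

text \<open>The canonical arrow \<open>A \<otimes> A\<^sup>\<bottom> \<rightarrow> \<bottom>\<close>, for negation defined by De Morgan duality.\<close>

primrec pairing :: "('o, 'a, 'p, 'b) llmodel \<Rightarrow> (nat \<Rightarrow> 'o) \<Rightarrow> form \<Rightarrow> 'a" where
  "pairing M v (Atom x) = ev M (v x) \<cdot>\<^bsub>lin M\<^esub> Sym (lin M) (v x) (dual M (v x))"
| "pairing M v (NAtom x) = ev M (v x)"
| "pairing M v One = LUnit (lin M) (Dbot M)"
| "pairing M v Bot = RUnit (lin M) (Dbot M)"
| "pairing M v (Tens A B) = (let C = lin M; a = obj M v A; b = obj M v B;
       a' = obj M v (neg A); b' = obj M v (neg B); d = dual M a' \<otimes>\<^bsub>C\<^esub> dual M b' in
     ev M d \<cdot>\<^bsub>C\<^esub> Sym C d (dual M d) \<cdot>\<^bsub>C\<^esub>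
     ((name M a a' (pairing M v A) \<odot>\<^bsub>C\<^esub> name M b b' (pairing M v B)) \<odot>\<^bsub>C\<^esub> Id C (dual M d)))"
| "pairing M v (Par A B) = (let C = lin M; a = obj M v A; b = obj M v B;
       a' = obj M v (neg A); b' = obj M v (neg B); d = dual M a \<otimes>\<^bsub>C\<^esub> dual M b in
     ev M d \<cdot>\<^bsub>C\<^esub>
     (Id C (dual M d) \<odot>\<^bsub>C\<^esub>
       (name M a' a (pairing M v A \<cdot>\<^bsub>C\<^esub> Sym C a' a) \<odot>\<^bsub>C\<^esub>
        name M b' b (pairing M v B \<cdot>\<^bsub>C\<^esub> Sym C b' b))))"
| "pairing M v (OfCourse A) = (let C = lin M; a = obj M v A;
       a' = obj M v (neg A); d = bang M (dual M a') in
     ev M d \<cdot>\<^bsub>C\<^esub> Sym C d (dual M d) \<cdot>\<^bsub>C\<^esub>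
     (banga M (name M a a' (pairing M v A)) \<odot>\<^bsub>C\<^esub> Id C (dual M d)))"
| "pairing M v (WhyNot A) = (let C = lin M; a = obj M v A;
       a' = obj M v (neg A); d = bang M (dual M a) in
     ev M d \<cdot>\<^bsub>C\<^esub>
     (Id C (dual M d) \<odot>\<^bsub>C\<^esub> banga M (name M a' a (pairing M v A \<cdot>\<^bsub>C\<^esub> Sym C a' a))))"
| "pairing M v (Para A) = pairing M v A"

text \<open>From \<open>g : c \<otimes> A\<^sup>\<bottom> \<rightarrow> \<bottom>\<close> to the transposed arrow \<open>c \<rightarrow> A\<close>.\<close>

definition transp :: "('o, 'a, 'p, 'b) llmodel \<Rightarrow> (nat \<Rightarrow> 'o) \<Rightarrow> form \<Rightarrow> 'o \<Rightarrow> 'a \<Rightarrow> 'a" where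
  "transp M v A c g = (let a = obj M v A; a' = obj M v (neg A) in
     iso_inv (lin M) a (dual M a') (name M a a' (pairing M v A)) \<cdot>\<^bsub>lin M\<^esub> name M c a' g)"

primrec neg_obj :: "('o, 'a, 'p, 'b) llmodel \<Rightarrow> (nat \<Rightarrow> 'o) \<Rightarrow> label \<Rightarrow> 'o" where
  "neg_obj M v (Fm A) = obj M v (neg A)"
| "neg_obj M v (Flat A) = bang M (obj M v (neg A))"

abbreviation negs ::
    "('o, 'a, 'p, 'b) llmodel \<Rightarrow> (nat \<Rightarrow> 'o) \<Rightarrow> (edge \<Rightarrow> label) \<Rightarrow> edge list \<Rightarrow> 'o list" where
  "negs M v lab \<Gamma> \<equiv> map (\<lambda>e. neg_obj M v (lab e)) \<Gamma>"

primrec tens_list :: "('o, 'a) mcat \<Rightarrow> 'o list \<Rightarrow> 'o" where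
  "tens_list C [] = Unit C"
| "tens_list C (a # as) = a \<otimes>\<^bsub>C\<^esub> tens_list C as"

primrec split_tens :: "('o, 'a) mcat \<Rightarrow> 'o list \<Rightarrow> 'o list \<Rightarrow> 'a" where
  "split_tens C [] bs = iso_inv C (Unit C \<otimes>\<^bsub>C\<^esub> tens_list C bs) (tens_list C bs) (LUnit C (tens_list C bs))"
| "split_tens C (a # as) bs = (let x = tens_list C as; y = tens_list C bs in
     iso_inv C ((a \<otimes>\<^bsub>C\<^esub> x) \<otimes>\<^bsub>C\<^esub> y) (a \<otimes>\<^bsub>C\<^esub> (x \<otimes>\<^bsub>C\<^esub> y)) (Assoc C a x y) \<cdot>\<^bsub>C\<^esub>
     (Id C a \<odot>\<^bsub>C\<^esub> split_tens C as bs))"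

definition weakening :: "('o, 'a, 'p, 'b) llmodel \<Rightarrow> 'o \<Rightarrow> 'a" where
  "weakening M a = (let D = car M in
     iso_inv (lin M) (Unit (lin M)) (Lo M (Unit D)) (Lu M) \<cdot>\<^bsub>lin M\<^esub> La M (to_unit D (Mo M a)))"

definition contraction :: "('o, 'a, 'p, 'b) llmodel \<Rightarrow> 'o \<Rightarrow> 'a" where
  "contraction M a = (let D = car M; x = Mo M a in
     iso_inv (lin M) (Lo M x \<otimes>\<^bsub>lin M\<^esub> Lo M x) (Lo M (x \<otimes>\<^bsub>D\<^esub> x)) (Lm M x x) \<cdot>\<^bsub>lin M\<^esub>
     La M (diagonal D x))"

text \<open>\<open>!a \<otimes> d \<rightarrow> !a \<otimes> (\<dots> \<otimes> (!a \<otimes> d))\<close> with \<open>n\<close> copies of \<open>!a\<close> in the target.\<close>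

primrec copies :: "('o, 'a, 'p, 'b) llmodel \<Rightarrow> 'o \<Rightarrow> 'o \<Rightarrow> nat \<Rightarrow> 'a" where
  "copies M a d 0 = LUnit (lin M) d \<cdot>\<^bsub>lin M\<^esub> (weakening M a \<odot>\<^bsub>lin M\<^esub> Id (lin M) d)"
| "copies M a d (Suc n) =
     (Id (lin M) (bang M a) \<odot>\<^bsub>lin M\<^esub> copies M a d n) \<cdot>\<^bsub>lin M\<^esub>
     Assoc (lin M) (bang M a) (bang M a) d \<cdot>\<^bsub>lin M\<^esub> (contraction M a \<odot>\<^bsub>lin M\<^esub> Id (lin M) d)"

text \<open>\<open>!a\<^sub>1 \<otimes> \<dots> \<otimes> !a\<^sub>n \<rightarrow> !(!a\<^sub>1 \<otimes> \<dots> \<otimes> !a\<^sub>n)\<close>, from digging and the monoidality of \<open>!\<close>.\<close>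

primrec distribute :: "('o, 'a, 'p, 'b) llmodel \<Rightarrow> 'o list \<Rightarrow> 'a" where
  "distribute M [] = La M (Mu M) \<cdot>\<^bsub>lin M\<^esub> Lu M"
| "distribute M (a # as) = (let x = bang M a; y = tens_list (lin M) (map (bang M) as) in
     (La M (Mm M x y) \<cdot>\<^bsub>lin M\<^esub> Lm M (Mo M x) (Mo M y)) \<cdot>\<^bsub>lin M\<^esub>
     (La M (Eta M (Mo M a)) \<odot>\<^bsub>lin M\<^esub> distribute M as))"

inductive exchange :: "('o, 'a) mcat \<Rightarrow> ('e \<Rightarrow> 'o) \<Rightarrow> 'e list \<Rightarrow> 'e list \<Rightarrow> 'a \<Rightarrow> bool" for C ob where
  "exchange C ob \<Gamma> \<Gamma> (Id C (tens_list C (map ob \<Gamma>)))"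
| "\<lbrakk> a = ob e; b = ob e'; g = tens_list C (map ob \<Gamma>) \<rbrakk> \<Longrightarrow>
   exchange C ob (e # e' # \<Gamma>) (e' # e # \<Gamma>)
     (Assoc C b a g \<cdot>\<^bsub>C\<^esub> (Sym C a b \<odot>\<^bsub>C\<^esub> Id C g) \<cdot>\<^bsub>C\<^esub>
      iso_inv C ((a \<otimes>\<^bsub>C\<^esub> b) \<otimes>\<^bsub>C\<^esub> g) (a \<otimes>\<^bsub>C\<^esub> (b \<otimes>\<^bsub>C\<^esub> g)) (Assoc C a b g))"
| "exchange C ob \<Gamma> \<Delta> s \<Longrightarrow> exchange C ob (e # \<Gamma>) (e # \<Delta>) (Id C (ob e) \<odot>\<^bsub>C\<^esub> s)"
| "\<lbrakk> exchange C ob \<Gamma> \<Delta> s; exchange C ob \<Delta> \<Theta> t \<rbrakk> \<Longrightarrow> exchange C ob \<Gamma> \<Theta> (t \<cdot>\<^bsub>C\<^esub> s)"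

text \<open>\<open>sequential M v lab R \<Gamma> g\<close>: the links \<open>R\<close> have a sequentialization with list of conclusions
  \<open>\<Gamma>\<close>, whose interpretation is \<open>g\<close>. The rules consume every link of \<open>R\<close> exactly once.\<close>

inductive sequential ::
    "('o, 'a, 'p, 'b) llmodel \<Rightarrow> (nat \<Rightarrow> 'o) \<Rightarrow> (edge \<Rightarrow> label) \<Rightarrow> link fset \<Rightarrow> edge list \<Rightarrow> 'a \<Rightarrow> bool"
  for M v lab where
  exch: "\<lbrakk> sequential M v lab R \<Gamma> g; exchange (lin M) (\<lambda>e. neg_obj M v (lab e)) \<Delta> \<Gamma> s \<rbrakk>
   \<Longrightarrow> sequential M v lab R \<Delta> (g \<cdot>\<^bsub>lin M\<^esub> s)"
| mix0: "Mix M = Some m \<Longrightarrow> sequential M v lab {||} [] m"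
| mix2: "\<lbrakk> Mix M = Some m; sequential M v lab R \<Gamma> g; sequential M v lab S \<Delta> h; R |\<inter>| S = {||} \<rbrakk>
   \<Longrightarrow> sequential M v lab (R |\<union>| S) (\<Gamma> @ \<Delta>)
     ((RUnit (lin M) (Dbot M) \<cdot>\<^bsub>lin M\<^esub>
        (Id (lin M) (Dbot M) \<odot>\<^bsub>lin M\<^esub> iso_inv (lin M) (Unit (lin M)) (Dbot M) m)) \<cdot>\<^bsub>lin M\<^esub>
      (g \<odot>\<^bsub>lin M\<^esub> h) \<cdot>\<^bsub>lin M\<^esub>
      split_tens (lin M) (negs M v lab \<Gamma>) (negs M v lab \<Delta>))"
| ax: "\<lbrakk> lab a = Fm (neg A); lab b = Fm A \<rbrakk>
   \<Longrightarrow> sequential M v lab {|AxL a b|} [a, b]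
     (pairing M v A \<cdot>\<^bsub>lin M\<^esub> (Id (lin M) (obj M v A) \<odot>\<^bsub>lin M\<^esub> RUnit (lin M) (obj M v (neg A))))"
| cut: "\<lbrakk> sequential M v lab R (a # \<Gamma>) g; sequential M v lab S (b # \<Delta>) h; R |\<inter>| S = {||};
     CutL a b |\<notin>| R |\<union>| S; lab a = Fm A; lab b = Fm (neg A);
     c = tens_list (lin M) (negs M v lab \<Gamma>);
     d = tens_list (lin M) (negs M v lab \<Delta>) \<rbrakk>
   \<Longrightarrow> sequential M v lab (finsert (CutL a b) (R |\<union>| S)) (\<Gamma> @ \<Delta>)
     (h \<cdot>\<^bsub>lin M\<^esub>
      (transp M v A c (g \<cdot>\<^bsub>lin M\<^esub> Sym (lin M) c (obj M v (neg A))) \<odot>\<^bsub>lin M\<^esub> Id (lin M) d) \<cdot>\<^bsub>lin M\<^esub>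
      split_tens (lin M) (negs M v lab \<Gamma>) (negs M v lab \<Delta>))"
| one: "lab c = Fm One \<Longrightarrow> sequential M v lab {|OneL c|} [c] (RUnit (lin M) (Dbot M))"
| bot: "\<lbrakk> sequential M v lab R \<Gamma> g; BotL c |\<notin>| R; lab c = Fm Bot \<rbrakk>
   \<Longrightarrow> sequential M v lab (finsert (BotL c) R) (c # \<Gamma>)
     (g \<cdot>\<^bsub>lin M\<^esub> LUnit (lin M) (tens_list (lin M) (negs M v lab \<Gamma>)))"
| tens: "\<lbrakk> sequential M v lab R (a # \<Gamma>) g; sequential M v lab S (b # \<Delta>) h; R |\<inter>| S = {||};
     TensL a b e |\<notin>| R |\<union>| S; lab a = Fm A; lab b = Fm B; lab e = Fm (Tens A B);
     c = tens_list (lin M) (negs M v lab \<Gamma>);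
     d = tens_list (lin M) (negs M v lab \<Delta>);
     a' = obj M v (neg A); b' = obj M v (neg B) \<rbrakk>
   \<Longrightarrow> sequential M v lab (finsert (TensL a b e) (R |\<union>| S)) (e # \<Gamma> @ \<Delta>)
     (ev M (dual M a' \<otimes>\<^bsub>lin M\<^esub> dual M b') \<cdot>\<^bsub>lin M\<^esub>
      (Id (lin M) (dual M (dual M a' \<otimes>\<^bsub>lin M\<^esub> dual M b')) \<odot>\<^bsub>lin M\<^esub>
       ((name M c a' (g \<cdot>\<^bsub>lin M\<^esub> Sym (lin M) c a') \<odot>\<^bsub>lin M\<^esub>
         name M d b' (h \<cdot>\<^bsub>lin M\<^esub> Sym (lin M) d b')) \<cdot>\<^bsub>lin M\<^esub>
        split_tens (lin M) (negs M v lab \<Gamma>) (negs M v lab \<Delta>))))"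
| par: "\<lbrakk> sequential M v lab R (a # b # \<Gamma>) g; ParL a b e |\<notin>| R;
     lab a = Fm A; lab b = Fm B; lab e = Fm (Par A B) \<rbrakk>
   \<Longrightarrow> sequential M v lab (finsert (ParL a b e) R) (e # \<Gamma>)
     (g \<cdot>\<^bsub>lin M\<^esub> Assoc (lin M) (obj M v (neg A)) (obj M v (neg B))
        (tens_list (lin M) (negs M v lab \<Gamma>)))"
| flat: "\<lbrakk> sequential M v lab R (a # \<Gamma>) g; FlatL a e |\<notin>| R; lab a = Fm A; lab e = Flat A \<rbrakk>
   \<Longrightarrow> sequential M v lab (finsert (FlatL a e) R) (e # \<Gamma>)
     (g \<cdot>\<^bsub>lin M\<^esub> (Eps M (obj M v (neg A)) \<odot>\<^bsub>lin M\<^esub>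
        Id (lin M) (tens_list (lin M) (negs M v lab \<Gamma>))))"
| whynot: "\<lbrakk> sequential M v lab R (es @ \<Gamma>) g; WhyNotL (fset_of_list es) e |\<notin>| R; distinct es;
     \<forall>x\<in>set es. lab x = Flat A; lab e = Fm (WhyNot A) \<rbrakk>
   \<Longrightarrow> sequential M v lab (finsert (WhyNotL (fset_of_list es) e) R) (e # \<Gamma>)
     (g \<cdot>\<^bsub>lin M\<^esub> copies M (obj M v (neg A))
        (tens_list (lin M) (negs M v lab \<Gamma>)) (length es))"
| para: "\<lbrakk> sequential M v lab R (a # \<Gamma>) g; ParaL a e |\<notin>| R; lab a = Fm A; lab e = Fm (Para A) \<rbrakk>
   \<Longrightarrow> sequential M v lab (finsert (ParaL a e) R) (e # \<Gamma>) g"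
| box: "\<lbrakk> sequential M v lab R (p # xs) g; distinct xs; lab p = Fm A; lab e = Fm (OfCourse A);
     map lab xs = map Flat Bs; map lab ys = map Flat Bs;
     c = tens_list (lin M) (negs M v lab xs);
     a' = obj M v (neg A) \<rbrakk>
   \<Longrightarrow> sequential M v lab {|BoxL R p e (fset_of_list (zip xs ys))|} (e # ys)
     (ev M (bang M (dual M a')) \<cdot>\<^bsub>lin M\<^esub>
      (Id (lin M) (dual M (bang M (dual M a'))) \<odot>\<^bsub>lin M\<^esub>
       (banga M (name M c a' (g \<cdot>\<^bsub>lin M\<^esub> Sym (lin M) c a')) \<cdot>\<^bsub>lin M\<^esub>
        distribute M (map (\<lambda>B. obj M v (neg B)) Bs))))"

text \<open>\<open>interprets M v \<pi> A f\<close>: the net \<open>\<pi>\<close> of conclusion \<open>A\<close> is interpreted by \<open>f : 1 \<rightarrow> A\<close>.\<close>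

definition interprets ::
    "('o, 'a, 'p, 'b) llmodel \<Rightarrow> (nat \<Rightarrow> 'o) \<Rightarrow> net \<Rightarrow> form \<Rightarrow> 'a \<Rightarrow> bool" where
  "interprets M v \<pi> A f \<longleftrightarrow> (\<exists>c g.
     conclusions (links \<pi>) = {c} \<and> label \<pi> c = Fm A \<and>
     sequential M v (label \<pi>) (links \<pi>) [c] g \<and>
     f = transp M v A (Unit (lin M)) (g \<cdot>\<^bsub>lin M\<^esub> Sym (lin M) (Unit (lin M)) (obj M v (neg A))))"

text \<open>\<open>interprets_morphism M v \<pi> A B f\<close>: the net \<open>\<pi>\<close> of conclusions \<open>A\<^sup>\<bottom>, B\<close>, as a morphism
  \<open>A \<rightarrow> B\<close> of the syntactic category, is interpreted by \<open>f : A \<rightarrow> B\<close>.\<close>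

definition interprets_morphism ::
    "('o, 'a, 'p, 'b) llmodel \<Rightarrow> (nat \<Rightarrow> 'o) \<Rightarrow> net \<Rightarrow> form \<Rightarrow> form \<Rightarrow> edge \<Rightarrow> edge \<Rightarrow> 'a \<Rightarrow> bool" where
  "interprets_morphism M v \<pi> A B a b f \<longleftrightarrow> (\<exists>g. sequential M v (label \<pi>) (links \<pi>) [a, b] g \<and>
     f = transp M v B (obj M v A)
       (g \<cdot>\<^bsub>lin M\<^esub> (Id (lin M) (obj M v A) \<odot>\<^bsub>lin M\<^esub>
         iso_inv (lin M) (obj M v (neg B) \<otimes>\<^bsub>lin M\<^esub> Unit (lin M)) (obj M v (neg B))
           (RUnit (lin M) (obj M v (neg B))))))"

definition PN_morphism :: "net \<Rightarrow> form \<Rightarrow> form \<Rightarrow> edge \<Rightarrow> edge \<Rightarrow> bool" where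
  "PN_morphism \<pi> A B a b \<longleftrightarrow> DR_net \<pi> \<and> cut_free \<pi> \<and> eta_expanded \<pi> \<and>
     conclusions (links \<pi>) = {a, b} \<and> a \<noteq> b \<and> label \<pi> a = Fm (neg A) \<and> label \<pi> b = Fm B"

definition non_trivial :: "('o, 'a, 'p, 'b) llmodel \<Rightarrow> bool" where
  "non_trivial M \<longleftrightarrow> (\<exists>v A \<pi> \<pi>' f f'. (\<forall>x. v x \<in> Obj (lin M)) \<and>
     DR_net \<pi> \<and> DR_net \<pi>' \<and> interprets M v \<pi> A f \<and> interprets M v \<pi>' A f' \<and> f \<noteq> f')"

text \<open>Swap-sensitivity with respect to the object \<open>\<Xi>\<close> chosen by non-triviality.\<close>

definition swap_sensitive :: "('o, 'a, 'p, 'b) llmodel \<Rightarrow> 'o \<Rightarrow> nat \<Rightarrow> bool" where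
  "swap_sensitive M \<Xi> X \<longleftrightarrow> non_trivial M \<and>
     \<Xi> \<in> Obj (lin M) \<and> Sym (lin M) \<Xi> \<Xi> \<noteq> Id (lin M) (\<Xi> \<otimes>\<^bsub>lin M\<^esub> \<Xi>) \<and>
     (\<forall>\<pi> \<pi>' A B a b f f'.
        PN_morphism \<pi> A B a b \<longrightarrow> precedes X \<pi>' \<pi> \<longrightarrow>
        interprets_morphism M (\<lambda>_. \<Xi>) \<pi> A B a b f \<longrightarrow>
        interprets_morphism M (\<lambda>_. \<Xi>) \<pi>' A B a b f' \<longrightarrow> f' \<noteq> f)"

section \<open>The category of involutions\<close>

definition Inv_cat :: "('o, 'a) mcat \<Rightarrow> ('o \<times> (int \<Rightarrow> 'a), 'a) mcat" where
  "Inv_cat C = \<lparr>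
     Obj = {(a, s). a \<in> Obj C \<and> (\<forall>k. s k \<in> Hom C a a \<and> s k \<cdot>\<^bsub>C\<^esub> s k = Id C a)},
     Hom = (\<lambda>(a, s) (b, t). {f \<in> Hom C a b. \<forall>k. t k \<cdot>\<^bsub>C\<^esub> f \<cdot>\<^bsub>C\<^esub> s k = f}),
     Id = (\<lambda>(a, s). Id C a),
     Comp = Comp C,
     Ten = (\<lambda>(a, s) (b, t). (a \<otimes>\<^bsub>C\<^esub> b, \<lambda>k. s k \<odot>\<^bsub>C\<^esub> t k)),
     Tena = Tena C,
     Unit = (Unit C, \<lambda>k. Id C (Unit C)),
     Assoc = (\<lambda>(a, s) (b, t) (c, u). Assoc C a b c),
     LUnit = (\<lambda>(a, s). LUnit C a),
     RUnit = (\<lambda>(a, s). RUnit C a),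
     Sym = (\<lambda>(a, s) (b, t). Sym C a b) \<rparr>"

definition Inv ::
    "('o, 'a, 'p, 'b) llmodel \<Rightarrow> ('o \<times> (int \<Rightarrow> 'a), 'a, 'p \<times> (int \<Rightarrow> 'b), 'b) llmodel" where
  "Inv M = \<lparr>
     lin = Inv_cat (lin M),
     Imp = (\<lambda>(a, s) (b, t). (Imp M a b,
       \<lambda>k. Cur M (Imp M a b) a b
         (t k \<cdot>\<^bsub>lin M\<^esub> Ev M a b \<cdot>\<^bsub>lin M\<^esub> (Id (lin M) (Imp M a b) \<odot>\<^bsub>lin M\<^esub> s k)))),
     Ev = (\<lambda>(a, s) (b, t). Ev M a b),
     Cur = (\<lambda>(c, u) (a, s) (b, t). Cur M c a b),
     Dbot = (Dbot M, \<lambda>k. Id (lin M) (Dbot M)),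
     Mix = Mix M,
     car = Inv_cat (car M),
     Lo = (\<lambda>(x, s). (Lo M x, \<lambda>k. La M (s k))),
     La = La M,
     Lm = (\<lambda>(x, s) (y, t). Lm M x y),
     Lu = Lu M,
     Mo = (\<lambda>(a, s). (Mo M a, \<lambda>k. Ma M (s k))),
     Ma = Ma M,
     Mm = (\<lambda>(a, s) (b, t). Mm M a b),
     Mu = Mu M,
     Eta = (\<lambda>(x, s). Eta M x),
     Eps = (\<lambda>(a, s). Eps M a) \<rparr>"

definition para_Inv :: "'o \<times> (int \<Rightarrow> 'a) \<Rightarrow> 'o \<times> (int \<Rightarrow> 'a)" where
  "para_Inv = (\<lambda>(a, s). (a, \<lambda>k. s (k - 1)))"

definition default_assignment ::
    "('o, 'a, 'p, 'b) llmodel \<Rightarrow> 'o \<Rightarrow> nat \<Rightarrow> 'o \<times> (int \<Rightarrow> 'a)" where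
  "default_assignment M \<Xi> x = (\<Xi> \<otimes>\<^bsub>lin M\<^esub> \<Xi>,
     \<lambda>k. if k = 0 then Sym (lin M) \<Xi> \<Xi> else Id (lin M) (\<Xi> \<otimes>\<^bsub>lin M\<^esub> \<Xi>))"

definition default_obj :: "('o, 'a, 'p, 'b) llmodel \<Rightarrow> 'o \<Rightarrow> form \<Rightarrow> 'o \<times> (int \<Rightarrow> 'a)" where
  "default_obj M \<Xi> A = fobj (Inv M) para_Inv (default_assignment M \<Xi>) A"

definition default_interprets ::
    "('o, 'a, 'p, 'b) llmodel \<Rightarrow> 'o \<Rightarrow> net \<Rightarrow> form \<Rightarrow> 'a \<Rightarrow> bool" where
  "default_interprets M \<Xi> \<pi> A f \<longleftrightarrow>
     interprets M (\<lambda>x. fst (default_assignment M \<Xi> x)) \<pi> A f"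

lemma neg_neg [simp]: "neg (neg A) = A"
  by (induction A) auto

lemma fst_fobj_Inv: "fst (fobj (Inv M) para_Inv v A) = obj M (\<lambda>x. fst (v x)) A"
  by (induction A) (auto simp: Inv_def Inv_cat_def dual_def bang_def para_Inv_def split: prod.splits)

lemma obj_plus_form: "obj M v (plus_form A) = obj M v A"
  by (induction A) auto

text \<open>The interpretation of a net of conclusion \<open>A\<close> has the right type.\<close>

lemma fst_default_obj_plus:
  "fst (default_obj M \<Xi> (plus_form A)) = obj M (\<lambda>x. fst (default_assignment M \<Xi> x)) A"
  by (simp add: default_obj_def fst_fobj_Inv obj_plus_form)

end

theory Submission
  imports Defs "HOL-Library.Nat_Bijection"
begin

text \<open>
  In a cut-free net an indexing propagates upwards from the conclusion, and the only constraints are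
  that the two conclusions of each axiom link agree. The \<open>k\<close>-th involution of \<open>\<lbrakk>A\<^sup>+\<rbrakk>\<close> applies the
  symmetry of \<open>\<Xi>\<close> at the atoms of \<open>A\<close> of exponential depth \<open>k\<close>; by naturality it can be pushed up
  through all links, until it meets the axioms, where it acts on the conclusions of index \<open>k\<close>.
  Replacing every atom by \<open>X \<otimes> X\<close> and \<open>\<eta>\<close>-expanding turns an axiom on an atom into \<open>id\<^bsub>X\<otimes>X\<^esub>\<close>, and the
  involution turns it into \<open>\<gamma>\<^bsub>X,X\<^esub>\<close> precisely if one but not both of its conclusions have index \<open>k\<close>. If
  the indices of all axioms agree, then nothing changes and the interpretation is invariant.
  Otherwise some \<open>k\<close> yields a net that precedes the expanded one, and swap-sensitivity shows that the
  interpretation is not invariant.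
  Arrows are handled as triples of a domain, an arrow and a codomain, since the hom-sets of the
  models need not be disjoint.
\<close>

section \<open>Symmetric monoidal categories with typed arrows\<close>

text \<open>A net is interpreted through its sequentializations, and nothing guarantees that two of
  them give the same arrow. So every comparison follows a single derivation: one induction on
  \<open>sequential\<close> yields, besides the arrow of the net, arrows for a whole family of
  expanded nets, one for each set \<tau> of indices. Swap-sensitivity speaks of all interpretations
  of two nets, so one derivation of each suffices for a contradiction. Interpreting atoms by \<Xi>
  \<otimes> \<Xi>, or substituting X \<otimes> X for them and interpreting X by \<Xi>, gives
  isomorphic but not equal objects. The k-th involution is absorbed into this isomorphism: the plain
  comparison after the involution is the comparison for \<tau> = {k}. Invariance of the
  interpretation thus becomes equality of the arrows of two expanded nets. Swap-sensitivity concerns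
  morphisms of the syntactic category, which have two conclusions. A bottom link supplies the second
  one. That the result is a DR-net is not derived from the given net but read off its
  sequentialization.\<close>

datatype ('o, 'a) arrow = Arrow (dom: 'o) (raw: 'a) (cod: 'o)

lemma exchange_set: "exchange C ob \<Gamma> \<Delta> s \<Longrightarrow> set \<Gamma> = set \<Delta> \<and> (distinct \<Gamma> \<longleftrightarrow> distinct \<Delta>)"
  by (induction rule: exchange.induct) auto

locale smc =
  fixes C :: "('o, 'a) mcat"
  assumes symmetric_monoidal: "symmetric_monoidal C"
begin

abbreviation tob :: "'o \<Rightarrow> 'o \<Rightarrow> 'o" (infixr "\<otimes>" 60) where "tob a b \<equiv> Ten C a b"

definition arr :: "('o, 'a) arrow \<Rightarrow> bool" where
  "arr t \<longleftrightarrow> dom t \<in> Obj C \<and> cod t \<in> Obj C \<and> raw t \<in> Hom C (dom t) (cod t)"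

definition cmp :: "('o, 'a) arrow \<Rightarrow> ('o, 'a) arrow \<Rightarrow> ('o, 'a) arrow" (infixr "\<bullet>" 55) where
  "t \<bullet> u = Arrow (dom u) (Comp C (raw t) (raw u)) (cod t)"

definition tn :: "('o, 'a) arrow \<Rightarrow> ('o, 'a) arrow \<Rightarrow> ('o, 'a) arrow" (infixr "\<star>" 60) where
  "t \<star> u = Arrow (dom t \<otimes> dom u) (Tena C (raw t) (raw u)) (cod t \<otimes> cod u)"

definition ide :: "'o \<Rightarrow> ('o, 'a) arrow" where "ide a = Arrow a (Id C a) a"

definition assoc :: "'o \<Rightarrow> 'o \<Rightarrow> 'o \<Rightarrow> ('o, 'a) arrow" where
  "assoc a b c = Arrow ((a \<otimes> b) \<otimes> c) (Assoc C a b c) (a \<otimes> (b \<otimes> c))"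

definition lunit :: "'o \<Rightarrow> ('o, 'a) arrow" where
  "lunit a = Arrow (Unit C \<otimes> a) (LUnit C a) a"

definition runit :: "'o \<Rightarrow> ('o, 'a) arrow" where
  "runit a = Arrow (a \<otimes> Unit C) (RUnit C a) a"

definition sym :: "'o \<Rightarrow> 'o \<Rightarrow> ('o, 'a) arrow" where
  "sym a b = Arrow (a \<otimes> b) (Sym C a b) (b \<otimes> a)"

definition inverse :: "('o, 'a) arrow \<Rightarrow> ('o, 'a) arrow" where
  "inverse t = Arrow (cod t) (iso_inv C (dom t) (cod t) (raw t)) (dom t)"

definition iso :: "('o, 'a) arrow \<Rightarrow> bool" where
  "iso t \<longleftrightarrow> arr t \<and> is_iso C (dom t) (cod t) (raw t)"

lemma dom_cod [simp]:
  "dom (t \<bullet> u) = dom u" "cod (t \<bullet> u) = cod t"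
  "dom (t \<star> u) = dom t \<otimes> dom u" "cod (t \<star> u) = cod t \<otimes> cod u"
  "dom (ide a) = a" "cod (ide a) = a"
  "dom (assoc a b c) = (a \<otimes> b) \<otimes> c" "cod (assoc a b c) = a \<otimes> (b \<otimes> c)"
  "dom (lunit a) = Unit C \<otimes> a" "cod (lunit a) = a"
  "dom (runit a) = a \<otimes> Unit C" "cod (runit a) = a"
  "dom (sym a b) = a \<otimes> b" "cod (sym a b) = b \<otimes> a"
  "dom (inverse t) = cod t" "cod (inverse t) = dom t"
  by (simp_all add: cmp_def tn_def ide_def assoc_def lunit_def runit_def sym_def inverse_def)

lemma raw_simps:
  "raw (t \<bullet> u) = Comp C (raw t) (raw u)"
  "raw (t \<star> u) = Tena C (raw t) (raw u)"
  "raw (ide a) = Id C a"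
  "raw (assoc a b c) = Assoc C a b c"
  "raw (lunit a) = LUnit C a"
  "raw (runit a) = RUnit C a"
  "raw (sym a b) = Sym C a b"
  "raw (inverse t) = iso_inv C (dom t) (cod t) (raw t)"
  by (simp_all add: cmp_def tn_def ide_def assoc_def lunit_def runit_def sym_def inverse_def)

lemma arrow_eqI: "dom t = dom u \<Longrightarrow> cod t = cod u \<Longrightarrow> raw t = raw u \<Longrightarrow> t = u"
  by (cases t; cases u) simp

lemma category: "category C" and tensor: "tensor_bifunctor C"
  using symmetric_monoidal by (simp_all add: symmetric_monoidal_def)

lemma raw_category:
  "a \<in> Obj C \<Longrightarrow> Id C a \<in> Hom C a a"
  "a \<in> Obj C \<Longrightarrow> b \<in> Obj C \<Longrightarrow> f \<in> Hom C a b \<Longrightarrow> Comp C f (Id C a) = f"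
  "a \<in> Obj C \<Longrightarrow> b \<in> Obj C \<Longrightarrow> f \<in> Hom C a b \<Longrightarrow> Comp C (Id C b) f = f"
  "a \<in> Obj C \<Longrightarrow> b \<in> Obj C \<Longrightarrow> c \<in> Obj C \<Longrightarrow> f \<in> Hom C a b \<Longrightarrow> g \<in> Hom C b c \<Longrightarrow> Comp C g f \<in> Hom C a c"
  "a \<in> Obj C \<Longrightarrow> b \<in> Obj C \<Longrightarrow> c \<in> Obj C \<Longrightarrow> d \<in> Obj C \<Longrightarrow>
    f \<in> Hom C a b \<Longrightarrow> g \<in> Hom C b c \<Longrightarrow> h \<in> Hom C c d \<Longrightarrow> Comp C (Comp C h g) f = Comp C h (Comp C g f)"
  using category unfolding category_def by blast+

lemma raw_tensor:
  "a \<in> Obj C \<Longrightarrow> b \<in> Obj C \<Longrightarrow> a' \<in> Obj C \<Longrightarrow> b' \<in> Obj C \<Longrightarrow> f \<in> Hom C a b \<Longrightarrow> f' \<in> Hom C a' b' \<Longrightarrow>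
    Tena C f f' \<in> Hom C (a \<otimes> a') (b \<otimes> b')"
  "a \<in> Obj C \<Longrightarrow> b \<in> Obj C \<Longrightarrow> c \<in> Obj C \<Longrightarrow> a' \<in> Obj C \<Longrightarrow> b' \<in> Obj C \<Longrightarrow> c' \<in> Obj C \<Longrightarrow>
    f \<in> Hom C a b \<Longrightarrow> g \<in> Hom C b c \<Longrightarrow> f' \<in> Hom C a' b' \<Longrightarrow> g' \<in> Hom C b' c' \<Longrightarrow>
    Tena C (Comp C g f) (Comp C g' f') = Comp C (Tena C g g') (Tena C f f')"
  using tensor unfolding tensor_bifunctor_def by blast+

lemma arr_obj: "arr t \<Longrightarrow> dom t \<in> Obj C" "arr t \<Longrightarrow> cod t \<in> Obj C"
  by (simp_all add: arr_def)

lemma obj_tensor [simp]: "a \<in> Obj C \<Longrightarrow> b \<in> Obj C \<Longrightarrow> a \<otimes> b \<in> Obj C"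
  using tensor by (simp add: tensor_bifunctor_def)

lemma obj_unit [simp]: "Unit C \<in> Obj C"
  using tensor by (simp add: tensor_bifunctor_def)

lemma arr_ide [simp]: "a \<in> Obj C \<Longrightarrow> arr (ide a)"
  by (simp add: raw_category arr_def ide_def)

lemma arr_cmp [simp]: "arr t \<Longrightarrow> arr u \<Longrightarrow> dom t = cod u \<Longrightarrow> arr (t \<bullet> u)"
  by (cases t; cases u) (auto simp: arr_def cmp_def intro: raw_category(4))

lemma arr_tn [simp]: "arr t \<Longrightarrow> arr u \<Longrightarrow> arr (t \<star> u)"
  by (simp add: raw_tensor(1) arr_def tn_def)

lemma ide_cmp [simp]: "arr t \<Longrightarrow> cod t = a \<Longrightarrow> ide a \<bullet> t = t"
  by (cases t) (auto simp: arr_def cmp_def ide_def intro: raw_category(2,3))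

lemma cmp_ide [simp]: "arr t \<Longrightarrow> dom t = a \<Longrightarrow> t \<bullet> ide a = t"
  by (cases t) (auto simp: arr_def cmp_def ide_def intro: raw_category(2,3))

lemma cmp_assoc [simp]:
  "arr t \<Longrightarrow> arr u \<Longrightarrow> arr w \<Longrightarrow> dom t = cod u \<Longrightarrow> dom u = cod w \<Longrightarrow> (t \<bullet> u) \<bullet> w = t \<bullet> (u \<bullet> w)"
  by (cases t; cases u; cases w) (simp add: arr_def cmp_def raw_category(5)[of "dom w" "dom u" "dom t" "cod t"])

lemma tn_ide [simp]: "a \<in> Obj C \<Longrightarrow> b \<in> Obj C \<Longrightarrow> ide a \<star> ide b = ide (a \<otimes> b)"
  using tensor by (simp add: tensor_bifunctor_def tn_def ide_def)

lemma tn_cmp: "arr t \<Longrightarrow> arr u \<Longrightarrow> arr t' \<Longrightarrow> arr u' \<Longrightarrow> dom t = cod t' \<Longrightarrow> dom u = cod u' \<Longrightarrow>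
   (t \<star> u) \<bullet> (t' \<star> u') = (t \<bullet> t') \<star> (u \<bullet> u')"
  by (cases t; cases u; cases t'; cases u')
    (simp add: arr_def cmp_def tn_def raw_tensor(2)[of "dom t'" "dom t" "cod t" "dom u'" "dom u" "cod u"])

text \<open>Simplification nests composites to the right (\<open>cmp_assoc\<close>), so the
  interchange law is also needed in front of a remaining composite \<open>w\<close>;
  \<open>merge\<close> collects both forms.\<close>

lemma tn_cmp_cmp: "arr t \<Longrightarrow> arr u \<Longrightarrow> arr t' \<Longrightarrow> arr u' \<Longrightarrow> arr w \<Longrightarrow> dom t = cod t' \<Longrightarrow> dom u = cod u' \<Longrightarrow>
   cod w = dom t' \<otimes> dom u' \<Longrightarrow>
   (t \<star> u) \<bullet> ((t' \<star> u') \<bullet> w) = ((t \<bullet> t') \<star> (u \<bullet> u')) \<bullet> w"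
  by (simp add: tn_cmp flip: cmp_assoc)

lemmas merge = tn_cmp tn_cmp_cmp

text \<open>Lets an equation between composites, typically a naturality square or a coherence law,
  rewrite the head of a longer right-nested composite.\<close>

lemma reassoc:
  "x \<bullet> y = z \<Longrightarrow> arr x \<Longrightarrow> arr y \<Longrightarrow> dom x = cod y \<Longrightarrow> arr w \<Longrightarrow> cod w = dom y \<Longrightarrow> x \<bullet> (y \<bullet> w) = z \<bullet> w"
  by (simp flip: cmp_assoc)

section \<open>Isomorphisms and their inverses\<close>

lemma is_inverse_unique:
  assumes "is_inverse C a b f g" "is_inverse C a b f h" "a \<in> Obj C" "b \<in> Obj C"
  shows "g = h"
proof -
  have "g = Comp C (Comp C h f) g"
    using assms raw_category(3)[of b a g] by (simp add: is_inverse_def)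
  also have "\<dots> = Comp C h (Comp C f g)"
    using assms by (intro raw_category(5)[of b a b a]) (auto simp: is_inverse_def)
  also have "\<dots> = h"
    using assms raw_category(2)[of b a h] by (simp add: is_inverse_def)
  finally show ?thesis .
qed

lemma inverse_props:
  assumes "iso t"
  shows "arr (inverse t)" "inverse t \<bullet> t = ide (dom t)" "t \<bullet> inverse t = ide (cod t)"
proof -
  obtain g where g: "is_inverse C (dom t) (cod t) (raw t) g" and t: "arr t"
    using assms by (auto simp: iso_def is_iso_def)
  \<comment> \<open>\<open>iso_inv\<close> is a definite description, so its value is known only
    through the uniqueness of inverses.\<close>
  have "iso_inv C (dom t) (cod t) (raw t) = g"
    unfolding iso_inv_def using g is_inverse_unique t by (intro the_equality) (auto simp: arr_def)
  then show "arr (inverse t)" "inverse t \<bullet> t = ide (dom t)" "t \<bullet> inverse t = ide (cod t)"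
    using g t by (auto simp: is_inverse_def arr_def inverse_def cmp_def ide_def)
qed

lemma isoI: "arr t \<Longrightarrow> arr u \<Longrightarrow> dom t = cod u \<Longrightarrow> dom u = cod t \<Longrightarrow> u \<bullet> t = ide (dom t) \<Longrightarrow> t \<bullet> u = ide (cod t) \<Longrightarrow> iso t"
  by (auto simp: iso_def is_iso_def is_inverse_def arr_def cmp_def ide_def intro!: exI[of _ "raw u"])

declare arr_obj [simp]

lemma iso_arr: "iso t \<Longrightarrow> arr t"
  by (simp add: iso_def)

lemma arr_inverse [simp]: "iso t \<Longrightarrow> arr (inverse t)"
  by (rule inverse_props)

lemma inverse_cmp [simp]: "iso t \<Longrightarrow> dom t = a \<Longrightarrow> inverse t \<bullet> t = ide a"
  and cmp_inverse [simp]: "iso t \<Longrightarrow> cod t = a \<Longrightarrow> t \<bullet> inverse t = ide a"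
  by (auto simp: inverse_props)

lemma inverse_cmp_cmp [simp]: "iso t \<Longrightarrow> arr w \<Longrightarrow> cod w = dom t \<Longrightarrow> inverse t \<bullet> (t \<bullet> w) = w"
  and cmp_inverse_cmp [simp]: "iso t \<Longrightarrow> arr w \<Longrightarrow> cod w = cod t \<Longrightarrow> t \<bullet> (inverse t \<bullet> w) = w"
  by (simp_all add: iso_arr flip: cmp_assoc)

lemma iso_inverse [simp]: "iso t \<Longrightarrow> iso (inverse t)"
  by (rule isoI[of _ t]) (auto simp: iso_arr)

lemma iso_cmp [simp]: "iso t \<Longrightarrow> iso u \<Longrightarrow> dom t = cod u \<Longrightarrow> iso (t \<bullet> u)"
  by (rule isoI[of _ "inverse u \<bullet> inverse t"]) (auto simp: iso_arr)

lemma iso_tn [simp]: "iso t \<Longrightarrow> iso u \<Longrightarrow> iso (t \<star> u)"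
  by (rule isoI[of _ "inverse t \<star> inverse u"]) (auto simp: tn_cmp iso_arr)

lemma iso_ide [simp]: "a \<in> Obj C \<Longrightarrow> iso (ide a)"
  by (rule isoI[of _ "ide a"]) auto

lemma iso_mono: "iso t \<Longrightarrow> arr u \<Longrightarrow> arr w \<Longrightarrow> cod u = dom t \<Longrightarrow> cod w = dom t \<Longrightarrow> t \<bullet> u = t \<bullet> w \<Longrightarrow> u = w"
  by (metis inverse_cmp_cmp)

lemma iso_epi:
  assumes "iso t" "arr u" "arr w" "dom u = cod t" "dom w = cod t" "u \<bullet> t = w \<bullet> t"
  shows "u = w"
proof -
  have "u = (u \<bullet> t) \<bullet> inverse t" using assms(1-5) by (simp add: iso_arr)
  also have "\<dots> = w" unfolding assms(6) using assms(1-5) by (simp add: iso_arr)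
  finally show ?thesis .
qed

lemma iso_lunit [simp]: "a \<in> Obj C \<Longrightarrow> iso (lunit a)"
  and iso_runit [simp]: "a \<in> Obj C \<Longrightarrow> iso (runit a)"
  and iso_assoc [simp]: "a \<in> Obj C \<Longrightarrow> b \<in> Obj C \<Longrightarrow> c \<in> Obj C \<Longrightarrow> iso (assoc a b c)"
  using symmetric_monoidal
  by (auto simp: symmetric_monoidal_def iso_def arr_def is_iso_def is_inverse_def lunit_def runit_def assoc_def simp del: arr_obj)

lemma arr_unitors [simp]:
  "a \<in> Obj C \<Longrightarrow> arr (lunit a)" "a \<in> Obj C \<Longrightarrow> arr (runit a)"
  "a \<in> Obj C \<Longrightarrow> b \<in> Obj C \<Longrightarrow> c \<in> Obj C \<Longrightarrow> arr (assoc a b c)"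
  by (simp_all add: iso_arr)

lemma arr_sym [simp]: "a \<in> Obj C \<Longrightarrow> b \<in> Obj C \<Longrightarrow> arr (sym a b)"
  and sym_sym [simp]: "a \<in> Obj C \<Longrightarrow> b \<in> Obj C \<Longrightarrow> sym b a \<bullet> sym a b = ide (a \<otimes> b)"
  using symmetric_monoidal
  by (auto simp: symmetric_monoidal_def arr_def sym_def cmp_def ide_def simp del: arr_obj)

lemma sym_sym_cmp [simp]: "a \<in> Obj C \<Longrightarrow> b \<in> Obj C \<Longrightarrow> arr w \<Longrightarrow> cod w = a \<otimes> b \<Longrightarrow> sym b a \<bullet> (sym a b \<bullet> w) = w"
  by (simp flip: cmp_assoc)

lemma iso_sym [simp]: "a \<in> Obj C \<Longrightarrow> b \<in> Obj C \<Longrightarrow> iso (sym a b)"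
  by (rule isoI[of _ "sym b a"]) auto

section \<open>Naturality and coherence axioms for typed arrows\<close>

lemma lunit_nat: "arr t \<Longrightarrow> cod t = b \<Longrightarrow> lunit b \<bullet> (ide (Unit C) \<star> t) = t \<bullet> lunit (dom t)"
  and runit_nat: "arr t \<Longrightarrow> cod t = b \<Longrightarrow> runit b \<bullet> (t \<star> ide (Unit C)) = t \<bullet> runit (dom t)"
  using symmetric_monoidal
  by (auto simp: symmetric_monoidal_def arr_def lunit_def runit_def cmp_def ide_def tn_def simp del: arr_obj)

lemma sym_nat: "arr t \<Longrightarrow> arr u \<Longrightarrow> cod t = a \<Longrightarrow> cod u = b \<Longrightarrow>
    sym a b \<bullet> (t \<star> u) = (u \<star> t) \<bullet> sym (dom t) (dom u)"
  using symmetric_monoidal unfolding symmetric_monoidal_def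
  by (intro arrow_eqI) (auto simp: arr_def sym_def cmp_def tn_def simp del: arr_obj)

lemma assoc_nat: "arr t \<Longrightarrow> arr u \<Longrightarrow> arr w \<Longrightarrow> cod t = a \<Longrightarrow> cod u = b \<Longrightarrow> cod w = c \<Longrightarrow>
    assoc a b c \<bullet> ((t \<star> u) \<star> w) = (t \<star> (u \<star> w)) \<bullet> assoc (dom t) (dom u) (dom w)"
  using symmetric_monoidal unfolding symmetric_monoidal_def
  by (intro arrow_eqI) (auto simp: arr_def assoc_def cmp_def tn_def simp del: arr_obj)

lemma pentagon: "a \<in> Obj C \<Longrightarrow> b \<in> Obj C \<Longrightarrow> c \<in> Obj C \<Longrightarrow> d \<in> Obj C \<Longrightarrow>
    assoc a b (c \<otimes> d) \<bullet> assoc (a \<otimes> b) c d =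
    (ide a \<star> assoc b c d) \<bullet> assoc a (b \<otimes> c) d \<bullet> (assoc a b c \<star> ide d)"
  using symmetric_monoidal unfolding symmetric_monoidal_def
  by (intro arrow_eqI) (auto simp: assoc_def cmp_def tn_def ide_def)

lemma triangle: "a \<in> Obj C \<Longrightarrow> b \<in> Obj C \<Longrightarrow>
    (ide a \<star> lunit b) \<bullet> assoc a (Unit C) b = runit a \<star> ide b"
  using symmetric_monoidal unfolding symmetric_monoidal_def
  by (intro arrow_eqI) (auto simp: assoc_def cmp_def tn_def ide_def lunit_def runit_def)

lemma hexagon: "a \<in> Obj C \<Longrightarrow> b \<in> Obj C \<Longrightarrow> c \<in> Obj C \<Longrightarrow>
    assoc b c a \<bullet> sym a (b \<otimes> c) \<bullet> assoc a b c =
    (ide b \<star> sym a c) \<bullet> assoc b a c \<bullet> (sym a b \<star> ide c)"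
  using symmetric_monoidal unfolding symmetric_monoidal_def
  by (intro arrow_eqI) (auto simp: assoc_def cmp_def tn_def ide_def sym_def)

text \<open>The axioms give naturality squares for the structural isomorphisms only. The splitting
  and exchange of contexts use their inverses, for which this turns the square around.\<close>

lemma inverse_nat:
  assumes "iso s" "iso r" "arr x" "arr y" "dom s = cod x" "dom y = cod r" "s \<bullet> x = y \<bullet> r"
    "dom x = dom r" "cod y = cod s"
  shows "inverse s \<bullet> y = x \<bullet> inverse r"
proof -
  have "inverse s \<bullet> y = inverse s \<bullet> (y \<bullet> r) \<bullet> inverse r" using assms(1-6,8,9) by (simp add: iso_arr)
  also have "\<dots> = x \<bullet> inverse r" unfolding assms(7)[symmetric] using assms(1-6,8,9) by (simp add: iso_arr)
  finally show ?thesis .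
qed

lemma assoc_inv_nat: "arr t \<Longrightarrow> arr u \<Longrightarrow> arr w \<Longrightarrow> cod t = a \<Longrightarrow> cod u = b \<Longrightarrow> cod w = c \<Longrightarrow>
    inverse (assoc a b c) \<bullet> (t \<star> (u \<star> w)) = ((t \<star> u) \<star> w) \<bullet> inverse (assoc (dom t) (dom u) (dom w))"
  by (rule inverse_nat) (auto simp: assoc_nat)

lemma lunit_inv_nat: "arr t \<Longrightarrow> cod t = b \<Longrightarrow> inverse (lunit b) \<bullet> t = (ide (Unit C) \<star> t) \<bullet> inverse (lunit (dom t))"
  by (rule inverse_nat) (auto simp: lunit_nat)

section \<open>Coherence of the unitors\<close>

lemma tn_unit_faithful:
  assumes "arr t" "arr u" "dom t = dom u" "cod t = cod u" "t \<star> ide (Unit C) = u \<star> ide (Unit C)"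
  shows "t = u"
proof (rule iso_epi[of "runit (dom t)"])
  have "t \<bullet> runit (dom t) = runit (cod t) \<bullet> (t \<star> ide (Unit C))" using assms(1-4) by (simp add: runit_nat)
  also have "\<dots> = runit (cod u) \<bullet> (u \<star> ide (Unit C))" by (simp add: assms)
  also have "\<dots> = u \<bullet> runit (dom t)" using assms(1-4) by (simp add: runit_nat)
  finally show "t \<bullet> runit (dom t) = u \<bullet> runit (dom t)" .
qed (use assms in auto)

text \<open>Kelly's unit coherence: it suffices to compare the arrows tensored with the unit, where the
  pentagon at \<open>a, b, 1, 1\<close> and the triangle apply.\<close>

lemma runit_tensor:
  assumes "a \<in> Obj C" "b \<in> Obj C"
  shows "(ide a \<star> runit b) \<bullet> assoc a b (Unit C) = runit (a \<otimes> b)"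
proof (rule tn_unit_faithful)
  let ?e = "Unit C"
  let ?l = "((ide a \<star> runit b) \<bullet> assoc a b ?e) \<star> ide ?e"
  have "assoc a b ?e \<bullet> ?l = assoc a b ?e \<bullet> ((ide a \<star> runit b) \<star> ide ?e) \<bullet> (assoc a b ?e \<star> ide ?e)"
    using assms by (simp add: merge)
  also have "\<dots> = (ide a \<star> (runit b \<star> ide ?e)) \<bullet> assoc a (b \<otimes> ?e) ?e \<bullet> (assoc a b ?e \<star> ide ?e)"
    using assms by (simp add: reassoc[OF assoc_nat])
  also have "\<dots> = (ide a \<star> (ide b \<star> lunit ?e)) \<bullet> (ide a \<star> assoc b ?e ?e) \<bullet> assoc a (b \<otimes> ?e) ?e \<bullet> (assoc a b ?e \<star> ide ?e)"
    using assms by (simp add: merge triangle)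
  also have "\<dots> = (ide a \<star> (ide b \<star> lunit ?e)) \<bullet> assoc a b (?e \<otimes> ?e) \<bullet> assoc (a \<otimes> b) ?e ?e"
    using assms by (simp add: pentagon)
  also have "\<dots> = assoc a b ?e \<bullet> ((ide (a \<otimes> b)) \<star> lunit ?e) \<bullet> assoc (a \<otimes> b) ?e ?e"
    using assms reassoc[OF assoc_nat[of "ide a" "ide b" "lunit ?e" a b ?e, symmetric]] by simp
  also have "\<dots> = assoc a b ?e \<bullet> (runit (a \<otimes> b) \<star> ide ?e)"
    using assms by (simp add: triangle)
  finally show "?l = runit (a \<otimes> b) \<star> ide ?e"
    by (rule iso_mono[rotated 5]) (use assms in auto)
qed (use assms in auto)

lemma unit_tn_faithful:
  assumes "arr t" "arr u" "dom t = dom u" "cod t = cod u" "ide (Unit C) \<star> t = ide (Unit C) \<star> u"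
  shows "t = u"
proof (rule iso_epi[of "lunit (dom t)"])
  have "t \<bullet> lunit (dom t) = lunit (cod t) \<bullet> (ide (Unit C) \<star> t)" using assms(1-4) by (simp add: lunit_nat)
  also have "\<dots> = lunit (cod u) \<bullet> (ide (Unit C) \<star> u)" by (simp add: assms)
  also have "\<dots> = u \<bullet> lunit (dom t)" using assms(1-4) by (simp add: lunit_nat)
  finally show "t \<bullet> lunit (dom t) = u \<bullet> lunit (dom t)" .
qed (use assms in auto)

lemma lunit_tensor:
  assumes "a \<in> Obj C" "b \<in> Obj C"
  shows "lunit (a \<otimes> b) \<bullet> assoc (Unit C) a b = lunit a \<star> ide b"
proof (rule unit_tn_faithful)
  let ?e = "Unit C"
  \<comment> \<open>What the pentagon at 1, 1, a, b leaves behind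
    \<open>ide ?e \<star> assoc ?e a b\<close>. It is invertible, so it can be carried along and
    cancelled at the end.\<close>
  let ?k = "assoc ?e (?e \<otimes> a) b \<bullet> (assoc ?e ?e a \<star> ide b)"
  have "(ide ?e \<star> (lunit (a \<otimes> b) \<bullet> assoc ?e a b)) \<bullet> ?k =
      (ide ?e \<star> lunit (a \<otimes> b)) \<bullet> (ide ?e \<star> assoc ?e a b) \<bullet> ?k"
    using assms by (simp add: merge)
  also have "\<dots> = (ide ?e \<star> lunit (a \<otimes> b)) \<bullet> assoc ?e ?e (a \<otimes> b) \<bullet> assoc (?e \<otimes> ?e) a b"
    using assms by (simp add: pentagon)
  also have "\<dots> = (runit ?e \<star> (ide a \<star> ide b)) \<bullet> assoc (?e \<otimes> ?e) a b"
    using assms by (simp add: reassoc[OF triangle])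
  also have "\<dots> = assoc ?e a b \<bullet> ((runit ?e \<star> ide a) \<star> ide b)"
    using assms assoc_nat[of "runit ?e" "ide a" "ide b" ?e a b] by simp
  also have "\<dots> = assoc ?e a b \<bullet> ((ide ?e \<star> lunit a) \<star> ide b) \<bullet> (assoc ?e ?e a \<star> ide b)"
    using assms by (simp add: merge triangle)
  also have "\<dots> = (ide ?e \<star> (lunit a \<star> ide b)) \<bullet> ?k"
    using assms by (simp add: reassoc[OF assoc_nat])
  finally show "ide ?e \<star> (lunit (a \<otimes> b) \<bullet> assoc ?e a b) = ide ?e \<star> (lunit a \<star> ide b)"
    by (rule iso_epi[rotated 5]) (use assms in auto)
qed (use assms in auto)

text \<open>Not an axiom, but a consequence of the hexagon at a, 1, 1: after tensoring with the unit
  both sides acquire a leading symmetry, which is invertible and cancelled.\<close>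

lemma lunit_sym:
  assumes "a \<in> Obj C"
  shows "lunit a \<bullet> sym a (Unit C) = runit a"
proof (rule tn_unit_faithful)
  let ?e = "Unit C"
  have "sym a ?e \<bullet> (runit a \<star> ide ?e) = sym a ?e \<bullet> (ide a \<star> lunit ?e) \<bullet> assoc a ?e ?e"
    using assms by (simp add: triangle)
  also have "\<dots> = (lunit ?e \<star> ide a) \<bullet> sym a (?e \<otimes> ?e) \<bullet> assoc a ?e ?e"
    using assms by (simp add: reassoc[OF sym_nat])
  also have "\<dots> = lunit (?e \<otimes> a) \<bullet> assoc ?e ?e a \<bullet> sym a (?e \<otimes> ?e) \<bullet> assoc a ?e ?e"
    using assms by (simp add: reassoc[OF lunit_tensor])
  also have "\<dots> = lunit (?e \<otimes> a) \<bullet> (ide ?e \<star> sym a ?e) \<bullet> assoc ?e a ?e \<bullet> (sym a ?e \<star> ide ?e)"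
    using assms by (simp add: hexagon)
  also have "\<dots> = sym a ?e \<bullet> ((lunit a \<bullet> sym a ?e) \<star> ide ?e)"
    using assms by (simp add: reassoc[OF lunit_nat] reassoc[OF lunit_tensor] merge)
  finally show "(lunit a \<bullet> sym a ?e) \<star> ide ?e = runit a \<star> ide ?e"
    by (rule iso_mono[rotated 5, symmetric]) (use assms in auto)
qed (use assms in auto)

lemma tn_id_cmp:
  "arr t \<Longrightarrow> arr u \<Longrightarrow> dom t = cod u \<Longrightarrow> a \<in> Obj C \<Longrightarrow> ide a \<star> (t \<bullet> u) = (ide a \<star> t) \<bullet> (ide a \<star> u)"
  "arr t \<Longrightarrow> arr u \<Longrightarrow> dom t = cod u \<Longrightarrow> a \<in> Obj C \<Longrightarrow> (t \<bullet> u) \<star> ide a = (t \<star> ide a) \<bullet> (u \<star> ide a)"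
  by (simp_all add: tn_cmp)

section \<open>Transpositions, the arrows of the basic \<open>exchange\<close> rule\<close>

definition swap :: "'o \<Rightarrow> 'o \<Rightarrow> 'o \<Rightarrow> ('o, 'a) arrow" where
  "swap a b g = assoc b a g \<bullet> (sym a b \<star> ide g) \<bullet> inverse (assoc a b g)"

lemma swap_dom_cod [simp]: "dom (swap a b g) = a \<otimes> (b \<otimes> g)" "cod (swap a b g) = b \<otimes> (a \<otimes> g)"
  by (simp_all add: swap_def)

lemma arr_swap [simp]: "a \<in> Obj C \<Longrightarrow> b \<in> Obj C \<Longrightarrow> g \<in> Obj C \<Longrightarrow> arr (swap a b g)"
  by (simp add: swap_def)

lemma swap_nat:
  assumes "arr t" "arr u" "arr w" "cod t = a" "cod u = b" "cod w = g"
  shows "swap a b g \<bullet> (t \<star> (u \<star> w)) = (u \<star> (t \<star> w)) \<bullet> swap (dom t) (dom u) (dom w)"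
proof -
  have [simp]: "a \<in> Obj C" "b \<in> Obj C" "g \<in> Obj C" using assms arr_obj by blast+
  have "swap a b g \<bullet> (t \<star> (u \<star> w)) =
      assoc b a g \<bullet> ((sym a b \<bullet> (t \<star> u)) \<star> w) \<bullet> inverse (assoc (dom t) (dom u) (dom w))"
    using assms by (simp add: swap_def assoc_inv_nat merge)
  also have "\<dots> = assoc b a g \<bullet> ((u \<star> t) \<star> w) \<bullet> (sym (dom t) (dom u) \<star> ide (dom w)) \<bullet>
      inverse (assoc (dom t) (dom u) (dom w))"
    using assms by (simp add: sym_nat merge)
  also have "\<dots> = (u \<star> (t \<star> w)) \<bullet> swap (dom t) (dom u) (dom w)"
    using assms by (simp add: swap_def reassoc[OF assoc_nat])
  finally show ?thesis .
qed

text \<open>\<open>tens_list\<close> ends in the unit, so exchanging the last two formulas of a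
  context carries a trailing unit along; its removal leaves a plain symmetry.\<close>

lemma swap_unit:
  assumes "a \<in> Obj C" "b \<in> Obj C"
  shows "(ide b \<star> runit a) \<bullet> swap a b (Unit C) = sym a b \<bullet> (ide a \<star> runit b)"
proof -
  have 1: "runit (a \<otimes> b) \<bullet> inverse (assoc a b (Unit C)) = ide a \<star> runit b"
    using assms by (simp flip: runit_tensor)
  show ?thesis
    using assms by (simp add: swap_def reassoc[OF runit_tensor] reassoc[OF runit_nat] 1)
qed

text \<open>The hexagon read backwards: followed by the opposite symmetry and an associator on the
  source side, the left-hand side collapses to that associator, and both are then cancelled.\<close>

lemma swap_hexagon:
  assumes "x \<in> Obj C" "y \<in> Obj C" "z \<in> Obj C"
  shows "swap x z y \<bullet> (ide x \<star> sym y z) \<bullet> assoc x y z = sym (x \<otimes> y) z" (is "?E = _")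
proof -
  have [simp]: "(ide x \<star> sym y z) \<bullet> (ide x \<star> sym z y) \<bullet> w = w" if "arr w" "cod w = x \<otimes> (z \<otimes> y)" for w
    using assms that by (simp add: merge)
  have "?E \<bullet> sym z (x \<otimes> y) \<bullet> assoc z x y =
      swap x z y \<bullet> (ide x \<star> sym y z) \<bullet> (ide x \<star> sym z y) \<bullet> assoc x z y \<bullet> (sym z x \<star> ide y)"
    using assms by (simp add: hexagon)
  also have "\<dots> = assoc z x y"
    using assms by (simp add: swap_def merge)
  finally have 1: "?E \<bullet> sym z (x \<otimes> y) \<bullet> assoc z x y = assoc z x y" .
  have "?E = (?E \<bullet> sym z (x \<otimes> y) \<bullet> assoc z x y) \<bullet> inverse (assoc z x y) \<bullet> sym (x \<otimes> y) z"
    using assms by simp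
  also have "\<dots> = sym (x \<otimes> y) z" unfolding 1 using assms by simp
  finally show ?thesis .
qed

text \<open>Two exchanges carry z to the front of x and y; together they are one symmetry, up to the
  trailing unit. In \<open>sq2_tens\<close> this moves the conclusion of a tensor link behind the
  two conclusions that a par link is to join.\<close>

lemma rotate_unit:
  assumes "x \<in> Obj C" "y \<in> Obj C" "z \<in> Obj C"
  shows "(ide z \<star> (ide x \<star> runit y)) \<bullet> swap x z (y \<otimes> Unit C) \<bullet> (ide x \<star> swap y z (Unit C)) \<bullet>
      assoc x y (z \<otimes> Unit C) = sym (x \<otimes> y) z \<bullet> (ide (x \<otimes> y) \<star> runit z)"
proof -
  have "(ide z \<star> (ide x \<star> runit y)) \<bullet> swap x z (y \<otimes> Unit C) \<bullet> (ide x \<star> swap y z (Unit C)) \<bullet>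
      assoc x y (z \<otimes> Unit C) =
      swap x z y \<bullet> (ide x \<star> ((ide z \<star> runit y) \<bullet> swap y z (Unit C))) \<bullet> assoc x y (z \<otimes> Unit C)"
    using assms reassoc[OF swap_nat[of "ide x" "ide z" "runit y" x z y, symmetric]] by (simp add: merge)
  also have "\<dots> = swap x z y \<bullet> (ide x \<star> sym y z) \<bullet> (ide x \<star> (ide y \<star> runit z)) \<bullet> assoc x y (z \<otimes> Unit C)"
    using assms by (simp add: swap_unit merge)
  also have "\<dots> = (swap x z y \<bullet> (ide x \<star> sym y z) \<bullet> assoc x y z) \<bullet> (ide (x \<otimes> y) \<star> runit z)"
    using assms assoc_nat[of "ide x" "ide y" "runit z" x y z, symmetric] by simp
  also have "\<dots> = sym (x \<otimes> y) z \<bullet> (ide (x \<otimes> y) \<star> runit z)"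
    using assms by (simp only: swap_hexagon)
  finally show ?thesis .
qed

section \<open>Tensors of lists of arrows and the splitting of contexts\<close>

primrec tlist :: "('o, 'a) arrow list \<Rightarrow> ('o, 'a) arrow" where
  "tlist [] = ide (Unit C)"
| "tlist (t # ts) = t \<star> tlist ts"

lemma tlist_dom_cod [simp]:
  "dom (tlist ts) = tens_list C (map dom ts)" "cod (tlist ts) = tens_list C (map cod ts)"
  by (induction ts) auto

lemma arr_tlist [simp]: "\<forall>t\<in>set ts. arr t \<Longrightarrow> arr (tlist ts)"
  by (induction ts) auto

lemma arr_tlist_append [simp]: "\<forall>t\<in>set ts. arr t \<Longrightarrow> \<forall>t\<in>set us. arr t \<Longrightarrow> arr (tlist (ts @ us))"
  by (rule arr_tlist) auto

lemma iso_tlist: "\<forall>t\<in>set ts. iso t \<Longrightarrow> iso (tlist ts)"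
  by (induction ts) auto

lemma obj_tens_list [simp]: "\<forall>a\<in>set as. a \<in> Obj C \<Longrightarrow> tens_list C as \<in> Obj C"
  by (induction as) auto

primrec split :: "'o list \<Rightarrow> 'o list \<Rightarrow> ('o, 'a) arrow" where
  "split [] bs = inverse (lunit (tens_list C bs))"
| "split (a # as) bs = inverse (assoc a (tens_list C as) (tens_list C bs)) \<bullet> (ide a \<star> split as bs)"

lemma split_dom_cod [simp]:
  "dom (split as bs) = tens_list C (as @ bs)" "cod (split as bs) = tens_list C as \<otimes> tens_list C bs"
  by (induction as) auto

lemma arr_split [simp]: "\<forall>a\<in>set as. a \<in> Obj C \<Longrightarrow> \<forall>a\<in>set bs. a \<in> Obj C \<Longrightarrow> arr (split as bs)"
  by (induction as) auto

lemma raw_split: "raw (split as bs) = split_tens C as bs"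
  by (induction as) (auto simp: raw_simps Let_def)

lemma split_nat:
  assumes "\<forall>t\<in>set ts. arr t" "\<forall>t\<in>set us. arr t"
  shows "split (map cod ts) (map cod us) \<bullet> tlist (ts @ us) =
    (tlist ts \<star> tlist us) \<bullet> split (map dom ts) (map dom us)"
  using assms(1)
proof (induction ts)
  case Nil
  then show ?case using assms by (auto simp: lunit_inv_nat)
next
  case (Cons t ts)
  have [simp]: "arr t" "arr (tlist ts)" "arr (tlist us)" "arr (tlist (ts @ us))"
    using Cons.prems assms by auto
  have [simp]: "tens_list C (map cod ts) \<in> Obj C" "tens_list C (map dom ts) \<in> Obj C"
    "tens_list C (map cod us) \<in> Obj C" "tens_list C (map dom us) \<in> Obj C"
    "arr (split (map cod ts) (map cod us))" "arr (split (map dom ts) (map dom us))"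
    using Cons.prems assms by (auto intro!: obj_tens_list arr_split)
  have "split (map cod (t # ts)) (map cod us) \<bullet> tlist ((t # ts) @ us) =
     inverse (assoc (cod t) (cod (tlist ts)) (cod (tlist us))) \<bullet>
       (t \<star> (split (map cod ts) (map cod us) \<bullet> tlist (ts @ us)))"
    using Cons.prems assms by (simp add: merge)
  also have "\<dots> = inverse (assoc (cod t) (cod (tlist ts)) (cod (tlist us))) \<bullet>
       (t \<star> (tlist ts \<star> tlist us)) \<bullet> (ide (dom t) \<star> split (map dom ts) (map dom us))"
    using Cons assms by (simp add: merge)
  also have "\<dots> = (tlist (t # ts) \<star> tlist us) \<bullet> split (map dom (t # ts)) (map dom us)"
    using Cons.prems assms by (simp add: reassoc[OF assoc_inv_nat])
  finally show ?case .
qed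

text \<open>Splitting two singletons merely inserts a unit between x and y, which the triangle law
  removes again.\<close>

lemma split_unit:
  assumes "x \<in> Obj C" "y \<in> Obj C"
  shows "(runit x \<star> runit y) \<bullet> split [x] [y] = ide x \<star> runit y"
proof -
  let ?e = "Unit C"
  have 1: "(runit x \<star> ide (y \<otimes> ?e)) \<bullet> inverse (assoc x ?e (y \<otimes> ?e)) = ide x \<star> lunit (y \<otimes> ?e)"
    using assms by (simp flip: triangle)
  have "runit x \<star> runit y = (ide x \<star> runit y) \<bullet> (runit x \<star> ide (y \<otimes> ?e))"
    using assms by (simp add: merge)
  then have "(runit x \<star> runit y) \<bullet> split [x] [y] = (ide x \<star> runit y) \<bullet>
     ((runit x \<star> ide (y \<otimes> ?e)) \<bullet> inverse (assoc x ?e (y \<otimes> ?e))) \<bullet> (ide x \<star> inverse (lunit (y \<otimes> ?e)))"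
    using assms by simp
  also have "\<dots> = ide x \<star> runit y"
    unfolding 1 using assms by (simp add: merge)
  finally show ?thesis .
qed

section \<open>Exchange of contexts\<close>

lemma exchange_arr:
  assumes "exchange C ob \<Gamma> \<Delta> s" "\<forall>e\<in>set \<Gamma>. ob e \<in> Obj C"
  shows "arr (Arrow (tens_list C (map ob \<Gamma>)) s (tens_list C (map ob \<Delta>)))"
  using assms
proof (induction rule: exchange.induct)
  case (1 \<Gamma>)
  then have "arr (ide (tens_list C (map ob \<Gamma>)))" by (intro arr_ide obj_tens_list) auto
  then show ?case by (simp add: ide_def)
next
  case (2 a e b e' g \<Gamma>)
  then have "arr (swap a b g)" by (auto intro!: arr_swap obj_tens_list)
  then show ?case using 2 by (simp add: swap_def cmp_def tn_def ide_def assoc_def sym_def inverse_def)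
next
  case (3 \<Gamma> \<Delta> s e)
  then have "arr (ide (ob e) \<star> Arrow (tens_list C (map ob \<Gamma>)) s (tens_list C (map ob \<Delta>)))" by auto
  then show ?case by (simp add: tn_def ide_def)
next
  case (4 \<Gamma> \<Delta> s \<Theta> t)
  then have "arr (Arrow (tens_list C (map ob \<Delta>)) t (tens_list C (map ob \<Theta>)) \<bullet> Arrow (tens_list C (map ob \<Gamma>)) s (tens_list C (map ob \<Delta>)))"
    using exchange_set[OF 4(1)] by (intro arr_cmp) auto
  then show ?case by (simp add: cmp_def)
qed

text \<open>A derivation of \<open>exchange\<close> uses only the positions in the list, so it can
  be replayed over renamed edges and other objects. The replayed arrow \<open>s'\<close> is chosen
  before \<tau>: otherwise the arrows of two expanded nets could come to differ by their exchanges
  alone.\<close>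

lemma exchange_nat:
  assumes "exchange C ob \<Gamma> \<Delta> s"
    "\<forall>e\<in>set \<Gamma>. ob e \<in> Obj C \<and> (\<forall>\<tau>. arr (\<phi> \<tau> e) \<and> dom (\<phi> \<tau> e) = ob e \<and> cod (\<phi> \<tau> e) = ob' (n e))"
  shows "\<exists>s'. exchange C ob' (map n \<Gamma>) (map n \<Delta>) s' \<and>
     (\<forall>\<tau>. Arrow (tens_list C (map ob' (map n \<Gamma>))) s' (tens_list C (map ob' (map n \<Delta>))) \<bullet> tlist (map (\<phi> \<tau>) \<Gamma>) =
     tlist (map (\<phi> \<tau>) \<Delta>) \<bullet> Arrow (tens_list C (map ob \<Gamma>)) s (tens_list C (map ob \<Delta>)))"
  using assms
proof (induction rule: exchange.induct)
  case (1 \<Gamma>)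
  have maps: "tens_list C (map (cod \<circ> \<phi> \<tau>) \<Gamma>) = tens_list C (map (ob' \<circ> n) \<Gamma>)" "tens_list C (map (dom \<circ> \<phi> \<tau>) \<Gamma>) = tens_list C (map ob \<Gamma>)" for \<tau>
    using 1 by (auto intro!: arg_cong[where f = "tens_list C"])
  have o: "tens_list C (map (ob' \<circ> n) \<Gamma>) \<in> Obj C" "tens_list C (map ob \<Gamma>) \<in> Obj C"
    using 1 by (auto intro!: obj_tens_list) (metis arr_obj(2))
  have "ide (tens_list C (map ob' (map n \<Gamma>))) \<bullet> tlist (map (\<phi> \<tau>) \<Gamma>) =
      tlist (map (\<phi> \<tau>) \<Gamma>) \<bullet> ide (tens_list C (map ob \<Gamma>))" for \<tau>
    using 1 maps o by simp
  then show ?case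
    using exchange.intros(1)[of C ob' "map n \<Gamma>"] unfolding ide_def by blast
next
  case (2 a e b e' g \<Gamma>)
  have maps: "tens_list C (map (cod \<circ> \<phi> \<tau>) \<Gamma>) = tens_list C (map (ob' \<circ> n) \<Gamma>)" "tens_list C (map (dom \<circ> \<phi> \<tau>) \<Gamma>) = tens_list C (map ob \<Gamma>)" for \<tau>
    using 2 by (auto intro!: arg_cong[where f = "tens_list C"])
  let ?g = "tens_list C (map ob' (map n \<Gamma>))"
  have "swap (ob' (n e)) (ob' (n e')) ?g \<bullet> tlist (map (\<phi> \<tau>) (e # e' # \<Gamma>)) =
     tlist (map (\<phi> \<tau>) (e' # e # \<Gamma>)) \<bullet> swap a b g" for \<tau>
    using 2 maps[of \<tau>] swap_nat[of "\<phi> \<tau> e" "\<phi> \<tau> e'" "tlist (map (\<phi> \<tau>) \<Gamma>)" "ob' (n e)" "ob' (n e')" ?g]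
    by simp
  then show ?case
    using exchange.intros(2)[of "ob' (n e)" ob' "n e" "ob' (n e')" "n e'" ?g C "map n \<Gamma>"] 2(1-3)
    by (intro exI conjI) (auto simp: swap_def cmp_def tn_def ide_def assoc_def sym_def inverse_def)
next
  case (3 \<Gamma> \<Delta> s e)
  then obtain s' where s': "exchange C ob' (map n \<Gamma>) (map n \<Delta>) s'"
    "\<And>\<tau>. Arrow (tens_list C (map ob' (map n \<Gamma>))) s' (tens_list C (map ob' (map n \<Delta>))) \<bullet> tlist (map (\<phi> \<tau>) \<Gamma>) =
     tlist (map (\<phi> \<tau>) \<Delta>) \<bullet> Arrow (tens_list C (map ob \<Gamma>)) s (tens_list C (map ob \<Delta>))"
    by auto
  let ?s' = "Arrow (tens_list C (map ob' (map n \<Gamma>))) s' (tens_list C (map ob' (map n \<Delta>)))"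
  let ?s = "Arrow (tens_list C (map ob \<Gamma>)) s (tens_list C (map ob \<Delta>))"
  have st: "set \<Gamma> = set \<Delta>" using exchange_set[OF 3(1)] by simp
  have maps: "tens_list C (map (cod \<circ> \<phi> \<tau>) \<Gamma>) = tens_list C (map (ob' \<circ> n) \<Gamma>)" "tens_list C (map (dom \<circ> \<phi> \<tau>) \<Delta>) = tens_list C (map ob \<Delta>)" for \<tau>
    using 3 st by (auto intro!: arg_cong[where f = "tens_list C"])
  have a: "arr ?s'" "arr ?s"
    using s'(1) 3 st by (intro exchange_arr; auto; metis arr_obj(2))+
  have "(ide (ob' (n e)) \<star> ?s') \<bullet> tlist (map (\<phi> \<tau>) (e # \<Gamma>)) = tlist (map (\<phi> \<tau>) (e # \<Delta>)) \<bullet> (ide (ob e) \<star> ?s)" for \<tau>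
  proof -
    have b: "arr (\<phi> \<tau> e)" "dom (\<phi> \<tau> e) = ob e" "cod (\<phi> \<tau> e) = ob' (n e)" "ob e \<in> Obj C"
      "arr (tlist (map (\<phi> \<tau>) \<Gamma>))" "arr (tlist (map (\<phi> \<tau>) \<Delta>))"
      using 3(3) st by auto
    then have "ob' (n e) \<in> Obj C" using arr_obj by metis
    then show ?thesis using a b maps[of \<tau>] s'(2)[of \<tau>] by (simp add: merge)
  qed
  then show ?case
    using exchange.intros(3)[OF s'(1), of "n e"] by (intro exI conjI) (auto simp: tn_def ide_def)
next
  case (4 \<Gamma> \<Delta> s \<Theta> t)
  have st: "set \<Gamma> = set \<Delta>" "set \<Delta> = set \<Theta>" using exchange_set[OF 4(1)] exchange_set[OF 4(2)] by simp_all
  obtain s' where s': "exchange C ob' (map n \<Gamma>) (map n \<Delta>) s'"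
    "\<And>\<tau>. Arrow (tens_list C (map ob' (map n \<Gamma>))) s' (tens_list C (map ob' (map n \<Delta>))) \<bullet> tlist (map (\<phi> \<tau>) \<Gamma>) =
     tlist (map (\<phi> \<tau>) \<Delta>) \<bullet> Arrow (tens_list C (map ob \<Gamma>)) s (tens_list C (map ob \<Delta>))"
    using 4(3,5) by auto
  obtain t' where t': "exchange C ob' (map n \<Delta>) (map n \<Theta>) t'"
    "\<And>\<tau>. Arrow (tens_list C (map ob' (map n \<Delta>))) t' (tens_list C (map ob' (map n \<Theta>))) \<bullet> tlist (map (\<phi> \<tau>) \<Delta>) =
     tlist (map (\<phi> \<tau>) \<Theta>) \<bullet> Arrow (tens_list C (map ob \<Delta>)) t (tens_list C (map ob \<Theta>))"
    using 4(4,5) st by auto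
  let ?s' = "Arrow (tens_list C (map ob' (map n \<Gamma>))) s' (tens_list C (map ob' (map n \<Delta>)))"
  let ?s = "Arrow (tens_list C (map ob \<Gamma>)) s (tens_list C (map ob \<Delta>))"
  let ?t' = "Arrow (tens_list C (map ob' (map n \<Delta>))) t' (tens_list C (map ob' (map n \<Theta>)))"
  let ?t = "Arrow (tens_list C (map ob \<Delta>)) t (tens_list C (map ob \<Theta>))"
  have a: "arr ?s'" "arr ?s" "arr ?t'" "arr ?t"
    using s'(1) t'(1) 4(1,2,5) st by (intro exchange_arr; auto; metis arr_obj(2))+
  have maps: "tens_list C (map (cod \<circ> \<phi> \<tau>) \<Gamma>) = tens_list C (map (ob' \<circ> n) \<Gamma>)" "tens_list C (map (dom \<circ> \<phi> \<tau>) \<Delta>) = tens_list C (map ob \<Delta>)"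
    "tens_list C (map (cod \<circ> \<phi> \<tau>) \<Delta>) = tens_list C (map (ob' \<circ> n) \<Delta>)" "tens_list C (map (dom \<circ> \<phi> \<tau>) \<Theta>) = tens_list C (map ob \<Theta>)" for \<tau>
    using 4(5) st by (auto intro!: arg_cong[where f = "tens_list C"])
  have arrs: "arr (tlist (map (\<phi> \<tau>) \<Gamma>))" "arr (tlist (map (\<phi> \<tau>) \<Delta>))" "arr (tlist (map (\<phi> \<tau>) \<Theta>))" for \<tau>
    using 4(5) st by (auto intro!: arg_cong[where f = "tens_list C"])
  have "(?t' \<bullet> ?s') \<bullet> tlist (map (\<phi> \<tau>) \<Gamma>) = tlist (map (\<phi> \<tau>) \<Theta>) \<bullet> (?t \<bullet> ?s)" for \<tau>
  proof -
    have "(?t' \<bullet> ?s') \<bullet> tlist (map (\<phi> \<tau>) \<Gamma>) = ?t' \<bullet> (?s' \<bullet> tlist (map (\<phi> \<tau>) \<Gamma>))"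
      using a arrs maps by (intro cmp_assoc) simp_all
    also have "\<dots> = (?t' \<bullet> tlist (map (\<phi> \<tau>) \<Delta>)) \<bullet> ?s"
      unfolding s' using a arrs maps by (intro cmp_assoc[symmetric]) simp_all
    also have "\<dots> = tlist (map (\<phi> \<tau>) \<Theta>) \<bullet> (?t \<bullet> ?s)"
      unfolding t' using a arrs maps by (intro cmp_assoc) simp_all
    finally show ?thesis .
  qed
  then show ?case
    using exchange.intros(4)[OF s'(1) t'(1)] by (intro exI conjI) (auto simp: cmp_def)
qed

end

section \<open>Models of linear logic\<close>

locale smf = A: smc C + B: smc D
  for C :: "('o, 'a) mcat" and D :: "('p, 'b) mcat" +
  fixes Fo :: "'o \<Rightarrow> 'p" and Fa :: "'a \<Rightarrow> 'b" and Ft :: "'o \<Rightarrow> 'o \<Rightarrow> 'b" and Fu :: 'b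
  assumes functorial: "symmetric_monoidal_functor C D Fo Fa Ft Fu"
begin

definition fmap :: "('o, 'a) arrow \<Rightarrow> ('p, 'b) arrow" where
  "fmap t = Arrow (Fo (dom t)) (Fa (raw t)) (Fo (cod t))"

definition mult :: "'o \<Rightarrow> 'o \<Rightarrow> ('p, 'b) arrow" where
  "mult a b = Arrow (Ten D (Fo a) (Fo b)) (Ft a b) (Fo (Ten C a b))"

definition unt :: "('p, 'b) arrow" where
  "unt = Arrow (Unit D) Fu (Fo (Unit C))"

lemma dom_cod_functor [simp]:
  "dom (fmap t) = Fo (dom t)" "cod (fmap t) = Fo (cod t)"
  "dom (mult a b) = Ten D (Fo a) (Fo b)" "cod (mult a b) = Fo (Ten C a b)"
  "dom unt = Unit D" "cod unt = Fo (Unit C)"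
  by (simp_all add: fmap_def mult_def unt_def)

lemma raw_functor: "raw (fmap t) = Fa (raw t)" "raw (mult a b) = Ft a b" "raw unt = Fu"
  by (simp_all add: fmap_def mult_def unt_def)

lemma functor_raw:
  "a \<in> Obj C \<Longrightarrow> Fo a \<in> Obj D"
  "a \<in> Obj C \<Longrightarrow> Fa (Id C a) = Id D (Fo a)"
  "a \<in> Obj C \<Longrightarrow> b \<in> Obj C \<Longrightarrow> f \<in> Hom C a b \<Longrightarrow> Fa f \<in> Hom D (Fo a) (Fo b)"
  "a \<in> Obj C \<Longrightarrow> b \<in> Obj C \<Longrightarrow> c \<in> Obj C \<Longrightarrow> f \<in> Hom C a b \<Longrightarrow> g \<in> Hom C b c \<Longrightarrow>
     Fa (Comp C g f) = Comp D (Fa g) (Fa f)"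
  "Fu \<in> Hom D (Unit D) (Fo (Unit C))"
  "a \<in> Obj C \<Longrightarrow> b \<in> Obj C \<Longrightarrow> Ft a b \<in> Hom D (Ten D (Fo a) (Fo b)) (Fo (Ten C a b))"
  "a \<in> Obj C \<Longrightarrow> b \<in> Obj C \<Longrightarrow> a' \<in> Obj C \<Longrightarrow> b' \<in> Obj C \<Longrightarrow> f \<in> Hom C a b \<Longrightarrow> f' \<in> Hom C a' b' \<Longrightarrow>
     Comp D (Ft b b') (Tena D (Fa f) (Fa f')) = Comp D (Fa (Tena C f f')) (Ft a a')"
  "a \<in> Obj C \<Longrightarrow> Comp D (Fa (RUnit C a)) (Comp D (Ft a (Unit C)) (Tena D (Id D (Fo a)) Fu)) = RUnit D (Fo a)"
  using functorial unfolding symmetric_monoidal_functor_def by (blast | meson)+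

lemma obj_functor [simp]: "a \<in> Obj C \<Longrightarrow> Fo a \<in> Obj D"
  by (rule functor_raw)

lemma arr_fmap [simp]: "A.arr t \<Longrightarrow> B.arr (fmap t)"
  by (cases t) (simp add: A.arr_def B.arr_def fmap_def functor_raw(3) del: A.arr_obj B.arr_obj)

lemma arr_mult [simp]: "a \<in> Obj C \<Longrightarrow> b \<in> Obj C \<Longrightarrow> B.arr (mult a b)"
  by (simp add: B.arr_def mult_def functor_raw(6) del: B.arr_obj)

lemma arr_unt [simp]: "B.arr unt"
  by (simp add: B.arr_def unt_def functor_raw(5) del: B.arr_obj)

lemma fmap_ide [simp]: "a \<in> Obj C \<Longrightarrow> fmap (A.ide a) = B.ide (Fo a)"
  by (simp add: fmap_def A.ide_def B.ide_def functor_raw(2))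

lemma fmap_cmp: "A.arr t \<Longrightarrow> A.arr u \<Longrightarrow> dom t = cod u \<Longrightarrow> fmap (A.cmp t u) = B.cmp (fmap t) (fmap u)"
  by (cases t; cases u) (auto simp: A.arr_def fmap_def A.cmp_def B.cmp_def intro: functor_raw(4) simp del: A.arr_obj)

lemma mult_nat: "A.arr t \<Longrightarrow> A.arr u \<Longrightarrow> cod t = b \<Longrightarrow> cod u = b' \<Longrightarrow>
    B.cmp (mult b b') (B.tn (fmap t) (fmap u)) = B.cmp (fmap (A.tn t u)) (mult (dom t) (dom u))"
  by (cases t; cases u) (auto simp: A.arr_def fmap_def A.tn_def B.tn_def B.cmp_def mult_def intro!: functor_raw(7) simp del: A.arr_obj)

lemma runit_functor: "a \<in> Obj C \<Longrightarrow>
    B.cmp (fmap (A.runit a)) (B.cmp (mult a (Unit C)) (B.tn (B.ide (Fo a)) unt)) = B.runit (Fo a)"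
  by (simp add: A.runit_def B.runit_def fmap_def B.tn_def B.cmp_def mult_def B.ide_def unt_def functor_raw)

lemma iso_fmap [simp]: "A.iso t \<Longrightarrow> B.iso (fmap t)"
  by (rule B.isoI[of _ "fmap (A.inverse t)"]) (auto simp: A.iso_arr simp flip: fmap_cmp)

end

section \<open>Closed structure and duality\<close>

locale model =
  fixes M :: "('o, 'a, 'p, 'b) llmodel"
  assumes model: "is_model M"
begin

sublocale L: smc "lin M"
  using model by unfold_locales (simp add: is_model_def star_autonomous_def)

sublocale K: smc "car M"
  using model by unfold_locales (simp add: is_model_def cartesian_def)

sublocale FL: smf "car M" "lin M" "Lo M" "La M" "Lm M" "Lu M"
  using model by unfold_locales (simp add: is_model_def monoidal_adjunction_def Let_def)

sublocale FM: smf "lin M" "car M" "Mo M" "Ma M" "Mm M" "Mu M"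
  using model by unfold_locales (simp add: is_model_def monoidal_adjunction_def Let_def)

notation L.cmp (infixr "\<bullet>" 55)
notation L.tn (infixr "\<star>" 60)
notation L.tob (infixr "\<otimes>" 60)

abbreviation "ob \<equiv> Obj (lin M)"
abbreviation "bt \<equiv> Dbot M"

lemma closed: "closed M" and obj_bot [simp]: "bt \<in> ob"
  using model by (simp_all add: is_model_def star_autonomous_def)

definition evl :: "'o \<Rightarrow> ('o, 'a) arrow" where
  "evl a = Arrow (dual M a \<otimes> a) (ev M a) bt"

definition nam :: "'o \<Rightarrow> 'o \<Rightarrow> ('o, 'a) arrow \<Rightarrow> ('o, 'a) arrow" where
  "nam c a t = Arrow c (name M c a (raw t)) (dual M a)"

text \<open>The transpose of an arrow, that is, the contravariant action of \<open>dual\<close> on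
  arrows.\<close>

definition Dl :: "('o, 'a) arrow \<Rightarrow> ('o, 'a) arrow" where
  "Dl t = nam (dual M (cod t)) (dom t) (evl (cod t) \<bullet> (L.ide (dual M (cod t)) \<star> t))"

text \<open>The canonical arrow into the bidual; its invertibility is the \<open>*\<close>-autonomy
  of the model.\<close>

definition dd :: "'o \<Rightarrow> ('o, 'a) arrow" where
  "dd a = nam a (dual M a) (evl a \<bullet> L.sym a (dual M a))"

lemma closed_dom_cod [simp]:
  "dom (evl a) = dual M a \<otimes> a" "cod (evl a) = bt"
  "dom (nam c a t) = c" "cod (nam c a t) = dual M a"
  "dom (Dl t) = dual M (cod t)" "cod (Dl t) = dual M (dom t)"
  "dom (dd a) = a" "cod (dd a) = dual M (dual M a)"
  by (simp_all add: evl_def nam_def Dl_def dd_def)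

lemma closed_raw: "raw (evl a) = ev M a" "raw (nam c a t) = name M c a (raw t)"
  by (simp_all add: evl_def nam_def)

lemma closed_facts:
  "a \<in> ob \<Longrightarrow> b \<in> ob \<Longrightarrow> Imp M a b \<in> ob"
  "a \<in> ob \<Longrightarrow> b \<in> ob \<Longrightarrow> Ev M a b \<in> Hom (lin M) (Imp M a b \<otimes> a) b"
  "a \<in> ob \<Longrightarrow> b \<in> ob \<Longrightarrow> c \<in> ob \<Longrightarrow> f \<in> Hom (lin M) (c \<otimes> a) b \<Longrightarrow> Cur M c a b f \<in> Hom (lin M) c (Imp M a b)"
  "a \<in> ob \<Longrightarrow> b \<in> ob \<Longrightarrow> c \<in> ob \<Longrightarrow> f \<in> Hom (lin M) (c \<otimes> a) b \<Longrightarrow>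
     Comp (lin M) (Ev M a b) (Tena (lin M) (Cur M c a b f) (Id (lin M) a)) = f"
  "a \<in> ob \<Longrightarrow> b \<in> ob \<Longrightarrow> c \<in> ob \<Longrightarrow> f \<in> Hom (lin M) (c \<otimes> a) b \<Longrightarrow> h \<in> Hom (lin M) c (Imp M a b) \<Longrightarrow>
     Comp (lin M) (Ev M a b) (Tena (lin M) h (Id (lin M) a)) = f \<Longrightarrow> h = Cur M c a b f"
  using closed unfolding closed_def Let_def by blast+

lemma obj_dual [simp]: "a \<in> ob \<Longrightarrow> dual M a \<in> ob"
  by (simp add: dual_def closed_facts)

lemma arr_evl [simp]: "a \<in> ob \<Longrightarrow> L.arr (evl a)"
  by (simp add: L.arr_def evl_def ev_def dual_def closed_facts(1,2) del: L.arr_obj)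

lemma arr_nam [simp]:
  "L.arr t \<Longrightarrow> dom t = c \<otimes> a \<Longrightarrow> cod t = bt \<Longrightarrow> c \<in> ob \<Longrightarrow> a \<in> ob \<Longrightarrow> L.arr (nam c a t)"
  by (simp add: L.arr_def nam_def name_def dual_def closed_facts(1,3) del: L.arr_obj)

lemma evl_nam: "L.arr t \<Longrightarrow> dom t = c \<otimes> a \<Longrightarrow> cod t = bt \<Longrightarrow> c \<in> ob \<Longrightarrow> a \<in> ob \<Longrightarrow>
    evl a \<bullet> (nam c a t \<star> L.ide a) = t"
  by (cases t) (simp add: L.arr_def nam_def name_def evl_def ev_def dual_def L.ide_def L.cmp_def L.tn_def closed_facts(4) del: L.arr_obj)

text \<open>The uniqueness half of currying. It allows equations between arrows into a dual to be
  checked after evaluation, which is how the laws of \<open>Dl\<close> are obtained.\<close>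

lemma nam_unique:
  assumes "L.arr h" "dom h = c" "cod h = dual M a" "a \<in> ob" "evl a \<bullet> (h \<star> L.ide a) = t"
  shows "h = nam c a t"
proof -
  have t: "L.arr t" "dom t = c \<otimes> a" "cod t = bt" using assms by auto
  have "raw h = Cur M c a bt (raw t)"
    using t assms(1-4) arg_cong[OF assms(5), of raw]
    by (intro closed_facts(5)) (auto simp: L.arr_def L.raw_simps evl_def ev_def dual_def simp del: L.arr_obj)
  then show ?thesis
    using assms by (cases h) (simp add: nam_def name_def)
qed

lemma evl_faithful:
  "L.arr h \<Longrightarrow> L.arr k \<Longrightarrow> dom h = dom k \<Longrightarrow> cod h = dual M a \<Longrightarrow> cod k = dual M a \<Longrightarrow> a \<in> ob \<Longrightarrow>
    evl a \<bullet> (h \<star> L.ide a) = evl a \<bullet> (k \<star> L.ide a) \<Longrightarrow> h = k"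
  using nam_unique by metis

lemma nam_inject:
  "nam c a t = nam c a u \<Longrightarrow> L.arr t \<Longrightarrow> dom t = c \<otimes> a \<Longrightarrow> cod t = bt \<Longrightarrow>
    L.arr u \<Longrightarrow> dom u = c \<otimes> a \<Longrightarrow> cod u = bt \<Longrightarrow> c \<in> ob \<Longrightarrow> a \<in> ob \<Longrightarrow> t = u"
  using evl_nam by metis

lemma nam_cmp: "L.arr t \<Longrightarrow> dom t = c \<otimes> a \<Longrightarrow> cod t = bt \<Longrightarrow> c \<in> ob \<Longrightarrow> a \<in> ob \<Longrightarrow> L.arr u \<Longrightarrow> cod u = c \<Longrightarrow>
    nam c a t \<bullet> u = nam (dom u) a (t \<bullet> (u \<star> L.ide a))"
  by (rule nam_unique) (simp_all add: L.tn_id_cmp L.reassoc[OF evl_nam])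

lemma nam_evl: "a \<in> ob \<Longrightarrow> nam (dual M a) a (evl a) = L.ide (dual M a)"
  by (rule nam_unique[symmetric]) auto

lemma arr_Dl [simp]: "L.arr t \<Longrightarrow> L.arr (Dl t)"
  by (simp add: Dl_def)

lemma evl_Dl: "L.arr t \<Longrightarrow> dom t = a \<Longrightarrow> evl a \<bullet> (Dl t \<star> L.ide a) = evl (cod t) \<bullet> (L.ide (dual M (cod t)) \<star> t)"
  unfolding Dl_def by (metis L.arr_cmp L.arr_ide L.arr_obj L.arr_tn L.dom_cod(1-6) arr_evl closed_dom_cod(1,2) evl_nam obj_dual)

lemma Dl_nam:
  assumes "L.arr h" "L.arr t" "dom t = c \<otimes> cod h" "cod t = bt" "c \<in> ob" "b = cod h"
  shows "Dl h \<bullet> nam c b t = nam c (dom h) (t \<bullet> (L.ide c \<star> h))"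
proof (rule nam_unique)
  have "evl (dom h) \<bullet> ((Dl h \<bullet> nam c b t) \<star> L.ide (dom h)) =
      evl b \<bullet> (L.ide (dual M b) \<star> h) \<bullet> (nam c b t \<star> L.ide (dom h))"
    using assms by (simp add: L.tn_id_cmp L.reassoc[OF evl_Dl])
  also have "\<dots> = evl b \<bullet> (nam c b t \<star> L.ide b) \<bullet> (L.ide c \<star> h)"
    using assms by (simp add: L.merge)
  also have "\<dots> = t \<bullet> (L.ide c \<star> h)"
    using assms by (simp add: L.reassoc[OF evl_nam])
  finally show "evl (dom h) \<bullet> ((Dl h \<bullet> nam c b t) \<star> L.ide (dom h)) = t \<bullet> (L.ide c \<star> h)" .
qed (use assms in auto)

lemma Dl_ide [simp]: "a \<in> ob \<Longrightarrow> Dl (L.ide a) = L.ide (dual M a)"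
  by (simp add: Dl_def nam_evl)

lemma Dl_cmp:
  assumes "L.arr t" "L.arr u" "dom t = cod u"
  shows "Dl (t \<bullet> u) = Dl u \<bullet> Dl t"
proof -
  have "Dl u \<bullet> Dl t = nam (dual M (cod t)) (dom u) ((evl (cod t) \<bullet> (L.ide (dual M (cod t)) \<star> t)) \<bullet> (L.ide (dual M (cod t)) \<star> u))"
    unfolding Dl_def[of t] using assms by (subst Dl_nam) auto
  then show ?thesis using assms by (simp add: Dl_def[of "t \<bullet> u"] L.tn_id_cmp)
qed

lemma iso_Dl [simp]: "L.iso t \<Longrightarrow> L.iso (Dl t)"
  by (rule L.isoI[of _ "Dl (L.inverse t)"]) (auto simp: L.iso_arr simp flip: Dl_cmp)

lemma iso_dd [simp]: "a \<in> ob \<Longrightarrow> L.iso (dd a)"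
proof -
  assume a: "a \<in> ob"
  then have "L.arr (dd a)" by (simp add: dd_def)
  moreover have "is_iso (lin M) a (dual M (dual M a)) (raw (dd a))"
    using model a by (simp add: is_model_def star_autonomous_def dd_def nam_def L.raw_simps evl_def)
  ultimately show ?thesis by (simp add: L.iso_def)
qed

text \<open>The name of the transposed pairing is the dual of the name, up to the bidual.\<close>

lemma iso_nam_sym:
  assumes "L.arr p" "dom p = a \<otimes> b" "cod p = bt" "a \<in> ob" "b \<in> ob" "L.iso (nam a b p)"
  shows "L.iso (nam b a (p \<bullet> L.sym b a))"
proof -
  have "Dl (nam a b p) \<bullet> dd b = nam b a ((evl b \<bullet> L.sym b (dual M b)) \<bullet> (L.ide b \<star> nam a b p))"
    unfolding dd_def using assms by (subst Dl_nam) auto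
  also have "(evl b \<bullet> L.sym b (dual M b)) \<bullet> (L.ide b \<star> nam a b p) = p \<bullet> L.sym b a"
    using assms by (simp add: L.sym_nat L.reassoc[OF evl_nam])
  finally show ?thesis using assms by (metis L.iso_cmp closed_dom_cod(4,5,8) iso_Dl iso_dd)
qed

section \<open>The exponential comonad and its adjunction\<close>

definition bng :: "('o, 'a) arrow \<Rightarrow> ('o, 'a) arrow" where
  "bng t = FL.fmap (FM.fmap t)"

lemma bng_dom_cod [simp]: "dom (bng t) = bang M (dom t)" "cod (bng t) = bang M (cod t)"
  by (simp_all add: bng_def bang_def)

lemma raw_bng: "raw (bng t) = banga M (raw t)"
  by (simp add: bng_def banga_def FL.raw_functor FM.raw_functor)

lemma arr_bng [simp]: "L.arr t \<Longrightarrow> L.arr (bng t)" and iso_bng [simp]: "L.iso t \<Longrightarrow> L.iso (bng t)"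
  by (simp_all add: bng_def)

lemma bng_ide [simp]: "a \<in> ob \<Longrightarrow> bng (L.ide a) = L.ide (bang M a)"
  by (simp add: bng_def bang_def)

lemma bng_cmp: "L.arr t \<Longrightarrow> L.arr u \<Longrightarrow> dom t = cod u \<Longrightarrow> bng (t \<bullet> u) = bng t \<bullet> bng u"
  by (simp add: bng_def FL.fmap_cmp FM.fmap_cmp)

lemma obj_bang [simp]: "a \<in> ob \<Longrightarrow> bang M a \<in> ob"
  by (simp add: bang_def)

definition eta :: "'p \<Rightarrow> ('p, 'b) arrow" where "eta x = Arrow x (Eta M x) (Mo M (Lo M x))"

definition eps :: "'o \<Rightarrow> ('o, 'a) arrow" where "eps a = Arrow (bang M a) (Eps M a) a"

lemma unit_dom_cod [simp]:
  "dom (eta x) = x" "cod (eta x) = Mo M (Lo M x)" "dom (eps a) = bang M a" "cod (eps a) = a"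
  by (simp_all add: eta_def eps_def)

lemma adjunction_raw:
  "x \<in> Obj (car M) \<Longrightarrow> Eta M x \<in> Hom (car M) x (Mo M (Lo M x))"
  "a \<in> ob \<Longrightarrow> Eps M a \<in> Hom (lin M) (Lo M (Mo M a)) a"
  "x \<in> Obj (car M) \<Longrightarrow> y \<in> Obj (car M) \<Longrightarrow> g \<in> Hom (car M) x y \<Longrightarrow>
    Comp (car M) (Eta M y) g = Comp (car M) (Ma M (La M g)) (Eta M x)"
  "a \<in> ob \<Longrightarrow> b \<in> ob \<Longrightarrow> f \<in> Hom (lin M) a b \<Longrightarrow>
    Comp (lin M) (Eps M b) (La M (Ma M f)) = Comp (lin M) f (Eps M a)"
  "x \<in> Obj (car M) \<Longrightarrow> Comp (lin M) (Eps M (Lo M x)) (La M (Eta M x)) = Id (lin M) (Lo M x)"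
  "a \<in> ob \<Longrightarrow> Comp (car M) (Ma M (Eps M a)) (Eta M (Mo M a)) = Id (car M) (Mo M a)"
  "x \<in> Obj (car M) \<Longrightarrow> y \<in> Obj (car M) \<Longrightarrow>
    Comp (car M) (Ma M (Lm M x y)) (Comp (car M) (Mm M (Lo M x) (Lo M y)) (Tena (car M) (Eta M x) (Eta M y))) =
    Eta M (Ten (car M) x y)"
  "Comp (car M) (Ma M (Lu M)) (Mu M) = Eta M (Unit (car M))"
  "a \<in> ob \<Longrightarrow> b \<in> ob \<Longrightarrow>
    Comp (lin M) (Eps M (a \<otimes> b)) (Comp (lin M) (La M (Mm M a b)) (Lm M (Mo M a) (Mo M b))) =
    Tena (lin M) (Eps M a) (Eps M b)"
  "Comp (lin M) (Eps M (Unit (lin M))) (Comp (lin M) (La M (Mu M)) (Lu M)) = Id (lin M) (Unit (lin M))"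
  using model unfolding is_model_def monoidal_adjunction_def Let_def by blast+

lemma arr_eta [simp]: "x \<in> Obj (car M) \<Longrightarrow> K.arr (eta x)"
  by (simp add: K.arr_def eta_def adjunction_raw(1) del: K.arr_obj)

lemma arr_eps [simp]: "a \<in> ob \<Longrightarrow> L.arr (eps a)"
  by (simp add: L.arr_def eps_def bang_def adjunction_raw(2) del: L.arr_obj)

lemma eta_nat: "K.arr t \<Longrightarrow> K.cmp (eta (cod t)) t = K.cmp (FM.fmap (FL.fmap t)) (eta (dom t))"
  by (cases t) (auto simp: K.arr_def eta_def K.cmp_def FM.fmap_def FL.fmap_def intro!: adjunction_raw(3) simp del: K.arr_obj)

lemma eps_nat: "L.arr t \<Longrightarrow> cod t = b \<Longrightarrow> eps b \<bullet> bng t = t \<bullet> eps (dom t)"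
  by (cases t) (auto simp: L.arr_def eps_def L.cmp_def bng_def FM.fmap_def FL.fmap_def bang_def intro!: adjunction_raw(4) simp del: L.arr_obj)

lemma eps_eta: "x \<in> Obj (car M) \<Longrightarrow> eps (Lo M x) \<bullet> FL.fmap (eta x) = L.ide (Lo M x)"
  by (simp add: eps_def eta_def L.cmp_def FL.fmap_def L.ide_def adjunction_raw(5))

lemma eta_eps: "a \<in> ob \<Longrightarrow> K.cmp (FM.fmap (eps a)) (eta (Mo M a)) = K.ide (Mo M a)"
  by (simp add: eps_def eta_def K.cmp_def FM.fmap_def K.ide_def adjunction_raw(6))

lemma eta_mult: "x \<in> Obj (car M) \<Longrightarrow> y \<in> Obj (car M) \<Longrightarrow>
    K.cmp (FM.fmap (FL.mult x y)) (K.cmp (FM.mult (Lo M x) (Lo M y)) (K.tn (eta x) (eta y))) = eta (Ten (car M) x y)"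
  by (simp add: eta_def K.cmp_def K.tn_def FM.fmap_def FL.mult_def FM.mult_def adjunction_raw(7))

lemma eta_unt: "K.cmp (FM.fmap FL.unt) FM.unt = eta (Unit (car M))"
  by (simp add: eta_def K.cmp_def FM.fmap_def FL.unt_def FM.unt_def adjunction_raw(8))

lemma eps_mult: "a \<in> ob \<Longrightarrow> b \<in> ob \<Longrightarrow>
    eps (a \<otimes> b) \<bullet> FL.fmap (FM.mult a b) \<bullet> FL.mult (Mo M a) (Mo M b) = eps a \<star> eps b"
  by (simp add: eps_def L.cmp_def L.tn_def FL.fmap_def FL.mult_def FM.mult_def adjunction_raw(9) bang_def)

lemma eps_unt: "eps (Unit (lin M)) \<bullet> FL.fmap FM.unt \<bullet> FL.unt = L.ide (Unit (lin M))"
  by (simp add: eps_def L.cmp_def FL.fmap_def FL.unt_def FM.unt_def adjunction_raw(10) L.ide_def)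

text \<open>The inverse is the mate of the monoidal structure of the right adjoint.\<close>

lemma iso_mult [simp]:
  assumes "x \<in> Obj (car M)" "y \<in> Obj (car M)"
  shows "L.iso (FL.mult x y)"
proof (rule L.isoI)
  let ?a = "Lo M x" and ?b = "Lo M y"
  let ?r = "FL.fmap (K.cmp (FM.mult ?a ?b) (K.tn (eta x) (eta y)))"
  let ?i = "eps (?a \<otimes> ?b) \<bullet> ?r"
  show "L.arr ?i" using assms by (simp add: bang_def)
  have "?i \<bullet> FL.mult x y = eps (?a \<otimes> ?b) \<bullet> FL.fmap (FM.mult ?a ?b) \<bullet> FL.fmap (K.tn (eta x) (eta y)) \<bullet> FL.mult x y"
    using assms by (simp add: bang_def FL.fmap_cmp)
  \<comment> \<open>Naturality of \<open>mult\<close> brings the three factors together that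
    monoidality of the counit evaluates; a triangle identity of the adjunction then finishes each
    component.\<close>
  also have "\<dots> = (eps (?a \<otimes> ?b) \<bullet> FL.fmap (FM.mult ?a ?b) \<bullet> FL.mult (Mo M ?a) (Mo M ?b)) \<bullet> (FL.fmap (eta x) \<star> FL.fmap (eta y))"
    using assms by (simp add: bang_def FL.mult_nat)
  also have "\<dots> = L.ide (dom (FL.mult x y))"
    unfolding eps_mult[OF FL.obj_functor[OF assms(1)] FL.obj_functor[OF assms(2)]]
    using assms by (simp add: L.tn_cmp bang_def eps_eta)
  finally show "?i \<bullet> FL.mult x y = L.ide (dom (FL.mult x y))" .
  \<comment> \<open>The opposite composite rests instead on naturality of the counit and monoidality
    of the unit.\<close>
  have "FL.mult x y \<bullet> ?i = eps (cod (FL.mult x y)) \<bullet> bng (FL.mult x y) \<bullet> ?r"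
    using assms by (simp add: bang_def L.reassoc[OF eps_nat])
  also have "\<dots> = eps (cod (FL.mult x y)) \<bullet> FL.fmap (eta (Ten (car M) x y))"
    using assms by (simp add: bng_def eta_mult flip: FL.fmap_cmp)
  finally show "FL.mult x y \<bullet> ?i = L.ide (cod (FL.mult x y))"
    using assms by (simp add: eps_eta)
qed (use assms in \<open>auto simp: bang_def\<close>)

lemma iso_unt [simp]: "L.iso FL.unt"
proof (rule L.isoI)
  let ?i = "eps (Unit (lin M)) \<bullet> FL.fmap FM.unt"
  show "L.arr ?i" by (simp add: bang_def)
  show "?i \<bullet> FL.unt = L.ide (dom FL.unt)" by (simp add: bang_def eps_unt)
  have "FL.unt \<bullet> ?i = eps (cod FL.unt) \<bullet> bng FL.unt \<bullet> FL.fmap FM.unt"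
    by (simp add: bang_def L.reassoc[OF eps_nat])
  also have "\<dots> = eps (cod FL.unt) \<bullet> FL.fmap (eta (Unit (car M)))"
    by (simp add: bng_def eta_unt flip: FL.fmap_cmp)
  finally show "FL.unt \<bullet> ?i = L.ide (cod FL.unt)" by (simp add: eps_eta)
qed (auto simp: bang_def)

section \<open>Products of the Cartesian category, weakening and contraction\<close>

definition to1 :: "'p \<Rightarrow> ('p, 'b) arrow" where "to1 x = Arrow x (to_unit (car M) x) (Unit (car M))"

definition diag :: "'p \<Rightarrow> ('p, 'b) arrow" where "diag x = Arrow x (diagonal (car M) x) (Ten (car M) x x)"

definition pr1 :: "'p \<Rightarrow> 'p \<Rightarrow> ('p, 'b) arrow" where
  "pr1 x y = K.cmp (K.runit x) (K.tn (K.ide x) (to1 y))"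

definition pr2 :: "'p \<Rightarrow> 'p \<Rightarrow> ('p, 'b) arrow" where
  "pr2 x y = K.cmp (K.lunit y) (K.tn (to1 x) (K.ide y))"

lemma cartesian_dom_cod [simp]:
  "dom (to1 x) = x" "cod (to1 x) = Unit (car M)" "dom (diag x) = x" "cod (diag x) = Ten (car M) x x"
  "dom (pr1 x y) = Ten (car M) x y" "cod (pr1 x y) = x"
  "dom (pr2 x y) = Ten (car M) x y" "cod (pr2 x y) = y"
  by (simp_all add: to1_def diag_def pr1_def pr2_def)

lemma terminal_unique: "x \<in> Obj (car M) \<Longrightarrow> \<exists>!f. f \<in> Hom (car M) x (Unit (car M))"
  using model by (simp add: is_model_def cartesian_def terminal_def)

lemma arr_to1 [simp]: "x \<in> Obj (car M) \<Longrightarrow> K.arr (to1 x)"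
  using theI'[OF terminal_unique[of x]] by (simp add: to1_def K.arr_def to_unit_def del: K.arr_obj)

lemma to1_unique: "K.arr t \<Longrightarrow> K.arr u \<Longrightarrow> dom t = dom u \<Longrightarrow> cod t = Unit (car M) \<Longrightarrow> cod u = Unit (car M) \<Longrightarrow> t = u"
  using terminal_unique[of "dom u"] by (cases t; cases u) (auto simp: K.arr_def simp del: K.arr_obj)

lemma arr_pr [simp]: "x \<in> Obj (car M) \<Longrightarrow> y \<in> Obj (car M) \<Longrightarrow> K.arr (pr1 x y)"
    "x \<in> Obj (car M) \<Longrightarrow> y \<in> Obj (car M) \<Longrightarrow> K.arr (pr2 x y)"
  by (simp_all add: pr1_def pr2_def)

lemma raw_pr: "raw (pr1 x y) = proj1 (car M) x y" "raw (pr2 x y) = proj2 (car M) x y"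
  by (simp_all add: pr1_def pr2_def proj1_def proj2_def K.raw_simps to1_def)

lemma pair_unique: "x \<in> Obj (car M) \<Longrightarrow> y \<in> Obj (car M) \<Longrightarrow> c \<in> Obj (car M) \<Longrightarrow>
    f \<in> Hom (car M) c x \<Longrightarrow> g \<in> Hom (car M) c y \<Longrightarrow>
    \<exists>!h. h \<in> Hom (car M) c (Ten (car M) x y) \<and> Comp (car M) (proj1 (car M) x y) h = f \<and>
      Comp (car M) (proj2 (car M) x y) h = g"
  using model unfolding is_model_def cartesian_def is_product_def by blast

lemma diagonal_facts:
  assumes "x \<in> Obj (car M)"
  shows "K.arr (diag x)" "K.cmp (pr1 x x) (diag x) = K.ide x" "K.cmp (pr2 x x) (diag x) = K.ide x"
  using theI'[OF pair_unique[OF assms assms assms K.raw_category(1)[OF assms] K.raw_category(1)[OF assms]]] assms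
  by (auto intro!: K.arrow_eqI simp: K.raw_simps raw_pr diag_def diagonal_def K.arr_def simp del: K.arr_obj)

lemma pair_eqI:
  assumes "K.arr t" "K.arr u" "dom t = dom u" "cod t = Ten (car M) x y" "cod u = Ten (car M) x y"
    "x \<in> Obj (car M)" "y \<in> Obj (car M)" "K.cmp (pr1 x y) t = K.cmp (pr1 x y) u" "K.cmp (pr2 x y) t = K.cmp (pr2 x y) u"
  shows "t = u"
proof (rule K.arrow_eqI)
  have "K.arr (K.cmp (pr1 x y) u)" "K.arr (K.cmp (pr2 x y) u)" using assms(2,5-7) by simp_all
  then have "\<exists>!h. h \<in> Hom (car M) (dom u) (Ten (car M) x y) \<and> Comp (car M) (proj1 (car M) x y) h = raw (K.cmp (pr1 x y) u) \<and>
      Comp (car M) (proj2 (car M) x y) h = raw (K.cmp (pr2 x y) u)"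
    using assms(1-7) by (intro pair_unique) (auto simp: K.arr_def simp del: K.arr_obj)
  moreover have "raw t \<in> Hom (car M) (dom u) (Ten (car M) x y)" "raw u \<in> Hom (car M) (dom u) (Ten (car M) x y)"
    using assms(1-5) by (auto simp: K.arr_def simp del: K.arr_obj)
  ultimately show "raw t = raw u"
    using arg_cong[OF assms(8), of raw] arg_cong[OF assms(9), of raw] by (auto simp: K.raw_simps raw_pr)
qed (use assms in auto)

text \<open>Projections are built from unitors and arrows into the terminal object, so their
  naturality comes from that of the unitors and from uniqueness of terminal arrows.\<close>

lemma pr_nat:
  assumes "K.arr t" "K.arr u"
  shows "K.cmp (pr1 (cod t) (cod u)) (K.tn t u) = K.cmp t (pr1 (dom t) (dom u))"
    "K.cmp (pr2 (cod t) (cod u)) (K.tn t u) = K.cmp u (pr2 (dom t) (dom u))"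
proof -
  have t1: "K.cmp (to1 (cod w)) w = to1 (dom w)" if "K.arr w" for w
    using that by (intro to1_unique) auto
  have "K.cmp (pr1 (cod t) (cod u)) (K.tn t u) = K.cmp (K.runit (cod t)) (K.cmp (K.tn t (K.ide (Unit (car M)))) (K.tn (K.ide (dom t)) (to1 (dom u))))"
    using assms by (simp add: pr1_def K.merge t1)
  then show "K.cmp (pr1 (cod t) (cod u)) (K.tn t u) = K.cmp t (pr1 (dom t) (dom u))"
    using assms by (simp add: K.reassoc[OF K.runit_nat] pr1_def)
  have "K.cmp (pr2 (cod t) (cod u)) (K.tn t u) = K.cmp (K.lunit (cod u)) (K.cmp (K.tn (K.ide (Unit (car M))) u) (K.tn (to1 (dom t)) (K.ide (dom u))))"
    using assms by (simp add: pr2_def K.merge t1)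
  then show "K.cmp (pr2 (cod t) (cod u)) (K.tn t u) = K.cmp u (pr2 (dom t) (dom u))"
    using assms by (simp add: K.reassoc[OF K.lunit_nat] pr2_def)
qed

lemma diag_nat:
  assumes "K.arr t"
  shows "K.cmp (diag (cod t)) t = K.cmp (K.tn t t) (diag (dom t))"
proof (rule pair_eqI[of _ _ "cod t" "cod t"])
  show "K.cmp (pr1 (cod t) (cod t)) (K.cmp (diag (cod t)) t) = K.cmp (pr1 (cod t) (cod t)) (K.cmp (K.tn t t) (diag (dom t)))"
    using assms by (simp add: diagonal_facts K.reassoc[OF diagonal_facts(2)] K.reassoc[OF pr_nat(1)])
  show "K.cmp (pr2 (cod t) (cod t)) (K.cmp (diag (cod t)) t) = K.cmp (pr2 (cod t) (cod t)) (K.cmp (K.tn t t) (diag (dom t)))"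
    using assms by (simp add: diagonal_facts K.reassoc[OF diagonal_facts(3)] K.reassoc[OF pr_nat(2)])
qed (use assms in \<open>auto simp: diagonal_facts\<close>)

text \<open>\<open>weak\<close> and \<open>contr\<close> are the terminal arrow and the diagonal of
  the Cartesian side, carried over by the left adjoint. Both use that its monoidal structure is
  invertible.\<close>

definition weak :: "'o \<Rightarrow> ('o, 'a) arrow" where
  "weak a = L.inverse FL.unt \<bullet> FL.fmap (to1 (Mo M a))"

definition contr :: "'o \<Rightarrow> ('o, 'a) arrow" where
  "contr a = L.inverse (FL.mult (Mo M a) (Mo M a)) \<bullet> FL.fmap (diag (Mo M a))"

lemma comonoid_dom_cod [simp]:
  "dom (weak a) = bang M a" "cod (weak a) = Unit (lin M)"
  "dom (contr a) = bang M a" "cod (contr a) = bang M a \<otimes> bang M a"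
  by (simp_all add: weak_def contr_def bang_def)

lemma comonoid_raw: "raw (weak a) = weakening M a" "raw (contr a) = contraction M a"
  by (simp_all add: weak_def contr_def weakening_def contraction_def L.raw_simps FL.raw_functor to1_def diag_def Let_def)

lemma arr_comonoid [simp]: "a \<in> ob \<Longrightarrow> L.arr (weak a)" "a \<in> ob \<Longrightarrow> L.arr (contr a)"
  by (simp_all add: weak_def contr_def diagonal_facts)

lemma weak_nat: "L.arr t \<Longrightarrow> cod t = b \<Longrightarrow> weak b \<bullet> bng t = weak (dom t)"
proof -
  assume t: "L.arr t" "cod t = b"
  have "K.cmp (to1 (Mo M (cod t))) (FM.fmap t) = to1 (Mo M (dom t))"
    using t by (intro to1_unique) auto
  then show ?thesis
    using t L.arr_obj(2)[OF t(1)] by (simp add: weak_def bng_def flip: FL.fmap_cmp)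
qed

lemma contr_nat:
  assumes "L.arr t" "cod t = b"
  shows "contr b \<bullet> bng t = (bng t \<star> bng t) \<bullet> contr (dom t)"
proof -
  have [simp]: "b \<in> ob" using assms by auto
  have 1: "K.cmp (diag (Mo M b)) (FM.fmap t) = K.cmp (K.tn (FM.fmap t) (FM.fmap t)) (diag (Mo M (dom t)))"
    using diag_nat[of "FM.fmap t"] assms by simp
  have 2: "L.inverse (FL.mult (Mo M b) (Mo M b)) \<bullet> FL.fmap (K.tn (FM.fmap t) (FM.fmap t)) =
     (bng t \<star> bng t) \<bullet> L.inverse (FL.mult (Mo M (dom t)) (Mo M (dom t)))"
    using assms by (intro L.inverse_nat) (auto simp: bng_def FL.mult_nat)
  have "contr b \<bullet> bng t = L.inverse (FL.mult (Mo M b) (Mo M b)) \<bullet> FL.fmap (K.cmp (diag (Mo M b)) (FM.fmap t))"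
    using assms by (simp add: contr_def bng_def FL.fmap_cmp diagonal_facts)
  also have "\<dots> = (bng t \<star> bng t) \<bullet> contr (dom t)"
    using assms by (simp add: 1 FL.fmap_cmp diagonal_facts L.reassoc[OF 2] contr_def bang_def)
  finally show ?thesis .
qed

text \<open>The right counit law of the comonoid structure on \<open>bang M a\<close>. The left
  adjoint turns it into the first projection after the diagonal.\<close>

lemma weak_contr:
  assumes "a \<in> ob"
  shows "L.runit (bang M a) \<bullet> (L.ide (bang M a) \<star> weak a) \<bullet> contr a = L.ide (bang M a)"
proof -
  let ?x = "Mo M a"
  have 1: "FL.fmap (K.runit ?x) \<bullet> FL.mult ?x (Unit (car M)) =
      L.runit (Lo M ?x) \<bullet> (L.ide (Lo M ?x) \<star> L.inverse FL.unt)"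
    using assms by (simp add: L.tn_cmp FL.runit_functor[of ?x, symmetric])
  have "L.runit (bang M a) \<bullet> (L.ide (bang M a) \<star> weak a) \<bullet> contr a =
     (L.runit (Lo M ?x) \<bullet> (L.ide (Lo M ?x) \<star> L.inverse FL.unt)) \<bullet> (L.ide (Lo M ?x) \<star> FL.fmap (to1 ?x)) \<bullet> contr a"
    using assms by (simp add: weak_def L.tn_id_cmp bang_def)
  also have "\<dots> = FL.fmap (K.runit ?x) \<bullet> (FL.mult ?x (Unit (car M)) \<bullet> (FL.fmap (K.ide ?x) \<star> FL.fmap (to1 ?x))) \<bullet> contr a"
    unfolding 1[symmetric] using assms by (simp add: bang_def)
  also have "\<dots> = FL.fmap (K.runit ?x) \<bullet> FL.fmap (K.tn (K.ide ?x) (to1 ?x)) \<bullet> FL.mult ?x ?x \<bullet> contr a"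
    using assms by (subst FL.mult_nat) (auto simp: bang_def)
  also have "\<dots> = FL.fmap (K.cmp (pr1 ?x ?x) (diag ?x))"
    using assms by (simp add: contr_def pr1_def FL.fmap_cmp diagonal_facts bang_def)
  also have "\<dots> = L.ide (bang M a)"
    using assms by (simp add: diagonal_facts bang_def)
  finally show ?thesis .
qed

section \<open>Duplication, for why not links\<close>

primrec copy :: "'o \<Rightarrow> 'o \<Rightarrow> nat \<Rightarrow> ('o, 'a) arrow" where
  "copy a d 0 = L.lunit d \<bullet> (weak a \<star> L.ide d)"
| "copy a d (Suc n) = (L.ide (bang M a) \<star> copy a d n) \<bullet> L.assoc (bang M a) (bang M a) d \<bullet> (contr a \<star> L.ide d)"

lemma raw_copy: "raw (copy a d n) = copies M a d n"
  by (induction n) (simp_all add: L.raw_simps comonoid_raw)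

lemma copy_dom_cod [simp]: "dom (copy a (tens_list (lin M) bs) n) = bang M a \<otimes> tens_list (lin M) bs"
  "cod (copy a (tens_list (lin M) bs) n) = tens_list (lin M) (replicate n (bang M a) @ bs)"
  by (induction n) auto

lemma dom_copy [simp]: "dom (copy a d n) = bang M a \<otimes> d"
  by (induction n) auto

lemma arr_copy [simp]: "a \<in> ob \<Longrightarrow> d \<in> ob \<Longrightarrow> L.arr (copy a d n)"
  by (induction n) auto

text \<open>Each contraction doubles \<open>bng t\<close>; one of the two passes to the context, the
  other to the remaining copies.\<close>

lemma copy_nat:
  assumes "L.arr t" "\<forall>u\<in>set us. L.arr u"
  shows "copy (cod t) (tens_list (lin M) (map cod us)) n \<bullet> (bng t \<star> L.tlist us) =
    L.tlist (replicate n (bng t) @ us) \<bullet> copy (dom t) (tens_list (lin M) (map dom us)) n"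
proof (induction n)
  case 0
  have [simp]: "L.arr (L.tlist us)" using assms by simp
  let ?d = "tens_list (lin M) (map cod us)" and ?d' = "tens_list (lin M) (map dom us)"
  have [simp]: "?d \<in> ob" "?d' \<in> ob" using assms by simp_all
  have "copy (cod t) ?d 0 \<bullet> (bng t \<star> L.tlist us) = L.lunit ?d \<bullet> (weak (dom t) \<star> L.tlist us)"
    using assms by (simp add: L.merge weak_nat)
  also have "weak (dom t) \<star> L.tlist us = (L.ide (Unit (lin M)) \<star> L.tlist us) \<bullet> (weak (dom t) \<star> L.ide ?d')"
    using assms by (simp add: L.merge)
  also have "L.lunit ?d \<bullet> \<dots> = L.tlist us \<bullet> copy (dom t) ?d' 0"
    using assms by (simp add: L.reassoc[OF L.lunit_nat])
  finally show ?case by simp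
next
  case (Suc n)
  let ?d = "tens_list (lin M) (map cod us)" and ?d' = "tens_list (lin M) (map dom us)"
  have [simp]: "L.arr (L.tlist us)" using assms by simp
  have [simp]: "?d \<in> ob" "?d' \<in> ob" using assms by simp_all
  have [simp]: "L.arr (L.tlist (replicate n (bng t) @ us))" using assms by (intro L.arr_tlist_append) auto
  have "copy (cod t) ?d (Suc n) \<bullet> (bng t \<star> L.tlist us) =
     (L.ide (bang M (cod t)) \<star> copy (cod t) ?d n) \<bullet> L.assoc (bang M (cod t)) (bang M (cod t)) ?d \<bullet>
       ((bng t \<star> bng t) \<star> L.tlist us) \<bullet> (contr (dom t) \<star> L.ide ?d')"
    using assms by (simp add: L.merge contr_nat)
  also have "\<dots> = (bng t \<star> (copy (cod t) ?d n \<bullet> (bng t \<star> L.tlist us))) \<bullet>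
      L.assoc (bang M (dom t)) (bang M (dom t)) ?d' \<bullet> (contr (dom t) \<star> L.ide ?d')"
    using assms by (subst L.reassoc[OF L.assoc_nat]) (simp_all add: L.merge)
  also have "\<dots> = L.tlist (replicate (Suc n) (bng t) @ us) \<bullet> copy (dom t) ?d' (Suc n)"
    unfolding Suc using assms by (simp add: L.merge)
  finally show ?case .
qed

text \<open>Duplication always ends with a weakening, so for one premise it contracts and then
  weakens, which the counit law undoes. The expansion of an axiom on an exponential formula contains
  a why not link with one premise.\<close>

lemma copy_one:
  assumes "a \<in> ob" "d \<in> ob"
  shows "copy a d 1 = L.ide (bang M a \<otimes> d)"
proof -
  let ?b = "bang M a" and ?e = "Unit (lin M)"
  have "copy a d 1 = (L.ide ?b \<star> L.lunit d) \<bullet> (L.ide ?b \<star> (weak a \<star> L.ide d)) \<bullet> L.assoc ?b ?b d \<bullet> (contr a \<star> L.ide d)"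
    using assms by (simp add: L.tn_id_cmp)
  also have "\<dots> = ((L.ide ?b \<star> L.lunit d) \<bullet> L.assoc ?b ?e d) \<bullet> ((L.ide ?b \<star> weak a) \<star> L.ide d) \<bullet> (contr a \<star> L.ide d)"
    using assms L.reassoc[OF L.assoc_nat[of "L.ide ?b" "weak a" "L.ide d", OF _ _ _ refl refl refl, symmetric], of "contr a \<star> L.ide d"]
    by simp
  also have "\<dots> = (L.runit ?b \<bullet> (L.ide ?b \<star> weak a) \<bullet> contr a) \<star> L.ide d"
    using assms by (simp add: L.triangle L.merge)
  also have "\<dots> = L.ide (?b \<otimes> d)" using assms by (simp add: weak_contr)
  finally show ?thesis .
qed

section \<open>Digging and promotion\<close>

definition bmult :: "'o \<Rightarrow> 'o \<Rightarrow> ('o, 'a) arrow" where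
  "bmult a b = FL.fmap (FM.mult a b) \<bullet> FL.mult (Mo M a) (Mo M b)"

definition dig :: "'o \<Rightarrow> ('o, 'a) arrow" where
  "dig a = FL.fmap (eta (Mo M a))"

lemma bmult_dom_cod [simp]:
  "dom (bmult a b) = bang M a \<otimes> bang M b" "cod (bmult a b) = bang M (a \<otimes> b)"
  "dom (dig a) = bang M a" "cod (dig a) = bang M (bang M a)"
  by (simp_all add: bmult_def dig_def bang_def)

lemma arr_bmult [simp]: "a \<in> ob \<Longrightarrow> b \<in> ob \<Longrightarrow> L.arr (bmult a b)" "a \<in> ob \<Longrightarrow> L.arr (dig a)"
  by (simp_all add: bmult_def dig_def)

lemma bmult_nat:
  assumes "L.arr t" "L.arr u"
  shows "bmult (cod t) (cod u) \<bullet> (bng t \<star> bng u) = bng (t \<star> u) \<bullet> bmult (dom t) (dom u)"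
proof -
  have "bmult (cod t) (cod u) \<bullet> (bng t \<star> bng u) =
      FL.fmap (FM.mult (cod t) (cod u)) \<bullet> FL.fmap (K.tn (FM.fmap t) (FM.fmap u)) \<bullet> FL.mult (Mo M (dom t)) (Mo M (dom u))"
    using assms by (simp add: bmult_def bng_def FL.mult_nat)
  also have "\<dots> = FL.fmap (K.cmp (FM.mult (cod t) (cod u)) (K.tn (FM.fmap t) (FM.fmap u))) \<bullet> FL.mult (Mo M (dom t)) (Mo M (dom u))"
    using assms by (simp add: FL.fmap_cmp)
  also have "\<dots> = bng (t \<star> u) \<bullet> bmult (dom t) (dom u)"
    using assms by (simp add: FM.mult_nat FL.fmap_cmp bmult_def bng_def)
  finally show ?thesis .
qed

lemma dig_nat: "L.arr t \<Longrightarrow> cod t = b \<Longrightarrow> dig b \<bullet> bng t = bng (bng t) \<bullet> dig (dom t)"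
  using eta_nat[of "FM.fmap t"] L.arr_obj(2)[of t] by (simp add: dig_def bng_def flip: FL.fmap_cmp)

lemma eps_dig: "a \<in> ob \<Longrightarrow> bng (eps a) \<bullet> dig a = L.ide (bang M a)"
  by (simp add: dig_def bng_def bang_def eta_eps flip: FL.fmap_cmp)

primrec distr :: "'o list \<Rightarrow> ('o, 'a) arrow" where
  "distr [] = FL.fmap FM.unt \<bullet> FL.unt"
| "distr (a # as) = bmult (bang M a) (tens_list (lin M) (map (bang M) as)) \<bullet> (dig a \<star> distr as)"

lemma raw_distr: "raw (distr as) = distribute M as"
  by (induction as) (simp_all add: L.raw_simps FL.raw_functor FM.raw_functor bmult_def dig_def eta_def Let_def)

lemma distr_dom_cod [simp]: "dom (distr as) = tens_list (lin M) (map (bang M) as)"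
  "cod (distr as) = bang M (tens_list (lin M) (map (bang M) as))"
  by (induction as) (auto simp: bang_def)

lemma arr_distr [simp]: "\<forall>a\<in>set as. a \<in> ob \<Longrightarrow> L.arr (distr as)"
  by (induction as) auto

lemma distr_nat:
  assumes "\<forall>t\<in>set ts. L.arr t"
  shows "distr (map cod ts) \<bullet> L.tlist (map bng ts) = bng (L.tlist (map bng ts)) \<bullet> distr (map dom ts)"
  using assms
proof (induction ts)
  case Nil
  then show ?case by (simp add: bang_def)
next
  case (Cons t ts)
  let ?u = "L.tlist (map bng ts)"
  have c: "tens_list (lin M) (map (bang M \<circ> cod) ts) = cod ?u" "tens_list (lin M) (map (bang M \<circ> dom) ts) = dom ?u"
    by (simp_all add: comp_def)
  have [simp]: "L.arr t" "L.arr ?u" "L.arr (distr (map cod ts))" "L.arr (distr (map dom ts))"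
    using Cons.prems by auto
  have [simp]: "cod ?u \<in> ob" "dom ?u \<in> ob" using L.arr_obj[of ?u] by simp_all
  \<comment> \<open>From here on the two ends of \<open>?u\<close> stay folded, so that the
    naturality of \<open>bmult\<close> matches with \<open>dom ?u\<close> and
    \<open>cod ?u\<close>.\<close>
  note L.tlist_dom_cod [simp del]
  have "distr (map cod (t # ts)) \<bullet> L.tlist (map bng (t # ts)) =
      bmult (bang M (cod t)) (cod ?u) \<bullet> ((dig (cod t) \<bullet> bng t) \<star> (distr (map cod ts) \<bullet> ?u))"
    by (simp add: L.merge c(1))
  also have "\<dots> = bmult (cod (bng t)) (cod ?u) \<bullet> (bng (bng t) \<star> bng ?u) \<bullet> (dig (dom t) \<star> distr (map dom ts))"
    using Cons by (simp add: L.merge dig_nat c(2))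
  also have "\<dots> = bng (L.tlist (map bng (t # ts))) \<bullet> distr (map dom (t # ts))"
    by (subst L.reassoc[OF bmult_nat]) (simp_all add: c(2))
  finally show ?case .
qed

text \<open>With a single formula, promotion is digging up to a trailing unit; the right unit laws
  of the two monoidal functors remove it. The boxes in expanded axioms have one pax link.\<close>

lemma distr_one:
  assumes "a \<in> ob"
  shows "bng (L.runit (bang M a)) \<bullet> distr [a] = dig a \<bullet> L.runit (bang M a)"
proof -
  let ?x = "bang M a" and ?e = "Unit (lin M)"
  have 1: "bng (L.runit ?x) \<bullet> bmult ?x ?e \<bullet> (L.ide (bang M ?x) \<star> distr []) = L.runit (bang M ?x)"
  proof -
    have "FL.fmap (FM.mult ?x ?e) \<bullet> (FL.mult (Mo M ?x) (Mo M ?e) \<bullet> (FL.fmap (K.ide (Mo M ?x)) \<star> FL.fmap FM.unt)) \<bullet> (L.ide (bang M ?x) \<star> FL.unt)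
      = FL.fmap (FM.mult ?x ?e) \<bullet> (FL.fmap (K.tn (K.ide (Mo M ?x)) FM.unt) \<bullet> FL.mult (Mo M ?x) (Unit (car M))) \<bullet> (L.ide (bang M ?x) \<star> FL.unt)"
      using assms by (subst FL.mult_nat) auto
    then have "bng (L.runit ?x) \<bullet> bmult ?x ?e \<bullet> (L.ide (bang M ?x) \<star> distr []) =
      FL.fmap (FM.fmap (L.runit ?x)) \<bullet> FL.fmap (FM.mult ?x ?e) \<bullet> FL.fmap (K.tn (K.ide (Mo M ?x)) FM.unt) \<bullet>
        FL.mult (Mo M ?x) (Unit (car M)) \<bullet> (L.ide (bang M ?x) \<star> FL.unt)"
      using assms by (simp add: bng_def bmult_def L.tn_id_cmp bang_def)
    also have "\<dots> = FL.fmap (K.cmp (FM.fmap (L.runit ?x)) (K.cmp (FM.mult ?x ?e) (K.tn (K.ide (Mo M ?x)) FM.unt))) \<bullet>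
        FL.mult (Mo M ?x) (Unit (car M)) \<bullet> (L.ide (bang M ?x) \<star> FL.unt)"
      using assms by (simp add: FL.fmap_cmp bang_def)
    also have "\<dots> = L.runit (bang M ?x)"
      using assms by (simp add: FM.runit_functor) (simp add: FL.runit_functor bang_def)
    finally show ?thesis .
  qed
  have "bng (L.runit ?x) \<bullet> distr [a] = (bng (L.runit ?x) \<bullet> bmult ?x ?e \<bullet> (L.ide (bang M ?x) \<star> distr [])) \<bullet> (dig a \<star> L.ide ?e)"
    using assms by (simp add: L.merge bang_def del: distr.simps) (simp add: L.merge bang_def)
  also have "\<dots> = dig a \<bullet> L.runit ?x"
    unfolding 1 using assms by (simp add: L.runit_nat)
  finally show ?thesis .
qed

end

section \<open>Pairings and induced isomorphisms\<close>

context model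
begin

lemma obj_fobj [simp]: "\<forall>x. v x \<in> ob \<Longrightarrow> obj M v A \<in> ob"
  by (induction A) auto

lemma obj_neg_obj [simp]: "\<forall>x. v x \<in> ob \<Longrightarrow> neg_obj M v l \<in> ob"
  by (cases l) auto

definition prg :: "(nat \<Rightarrow> 'o) \<Rightarrow> form \<Rightarrow> ('o, 'a) arrow" where
  "prg v A = Arrow (obj M v A \<otimes> obj M v (neg A)) (pairing M v A) bt"

lemma prg_dom_cod [simp]: "dom (prg v A) = obj M v A \<otimes> obj M v (neg A)" "cod (prg v A) = bt"
  by (simp_all add: prg_def)

text \<open>The pairing of a positive connective is evaluation after an arrow \<open>n\<close> into the dual of the
  interpretation of the negation.\<close>

definition pos :: "'o \<Rightarrow> ('o, 'a) arrow \<Rightarrow> ('o, 'a) arrow" where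
  "pos d n = evl d \<bullet> L.sym d (dual M d) \<bullet> (n \<star> L.ide (dual M d))"

text \<open>The same pairing with its factors exchanged, as needed for the negative connectives;
  \<open>pos_sym\<close> and \<open>ngt_sym\<close> pass between the two.\<close>

definition ngt :: "'o \<Rightarrow> ('o, 'a) arrow \<Rightarrow> ('o, 'a) arrow" where
  "ngt d n = evl d \<bullet> (L.ide (dual M d) \<star> n)"

text \<open>The arrow that \<open>transp\<close> inverts in order to turn an arrow out of the
  negation into one into the formula; see \<open>iso_nprg\<close>.\<close>

abbreviation nprg :: "(nat \<Rightarrow> 'o) \<Rightarrow> form \<Rightarrow> ('o, 'a) arrow" where
  "nprg v A \<equiv> nam (obj M v A) (obj M v (neg A)) (prg v A)"

abbreviation sprg :: "(nat \<Rightarrow> 'o) \<Rightarrow> form \<Rightarrow> ('o, 'a) arrow" where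
  "sprg v A \<equiv> nam (obj M v (neg A)) (obj M v A) (prg v A \<bullet> L.sym (obj M v (neg A)) (obj M v A))"

lemma prg_simps:
  "prg v (Atom x) = evl (v x) \<bullet> L.sym (v x) (dual M (v x))"
  "prg v (NAtom x) = evl (v x)"
  "prg v One = L.lunit bt"
  "prg v Bot = L.runit bt"
  "prg v (Tens A B) = pos (dual M (obj M v (neg A)) \<otimes> dual M (obj M v (neg B))) (nprg v A \<star> nprg v B)"
  "prg v (Par A B) = ngt (dual M (obj M v A) \<otimes> dual M (obj M v B)) (sprg v A \<star> sprg v B)"
  "prg v (OfCourse A) = pos (bang M (dual M (obj M v (neg A)))) (bng (nprg v A))"
  "prg v (WhyNot A) = ngt (bang M (dual M (obj M v A))) (bng (sprg v A))"
  "prg v (Para A) = prg v A"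
  by (auto intro!: L.arrow_eqI simp: L.raw_simps closed_raw raw_bng Let_def pos_def ngt_def)
     (simp_all add: prg_def L.raw_simps closed_raw raw_bng Let_def)

lemma pos_dom_cod [simp]: "dom (pos d n) = dom n \<otimes> dual M d" "cod (pos d n) = bt"
  "dom (ngt d n) = dual M d \<otimes> dom n" "cod (ngt d n) = bt"
  by (simp_all add: pos_def ngt_def)

lemma arr_pos [simp]: "L.arr n \<Longrightarrow> cod n = d \<Longrightarrow> L.arr (pos d n)" "L.arr n \<Longrightarrow> cod n = d \<Longrightarrow> L.arr (ngt d n)"
  using L.arr_obj(2)[of n] by (simp_all add: pos_def ngt_def)

lemma arr_prg [simp]: "\<forall>x. v x \<in> ob \<Longrightarrow> L.arr (prg v A)"
  by (induction A) (simp_all add: prg_simps)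

lemma pos_sym: "L.arr n \<Longrightarrow> cod n = d \<Longrightarrow> pos d n \<bullet> L.sym (dual M d) (dom n) = ngt d n"
  using L.arr_obj(2)[of n] L.sym_nat[of "L.ide (dual M d)" n "dual M d" d, symmetric]
  by (simp add: pos_def ngt_def)

lemma ngt_sym: "L.arr n \<Longrightarrow> cod n = d \<Longrightarrow> ngt d n \<bullet> L.sym (dom n) (dual M d) = pos d n"
  using L.arr_obj(2)[of n] L.sym_nat[of n "L.ide (dual M d)" d "dual M d", symmetric]
  by (simp add: pos_def ngt_def)

text \<open>The compound connectives are settled by the symmetry between \<open>pos\<close> and
  \<open>ngt\<close>; only the constants need a coherence argument, namely \<open>lunit_sym\<close>.
  Together with \<open>expand_neg\<close> this halves the inductions over expanded axioms.\<close>

lemma prg_neg: "\<forall>x. v x \<in> ob \<Longrightarrow> prg v (neg A) = prg v A \<bullet> L.sym (obj M v (neg A)) (obj M v A)"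
proof (induction A)
  case One
  then show ?case by (simp add: prg_simps L.lunit_sym)
next
  case Bot
  then show ?case by (simp add: prg_simps flip: L.lunit_sym)
next
  case (Tens A B)
  let ?n = "nprg v A \<star> nprg v B"
  have "pos (cod ?n) ?n \<bullet> L.sym (dual M (cod ?n)) (dom ?n) = ngt (cod ?n) ?n"
    using Tens.prems by (intro pos_sym) auto
  then show ?case using Tens by (simp add: prg_simps)
next
  case (Par A B)
  let ?n = "sprg v A \<star> sprg v B"
  have "ngt (cod ?n) ?n \<bullet> L.sym (dom ?n) (dual M (cod ?n)) = pos (cod ?n) ?n"
    using Par.prems by (intro ngt_sym) auto
  then show ?case using Par by (simp add: prg_simps)
next
  case (OfCourse A)
  let ?n = "bng (nprg v A)"
  have "pos (cod ?n) ?n \<bullet> L.sym (dual M (cod ?n)) (dom ?n) = ngt (cod ?n) ?n"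
    using OfCourse.prems by (intro pos_sym) auto
  then show ?case using OfCourse by (simp add: prg_simps)
next
  case (WhyNot A)
  let ?n = "bng (sprg v A)"
  have "ngt (cod ?n) ?n \<bullet> L.sym (dom ?n) (dual M (cod ?n)) = pos (cod ?n) ?n"
    using WhyNot.prems by (intro ngt_sym) auto
  then show ?case using WhyNot by (simp add: prg_simps)
qed (auto simp: prg_simps)

text \<open>Reduces invertibility of the name of a positive pairing to that of \<open>n\<close>,
  since the arrow into the bidual is invertible.\<close>

lemma nam_pos: "L.arr n \<Longrightarrow> cod n = d \<Longrightarrow> nam (dom n) (dual M d) (pos d n) = dd d \<bullet> n"
  using L.arr_obj(2)[of n] by (simp add: dd_def nam_cmp pos_def)

text \<open>\<bottom> is its own dual with respect to 1: evaluation at the unit, after undoing the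
  unitor, is inverse to this name. It is the base case for the constants.\<close>

lemma iso_nam_runit: "L.iso (nam bt (Unit (lin M)) (L.runit bt))"
proof (rule L.isoI)
  let ?e = "Unit (lin M)"
  let ?n = "nam bt ?e (L.runit bt)" and ?i = "evl ?e \<bullet> L.inverse (L.runit (dual M ?e))"
  have "L.inverse (L.runit (dual M ?e)) \<bullet> ?n = (?n \<star> L.ide ?e) \<bullet> L.inverse (L.runit bt)"
    by (intro L.inverse_nat) (auto simp: L.runit_nat)
  then show "?i \<bullet> ?n = L.ide (dom ?n)"
    by (simp add: L.reassoc[OF evl_nam])
  show "?n \<bullet> ?i = L.ide (cod ?n)"
  proof (rule evl_faithful[of _ _ ?e])
    have "evl ?e \<bullet> ((?n \<bullet> ?i) \<star> L.ide ?e) = L.runit bt \<bullet> (?i \<star> L.ide ?e)"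
      by (simp add: L.tn_id_cmp L.reassoc[OF evl_nam])
    also have "\<dots> = evl ?e" by (simp add: L.runit_nat)
    finally show "evl ?e \<bullet> ((?n \<bullet> ?i) \<star> L.ide ?e) = evl ?e \<bullet> (L.ide (cod ?n) \<star> L.ide ?e)" by simp
  qed auto
qed auto

lemma iso_nprg_neg:
  assumes "\<forall>x. v x \<in> ob" "L.iso (nprg v A)"
  shows "L.iso (nam (obj M v (neg A)) (obj M v A) (prg v (neg A)))"
  using assms by (simp add: prg_neg iso_nam_sym)

text \<open>Positive connectives follow from \<open>nam_pos\<close>. A negative formula is the
  negation of a positive one, and exchanging the factors of a pairing preserves invertibility of the
  name by \<open>iso_nam_sym\<close>.\<close>

lemma iso_nprg:
  assumes v: "\<forall>x. v x \<in> ob"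
  shows "L.iso (nprg v A)"
proof (induction A)
  case (Atom x)
  then show ?case using v iso_dd[of "v x"] by (simp add: prg_simps dd_def)
next
  case (NAtom x)
  then show ?case using v by (simp add: prg_simps nam_evl)
next
  case One
  then show ?case using iso_nprg_neg[OF v, of Bot] iso_nam_runit by (simp add: prg_simps)
next
  case Bot
  then show ?case using iso_nam_runit by (simp add: prg_simps)
next
  case (Tens A B)
  let ?n = "nprg v A \<star> nprg v B"
  have "nam (dom ?n) (dual M (cod ?n)) (pos (cod ?n) ?n) = dd (cod ?n) \<bullet> ?n"
    using v by (intro nam_pos) auto
  then show ?case using Tens v by (simp add: prg_simps)
next
  case (Par A B)
  have "L.iso (nprg v (Tens (neg A) (neg B)))"
  proof -
    let ?n = "nprg v (neg A) \<star> nprg v (neg B)"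
    have "nam (dom ?n) (dual M (cod ?n)) (pos (cod ?n) ?n) = dd (cod ?n) \<bullet> ?n"
      using v by (intro nam_pos) auto
    then show ?thesis using Par[THEN iso_nprg_neg[OF v]] v by (simp add: prg_simps)
  qed
  from iso_nprg_neg[OF v this] show ?case by simp
next
  case (OfCourse A)
  let ?n = "bng (nprg v A)"
  have "nam (dom ?n) (dual M (cod ?n)) (pos (cod ?n) ?n) = dd (cod ?n) \<bullet> ?n"
    using v by (intro nam_pos) auto
  then show ?case using OfCourse v by (simp add: prg_simps)
next
  case (WhyNot A)
  have "L.iso (nprg v (OfCourse (neg A)))"
  proof -
    let ?n = "bng (nprg v (neg A))"
    have "nam (dom ?n) (dual M (cod ?n)) (pos (cod ?n) ?n) = dd (cod ?n) \<bullet> ?n"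
      using v by (intro nam_pos) auto
    then show ?thesis using WhyNot[THEN iso_nprg_neg[OF v]] v by (simp add: prg_simps)
  qed
  from iso_nprg_neg[OF v this] show ?case by simp
next
  case (Para A)
  then show ?case by (simp add: prg_simps)
qed

section \<open>Naturality of names and dinaturality of evaluation\<close>

lemma nam_nat:
  assumes "L.arr t" "dom t = cod u \<otimes> cod h" "cod t = bt" "L.arr u" "L.arr h"
  shows "nam (dom u) (dom h) (t \<bullet> (u \<star> h)) = Dl h \<bullet> nam (cod u) (cod h) t \<bullet> u"
proof -
  have "Dl h \<bullet> nam (cod u) (cod h) t \<bullet> u = (Dl h \<bullet> nam (cod u) (cod h) t) \<bullet> u"
    using assms by simp
  also have "\<dots> = nam (dom u) (dom h) (t \<bullet> (u \<star> h))"
    using assms by (subst Dl_nam) (simp_all add: nam_cmp L.merge)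
  finally show ?thesis ..
qed

lemma nam_sym_nat:
  assumes "L.arr t" "dom t = cod h \<otimes> cod u" "cod t = bt" "L.arr u" "L.arr h"
  shows "nam (dom u) (dom h) ((t \<bullet> (h \<star> u)) \<bullet> L.sym (dom u) (dom h)) =
    Dl h \<bullet> nam (cod u) (cod h) (t \<bullet> L.sym (cod u) (cod h)) \<bullet> u"
proof -
  have "(t \<bullet> (h \<star> u)) \<bullet> L.sym (dom u) (dom h) = (t \<bullet> L.sym (cod u) (cod h)) \<bullet> (u \<star> h)"
    using assms by (simp add: L.sym_nat)
  then show ?thesis using assms by (simp only:, subst nam_nat) auto
qed

text \<open>Dinaturality of evaluation: an arrow on the argument moves to the functional as its
  transpose. It carries isomorphisms through the links that are interpreted by an evaluation, namely
  tensor links and boxes.\<close>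

lemma ev_dinat: "L.arr h \<Longrightarrow> L.arr w \<Longrightarrow> cod w = dom h \<Longrightarrow> cod h = d \<Longrightarrow>
    evl d \<bullet> (L.ide (dual M d) \<star> (h \<bullet> w)) = evl (dom h) \<bullet> (Dl h \<star> w)"
proof -
  assume a: "L.arr h" "L.arr w" "cod w = dom h" "cod h = d"
  have o: "d \<in> ob" "dom h \<in> ob" using a L.arr_obj by blast+
  have "evl d \<bullet> (L.ide (dual M d) \<star> (h \<bullet> w)) = (evl d \<bullet> (L.ide (dual M d) \<star> h)) \<bullet> (L.ide (dual M d) \<star> w)"
    using a o by (simp add: L.merge)
  also have "\<dots> = (evl (dom h) \<bullet> (Dl h \<star> L.ide (dom h))) \<bullet> (L.ide (dual M d) \<star> w)"
    using a evl_Dl[of h "dom h"] by simp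
  also have "\<dots> = evl (dom h) \<bullet> (Dl h \<star> w)"
    using a o by (simp add: L.merge)
  finally show ?thesis .
qed

text \<open>The form that \<open>ev_dinat\<close> takes for positive pairings: \<open>H\<close>
  after the name becomes its transpose on the other factor. In \<open>axiom_expansion\<close> it
  compares the pairings of one formula under two assignments.\<close>

lemma pos_rel:
  assumes "L.arr H" "L.arr n'" "L.arr f" "cod f = dom n'" "cod n' = dom H"
  shows "pos (cod H) (H \<bullet> n' \<bullet> f) = pos (dom H) n' \<bullet> (f \<star> Dl H)"
proof -
  let ?d = "cod H" and ?d' = "dom H"
  have "pos ?d (H \<bullet> n' \<bullet> f) = ngt ?d (H \<bullet> n' \<bullet> f) \<bullet> L.sym (dom f) (dual M ?d)"
    using assms ngt_sym[of "H \<bullet> n' \<bullet> f" ?d] by simp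
  also have "\<dots> = evl ?d' \<bullet> (Dl H \<star> (n' \<bullet> f)) \<bullet> L.sym (dom f) (dual M ?d)"
    using assms by (simp add: ngt_def ev_dinat)
  also have "\<dots> = evl ?d' \<bullet> L.sym ?d' (dual M ?d') \<bullet> ((n' \<bullet> f) \<star> Dl H)"
    using assms L.sym_nat[of "n' \<bullet> f" "Dl H" ?d' "dual M ?d'", symmetric] by simp
  also have "\<dots> = pos ?d' n' \<bullet> (f \<star> Dl H)"
    using assms by (simp add: pos_def L.merge)
  finally show ?thesis .
qed

lemma pos_cmp: "L.arr n \<Longrightarrow> cod n = d \<Longrightarrow> L.arr u \<Longrightarrow> cod u = dom n \<Longrightarrow> pos d n \<bullet> (u \<star> L.ide (dual M d)) = pos d (n \<bullet> u)"
  using L.arr_obj(2)[of n] by (simp add: pos_def L.merge)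

text \<open>The induced arrows on formulas, given arrows \<open>at i\<close> and \<open>na i\<close> on the atoms and the negated
  atoms of index \<open>i\<close>.\<close>

primrec induced :: "(int \<Rightarrow> ('o, 'a) arrow) \<Rightarrow> (int \<Rightarrow> ('o, 'a) arrow) \<Rightarrow> form \<Rightarrow> int \<Rightarrow> ('o, 'a) arrow" where
  "induced at na (Atom x) i = at i"
| "induced at na (NAtom x) i = na i"
| "induced at na One i = L.ide (Unit (lin M))"
| "induced at na Bot i = L.ide bt"
| "induced at na (Tens A B) i = induced at na A i \<star> induced at na B i"
| "induced at na (Par A B) i = Dl (Dl (induced at na A i) \<star> Dl (induced at na B i))"
| "induced at na (OfCourse A) i = bng (induced at na A (i + 1))"
| "induced at na (WhyNot A) i = Dl (bng (Dl (induced at na A (i + 1))))"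
| "induced at na (Para A) i = induced at na A (i + 1)"

lemma dom_induced: "\<forall>i. dom (at i) = s \<and> dom (na i) = dual M s \<Longrightarrow> dom (induced at na A i) = obj M (\<lambda>_. s) A"
  by (induction A arbitrary: i) auto

lemma cod_induced: "\<forall>i. cod (at i) = s \<and> cod (na i) = dual M s \<Longrightarrow> cod (induced at na A i) = obj M (\<lambda>_. s) A"
  by (induction A arbitrary: i) auto

lemma arr_induced: "\<forall>i. L.arr (at i) \<and> L.arr (na i) \<Longrightarrow> L.arr (induced at na A i)"
  by (induction A arbitrary: i) auto

lemma iso_induced: "\<forall>i. L.iso (at i) \<and> L.iso (na i) \<Longrightarrow> L.iso (induced at na A i)"
  by (induction A arbitrary: i) auto

text \<open>In the negative connectives the contravariant \<open>Dl\<close> is applied twice, so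
  that induced arrows compose in the order of the given ones.\<close>

lemma induced_cmp:
  assumes "\<forall>i. L.arr (at i) \<and> L.arr (na i) \<and> L.arr (at' i) \<and> L.arr (na' i)"
    "\<forall>i. dom (at i) = s \<and> dom (na i) = dual M s \<and> cod (at' i) = s \<and> cod (na' i) = dual M s"
  shows "induced at na A i \<bullet> induced at' na' A i = induced (\<lambda>i. at i \<bullet> at' i) (\<lambda>i. na i \<bullet> na' i) A i"
proof -
  have [simp]: "L.arr (induced at na B j)" "L.arr (induced at' na' B j)" "dom (induced at na B j) = obj M (\<lambda>_. s) B" "cod (induced at' na' B j) = obj M (\<lambda>_. s) B" for B j
    using assms by (simp_all add: arr_induced dom_induced cod_induced)
  show ?thesis
  proof (induction A arbitrary: i)
    case (Par A B)
    then show ?case by (simp add: L.tn_cmp flip: Dl_cmp)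
  next
    case (WhyNot A)
    then show ?case by (simp flip: Dl_cmp bng_cmp)
  next
    case (OfCourse A)
    then show ?case by (simp flip: bng_cmp)
  qed (auto simp: L.tn_cmp)
qed

end

section \<open>Interpretation of sequentializations\<close>

context model
begin

text \<open>The arrows that the rules of \<open>sequential\<close> assign to tensor links, boxes and
  binary mix, as functions of the arrows of the premises. In this form their naturality can be
  stated without reference to nets.\<close>

definition tens_op :: "'o \<Rightarrow> 'o \<Rightarrow> 'o list \<Rightarrow> 'o list \<Rightarrow> ('o, 'a) arrow \<Rightarrow> ('o, 'a) arrow \<Rightarrow> ('o, 'a) arrow" where
  "tens_op a b as bs t u = ngt (dual M a \<otimes> dual M b)
     ((nam (tens_list (lin M) as) a (t \<bullet> L.sym (tens_list (lin M) as) a) \<star>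
       nam (tens_list (lin M) bs) b (u \<bullet> L.sym (tens_list (lin M) bs) b)) \<bullet> L.split as bs)"

definition box_op :: "'o \<Rightarrow> 'o list \<Rightarrow> ('o, 'a) arrow \<Rightarrow> ('o, 'a) arrow" where
  "box_op a bs t = ngt (bang M (dual M a))
     (bng (nam (tens_list (lin M) (map (bang M) bs)) a (t \<bullet> L.sym (tens_list (lin M) (map (bang M) bs)) a)) \<bullet> distr bs)"

definition mix_op :: "'a \<Rightarrow> 'o list \<Rightarrow> 'o list \<Rightarrow> ('o, 'a) arrow \<Rightarrow> ('o, 'a) arrow \<Rightarrow> ('o, 'a) arrow" where
  "mix_op m as bs t u = (L.runit bt \<bullet> (L.ide bt \<star> L.inverse (Arrow (Unit (lin M)) m bt))) \<bullet> (t \<star> u) \<bullet> L.split as bs"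

lemma op_dom_cod [simp]:
  "dom (tens_op a b as bs t u) = dual M (dual M a \<otimes> dual M b) \<otimes> tens_list (lin M) (as @ bs)" "cod (tens_op a b as bs t u) = bt"
  "dom (box_op a bs t) = dual M (bang M (dual M a)) \<otimes> tens_list (lin M) (map (bang M) bs)" "cod (box_op a bs t) = bt"
  "dom (mix_op m as bs t u) = tens_list (lin M) (as @ bs)" "cod (mix_op m as bs t u) = bt"
  by (simp_all add: tens_op_def box_op_def mix_op_def)

lemma arr_tens_op:
  "L.arr t \<Longrightarrow> L.arr u \<Longrightarrow> dom t = a \<otimes> tens_list (lin M) as \<Longrightarrow> dom u = b \<otimes> tens_list (lin M) bs \<Longrightarrow>
   cod t = bt \<Longrightarrow> cod u = bt \<Longrightarrow> a \<in> ob \<Longrightarrow> b \<in> ob \<Longrightarrow> \<forall>x\<in>set as. x \<in> ob \<Longrightarrow> \<forall>x\<in>set bs. x \<in> ob \<Longrightarrow>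
   L.arr (tens_op a b as bs t u)"
  by (auto simp: tens_op_def intro!: arr_pos L.arr_cmp L.arr_tn arr_nam)

lemma arr_box_op:
  "L.arr t \<Longrightarrow> dom t = a \<otimes> tens_list (lin M) (map (bang M) bs) \<Longrightarrow> cod t = bt \<Longrightarrow> a \<in> ob \<Longrightarrow> \<forall>x\<in>set bs. x \<in> ob \<Longrightarrow>
   L.arr (box_op a bs t)"
  by (auto simp: box_op_def intro!: arr_pos L.arr_cmp L.arr_tn arr_nam arr_bng arr_distr)

lemma iso_mix: "Mix M = Some m \<Longrightarrow> L.iso (Arrow (Unit (lin M)) m bt)"
  using model by (auto simp: is_model_def L.iso_def is_iso_def is_inverse_def L.arr_def simp del: L.arr_obj)

lemma arr_mix_op:
  "Mix M = Some m \<Longrightarrow> L.arr t \<Longrightarrow> L.arr u \<Longrightarrow> dom t = tens_list (lin M) as \<Longrightarrow> dom u = tens_list (lin M) bs \<Longrightarrow>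
   cod t = bt \<Longrightarrow> cod u = bt \<Longrightarrow> \<forall>x\<in>set as. x \<in> ob \<Longrightarrow> \<forall>x\<in>set bs. x \<in> ob \<Longrightarrow>
   L.arr (mix_op m as bs t u)"
  using iso_mix[of m] by (auto simp: mix_op_def intro!: L.arr_cmp L.arr_tn)

text \<open>Naming transposes the arrows \<open>h\<close> and \<open>k\<close> of the two active
  formulas, and \<open>ev_dinat\<close> transposes their tensor once more; the arrows of the
  contexts pass through the splitting.\<close>

lemma tens_op_nat:
  assumes "L.arr t" "L.arr u" "dom t = cod h \<otimes> cod (L.tlist ts)" "dom u = cod k \<otimes> cod (L.tlist us)"
    "cod t = bt" "cod u = bt" "L.arr h" "L.arr k" "\<forall>x\<in>set ts. L.arr x" "\<forall>x\<in>set us. L.arr x"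
  shows "tens_op (dom h) (dom k) (map dom ts) (map dom us) (t \<bullet> (h \<star> L.tlist ts)) (u \<bullet> (k \<star> L.tlist us)) =
    tens_op (cod h) (cod k) (map cod ts) (map cod us) t u \<bullet> (Dl (Dl h \<star> Dl k) \<star> L.tlist (ts @ us))"
proof -
  let ?T = "L.tlist ts" and ?U = "L.tlist us"
  let ?n = "nam (cod ?T) (cod h) (t \<bullet> L.sym (cod ?T) (cod h))" and ?m = "nam (cod ?U) (cod k) (u \<bullet> L.sym (cod ?U) (cod k))"
  have [simp]: "L.arr ?T" "L.arr ?U" "L.arr (L.tlist (ts @ us))" using assms by simp_all
  have [simp]: "L.arr ?n" "L.arr ?m" using assms by (auto intro!: arr_nam)
  have [simp]: "L.arr (L.split (map dom ts) (map dom us))" "L.arr (L.split (map cod ts) (map cod us))"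
    using assms by (auto intro!: L.arr_split)
  have "tens_op (dom h) (dom k) (map dom ts) (map dom us) (t \<bullet> (h \<star> ?T)) (u \<bullet> (k \<star> ?U)) =
    ngt (dual M (dom h) \<otimes> dual M (dom k)) (((Dl h \<bullet> ?n \<bullet> ?T) \<star> (Dl k \<bullet> ?m \<bullet> ?U)) \<bullet> L.split (map dom ts) (map dom us))"
    unfolding tens_op_def using nam_sym_nat[of t h ?T] nam_sym_nat[of u k ?U] assms by simp
  also have "((Dl h \<bullet> ?n \<bullet> ?T) \<star> (Dl k \<bullet> ?m \<bullet> ?U)) \<bullet> L.split (map dom ts) (map dom us) =
     (Dl h \<star> Dl k) \<bullet> (?n \<star> ?m) \<bullet> (?T \<star> ?U) \<bullet> L.split (map dom ts) (map dom us)"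
    using assms by (simp add: L.merge)
  also have "\<dots> = (Dl h \<star> Dl k) \<bullet> ((?n \<star> ?m) \<bullet> L.split (map cod ts) (map cod us)) \<bullet> L.tlist (ts @ us)"
    using assms by (simp add: L.split_nat)
  also have "ngt (dual M (dom h) \<otimes> dual M (dom k)) \<dots> =
     evl (dual M (cod h) \<otimes> dual M (cod k)) \<bullet> (Dl (Dl h \<star> Dl k) \<star> (((?n \<star> ?m) \<bullet> L.split (map cod ts) (map cod us)) \<bullet> L.tlist (ts @ us)))"
    unfolding ngt_def using assms by (subst ev_dinat) auto
  also have "\<dots> = tens_op (cod h) (cod k) (map cod ts) (map cod us) t u \<bullet> (Dl (Dl h \<star> Dl k) \<star> L.tlist (ts @ us))"
    unfolding tens_op_def ngt_def using assms by (simp add: L.merge)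
  finally show ?thesis .
qed

text \<open>As for the tensor link, with promotion in the place of splitting. The arrows of the
  context are of the form \<open>bng t\<close>, because the auxiliary conclusions of a box are flat
  and \<open>distr_nat\<close> applies to such lists.\<close>

lemma box_op_nat:
  assumes "L.arr t" "dom t = cod h \<otimes> cod (L.tlist (map bng ts))" "cod t = bt" "L.arr h" "\<forall>x\<in>set ts. L.arr x"
  shows "box_op (dom h) (map dom ts) (t \<bullet> (h \<star> L.tlist (map bng ts))) =
    box_op (cod h) (map cod ts) t \<bullet> (Dl (bng (Dl h)) \<star> L.tlist (map bng ts))"
proof -
  let ?T = "L.tlist (map bng ts)"
  let ?n = "nam (cod ?T) (cod h) (t \<bullet> L.sym (cod ?T) (cod h))"
  have c: "tens_list (lin M) (map (bang M) (map cod ts)) = cod ?T" "tens_list (lin M) (map (bang M) (map dom ts)) = dom ?T"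
    by (simp_all add: comp_def)
  have [simp]: "L.arr ?T" using assms by simp
  have [simp]: "L.arr ?n" using assms by (auto intro!: arr_nam)
  have [simp]: "L.arr (distr (map dom ts))" "L.arr (distr (map cod ts))" using assms by simp_all
  have dc: "dom (distr (map dom ts)) = dom ?T" "cod (distr (map dom ts)) = bang M (dom ?T)"
    "dom (distr (map cod ts)) = cod ?T" "cod (distr (map cod ts)) = bang M (cod ?T)"
    by (simp_all add: comp_def)
  note L.tlist_dom_cod [simp del] distr_dom_cod [simp del] dc [simp]
  have "box_op (dom h) (map dom ts) (t \<bullet> (h \<star> ?T)) = ngt (bang M (dual M (dom h))) (bng (Dl h \<bullet> ?n \<bullet> ?T) \<bullet> distr (map dom ts))"
    unfolding box_op_def c using nam_sym_nat[of t h ?T] assms by simp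
  also have "bng (Dl h \<bullet> ?n \<bullet> ?T) \<bullet> distr (map dom ts) = bng (Dl h) \<bullet> bng ?n \<bullet> bng ?T \<bullet> distr (map dom ts)"
    using assms by (simp add: bng_cmp)
  also have "bng ?T \<bullet> distr (map dom ts) = distr (map cod ts) \<bullet> ?T"
    using assms by (simp add: distr_nat)
  also have "ngt (bang M (dual M (dom h))) (bng (Dl h) \<bullet> bng ?n \<bullet> distr (map cod ts) \<bullet> ?T) =
     evl (bang M (dual M (cod h))) \<bullet> (Dl (bng (Dl h)) \<star> (bng ?n \<bullet> distr (map cod ts) \<bullet> ?T))"
    unfolding ngt_def using assms by (subst ev_dinat) auto
  also have "\<dots> = box_op (cod h) (map cod ts) t \<bullet> (Dl (bng (Dl h)) \<star> ?T)"
    unfolding box_op_def ngt_def c using assms by (simp add: L.merge)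
  finally show ?thesis .
qed

lemma mix_op_nat:
  assumes "Mix M = Some m" "L.arr t" "L.arr u" "dom t = cod (L.tlist ts)" "dom u = cod (L.tlist us)"
    "cod t = bt" "cod u = bt" "\<forall>x\<in>set ts. L.arr x" "\<forall>x\<in>set us. L.arr x"
  shows "mix_op m (map dom ts) (map dom us) (t \<bullet> L.tlist ts) (u \<bullet> L.tlist us) =
    mix_op m (map cod ts) (map cod us) t u \<bullet> L.tlist (ts @ us)"
proof -
  let ?T = "L.tlist ts" and ?U = "L.tlist us"
  let ?w = "L.runit bt \<bullet> (L.ide bt \<star> L.inverse (Arrow (Unit (lin M)) m bt))"
  have [simp]: "L.arr ?T" "L.arr ?U" "L.arr (L.tlist (ts @ us))" using assms by simp_all
  have [simp]: "L.arr (L.split (map dom ts) (map dom us))" "L.arr (L.split (map cod ts) (map cod us))"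
    using assms by (auto intro!: L.arr_split)
  have w: "L.arr ?w" "dom ?w = bt \<otimes> bt" "cod ?w = bt" using iso_mix[OF assms(1)] by simp_all
  have "mix_op m (map dom ts) (map dom us) (t \<bullet> ?T) (u \<bullet> ?U) = ?w \<bullet> ((t \<star> u) \<bullet> (?T \<star> ?U)) \<bullet> L.split (map dom ts) (map dom us)"
    unfolding mix_op_def using assms by (simp add: L.merge)
  also have "\<dots> = ?w \<bullet> (t \<star> u) \<bullet> L.split (map cod ts) (map cod us) \<bullet> L.tlist (ts @ us)"
    using assms by (simp add: L.split_nat)
  also have "\<dots> = mix_op m (map cod ts) (map cod us) t u \<bullet> L.tlist (ts @ us)"
    unfolding mix_op_def
    using assms L.cmp_assoc[of ?w "(t \<star> u) \<bullet> L.split (map cod ts) (map cod us)" "L.tlist (ts @ us)"] w by simp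
  finally show ?thesis .
qed

section \<open>Typed sequentializations, rule by rule\<close>

abbreviation tl :: "(nat \<Rightarrow> 'o) \<Rightarrow> (edge \<Rightarrow> label) \<Rightarrow> edge list \<Rightarrow> 'o" where
  "tl v lab \<Gamma> \<equiv> tens_list (lin M) (negs M v lab \<Gamma>)"

definition sq :: "(nat \<Rightarrow> 'o) \<Rightarrow> (edge \<Rightarrow> label) \<Rightarrow> link fset \<Rightarrow> edge list \<Rightarrow> ('o, 'a) arrow \<Rightarrow> bool" where
  "sq v lab R \<Gamma> t \<longleftrightarrow> sequential M v lab R \<Gamma> (raw t) \<and> L.arr t \<and> dom t = tl v lab \<Gamma> \<and> cod t = bt"

lemma sqD: "sq v lab R \<Gamma> t \<Longrightarrow> sequential M v lab R \<Gamma> (raw t)"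
  "sq v lab R \<Gamma> t \<Longrightarrow> L.arr t" "sq v lab R \<Gamma> t \<Longrightarrow> dom t = tl v lab \<Gamma>" "sq v lab R \<Gamma> t \<Longrightarrow> cod t = bt"
  by (simp_all add: sq_def)

lemma sqI: "sequential M v lab R \<Gamma> g \<Longrightarrow> g = raw t \<Longrightarrow> L.arr t \<Longrightarrow> dom t = tl v lab \<Gamma> \<Longrightarrow> cod t = bt \<Longrightarrow> sq v lab R \<Gamma> t"
  by (simp add: sq_def)

context
  fixes v :: "nat \<Rightarrow> 'o" and lab :: "edge \<Rightarrow> label"
  assumes v: "\<forall>x. v x \<in> ob"
begin

lemma sq_exch:
  assumes "sq v lab R \<Gamma> t" "exchange (lin M) (\<lambda>e. neg_obj M v (lab e)) \<Delta> \<Gamma> s"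
  shows "sq v lab R \<Delta> (t \<bullet> Arrow (tl v lab \<Delta>) s (tl v lab \<Gamma>))"
  using sequential.exch[OF sqD(1)[OF assms(1)] assms(2)] sqD[OF assms(1)] L.exchange_arr[OF assms(2)] v
  by (intro sqI) (auto simp: L.raw_simps)

lemma sq_swap:
  assumes "sq v lab R (e' # e # \<Gamma>) t"
  shows "sq v lab R (e # e' # \<Gamma>) (t \<bullet> L.swap (neg_obj M v (lab e)) (neg_obj M v (lab e')) (tl v lab \<Gamma>))"
  using sq_exch[OF assms exchange.intros(2)[OF refl refl refl]]
  by (simp add: L.swap_def L.cmp_def L.tn_def L.ide_def L.assoc_def L.sym_def L.inverse_def)

lemma sq_swap_tail:
  assumes "sq v lab R (x # e' # e # \<Gamma>) t"
  shows "sq v lab R (x # e # e' # \<Gamma>)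
    (t \<bullet> (L.ide (neg_obj M v (lab x)) \<star> L.swap (neg_obj M v (lab e)) (neg_obj M v (lab e')) (tl v lab \<Gamma>)))"
  using sq_exch[OF assms exchange.intros(3)[OF exchange.intros(2)[OF refl refl refl]]]
  by (simp add: L.swap_def L.cmp_def L.tn_def L.ide_def L.assoc_def L.sym_def L.inverse_def)

lemma sq_mix0: "Mix M = Some m \<Longrightarrow> sq v lab {||} [] (Arrow (Unit (lin M)) m bt)"
  by (rule sqI[OF sequential.mix0]) (auto simp: iso_mix L.iso_arr)

lemma sq_mix2:
  assumes "Mix M = Some m" "sq v lab R \<Gamma> t" "sq v lab S \<Delta> u" "R |\<inter>| S = {||}"
  shows "sq v lab (R |\<union>| S) (\<Gamma> @ \<Delta>) (mix_op m (negs M v lab \<Gamma>) (negs M v lab \<Delta>) t u)"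
  by (rule sqI[OF sequential.mix2[OF assms(1) sqD(1)[OF assms(2)] sqD(1)[OF assms(3)] assms(4)]])
     (use v sqD[OF assms(2)] sqD[OF assms(3)] assms(1) in \<open>auto simp: mix_op_def L.raw_simps L.raw_split intro!: arr_mix_op[unfolded mix_op_def]\<close>)

lemma sq_ax:
  assumes "lab a = Fm (neg A)" "lab b = Fm A"
  shows "sq v lab {|AxL a b|} [a, b] (prg v A \<bullet> (L.ide (obj M v A) \<star> L.runit (obj M v (neg A))))"
  by (rule sqI[OF sequential.ax[OF assms]]) (use assms v in \<open>auto simp: L.raw_simps prg_def[of v A, THEN arg_cong[of _ _ raw], simplified]\<close>)

lemma sq_one: "lab c = Fm One \<Longrightarrow> sq v lab {|OneL c|} [c] (L.runit bt)"
  by (rule sqI[OF sequential.one]) (auto simp: L.raw_simps)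

lemma sq_bot:
  assumes "sq v lab R \<Gamma> t" "BotL c |\<notin>| R" "lab c = Fm Bot"
  shows "sq v lab (finsert (BotL c) R) (c # \<Gamma>) (t \<bullet> L.lunit (tl v lab \<Gamma>))"
  by (rule sqI[OF sequential.bot[OF sqD(1)[OF assms(1)] assms(2,3)]])
     (use v sqD[OF assms(1)] assms(3) in \<open>auto simp: L.raw_simps\<close>)

lemma sq_tens:
  assumes "sq v lab R (a # \<Gamma>) t" "sq v lab S (b # \<Delta>) u" "R |\<inter>| S = {||}" "TensL a b e |\<notin>| R |\<union>| S"
    "lab a = Fm A" "lab b = Fm B" "lab e = Fm (Tens A B)"
  shows "sq v lab (finsert (TensL a b e) (R |\<union>| S)) (e # \<Gamma> @ \<Delta>)
    (tens_op (obj M v (neg A)) (obj M v (neg B)) (negs M v lab \<Gamma>) (negs M v lab \<Delta>) t u)"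
  by (rule sqI[OF sequential.tens[OF sqD(1)[OF assms(1)] sqD(1)[OF assms(2)] assms(3-) refl refl refl refl]])
     (use v sqD[OF assms(1)] sqD[OF assms(2)] assms(5-) in
       \<open>auto simp: tens_op_def ngt_def L.raw_simps closed_raw L.raw_split intro!: arr_tens_op[unfolded tens_op_def ngt_def]\<close>)

lemma sq_par:
  assumes "sq v lab R (a # b # \<Gamma>) t" "ParL a b e |\<notin>| R" "lab a = Fm A" "lab b = Fm B" "lab e = Fm (Par A B)"
  shows "sq v lab (finsert (ParL a b e) R) (e # \<Gamma>) (t \<bullet> L.assoc (obj M v (neg A)) (obj M v (neg B)) (tl v lab \<Gamma>))"
  by (rule sqI[OF sequential.par[OF sqD(1)[OF assms(1)] assms(2-)]])
     (use v sqD[OF assms(1)] assms(3-) in \<open>auto simp: L.raw_simps\<close>)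

lemma sq_flat:
  assumes "sq v lab R (a # \<Gamma>) t" "FlatL a e |\<notin>| R" "lab a = Fm A" "lab e = Flat A"
  shows "sq v lab (finsert (FlatL a e) R) (e # \<Gamma>) (t \<bullet> (eps (obj M v (neg A)) \<star> L.ide (tl v lab \<Gamma>)))"
  by (rule sqI[OF sequential.flat[OF sqD(1)[OF assms(1)] assms(2-)]])
     (use v sqD[OF assms(1)] assms(3-) in \<open>auto simp: L.raw_simps eps_def[THEN arg_cong[of _ _ raw], simplified]\<close>)

lemma negs_flat: "\<forall>x\<in>set es. lab x = Flat A \<Longrightarrow> negs M v lab (es @ \<Gamma>) = replicate (length es) (bang M (obj M v (neg A))) @ negs M v lab \<Gamma>"
  by (induction es) auto

lemma sq_whynot:
  assumes "sq v lab R (es @ \<Gamma>) t" "WhyNotL (fset_of_list es) e |\<notin>| R" "distinct es"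
     "\<forall>x\<in>set es. lab x = Flat A" "lab e = Fm (WhyNot A)"
  shows "sq v lab (finsert (WhyNotL (fset_of_list es) e) R) (e # \<Gamma>)
    (t \<bullet> copy (obj M v (neg A)) (tl v lab \<Gamma>) (length es))"
proof -
  have "dom t = tens_list (lin M) (replicate (length es) (bang M (obj M v (neg A))) @ negs M v lab \<Gamma>)"
    using sqD(3)[OF assms(1)] unfolding negs_flat[OF assms(4)] .
  then show ?thesis
    by (intro sqI[OF sequential.whynot[OF sqD(1)[OF assms(1)] assms(2-)]])
       (use v sqD[OF assms(1)] assms(5) in \<open>auto simp: L.raw_simps raw_copy\<close>)
qed

lemma sq_para:
  assumes "sq v lab R (a # \<Gamma>) t" "ParaL a e |\<notin>| R" "lab a = Fm A" "lab e = Fm (Para A)"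
  shows "sq v lab (finsert (ParaL a e) R) (e # \<Gamma>) t"
  by (rule sqI[OF sequential.para[OF sqD(1)[OF assms(1)] assms(2-)]])
     (use v sqD[OF assms(1)] assms(3-) in auto)

lemma negs_Flat: "map lab xs = map Flat Bs \<Longrightarrow> negs M v lab xs = map (bang M) (map (\<lambda>B. obj M v (neg B)) Bs)"
proof -
  assume "map lab xs = map Flat Bs"
  then have "map (neg_obj M v) (map lab xs) = map (neg_obj M v) (map Flat Bs)" by simp
  then show ?thesis by (simp add: comp_def)
qed

lemma sq_box:
  assumes "sq v lab R (p # xs) t" "distinct xs" "lab p = Fm A" "lab e = Fm (OfCourse A)"
     "map lab xs = map Flat Bs" "map lab ys = map Flat Bs"
  shows "sq v lab {|BoxL R p e (fset_of_list (zip xs ys))|} (e # ys)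
    (box_op (obj M v (neg A)) (map (\<lambda>B. obj M v (neg B)) Bs) t)"
proof -
  have "L.arr (box_op (obj M v (neg A)) (map (\<lambda>B. obj M v (neg B)) Bs) t)"
    using v sqD[OF assms(1)] assms(3) negs_Flat[OF assms(5)] by (intro arr_box_op) auto
  then show ?thesis
    by (intro sqI[OF sequential.box[OF sqD(1)[OF assms(1)] assms(2-) refl refl]])
     (use v sqD[OF assms(1)] assms(3,4) negs_Flat[OF assms(5)] negs_Flat[OF assms(6)] in
       \<open>auto simp: box_op_def ngt_def L.raw_simps closed_raw raw_bng raw_distr\<close>)
qed

text \<open>Sequentializations with two conclusions and their interpretations without the trailing unit.\<close>

definition sq2 :: "link fset \<Rightarrow> edge \<Rightarrow> edge \<Rightarrow> ('o, 'a) arrow \<Rightarrow> bool" where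
  "sq2 R a b q \<longleftrightarrow> L.arr q \<and> dom q = neg_obj M v (lab a) \<otimes> neg_obj M v (lab b) \<and> cod q = bt \<and>
     sq v lab R [a, b] (q \<bullet> (L.ide (neg_obj M v (lab a)) \<star> L.runit (neg_obj M v (lab b))))"

lemma sq2_sym:
  assumes "sq2 R a b q"
  shows "sq2 R b a (q \<bullet> L.sym (neg_obj M v (lab b)) (neg_obj M v (lab a)))"
proof -
  let ?a = "neg_obj M v (lab a)" and ?b = "neg_obj M v (lab b)"
  have q: "L.arr q" "dom q = ?a \<otimes> ?b" "cod q = bt" using assms by (auto simp: sq2_def)
  have s: "sq v lab R [b, a] ((q \<bullet> (L.ide ?a \<star> L.runit ?b)) \<bullet> L.swap ?b ?a (Unit (lin M)))"
    using assms sq_swap[of R a b "[]"] by (simp add: sq2_def)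
  have "(q \<bullet> (L.ide ?a \<star> L.runit ?b)) \<bullet> L.swap ?b ?a (Unit (lin M)) = (q \<bullet> L.sym ?b ?a) \<bullet> (L.ide ?b \<star> L.runit ?a)"
    using q v by (simp add: L.swap_unit)
  then show ?thesis using s q v by (simp add: sq2_def)
qed

lemma sq2_ax: "lab a = Fm (neg A) \<Longrightarrow> lab b = Fm A \<Longrightarrow> sq2 {|AxL a b|} a b (prg v A)"
  using sq_ax v by (simp add: sq2_def)

lemma sq2_one:
  assumes "lab a = Fm Bot" "lab b = Fm One" "a \<noteq> b"
  shows "sq2 {|OneL b, BotL a|} a b (L.lunit bt)"
proof -
  have "sq v lab {|BotL a, OneL b|} [a, b] (L.runit bt \<bullet> L.lunit (bt \<otimes> Unit (lin M)))"
    using sq_bot[OF sq_one[OF assms(2)], of a] assms by simp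
  moreover have "L.runit bt \<bullet> L.lunit (bt \<otimes> Unit (lin M)) = L.lunit bt \<bullet> (L.ide (Unit (lin M)) \<star> L.runit bt)"
    by (simp add: L.lunit_nat)
  ultimately show ?thesis using assms v by (simp add: sq2_def finsert_commute)
qed

lemma sq2_para:
  assumes "sq2 R a' b' q" "lab a' = Fm (neg A)" "lab b' = Fm A" "lab a = Fm (Para (neg A))" "lab b = Fm (Para A)"
    "ParaL a' a |\<notin>| R" "ParaL b' b |\<notin>| R" "a' \<noteq> b'"
  shows "sq2 (finsert (ParaL a' a) (finsert (ParaL b' b) R)) a b q"
proof -
  have 1: "sq2 (finsert (ParaL a' a) R) a b' q"
    using assms sq_para[of R a' "[b']" _ a "neg A"] by (simp add: sq2_def)
  have 2: "sq2 (finsert (ParaL b' b) (finsert (ParaL a' a) R)) b a (q \<bullet> L.sym (obj M v (neg A)) (obj M v A))"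
    using sq2_sym[OF 1] assms sq_para[of "finsert (ParaL a' a) R" b' "[a]" _ b A] by (simp add: sq2_def)
  show ?thesis
    using sq2_sym[OF 2] assms v by (simp add: sq2_def finsert_commute)
qed

text \<open>Stops before the par link: the expansions into an identity and into a symmetry share
  this part and differ only in the order of the premises of the par link.\<close>

lemma sq2_tens_aux:
  assumes "sq2 R a0 b0 q0" "sq2 S a1 b1 q1" "R |\<inter>| S = {||}" "TensL b0 b1 b |\<notin>| R |\<union>| S"
    "lab a0 = Fm (neg A)" "lab b0 = Fm A" "lab a1 = Fm (neg B)" "lab b1 = Fm B" "lab b = Fm (Tens A B)"
  defines "x \<equiv> obj M v A" and "y \<equiv> obj M v B" and "d \<equiv> dual M (obj M v (neg A)) \<otimes> dual M (obj M v (neg B))"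
  defines "n0 \<equiv> nam x (obj M v (neg A)) q0" and "n1 \<equiv> nam y (obj M v (neg B)) q1"
  shows "sq v lab (finsert (TensL b0 b1 b) (R |\<union>| S)) [a0, a1, b]
    (ngt d (n0 \<star> n1) \<bullet> (L.ide (dual M d) \<star> (L.ide x \<star> L.runit y)) \<bullet>
      L.swap x (dual M d) (y \<otimes> Unit (lin M)) \<bullet> (L.ide x \<star> L.swap y (dual M d) (Unit (lin M))))"
proof -
  let ?x' = "obj M v (neg A)" and ?y' = "obj M v (neg B)" and ?e = "Unit (lin M)"
  have o [simp]: "x \<in> ob" "y \<in> ob" "?x' \<in> ob" "?y' \<in> ob" "d \<in> ob" using v by (simp_all add: x_def y_def d_def)
  have q: "L.arr q0" "dom q0 = x \<otimes> ?x'" "cod q0 = bt" "L.arr q1" "dom q1 = y \<otimes> ?y'" "cod q1 = bt"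
    using assms(1,2,5-8) by (simp_all add: sq2_def x_def y_def)
  have n: "L.arr n0" "L.arr n1" "dom n0 = x" "dom n1 = y" "cod n0 \<otimes> cod n1 = d"
    using q by (simp_all add: n0_def n1_def d_def)
  \<comment> \<open>Takes the trailing unit of a one-formula context out of its name.\<close>
  have nm: "nam (u \<otimes> ?e) u' (((p \<bullet> L.sym u' u) \<bullet> (L.ide u' \<star> L.runit u)) \<bullet> L.sym (u \<otimes> ?e) u') = nam u u' p \<bullet> L.runit u"
    if "L.arr p" "dom p = u \<otimes> u'" "cod p = bt" "u \<in> ob" "u' \<in> ob" for p u u'
  proof -
    have "((p \<bullet> L.sym u' u) \<bullet> (L.ide u' \<star> L.runit u)) \<bullet> L.sym (u \<otimes> ?e) u' = p \<bullet> (L.runit u \<star> L.ide u')"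
      using that L.sym_nat[of "L.runit u" "L.ide u'" u u', symmetric] by simp
    then show ?thesis using that by (simp add: nam_cmp)
  qed
  have 1: "sq v lab R [b0, a0] ((q0 \<bullet> L.sym ?x' x) \<bullet> (L.ide ?x' \<star> L.runit x))"
    "sq v lab S [b1, a1] ((q1 \<bullet> L.sym ?y' y) \<bullet> (L.ide ?y' \<star> L.runit y))"
    using sq2_sym[OF assms(1)] sq2_sym[OF assms(2)] assms(5-8) by (simp_all add: sq2_def x_def y_def)
  have "tens_op ?x' ?y' [x] [y] ((q0 \<bullet> L.sym ?x' x) \<bullet> (L.ide ?x' \<star> L.runit x)) ((q1 \<bullet> L.sym ?y' y) \<bullet> (L.ide ?y' \<star> L.runit y)) =
     ngt d (((n0 \<bullet> L.runit x) \<star> (n1 \<bullet> L.runit y)) \<bullet> L.split [x] [y])"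
    unfolding tens_op_def tens_list.simps using nm[OF q(1-3) o(1,3)] nm[OF q(4-6) o(2,4)]
    by (simp add: n0_def n1_def d_def)
  also have "((n0 \<bullet> L.runit x) \<star> (n1 \<bullet> L.runit y)) \<bullet> L.split [x] [y] = (n0 \<star> n1) \<bullet> (L.runit x \<star> L.runit y) \<bullet> L.split [x] [y]"
    using n by (subst L.tn_cmp_cmp) (auto simp del: L.split.simps)
  also have "(L.runit x \<star> L.runit y) \<bullet> L.split [x] [y] = L.ide x \<star> L.runit y"
    by (rule L.split_unit) auto
  also have "ngt d ((n0 \<star> n1) \<bullet> (L.ide x \<star> L.runit y)) = ngt d (n0 \<star> n1) \<bullet> (L.ide (dual M d) \<star> (L.ide x \<star> L.runit y))"
    unfolding ngt_def using n by (simp add: L.merge)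
  finally have e: "tens_op ?x' ?y' [x] [y] ((q0 \<bullet> L.sym ?x' x) \<bullet> (L.ide ?x' \<star> L.runit x)) ((q1 \<bullet> L.sym ?y' y) \<bullet> (L.ide ?y' \<star> L.runit y)) =
     ngt d (n0 \<star> n1) \<bullet> (L.ide (dual M d) \<star> (L.ide x \<star> L.runit y))" .
  have "negs M v lab [a0] = [x]" "negs M v lab [a1] = [y]" using assms(5,7) by (simp_all add: x_def y_def)
  with sq_tens[OF 1 assms(3,4,6,8,9)] e
  have "sq v lab (finsert (TensL b0 b1 b) (R |\<union>| S)) [b, a0, a1] (ngt d (n0 \<star> n1) \<bullet> (L.ide (dual M d) \<star> (L.ide x \<star> L.runit y)))"
    by simp
  from sq_swap_tail[OF sq_swap[OF this]] show ?thesis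
    using assms(5,7,9) n by (simp add: x_def[symmetric] y_def[symmetric] d_def[symmetric])
qed

text \<open>The expansion of an axiom on a tensor formula has the arrow of the axiom itself:
  \<open>rotate_unit\<close> condenses the exchanges between the tensor and the par link into a
  symmetry, which \<open>ngt_sym\<close> turns into a positive pairing.\<close>

lemma sq2_tens:
  assumes "sq2 R a0 b0 q0" "sq2 S a1 b1 q1" "R |\<inter>| S = {||}" "TensL b0 b1 b |\<notin>| R |\<union>| S"
    "lab a0 = Fm (neg A)" "lab b0 = Fm A" "lab a1 = Fm (neg B)" "lab b1 = Fm B"
    "lab a = Fm (Par (neg A) (neg B))" "lab b = Fm (Tens A B)" "ParL a0 a1 a |\<notin>| R |\<union>| S"
  shows "sq2 (finsert (ParL a0 a1 a) (finsert (TensL b0 b1 b) (R |\<union>| S))) a b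
    (pos (dual M (obj M v (neg A)) \<otimes> dual M (obj M v (neg B)))
      (nam (obj M v A) (obj M v (neg A)) q0 \<star> nam (obj M v B) (obj M v (neg B)) q1))"
proof -
  let ?x = "obj M v A" and ?y = "obj M v B" and ?d = "dual M (obj M v (neg A)) \<otimes> dual M (obj M v (neg B))"
  let ?n = "nam ?x (obj M v (neg A)) q0 \<star> nam ?y (obj M v (neg B)) q1" and ?e = "Unit (lin M)"
  have n: "L.arr ?n" using assms(1,2,5-8) v by (simp add: sq2_def)
  have ng: "L.arr (ngt ?d ?n)" using n by simp
  have "(ngt ?d ?n \<bullet> (L.ide (dual M ?d) \<star> (L.ide ?x \<star> L.runit ?y)) \<bullet>
      L.swap ?x (dual M ?d) (?y \<otimes> ?e) \<bullet> (L.ide ?x \<star> L.swap ?y (dual M ?d) ?e)) \<bullet>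
      L.assoc ?x ?y (dual M ?d \<otimes> ?e) =
      ngt ?d ?n \<bullet> ((L.ide (dual M ?d) \<star> (L.ide ?x \<star> L.runit ?y)) \<bullet>
      L.swap ?x (dual M ?d) (?y \<otimes> ?e) \<bullet> (L.ide ?x \<star> L.swap ?y (dual M ?d) ?e) \<bullet>
      L.assoc ?x ?y (dual M ?d \<otimes> ?e))"
    using ng v by simp
  also have "\<dots> = ngt ?d ?n \<bullet> L.sym (?x \<otimes> ?y) (dual M ?d) \<bullet> (L.ide (?x \<otimes> ?y) \<star> L.runit (dual M ?d))"
    using v by (subst L.rotate_unit) auto
  also have "\<dots> = (ngt ?d ?n \<bullet> L.sym (dom ?n) (dual M ?d)) \<bullet> (L.ide (?x \<otimes> ?y) \<star> L.runit (dual M ?d))"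
    using ng v by simp
  also have "\<dots> = pos ?d ?n \<bullet> (L.ide (?x \<otimes> ?y) \<star> L.runit (dual M ?d))"
    using n by (subst ngt_sym) auto
  finally have "(ngt ?d ?n \<bullet> (L.ide (dual M ?d) \<star> (L.ide ?x \<star> L.runit ?y)) \<bullet>
      L.swap ?x (dual M ?d) (?y \<otimes> ?e) \<bullet> (L.ide ?x \<star> L.swap ?y (dual M ?d) ?e)) \<bullet>
      L.assoc ?x ?y (dual M ?d \<otimes> ?e) = pos ?d ?n \<bullet> (L.ide (?x \<otimes> ?y) \<star> L.runit (dual M ?d))" .
  with sq_par[OF sq2_tens_aux[OF assms(1-8,10)], of a "neg A" "neg B"] show ?thesis
    using assms(5,7,9-11) n by (simp add: sq2_def)
qed

text \<open>One more exchange precedes the par link and leaves a symmetry, which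
  \<open>pos_cmp\<close> moves into the name. For two axioms on the atom X this is the arrow of the
  net \<gamma>.\<close>

lemma sq2_tens_swapped:
  assumes "sq2 R a0 b0 q0" "sq2 S a1 b1 q1" "R |\<inter>| S = {||}" "TensL b0 b1 b |\<notin>| R |\<union>| S"
    "lab a0 = Fm (neg A)" "lab b0 = Fm A" "lab a1 = Fm (neg B)" "lab b1 = Fm B"
    "lab a = Fm (Par (neg B) (neg A))" "lab b = Fm (Tens A B)" "ParL a1 a0 a |\<notin>| R |\<union>| S"
  shows "sq2 (finsert (ParL a1 a0 a) (finsert (TensL b0 b1 b) (R |\<union>| S))) a b
    (pos (dual M (obj M v (neg A)) \<otimes> dual M (obj M v (neg B)))
      ((nam (obj M v A) (obj M v (neg A)) q0 \<star> nam (obj M v B) (obj M v (neg B)) q1) \<bullet> L.sym (obj M v B) (obj M v A)))"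
proof -
  let ?x = "obj M v A" and ?y = "obj M v B" and ?d = "dual M (obj M v (neg A)) \<otimes> dual M (obj M v (neg B))"
  let ?n = "nam ?x (obj M v (neg A)) q0 \<star> nam ?y (obj M v (neg B)) q1" and ?e = "Unit (lin M)"
  have n: "L.arr ?n" using assms(1,2,5-8) v by (simp add: sq2_def)
  have ng: "L.arr (ngt ?d ?n)" using n by simp
  have "((ngt ?d ?n \<bullet> (L.ide (dual M ?d) \<star> (L.ide ?x \<star> L.runit ?y)) \<bullet>
      L.swap ?x (dual M ?d) (?y \<otimes> ?e) \<bullet> (L.ide ?x \<star> L.swap ?y (dual M ?d) ?e)) \<bullet>
      L.swap ?y ?x (dual M ?d \<otimes> ?e)) \<bullet> L.assoc ?y ?x (dual M ?d \<otimes> ?e) =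
      ngt ?d ?n \<bullet> ((L.ide (dual M ?d) \<star> (L.ide ?x \<star> L.runit ?y)) \<bullet>
      L.swap ?x (dual M ?d) (?y \<otimes> ?e) \<bullet> (L.ide ?x \<star> L.swap ?y (dual M ?d) ?e) \<bullet>
      L.assoc ?x ?y (dual M ?d \<otimes> ?e)) \<bullet> (L.sym ?y ?x \<star> L.ide (dual M ?d \<otimes> ?e))"
    using ng v by (simp add: L.swap_def[of ?y ?x])
  also have "\<dots> = ngt ?d ?n \<bullet> (L.sym (?x \<otimes> ?y) (dual M ?d) \<bullet> (L.ide (?x \<otimes> ?y) \<star> L.runit (dual M ?d))) \<bullet> (L.sym ?y ?x \<star> L.ide (dual M ?d \<otimes> ?e))"
    using v by (subst L.rotate_unit) auto
  also have "\<dots> = (ngt ?d ?n \<bullet> L.sym (dom ?n) (dual M ?d)) \<bullet> (L.sym ?y ?x \<star> L.ide (dual M ?d)) \<bullet> (L.ide (?y \<otimes> ?x) \<star> L.runit (dual M ?d))"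
    using ng v by (simp add: L.merge)
  also have "\<dots> = (pos ?d ?n \<bullet> (L.sym ?y ?x \<star> L.ide (dual M ?d))) \<bullet> (L.ide (?y \<otimes> ?x) \<star> L.runit (dual M ?d))"
    using n v by (subst ngt_sym) auto
  also have "\<dots> = pos ?d (?n \<bullet> L.sym ?y ?x) \<bullet> (L.ide (?y \<otimes> ?x) \<star> L.runit (dual M ?d))"
    using n v by (subst pos_cmp) auto
  finally have e: "((ngt ?d ?n \<bullet> (L.ide (dual M ?d) \<star> (L.ide ?x \<star> L.runit ?y)) \<bullet>
      L.swap ?x (dual M ?d) (?y \<otimes> ?e) \<bullet> (L.ide ?x \<star> L.swap ?y (dual M ?d) ?e)) \<bullet>
      L.swap ?y ?x (dual M ?d \<otimes> ?e)) \<bullet> L.assoc ?y ?x (dual M ?d \<otimes> ?e) = pos ?d (?n \<bullet> L.sym ?y ?x) \<bullet> (L.ide (?y \<otimes> ?x) \<star> L.runit (dual M ?d))" .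
  have s: "sq v lab (finsert (ParL a1 a0 a) (finsert (TensL b0 b1 b) (R |\<union>| S))) [a, b]
     (((ngt ?d ?n \<bullet> (L.ide (dual M ?d) \<star> (L.ide ?x \<star> L.runit ?y)) \<bullet>
      L.swap ?x (dual M ?d) (?y \<otimes> ?e) \<bullet> (L.ide ?x \<star> L.swap ?y (dual M ?d) ?e)) \<bullet>
      L.swap ?y ?x (dual M ?d \<otimes> ?e)) \<bullet> L.assoc ?y ?x (dual M ?d \<otimes> ?e))"
    using sq_par[OF sq_swap[OF sq2_tens_aux[OF assms(1-8,10)]], of a "neg B" "neg A"] assms(5,7,9-11) by simp
  show ?thesis
    using s[unfolded e] assms(9,10) n v by (simp add: sq2_def)
qed

text \<open>The expansion consists of a flat link in a box and a why not link outside. Dereliction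
  cancels against the digging of the promotion by \<open>eps_dig\<close>, and the contraction of the
  why not link against its weakening by \<open>copy_one\<close>.\<close>

lemma sq2_ofcourse:
  assumes "sq2 R a0 b0 q" "lab a0 = Fm (neg A)" "lab b0 = Fm A" "lab a1 = Flat (neg A)" "lab a2 = Flat (neg A)"
    "lab a = Fm (WhyNot (neg A))" "lab b = Fm (OfCourse A)" "FlatL a0 a1 |\<notin>| R"
  shows "sq2 {|BoxL (finsert (FlatL a0 a1) R) b0 b {|(a1, a2)|}, WhyNotL {|a2|} a|} a b
    (pos (bang M (dual M (obj M v (neg A)))) (bng (nam (obj M v A) (obj M v (neg A)) q)))"
proof -
  let ?x = "obj M v A" and ?x' = "obj M v (neg A)" and ?e = "Unit (lin M)"
  let ?n = "nam ?x ?x' q" and ?d = "bang M (dual M (obj M v (neg A)))"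
  have o [simp]: "?x \<in> ob" "?x' \<in> ob" using v by simp_all
  have q [simp]: "L.arr q" "dom q = ?x \<otimes> ?x'" "cod q = bt" using assms(1-3) by (simp_all add: sq2_def)
  have "sq2 (finsert (FlatL a0 a1) R) a1 b0 (q \<bullet> (eps ?x \<star> L.ide ?x'))"
    using sq_flat[of R a0 "[b0]" "q \<bullet> (L.ide ?x \<star> L.runit ?x')" a1 "neg A"] assms by (simp add: sq2_def L.merge)
  from sq2_sym[OF this]
  have 1: "sq v lab (finsert (FlatL a0 a1) R) [b0, a1] (((q \<bullet> (eps ?x \<star> L.ide ?x')) \<bullet> L.sym ?x' (bang M ?x)) \<bullet> (L.ide ?x' \<star> L.runit (bang M ?x)))"
    using assms(2-4) by (simp add: sq2_def)
  have nm: "nam (bang M ?x \<otimes> ?e) ?x' ((((q \<bullet> (eps ?x \<star> L.ide ?x')) \<bullet> L.sym ?x' (bang M ?x)) \<bullet> (L.ide ?x' \<star> L.runit (bang M ?x))) \<bullet> L.sym (bang M ?x \<otimes> ?e) ?x')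
    = ?n \<bullet> eps ?x \<bullet> L.runit (bang M ?x)"
  proof -
    have "(((q \<bullet> (eps ?x \<star> L.ide ?x')) \<bullet> L.sym ?x' (bang M ?x)) \<bullet> (L.ide ?x' \<star> L.runit (bang M ?x))) \<bullet> L.sym (bang M ?x \<otimes> ?e) ?x'
      = q \<bullet> ((eps ?x \<bullet> L.runit (bang M ?x)) \<star> L.ide ?x')"
      using L.sym_nat[of "L.runit (bang M ?x)" "L.ide ?x'" "bang M ?x" ?x', symmetric] by (simp add: L.merge)
    then show ?thesis by (simp add: nam_cmp)
  qed
  have "bng (?n \<bullet> eps ?x \<bullet> L.runit (bang M ?x)) \<bullet> distr [?x] = bng ?n \<bullet> bng (eps ?x) \<bullet> bng (L.runit (bang M ?x)) \<bullet> distr [?x]"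
    by (simp add: bng_cmp del: distr.simps)
  also have "\<dots> = bng ?n \<bullet> bng (eps ?x) \<bullet> dig ?x \<bullet> L.runit (bang M ?x)"
    by (simp add: distr_one del: distr.simps)
  also have "\<dots> = bng ?n \<bullet> L.runit (bang M ?x)"
    by (simp add: L.reassoc[OF eps_dig])
  finally have 2: "bng (?n \<bullet> eps ?x \<bullet> L.runit (bang M ?x)) \<bullet> distr [?x] = bng ?n \<bullet> L.runit (bang M ?x)" .
  have 3: "box_op ?x' [?x] (((q \<bullet> (eps ?x \<star> L.ide ?x')) \<bullet> L.sym ?x' (bang M ?x)) \<bullet> (L.ide ?x' \<star> L.runit (bang M ?x))) =
     ngt ?d (bng ?n) \<bullet> (L.ide (dual M ?d) \<star> L.runit (bang M ?x))"
    unfolding box_op_def list.map tens_list.simps nm 2 ngt_def by (simp add: L.merge)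
  have "sq v lab {|BoxL (finsert (FlatL a0 a1) R) b0 b {|(a1, a2)|}|} [b, a2] (ngt ?d (bng ?n) \<bullet> (L.ide (dual M ?d) \<star> L.runit (bang M ?x)))"
    using sq_box[OF 1, of A b "[neg A]" "[a2]"] assms(2-7) 3 by (simp add: fset_of_list.rep_eq)
  then have "sq2 {|BoxL (finsert (FlatL a0 a1) R) b0 b {|(a1, a2)|}|} b a2 (ngt ?d (bng ?n))"
    using assms by (simp add: sq2_def)
  from sq2_sym[OF this]
  have 4: "sq2 {|BoxL (finsert (FlatL a0 a1) R) b0 b {|(a1, a2)|}|} a2 b (pos ?d (bng ?n))"
    using assms ngt_sym[of "bng ?n" ?d] by simp
  have "sq v lab (finsert (WhyNotL (fset_of_list [a2]) a) {|BoxL (finsert (FlatL a0 a1) R) b0 b {|(a1, a2)|}|}) [a, b]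
    ((pos ?d (bng ?n) \<bullet> (L.ide (bang M ?x) \<star> L.runit (dual M ?d))) \<bullet> copy ?x (dual M ?d \<otimes> ?e) (length [a2]))"
    using sq_whynot[of "{|BoxL (finsert (FlatL a0 a1) R) b0 b {|(a1, a2)|}|}" "[a2]" "[b]"
        "pos ?d (bng ?n) \<bullet> (L.ide (bang M ?x) \<star> L.runit (dual M ?d))" a "neg A"] 4 assms
    by (simp add: sq2_def del: copy.simps)
  then have "sq v lab {|BoxL (finsert (FlatL a0 a1) R) b0 b {|(a1, a2)|}, WhyNotL {|a2|} a|} [a, b]
     (pos ?d (bng ?n) \<bullet> (L.ide (bang M ?x) \<star> L.runit (dual M ?d)))"
    by (simp add: copy_one[unfolded One_nat_def] finsert_commute del: copy.simps)
  then show ?thesis using assms by (simp add: sq2_def)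
qed

end

end

section \<open>Well-formedness\<close>

lemma edge_in_iff:
  "edge_in e l \<longleftrightarrow> e \<in> concls l \<or> (\<exists>S p c P l'. l = BoxL S p c P \<and> l' |\<in>| S \<and> edge_in e l')"
  by (auto elim: edge_in.cases intro: edge_in.intros)

definition edges :: "link fset \<Rightarrow> edge set" where
  "edges R = {e. \<exists>l. l |\<in>| R \<and> edge_in e l}"

lemma edges_simps [simp]:
  "edges {||} = {}" "edges (finsert l R) = {e. edge_in e l} \<union> edges R" "edges (R |\<union>| S) = edges R \<union> edges S"
  by (auto simp: edges_def)

lemma edges_ffUnion: "edges (ffUnion F) = (\<Union>R\<in>fset F. edges R)"
  unfolding edges_def by (auto simp: ffUnion.rep_eq)

lemma edge_in_simps [simp]:
  "edge_in e (AxL a b) \<longleftrightarrow> e = a \<or> e = b"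
  "\<not> edge_in e (CutL a b)"
  "edge_in e (OneL c) \<longleftrightarrow> e = c"
  "edge_in e (BotL c) \<longleftrightarrow> e = c"
  "edge_in e (TensL a b c) \<longleftrightarrow> e = c"
  "edge_in e (ParL a b c) \<longleftrightarrow> e = c"
  "edge_in e (FlatL a c) \<longleftrightarrow> e = c"
  "edge_in e (WhyNotL E c) \<longleftrightarrow> e = c"
  "edge_in e (ParaL a c) \<longleftrightarrow> e = c"
  "edge_in e (BoxL S p c P) \<longleftrightarrow> e = c \<or> e \<in> snd ` fset P \<or> e \<in> edges S"
  unfolding edges_def by (auto simp: edge_in_iff[of e "AxL a b"] edge_in_iff[of e "CutL a b"] edge_in_iff[of e "OneL c"]
     edge_in_iff[of e "BotL c"] edge_in_iff[of e "TensL a b c"] edge_in_iff[of e "ParL a b c"] edge_in_iff[of e "FlatL a c"]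
     edge_in_iff[of e "WhyNotL E c"] edge_in_iff[of e "ParaL a c"] edge_in_iff[of e "BoxL S p c P"])

definition cns :: "link fset \<Rightarrow> edge set" where "cns R = (\<Union>l\<in>fset R. concls l)"

definition prs :: "link fset \<Rightarrow> edge set" where "prs R = (\<Union>l\<in>fset R. prems l)"

lemma cns_simps [simp]:
  "cns {||} = {}" "cns (finsert l R) = concls l \<union> cns R" "cns (R |\<union>| S) = cns R \<union> cns S"
  "prs {||} = {}" "prs (finsert l R) = prems l \<union> prs R" "prs (R |\<union>| S) = prs R \<union> prs S"
  by (auto simp: cns_def prs_def)

lemma conclusions_cns: "conclusions R = cns R - prs R"
  by (simp add: conclusions_def cns_def prs_def)

lemma cns_edges: "cns R \<subseteq> edges R"
  by (auto simp: cns_def edges_def intro: edge_in.intros)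

text \<open>Well-formedness without the requirement that premises and conclusions match up; unlike
  \<open>well_formed\<close>, it passes to subsets.\<close>

inductive pre_wf :: "(edge \<Rightarrow> label) \<Rightarrow> link fset \<Rightarrow> bool" for lab where
  "\<lbrakk> \<forall>l. l |\<in>| R \<longrightarrow> link_typed lab l;
     \<forall>l l'. l |\<in>| R \<longrightarrow> l' |\<in>| R \<longrightarrow> l \<noteq> l' \<longrightarrow> (\<forall>e. \<not> (edge_in e l \<and> edge_in e l'));
     \<forall>S p c P. BoxL S p c P |\<in>| R \<longrightarrow> pre_wf lab S \<and> edges S \<inter> concls (BoxL S p c P) = {} \<rbrakk>
   \<Longrightarrow> pre_wf lab R"

lemma pre_wf_typed: "pre_wf lab R \<Longrightarrow> l |\<in>| R \<Longrightarrow> link_typed lab l"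
  by (erule pre_wf.cases) simp

lemma pre_wf_disjoint: "pre_wf lab R \<Longrightarrow> l |\<in>| R \<Longrightarrow> l' |\<in>| R \<Longrightarrow> l \<noteq> l' \<Longrightarrow> edge_in e l \<Longrightarrow> \<not> edge_in e l'"
  by (erule pre_wf.cases) simp

lemma pre_wf_box: "pre_wf lab R \<Longrightarrow> BoxL S p c P |\<in>| R \<Longrightarrow> pre_wf lab S"
  "pre_wf lab R \<Longrightarrow> BoxL S p c P |\<in>| R \<Longrightarrow> edges S \<inter> concls (BoxL S p c P) = {}"
  by (erule pre_wf.cases, metis)+

lemma pre_wfI:
  assumes "\<And>l. l |\<in>| R \<Longrightarrow> link_typed lab l"
    "\<And>l l' e. l |\<in>| R \<Longrightarrow> l' |\<in>| R \<Longrightarrow> l \<noteq> l' \<Longrightarrow> edge_in e l \<Longrightarrow> edge_in e l' \<Longrightarrow> False"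
    "\<And>S p c P. BoxL S p c P |\<in>| R \<Longrightarrow> pre_wf lab S"
    "\<And>S p c P. BoxL S p c P |\<in>| R \<Longrightarrow> edges S \<inter> concls (BoxL S p c P) = {}"
  shows "pre_wf lab R"
  using assms by (intro pre_wf.intros) metis+

lemma well_formed_pre_wf: "well_formed lab R \<Longrightarrow> pre_wf lab R"
proof (induction rule: well_formed.induct)
  case (1 R)
  show ?case
  proof (rule pre_wf.intros)
    show "\<forall>S p c P. BoxL S p c P |\<in>| R \<longrightarrow> pre_wf lab S \<and> edges S \<inter> concls (BoxL S p c P) = {}"
      using 1(3) unfolding edges_def by blast
  qed (use 1(1,2) in blast)+
qed

lemma well_formedD:
  assumes "well_formed lab R"
  shows "l |\<in>| R \<Longrightarrow> prems l \<subseteq> cns R"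
    "l |\<in>| R \<Longrightarrow> l' |\<in>| R \<Longrightarrow> l \<noteq> l' \<Longrightarrow> prems l \<inter> prems l' = {}"
    "BoxL S p c P |\<in>| R \<Longrightarrow> well_formed lab S"
    "BoxL S p c P |\<in>| R \<Longrightarrow> conclusions S = insert p (fst ` fset P)"
  using assms unfolding cns_def by (rule well_formed.cases, meson)+

lemma well_formedI:
  assumes "pre_wf lab R" "\<And>l. l |\<in>| R \<Longrightarrow> prems l \<subseteq> cns R"
    "\<And>l l'. l |\<in>| R \<Longrightarrow> l' |\<in>| R \<Longrightarrow> l \<noteq> l' \<Longrightarrow> prems l \<inter> prems l' = {}"
    "\<And>S p c P. BoxL S p c P |\<in>| R \<Longrightarrow> well_formed lab S"
    "\<And>S p c P. BoxL S p c P |\<in>| R \<Longrightarrow> conclusions S = insert p (fst ` fset P)"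
  shows "well_formed lab R"
proof (rule well_formed.intros)
  show "\<forall>l. l |\<in>| R \<longrightarrow> link_typed lab l \<and> prems l \<subseteq> (\<Union>l'\<in>fset R. concls l')"
    using assms(2) pre_wf_typed[OF assms(1)] by (simp add: cns_def)
  show "\<forall>l l'. l |\<in>| R \<longrightarrow> l' |\<in>| R \<longrightarrow> l \<noteq> l' \<longrightarrow>
       prems l \<inter> prems l' = {} \<and> (\<forall>e. \<not> (edge_in e l \<and> edge_in e l'))"
    using assms(3) pre_wf_disjoint[OF assms(1)] by blast
  show "\<forall>S p c P. BoxL S p c P |\<in>| R \<longrightarrow>
       well_formed lab S \<and> conclusions S = insert p (fst ` fset P) \<and>
       (\<forall>l e. l |\<in>| S \<longrightarrow> edge_in e l \<longrightarrow> e \<notin> concls (BoxL S p c P))"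
  proof (intro allI impI conjI)
    fix S p c P assume b: "BoxL S p c P |\<in>| R"
    show "well_formed lab S" "conclusions S = insert p (fst ` fset P)" using assms(4,5)[OF b] .
    show "e \<notin> concls (BoxL S p c P)" if "l |\<in>| S" "edge_in e l" for l e
      using pre_wf_box(2)[OF assms(1) b] that unfolding edges_def by blast
  qed
qed

lemma pre_wf_subset: "pre_wf lab R \<Longrightarrow> S |\<subseteq>| R \<Longrightarrow> pre_wf lab S"
proof (rule pre_wfI)
  assume w: "pre_wf lab R" and "S |\<subseteq>| R"
  then have s: "l |\<in>| R" if "l |\<in>| S" for l using that by blast
  show "link_typed lab l" if "l |\<in>| S" for l using pre_wf_typed[OF w s[OF that]] .
  show False if "l |\<in>| S" "l' |\<in>| S" "l \<noteq> l'" "edge_in e l" "edge_in e l'" for l l' e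
    using pre_wf_disjoint[OF w s[OF that(1)] s[OF that(2)] that(3,4)] that(5) by simp
  show "pre_wf lab T" if "BoxL T p c P |\<in>| S" for T p c P using pre_wf_box(1)[OF w s[OF that]] .
  show "edges T \<inter> concls (BoxL T p c P) = {}" if "BoxL T p c P |\<in>| S" for T p c P using pre_wf_box(2)[OF w s[OF that]] .
qed

lemma pre_wf_edges_disjoint:
  assumes "pre_wf lab (R |\<union>| S)" "R |\<inter>| S = {||}"
  shows "edges R \<inter> edges S = {}"
proof (rule ccontr)
  assume "edges R \<inter> edges S \<noteq> {}"
  then obtain e l l' where e: "l |\<in>| R" "l' |\<in>| S" "edge_in e l" "edge_in e l'" by (auto simp: edges_def)
  then have "l \<noteq> l'" using assms(2) by (auto simp: fset_eq_iff)
  then show False using pre_wf_disjoint[OF assms(1), of l l' e] e by simp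
qed

lemma pre_wf_insert_edges: "pre_wf lab (finsert l R) \<Longrightarrow> l |\<notin>| R \<Longrightarrow> edge_in e l \<Longrightarrow> e \<notin> edges R"
  using pre_wf_edges_disjoint[of lab "{|l|}" R] by auto

lemma pre_wf_insertD:
  assumes w: "pre_wf lab (finsert l R)"
  shows "pre_wf lab R \<and> link_typed lab l"
  using pre_wf_typed[OF w, of l] pre_wf_subset[OF w, of R] by auto

lemma pre_wf_unionD: "pre_wf lab (R |\<union>| S) \<Longrightarrow> pre_wf lab R \<and> pre_wf lab S"
  using pre_wf_subset[of lab "R |\<union>| S" R] pre_wf_subset[of lab "R |\<union>| S" S] by auto

lemma pre_wf_boxD:
  assumes w: "pre_wf lab {|BoxL S p c P|}"
  shows "pre_wf lab S \<and> link_typed lab (BoxL S p c P) \<and> edges S \<inter> insert c (snd ` fset P) = {}"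
  using pre_wf_typed[OF w] pre_wf_box[OF w, of S p c P] by auto

lemma pre_wf_union:
  assumes R: "pre_wf lab R" and S: "pre_wf lab S" and d: "edges R \<inter> edges S = {}"
  shows "pre_wf lab (R |\<union>| S)"
proof (rule pre_wfI)
  have d': False if "l |\<in>| R" "l' |\<in>| S" "edge_in e l" "edge_in e l'" for l l' e
    using d that by (auto simp: edges_def)
  show "link_typed lab l" if "l |\<in>| R |\<union>| S" for l
    using that pre_wf_typed[OF R, of l] pre_wf_typed[OF S, of l] by auto
  show False if "l |\<in>| R |\<union>| S" "l' |\<in>| R |\<union>| S" "l \<noteq> l'" "edge_in e l" "edge_in e l'" for l l' e
    using that pre_wf_disjoint[OF R, of l l' e] pre_wf_disjoint[OF S, of l l' e] d'[of l l' e] d'[of l' l e] by auto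
  show "pre_wf lab T" if "BoxL T p c P |\<in>| R |\<union>| S" for T p c P
    using that pre_wf_box(1)[OF R, of T p c P] pre_wf_box(1)[OF S, of T p c P] by auto
  show "edges T \<inter> concls (BoxL T p c P) = {}" if "BoxL T p c P |\<in>| R |\<union>| S" for T p c P
    using that pre_wf_box(2)[OF R, of T p c P] pre_wf_box(2)[OF S, of T p c P] by auto
qed

lemma pre_wf_empty: "pre_wf lab {||}"
  by (rule pre_wfI) auto

lemma pre_wf_single: "link_typed lab l \<Longrightarrow> \<forall>S p c P. l \<noteq> BoxL S p c P \<Longrightarrow> pre_wf lab {|l|}"
  by (rule pre_wfI) auto

lemma pre_wf_single_box:
  "link_typed lab (BoxL S p c P) \<Longrightarrow> pre_wf lab S \<Longrightarrow> edges S \<inter> insert c (snd ` fset P) = {} \<Longrightarrow> pre_wf lab {|BoxL S p c P|}"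
  by (rule pre_wfI) auto

section \<open>Links at all depths\<close>

definition dlinks :: "link fset \<Rightarrow> link set" where
  "dlinks R = {l. \<exists>S. level R S \<and> l |\<in>| S}"

lemma all_links_dlinks: "all_links \<pi> = dlinks (links \<pi>)"
  by (simp add: all_links_def dlinks_def)

lemma dlinks_iff: "l \<in> dlinks R \<longleftrightarrow> l |\<in>| R \<or> (\<exists>S p c P. BoxL S p c P |\<in>| R \<and> l \<in> dlinks S)"
  unfolding dlinks_def mem_Collect_eq
proof
  assume "\<exists>S. level R S \<and> l |\<in>| S"
  then obtain S where S: "level R S" "l |\<in>| S" by blast
  from S(1) show "l |\<in>| R \<or> (\<exists>S p c P. BoxL S p c P |\<in>| R \<and> (\<exists>Sa. level S Sa \<and> l |\<in>| Sa))"
    by cases (use S(2) in blast)+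
next
  assume "l |\<in>| R \<or> (\<exists>S p c P. BoxL S p c P |\<in>| R \<and> (\<exists>Sa. level S Sa \<and> l |\<in>| Sa))"
  then show "\<exists>S. level R S \<and> l |\<in>| S" using level.intros by metis
qed

lemma dlinks_empty [simp]: "dlinks {||} = {}"
  by (auto simp: dlinks_iff[of _ "{||}"])

lemma dlinks_union [simp]: "dlinks (R |\<union>| S) = dlinks R \<union> dlinks S"
  unfolding set_eq_iff Un_iff dlinks_iff[of _ "R |\<union>| S"] dlinks_iff[of _ R] dlinks_iff[of _ S] by blast

lemma dlinks_single: "dlinks {|l|} = insert l (case l of BoxL S p c P \<Rightarrow> dlinks S | _ \<Rightarrow> {})"
  by (rule set_eqI, subst dlinks_iff) (auto split: link.splits)

lemma dlinks_insert [simp]: "dlinks (finsert l R) = insert l (case l of BoxL S p c P \<Rightarrow> dlinks S | _ \<Rightarrow> {}) \<union> dlinks R"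
  using dlinks_union[of "{|l|}" R] by (simp only: dlinks_single funion_finsert_left funion_fempty_left)

section \<open>Acyclicity of sequentializable nets\<close>

definition acyclic_level :: "link fset \<Rightarrow> bool" where
  "acyclic_level R \<longleftrightarrow> (\<forall>\<sigma>. switching R \<sigma> \<longrightarrow> \<not> cyclic R \<sigma>)"

definition acyclic_levels :: "link fset \<Rightarrow> bool" where
  "acyclic_levels R \<longleftrightarrow> (\<forall>S. level R S \<longrightarrow> acyclic_level S)"

lemma acyclic_levels_iff: "acyclic_levels R \<longleftrightarrow> acyclic_level R \<and> (\<forall>S p c P. BoxL S p c P |\<in>| R \<longrightarrow> acyclic_levels S)"
proof
  assume d: "acyclic_levels R"
  show "acyclic_level R \<and> (\<forall>S p c P. BoxL S p c P |\<in>| R \<longrightarrow> acyclic_levels S)"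
    using d level.intros unfolding acyclic_levels_def by metis
next
  assume d: "acyclic_level R \<and> (\<forall>S p c P. BoxL S p c P |\<in>| R \<longrightarrow> acyclic_levels S)"
  show "acyclic_levels R"
    unfolding acyclic_levels_def
  proof (intro allI impI)
    fix S assume "level R S"
    then show "acyclic_level S" by cases (use d in \<open>auto simp: acyclic_levels_def\<close>)
  qed
qed

text \<open>Round a cycle a two-colouring changes an even number of times; so if it changes in at
  most one place, it never does.\<close>

lemma cyclic_constant:
  fixes b :: "nat \<Rightarrow> bool"
  assumes n: "n > 0" and cross: "\<And>i j. i < n \<Longrightarrow> j < n \<Longrightarrow> b i \<noteq> b (Suc i mod n) \<Longrightarrow> b j \<noteq> b (Suc j mod n) \<Longrightarrow> i = j"
    and i: "i < n"
  shows "b i = b 0"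
proof -
  have no: "b j = b (Suc j mod n)" if j: "j < n" for j
  proof (rule ccontr)
    assume c: "b j \<noteq> b (Suc j mod n)"
    \<comment> \<open>A walk from the successor of the supposed change meets no other change, and n
      - 1 steps lead back to j.\<close>
    have "k < n \<Longrightarrow> b ((j + 1 + k) mod n) = b ((j + 1) mod n)" for k
    proof (induction k)
      case (Suc k)
      let ?m = "(j + 1 + k) mod n"
      \<comment> \<open>The position j would be reached only after n - 1 steps, and
        \<open>Suc k < n\<close>.\<close>
      have "?m \<noteq> j"
      proof
        assume m: "?m = j"
        show False
        proof (cases "j + 1 + k < n")
          case False
          then have "?m = j + 1 + k - n" using Suc.prems j by (simp add: le_mod_geq)
          then show False using m Suc.prems False by linarith
        qed (use m in simp)
      qed
      then have "b ?m = b (Suc ?m mod n)"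
        using cross[of ?m j] c j n by auto
      moreover have "Suc ?m mod n = (j + 1 + Suc k) mod n" by (simp add: mod_Suc_eq)
      ultimately show ?case using Suc by simp
    qed simp
    from this[of "n - 1"] have "b ((j + n) mod n) = b ((j + 1) mod n)" using n by simp
    then show False using c j by simp
  qed
  show ?thesis using i
  proof (induction i)
    case (Suc i)
    then show ?case using no[of i] by simp
  qed simp
qed

lemma switching_subset: "switching R \<sigma> \<Longrightarrow> S |\<subseteq>| R \<Longrightarrow> switching S \<sigma>"
  unfolding switching_def by blast

lemma kept_prems: "switching R \<sigma> \<Longrightarrow> l |\<in>| R \<Longrightarrow> kept \<sigma> l \<subseteq> prems l"
  by (cases l) (auto simp: switching_def)

text \<open>A cycle that crosses between two parts joined by a single edge would use that edge twice.\<close>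

lemma acyclic_level_union:
  assumes "acyclic_level R" "acyclic_level S"
    and cross: "\<And>\<sigma> e l l'. switching (R |\<union>| S) \<sigma> \<Longrightarrow> joins (R |\<union>| S) \<sigma> e l l' \<Longrightarrow> l |\<in>| R \<Longrightarrow> l' |\<notin>| R \<Longrightarrow> e = x \<sigma>"
  shows "acyclic_level (R |\<union>| S)"
  unfolding acyclic_level_def
proof (intro allI impI notI)
  fix \<sigma> assume sw: "switching (R |\<union>| S) \<sigma>" and "cyclic (R |\<union>| S) \<sigma>"
  then obtain es ls where c: "es \<noteq> []" "length ls = length es" "distinct es" "distinct ls"
    and j: "\<And>i. i < length es \<Longrightarrow> joins (R |\<union>| S) \<sigma> (es ! i) (ls ! i) (ls ! (Suc i mod length es))"
    unfolding cyclic_def by blast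
  let ?n = "length es"
  have n: "?n > 0" using c by simp
  let ?b = "\<lambda>i. ls ! i |\<in>| R"
  have x: "es ! i = x \<sigma>" if "i < ?n" "?b i \<noteq> ?b (Suc i mod ?n)" for i
  proof (cases "?b i")
    case True
    then show ?thesis using cross[OF sw j[OF that(1)]] that by auto
  next
    case False
    have "joins (R |\<union>| S) \<sigma> (es ! i) (ls ! (Suc i mod ?n)) (ls ! i)"
      using j[OF that(1)] by (auto simp: joins_def)
    then show ?thesis using cross[OF sw, of "es ! i" "ls ! (Suc i mod ?n)" "ls ! i"] False that by auto
  qed
  have const: "?b i = ?b 0" if "i < ?n" for i
    using n _ that
  proof (rule cyclic_constant[of ?n ?b])
    fix i k assume "i < ?n" "k < ?n" "?b i \<noteq> ?b (Suc i mod ?n)" "?b k \<noteq> ?b (Suc k mod ?n)"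
    then show "i = k" using x[of i] x[of k] nth_eq_iff_index_eq[OF c(3), of i k] by metis
  qed
  have m: "Suc i mod ?n < ?n" for i using n by simp
  show False
  proof (cases "?b 0")
    case True
    then have "joins R \<sigma> (es ! i) (ls ! i) (ls ! (Suc i mod ?n))" if "i < ?n" for i
      using j[OF that] const[OF that] const[OF m[of i]] by (auto simp: joins_def)
    then have "cyclic R \<sigma>" unfolding cyclic_def using c by blast
    then show False using assms(1) switching_subset[OF sw, of R] by (auto simp: acyclic_level_def)
  next
    case False
    then have "joins S \<sigma> (es ! i) (ls ! i) (ls ! (Suc i mod ?n))" if "i < ?n" for i
      using j[OF that] const[OF that] const[OF m[of i]] by (auto simp: joins_def)
    then have "cyclic S \<sigma>" unfolding cyclic_def using c by blast
    then show False using assms(2) switching_subset[OF sw, of S] by (auto simp: acyclic_level_def)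
  qed
qed

lemma acyclic_level_empty: "acyclic_level {||}"
  unfolding acyclic_level_def cyclic_def joins_def by (auto simp: neq_Nil_conv)

lemma acyclic_level_single: "concls l \<inter> prems l = {} \<Longrightarrow> acyclic_level {|l|}"
  unfolding acyclic_level_def cyclic_def
proof (intro allI impI notI)
  fix \<sigma> assume l: "concls l \<inter> prems l = {}" and sw: "switching {|l|} \<sigma>"
    and "\<exists>es ls. es \<noteq> [] \<and> length ls = length es \<and> distinct es \<and> distinct ls \<and>
     (\<forall>i<length es. joins {|l|} \<sigma> (es ! i) (ls ! i) (ls ! (Suc i mod length es)))"
  then obtain e where "joins {|l|} \<sigma> e l l" by (auto simp: neq_Nil_conv joins_def)
  then show False using l kept_prems[OF sw, of l] by (auto simp: joins_def)
qed

section \<open>Conclusions, well-formedness and acyclicity of composed nets\<close>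

definition struct :: "(edge \<Rightarrow> label) \<Rightarrow> link fset \<Rightarrow> edge list \<Rightarrow> bool" where
  "struct lab R \<Gamma> \<longleftrightarrow> distinct \<Gamma> \<and> set \<Gamma> = conclusions R \<and> well_formed lab R"

lemma struct_prs: "struct lab R \<Gamma> \<Longrightarrow> prs R \<subseteq> cns R"
  using well_formedD(1)[of lab R] by (fastforce simp: struct_def prs_def)

lemma struct_edges: "struct lab R \<Gamma> \<Longrightarrow> set \<Gamma> \<subseteq> edges R"
  using cns_edges by (auto simp: struct_def conclusions_cns)

lemma struct_union:
  assumes "struct lab R \<Gamma>" "struct lab S \<Delta>" "edges R \<inter> edges S = {}"
  shows "struct lab (R |\<union>| S) (\<Gamma> @ \<Delta>)"
proof -
  have e: "cns R \<subseteq> edges R" "cns S \<subseteq> edges S" "prs R \<subseteq> cns R" "prs S \<subseteq> cns S"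
    using cns_edges struct_prs assms by blast+
  have "conclusions (R |\<union>| S) = conclusions R \<union> conclusions S"
    using e assms(3) unfolding conclusions_cns cns_simps by blast
  moreover have "set \<Gamma> \<inter> set \<Delta> = {}" using struct_edges assms by blast
  moreover have "well_formed lab (R |\<union>| S)"
  proof -
    have w: "well_formed lab R" "well_formed lab S" using assms by (auto simp: struct_def)
    have d: "prems l \<inter> prems l' = {}" if "l |\<in>| R" "l' |\<in>| S" for l l'
    proof -
      have "prems l \<subseteq> prs R" "prems l' \<subseteq> prs S" using that by (auto simp: prs_def)
      then show ?thesis using e assms(3) by blast
    qed
    show ?thesis
    proof (rule well_formedI)
      show "pre_wf lab (R |\<union>| S)" using w[THEN well_formed_pre_wf] assms(3) by (rule pre_wf_union)
      show "prems l \<subseteq> cns (R |\<union>| S)" if "l |\<in>| R |\<union>| S" for l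
        using that well_formedD(1)[OF w(1), of l] well_formedD(1)[OF w(2), of l] by auto
      show "prems l \<inter> prems l' = {}" if "l |\<in>| R |\<union>| S" "l' |\<in>| R |\<union>| S" "l \<noteq> l'" for l l'
        using that well_formedD(2)[OF w(1), of l l'] well_formedD(2)[OF w(2), of l l'] d[of l l'] d[of l' l] by auto
      show "well_formed lab T" if "BoxL T p c P |\<in>| R |\<union>| S" for T p c P
        using that well_formedD(3)[OF w(1), of T p c P] well_formedD(3)[OF w(2), of T p c P] by auto
      show "conclusions T = insert p (fst ` fset P)" if "BoxL T p c P |\<in>| R |\<union>| S" for T p c P
        using that well_formedD(4)[OF w(1), of T p c P] well_formedD(4)[OF w(2), of T p c P] by auto
    qed
  qed
  ultimately show ?thesis using assms(1,2) by (auto simp: struct_def)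
qed

lemma struct_insert:
  assumes s: "struct lab R \<Gamma>'" and w: "pre_wf lab (finsert l R)" and l: "l |\<notin>| R" "prems l \<subseteq> set \<Gamma>'" "concls l = {e}"
    "\<forall>S p c P. l \<noteq> BoxL S p c P" and \<Gamma>: "distinct \<Gamma>" "set \<Gamma> = set \<Gamma>' - prems l"
  shows "struct lab (finsert l R) (e # \<Gamma>)"
proof -
  have e: "e \<notin> edges R" using pre_wf_insert_edges[OF w l(1), of e] l(3) by (auto intro: edge_in.intros)
  have c: "cns R \<subseteq> edges R" "prs R \<subseteq> cns R" "set \<Gamma>' = cns R - prs R"
    using cns_edges struct_prs[OF s] s by (auto simp: struct_def conclusions_cns)
  have "conclusions (finsert l R) = insert e (set \<Gamma>)"
    using e c l(2,3) \<Gamma>(2) by (auto simp: conclusions_cns)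
  moreover have "well_formed lab (finsert l R)"
  proof -
    have wR: "well_formed lab R" using s by (simp add: struct_def)
    have d: "prems l \<inter> prems l' = {}" if "l' |\<in>| R" for l'
      using that l(2) c(3) by (auto simp: prs_def)
    show ?thesis
    proof (rule well_formedI[OF w])
      show "prems k \<subseteq> cns (finsert l R)" if "k |\<in>| finsert l R" for k
        using that l(2) c(3) well_formedD(1)[OF wR, of k] by auto
      show "prems k \<inter> prems k' = {}" if "k |\<in>| finsert l R" "k' |\<in>| finsert l R" "k \<noteq> k'" for k k'
        using that well_formedD(2)[OF wR, of k k'] d[of k] d[of k'] by auto
      show "well_formed lab T" if "BoxL T p c P |\<in>| finsert l R" for T p c P
        using that l(4) well_formedD(3)[OF wR, of T p c P] by auto
      show "conclusions T = insert p (fst ` fset P)" if "BoxL T p c P |\<in>| finsert l R" for T p c P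
        using that l(4) well_formedD(4)[OF wR, of T p c P] by auto
    qed
  qed
  moreover have "e \<notin> set \<Gamma>" using e c \<Gamma>(2) by auto
  ultimately show ?thesis using \<Gamma>(1) by (simp add: struct_def)
qed

text \<open>The new link has fresh conclusions and keeps, by \<open>one\<close>, at most one premise
  under a switching, so a single edge attaches it to \<open>R\<close>. For par and why not links
  this edge is the one that the switching selects.\<close>

lemma acyclic_level_insert:
  assumes s: "struct lab R \<Gamma>'" and w: "pre_wf lab (finsert l R)" and l: "l |\<notin>| R" "prems l \<subseteq> set \<Gamma>'"
    and one: "\<And>\<sigma>. switching (finsert l R) \<sigma> \<Longrightarrow> kept \<sigma> l \<inter> edges R \<subseteq> {x \<sigma>}" and acyclic_level: "acyclic_level R"
  shows "acyclic_level (finsert l R)"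
proof -
  have e: "\<And>e. e \<in> concls l \<Longrightarrow> e \<notin> edges R" using pre_wf_insert_edges[OF w l(1)] by (auto intro: edge_in.intros)
  have c: "cns R \<subseteq> edges R" "prs R \<subseteq> cns R" "set \<Gamma>' = cns R - prs R"
    using cns_edges struct_prs[OF s] s by (auto simp: struct_def conclusions_cns)
  have "acyclic_level ({|l|} |\<union>| R)"
  proof (rule acyclic_level_union[OF acyclic_level_single acyclic_level, of _ x])
    show "concls l \<inter> prems l = {}" using e l(2) c by blast
    fix \<sigma> e l1 l2
    assume sw: "switching ({|l|} |\<union>| R) \<sigma>" and j: "joins ({|l|} |\<union>| R) \<sigma> e l1 l2" and 1: "l1 |\<in>| {|l|}" "l2 |\<notin>| {|l|}"
    then have 2: "l1 = l" "l2 |\<in>| R" by (auto simp: joins_def)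
    have "kept \<sigma> l2 \<subseteq> prems l2" "prems l2 \<subseteq> prs R" "concls l2 \<subseteq> cns R"
      using kept_prems[OF sw, of l2] 2 by (auto simp: prs_def cns_def)
    moreover have "kept \<sigma> l \<inter> edges R \<subseteq> {x \<sigma>}" using one[of \<sigma>] sw by simp
    moreover have "e \<in> concls l \<and> e \<in> kept \<sigma> l2 \<or> e \<in> concls l2 \<and> e \<in> kept \<sigma> l"
      using j 2 by (simp add: joins_def)
    ultimately show "e = x \<sigma>" using \<open>\<And>e. e \<in> concls l \<Longrightarrow> e \<notin> edges R\<close> c by blast
  qed
  then show ?thesis by simp
qed

lemma acyclic_level_disjoint_union:
  assumes "struct lab R \<Gamma>" "struct lab S \<Delta>" "edges R \<inter> edges S = {}" "acyclic_level R" "acyclic_level S"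
  shows "acyclic_level (R |\<union>| S)"
proof (rule acyclic_level_union[OF assms(4,5)])
  have e: "cns R \<subseteq> edges R" "cns S \<subseteq> edges S" "prs R \<subseteq> cns R" "prs S \<subseteq> cns S"
    using cns_edges struct_prs assms by blast+
  fix \<sigma> e l1 l2
  assume sw: "switching (R |\<union>| S) \<sigma>" and j: "joins (R |\<union>| S) \<sigma> e l1 l2" and 1: "l1 |\<in>| R" "l2 |\<notin>| R"
  then have 2: "l2 |\<in>| S" by (auto simp: joins_def)
  have k: "kept \<sigma> l2 \<subseteq> prs S" "concls l2 \<subseteq> cns S" "kept \<sigma> l1 \<subseteq> prs R" "concls l1 \<subseteq> cns R"
    using kept_prems[OF sw, of l2] kept_prems[OF sw, of l1] 1 2 by (auto simp: prs_def cns_def)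
  have "e \<in> concls l1 \<and> e \<in> kept \<sigma> l2 \<or> e \<in> concls l2 \<and> e \<in> kept \<sigma> l1"
    using j by (simp add: joins_def)
  \<comment> \<open>No edge crosses between the two parts, so the candidate for the crossing edge is
    arbitrary.\<close>
  then show "e = undefined \<sigma>" using k e assms(3) by blast
qed

lemma acyclic_levels_insert: "acyclic_level (finsert l R) \<Longrightarrow> \<forall>S p c P. l \<noteq> BoxL S p c P \<Longrightarrow> acyclic_levels R \<Longrightarrow> acyclic_levels (finsert l R)"
  unfolding acyclic_levels_iff[of "finsert l R"] acyclic_levels_iff[of R] by blast

lemma acyclic_levels_union: "acyclic_level (R |\<union>| S) \<Longrightarrow> acyclic_levels R \<Longrightarrow> acyclic_levels S \<Longrightarrow> acyclic_levels (R |\<union>| S)"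
  unfolding acyclic_levels_iff[of "R |\<union>| S"] acyclic_levels_iff[of R] acyclic_levels_iff[of S] by blast

lemma acyclic_levels_acyclic_level: "acyclic_levels R \<Longrightarrow> acyclic_level R"
  by (simp add: acyclic_levels_iff[of R])

definition no_cut :: "link fset \<Rightarrow> bool" where "no_cut R \<longleftrightarrow> (\<forall>a b. CutL a b \<notin> dlinks R)"

lemma no_cut_simps [simp]:
  "no_cut {||}" "no_cut (R |\<union>| S) \<longleftrightarrow> no_cut R \<and> no_cut S"
  "no_cut (finsert l R) \<longleftrightarrow> (\<forall>a b. l \<noteq> CutL a b) \<and> (case l of BoxL S p c P \<Rightarrow> no_cut S | _ \<Rightarrow> True) \<and> no_cut R"
  by (auto simp: no_cut_def split: link.splits)

lemma distinct_zip_snd: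
  assumes "distinct xs" "length xs = length ys" "inj_on snd (set (zip xs ys))"
  shows "distinct ys"
proof -
  have "distinct (zip xs ys)" using assms(1) by (rule distinct_zipI1)
  then have "distinct (map snd (zip xs ys))" using assms(3) unfolding distinct_map by blast
  then show ?thesis unfolding map_snd_zip[OF assms(2)] .
qed

text \<open>The easy half of sequentialization.\<close>

lemma sequential_correct:
  assumes "sequential M v lab R \<Gamma> g" "pre_wf lab R" "no_cut R"
  shows "struct lab R \<Gamma> \<and> acyclic_levels R"
  using assms
proof (induction rule: sequential.induct)
  case (exch R \<Gamma> g \<Delta> s)
  then show ?case using exchange_set[OF exch.hyps(2)] by (auto simp: struct_def)
next
  case (mix0 m)
  then show ?case using well_formedI[of lab "{||}"]
    by (auto simp: struct_def conclusions_cns acyclic_levels_iff[of "{||}"] acyclic_level_empty)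
next
  case (mix2 m R \<Gamma> g S \<Delta> h)
  have d: "edges R \<inter> edges S = {}" using pre_wf_edges_disjoint mix2 by blast
  have IH: "struct lab R \<Gamma>" "acyclic_levels R" "struct lab S \<Delta>" "acyclic_levels S" using mix2 pre_wf_unionD[of lab R S] by auto
  then show ?case using struct_union acyclic_level_disjoint_union d acyclic_levels_union acyclic_levels_acyclic_level by metis
next
  case (ax a A b)
  have "a \<noteq> b" using pre_wf_insertD[OF ax(3)] by simp
  then show ?case
    using well_formedI[OF ax(3)]
    by (auto simp: struct_def conclusions_cns acyclic_levels_iff[of "{|AxL a b|}"] acyclic_level_single)
next
  case (one c)
  then show ?case using well_formedI[OF one(2)]
    by (auto simp: struct_def conclusions_cns acyclic_levels_iff[of "{|OneL c|}"] acyclic_level_single)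
next
  case (bot R \<Gamma> g c)
  then have IH: "struct lab R \<Gamma>" "acyclic_levels R" using pre_wf_insertD[of lab "BotL c" R] by auto
  have "struct lab (finsert (BotL c) R) (c # \<Gamma>)"
    using IH bot by (intro struct_insert[of lab R \<Gamma>]) (auto simp: struct_def)
  moreover have "acyclic_level (finsert (BotL c) R)"
    by (rule acyclic_level_insert[OF IH(1) bot.prems(1) bot.hyps(2)]) (use acyclic_levels_acyclic_level[OF IH(2)] in auto)
  ultimately show ?case using acyclic_levels_insert IH by auto
next
  case (tens R a \<Gamma> g S b \<Delta> h e A B c d a' b')
  let ?l = "TensL a b e"
  have w: "pre_wf lab (R |\<union>| S)" using pre_wf_insertD[OF tens.prems(1)] by simp
  have d: "edges R \<inter> edges S = {}" using pre_wf_edges_disjoint[OF w] tens by blast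
  have IH: "struct lab R (a # \<Gamma>)" "acyclic_levels R" "struct lab S (b # \<Delta>)" "acyclic_levels S" using tens pre_wf_unionD[OF w] by auto
  have su: "struct lab (R |\<union>| S) ((a # \<Gamma>) @ (b # \<Delta>))" using struct_union[OF IH(1,3) d] .
  have "struct lab (finsert ?l (R |\<union>| S)) (e # \<Gamma> @ \<Delta>)"
    using su tens by (intro struct_insert[OF su]) (auto simp: struct_def)
  moreover have "acyclic_level (finsert ?l (R |\<union>| S))"
  proof -
    have sub: "finsert ?l R |\<subseteq>| finsert ?l (R |\<union>| S)" by auto
    have a: "a \<in> edges R" "b \<in> edges S" using struct_edges[OF IH(1)] struct_edges[OF IH(3)] by auto
    \<comment> \<open>Both premises of a tensor link survive a switching. Hence the two parts are
      attached one after the other, each by a single edge: \<open>R\<close> by a, then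
      \<open>S\<close> by b.\<close>
    have "acyclic_level (finsert ?l R)"
    proof -
      have 1: "acyclic_level ({|?l|} |\<union>| R)"
      proof (rule acyclic_level_union[of _ _ "\<lambda>_. a"])
        have el: "e \<notin> edges (R |\<union>| S)" using pre_wf_insert_edges[OF tens.prems(1)] tens by auto
        show "acyclic_level {|?l|}" using a el by (intro acyclic_level_single) auto
        fix \<sigma> x l1 l2
        assume sw: "switching ({|?l|} |\<union>| R) \<sigma>" and j: "joins ({|?l|} |\<union>| R) \<sigma> x l1 l2" and 1: "l1 |\<in>| {|?l|}" "l2 |\<notin>| {|?l|}"
        then have 2: "l1 = ?l" "l2 |\<in>| R" by (auto simp: joins_def)
        have "kept \<sigma> l2 \<subseteq> prs R" "concls l2 \<subseteq> cns R"
          using kept_prems[OF sw, of l2] 2 by (auto simp: prs_def cns_def)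
        moreover have "x = e \<and> x \<in> kept \<sigma> l2 \<or> x \<in> concls l2 \<and> x \<in> {a, b}"
          using j 2 by (simp add: joins_def)
        ultimately show "x = a" using a d el cns_edges[of R] struct_prs[OF IH(1)] unfolding edges_simps by blast
      qed (use IH acyclic_levels_acyclic_level in auto)
      then show ?thesis by simp
    qed
    then have "acyclic_level (finsert ?l R |\<union>| S)"
    proof (rule acyclic_level_union[of _ _ "\<lambda>_. b"])
      have el: "e \<notin> edges (R |\<union>| S)" using pre_wf_insert_edges[OF tens.prems(1)] tens by auto
      fix \<sigma> x l1 l2
      assume sw: "switching (finsert ?l R |\<union>| S) \<sigma>" and j: "joins (finsert ?l R |\<union>| S) \<sigma> x l1 l2"
        and 1: "l1 |\<in>| finsert ?l R" "l2 |\<notin>| finsert ?l R"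
      then have 2: "l2 |\<in>| S" by (auto simp: joins_def)
      have k: "kept \<sigma> l2 \<subseteq> prs S" "concls l2 \<subseteq> cns S"
        using kept_prems[OF sw, of l2] 2 by (auto simp: prs_def cns_def)
      consider "l1 = ?l" | "kept \<sigma> l1 \<subseteq> prs R" "concls l1 \<subseteq> cns R"
        using kept_prems[OF sw, of l1] 1 by (fastforce simp: prs_def cns_def)
      then show "x = b"
      proof cases
        case 1
        then have "x = e \<and> x \<in> kept \<sigma> l2 \<or> x \<in> concls l2 \<and> x \<in> {a, b}" using j by (simp add: joins_def)
        then show ?thesis using k a d el cns_edges[of S] struct_prs[OF IH(3)] unfolding edges_simps by blast
      next
        case 2
        have "x \<in> concls l1 \<and> x \<in> kept \<sigma> l2 \<or> x \<in> concls l2 \<and> x \<in> kept \<sigma> l1" using j by (simp add: joins_def)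
        then show ?thesis
          using 2 k d cns_edges[of R] cns_edges[of S] struct_prs[OF IH(1)] struct_prs[OF IH(3)] by blast
      qed
    qed (use IH acyclic_levels_acyclic_level in auto)
    then show ?thesis by simp
  qed
  moreover have "acyclic_levels (R |\<union>| S)"
    using IH acyclic_level_disjoint_union[OF IH(1,3) d] acyclic_levels_union acyclic_levels_acyclic_level by auto
  ultimately show ?case by (auto intro: acyclic_levels_insert)
next
  case (par R a b \<Gamma> g e A B)
  then have IH: "struct lab R (a # b # \<Gamma>)" "acyclic_levels R" using pre_wf_insertD[of lab "ParL a b e" R] by auto
  have "struct lab (finsert (ParL a b e) R) (e # \<Gamma>)"
    using IH par by (intro struct_insert[OF IH(1)]) (auto simp: struct_def)
  moreover have "acyclic_level (finsert (ParL a b e) R)"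
    by (rule acyclic_level_insert[OF IH(1) par.prems(1) par.hyps(2), of "\<lambda>\<sigma>. \<sigma> (ParL a b e)"]) (use acyclic_levels_acyclic_level[OF IH(2)] in auto)
  ultimately show ?case using acyclic_levels_insert IH by auto
next
  case (flat R a \<Gamma> g e A)
  then have IH: "struct lab R (a # \<Gamma>)" "acyclic_levels R" using pre_wf_insertD[of lab "FlatL a e" R] by auto
  have "struct lab (finsert (FlatL a e) R) (e # \<Gamma>)"
    using IH flat by (intro struct_insert[OF IH(1)]) (auto simp: struct_def)
  moreover have "acyclic_level (finsert (FlatL a e) R)"
    by (rule acyclic_level_insert[OF IH(1) flat.prems(1) flat.hyps(2)]) (use acyclic_levels_acyclic_level[OF IH(2)] in auto)
  ultimately show ?case using acyclic_levels_insert IH by auto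
next
  case (whynot R es \<Gamma> g e A)
  let ?l = "WhyNotL (fset_of_list es) e"
  have IH: "struct lab R (es @ \<Gamma>)" "acyclic_levels R" using whynot pre_wf_insertD[of lab ?l R] by auto
  have "struct lab (finsert ?l R) (e # \<Gamma>)"
    using IH whynot by (intro struct_insert[OF IH(1)]) (auto simp: struct_def fset_of_list.rep_eq)
  moreover have "acyclic_level (finsert ?l R)"
    by (rule acyclic_level_insert[OF IH(1) whynot.prems(1) whynot.hyps(2), of "\<lambda>\<sigma>. \<sigma> ?l"])
       (use acyclic_levels_acyclic_level[OF IH(2)] in \<open>auto simp: fset_of_list.rep_eq\<close>)
  ultimately show ?case using acyclic_levels_insert IH by auto
next
  case (para R a \<Gamma> g e A)
  then have IH: "struct lab R (a # \<Gamma>)" "acyclic_levels R" using pre_wf_insertD[of lab "ParaL a e" R] by auto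
  have "struct lab (finsert (ParaL a e) R) (e # \<Gamma>)"
    using IH para by (intro struct_insert[OF IH(1)]) (auto simp: struct_def)
  moreover have "acyclic_level (finsert (ParaL a e) R)"
    by (rule acyclic_level_insert[OF IH(1) para.prems(1) para.hyps(2)]) (use acyclic_levels_acyclic_level[OF IH(2)] in auto)
  ultimately show ?case using acyclic_levels_insert IH by auto
next
  case (box R p xs g A e Bs ys c a')
  let ?P = "fset_of_list (zip xs ys)"
  have w: "pre_wf lab R" "link_typed lab (BoxL R p e ?P)" "edges R \<inter> insert e (snd ` fset ?P) = {}"
    using pre_wf_boxD[OF box.prems(1)] by auto
  have IH: "struct lab R (p # xs)" "acyclic_levels R" using box w by auto
  have len: "length xs = length ys" using box.hyps by (metis length_map)
  have P: "fst ` fset ?P = set xs" "snd ` fset ?P = set ys"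
    using len by (simp_all add: fset_of_list.rep_eq flip: set_map)
  have "inj_on snd (set (zip xs ys))" using w(2) unfolding link_typed.simps fset_of_list.rep_eq by blast
  then have "distinct ys" using distinct_zip_snd[OF box.hyps(2) len] by blast
  \<comment> \<open>The conclusion of the of course link carries an exponential formula, those of
    the pax links carry flat formulas.\<close>
  moreover have "e \<notin> set ys"
  proof
    assume "e \<in> set ys"
    then have "lab e \<in> set (map lab ys)" by simp
    then show False using box.hyps by auto
  qed
  moreover have "well_formed lab {|BoxL R p e ?P|}"
  proof (rule well_formedI[OF box.prems(1)])
    have "well_formed lab R" "conclusions R = insert p (fst ` fset ?P)"
      using IH(1) P by (simp_all add: struct_def)
    then show "well_formed lab S" "conclusions S = insert q (fst ` fset Q)" if "BoxL S q c Q |\<in>| {|BoxL R p e ?P|}" for S q c Q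
      using that by simp_all
  qed auto
  ultimately have "struct lab {|BoxL R p e ?P|} (e # ys)"
    using P by (auto simp: struct_def conclusions_cns)
  moreover have "acyclic_levels {|BoxL R p e ?P|}"
    using IH(2) by (subst acyclic_levels_iff) (simp add: acyclic_level_single)
  ultimately show ?case ..
next
  case cut
  then show ?case by simp
qed

section \<open>Indexing from the conclusions upwards\<close>

text \<open>The edges that the condition \<open>index_ok\<close> mentions. For a box these include
  the premises of its links, which \<open>prems\<close> omits since a collapsed box has
  none.\<close>

fun touched :: "link \<Rightarrow> edge set" where
  "touched (BoxL S p c P) = {p, c} \<union> fst ` fset P \<union> snd ` fset P"
| "touched l = prems l \<union> concls l"

lemma index_ok_cong: "\<forall>e\<in>touched l. I e = I' e \<Longrightarrow> index_ok I l = index_ok I' l"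
proof (cases l)
  case (BoxL S p c P)
  assume "\<forall>e\<in>touched l. I e = I' e"
  then have "I p = I' p" "I c = I' c" "I x = I' x" "I y = I' y" if "(x, y) |\<in>| P" for x y
    using BoxL that by force+
  then show ?thesis using BoxL \<open>\<forall>e\<in>touched l. I e = I' e\<close> by auto
qed auto

text \<open>Axiom links are exempt: an indexing is propagated from the conclusion regardless of them
  and tested on them afterwards.\<close>

definition indexed :: "(edge \<Rightarrow> int) \<Rightarrow> link fset \<Rightarrow> bool" where
  "indexed I R \<longleftrightarrow> (\<forall>l\<in>dlinks R. (\<forall>a b. l \<noteq> AxL a b) \<longrightarrow> index_ok I l)"

lemma indexed_simps [simp]:
  "indexed I {||}" "indexed I (R |\<union>| S) \<longleftrightarrow> indexed I R \<and> indexed I S"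
  "indexed I (finsert l R) \<longleftrightarrow> ((\<forall>a b. l \<noteq> AxL a b) \<longrightarrow> index_ok I l) \<and> (case l of BoxL S p c P \<Rightarrow> indexed I S | _ \<Rightarrow> True) \<and> indexed I R"
  by (auto simp: indexed_def split: link.splits)

lemma dlinks_touched: "well_formed lab R \<Longrightarrow> l \<in> dlinks R \<Longrightarrow> touched l \<subseteq> edges R"
proof (induction rule: well_formed.induct)
  case (1 R)
  have w: "well_formed lab R" 
    by (rule well_formed.intros[OF 1(1,2)]) (intro allI impI, drule 1(3)[rule_format], elim conjE, intro conjI, assumption+)
  from 1(4) consider "l |\<in>| R" | S p c P where "BoxL S p c P |\<in>| R" "l \<in> dlinks S"
    by (subst (asm) dlinks_iff) blast
  then show ?case
  proof cases
    case 1
    have "prems l \<subseteq> edges R" using well_formedD(1)[OF w 1] cns_edges by blast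
    moreover have "concls l \<subseteq> edges R" using 1 by (auto simp: edges_def intro: edge_in.intros)
    moreover have "insert p (fst ` fset P) \<subseteq> edges R" if "l = BoxL S p c P" for S p c P
    proof -
      have "insert p (fst ` fset P) \<subseteq> edges S"
        using well_formedD(4)[OF w, of S p c P] 1 that cns_edges by (auto simp: conclusions_cns)
      also have "\<dots> \<subseteq> {e. edge_in e l}" using that by auto
      finally show ?thesis using 1 by (auto simp: edges_def)
    qed
    ultimately show ?thesis by (cases l) auto
  next
    case (2 S p c P)
    then have "touched l \<subseteq> edges S" using 1(3) by blast
    also have "\<dots> \<subseteq> {e. edge_in e (BoxL S p c P)}" by auto
    also have "\<dots> \<subseteq> edges R" using 2(1) unfolding edges_def by blast
    finally show ?thesis .
  qed
qed

lemma indexed_cong: "well_formed lab R \<Longrightarrow> \<forall>e\<in>edges R. I e = I' e \<Longrightarrow> indexed I R = indexed I' R"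
  unfolding indexed_def using dlinks_touched index_ok_cong by (metis subsetD)

text \<open>Indexings of edge-disjoint parts can be glued, since \<open>indexed_cong\<close> lets
  each part ignore the edges of the other.\<close>

lemma ex_indexing_union:
  assumes "\<And>J. \<exists>I. (\<forall>e\<in>set \<Gamma>. I e = J e) \<and> indexed I R" "\<And>J. \<exists>I. (\<forall>e\<in>set \<Delta>. I e = J e) \<and> indexed I S"
    and s: "struct lab R \<Gamma>" "struct lab S \<Delta>" and d: "edges R \<inter> edges S = {}"
  shows "\<exists>I. (\<forall>e\<in>set (\<Gamma> @ \<Delta>). I e = J e) \<and> indexed I (R |\<union>| S)"
proof -
  obtain I1 I2 where I: "\<forall>e\<in>set \<Gamma>. I1 e = J e" "indexed I1 R" "\<forall>e\<in>set \<Delta>. I2 e = J e" "indexed I2 S"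
    using assms(1)[of J] assms(2)[of J] by blast
  let ?I = "\<lambda>e. if e \<in> edges R then I1 e else I2 e"
  have "indexed ?I R" using indexed_cong[of lab R ?I I1] s I by (auto simp: struct_def)
  moreover have "\<forall>e\<in>edges S. ?I e = I2 e" using d by (auto simp: disjoint_iff)
  then have "indexed ?I S" using indexed_cong[of lab S ?I I2] s I by (auto simp: struct_def)
  moreover have "\<forall>e\<in>set (\<Gamma> @ \<Delta>). ?I e = J e"
    using I struct_edges[OF s(1)] struct_edges[OF s(2)] d by (auto simp: disjoint_iff)
  ultimately show ?thesis by (intro exI[of _ ?I]) simp
qed

text \<open>\<delta> is the step of the index at the link: 1 for why not and paragraph links, 0
  otherwise. The prescription \<open>J\<close> is arbitrary so that the induction hypothesis can be
  used with \<open>J e + \<delta>\<close> at the premises.\<close>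

lemma ex_indexing_insert:
  assumes IH: "\<And>J. \<exists>I. (\<forall>e\<in>set \<Gamma>'. I e = J e) \<and> indexed I R" and s: "struct lab R \<Gamma>'"
    and w: "pre_wf lab (finsert l R)" and l: "l |\<notin>| R" "concls l = {e}" "prems l \<subseteq> set \<Gamma>'" "set \<Gamma> = set \<Gamma>' - prems l"
    "\<forall>S p c P. l \<noteq> BoxL S p c P" and ok: "\<And>I. \<forall>x\<in>prems l. I x = I e + \<delta> \<Longrightarrow> index_ok I l"
  shows "\<exists>I. (\<forall>x\<in>set (e # \<Gamma>). I x = J x) \<and> indexed I (finsert l R)"
proof -
  have e: "e \<notin> edges R" using pre_wf_insert_edges[OF w l(1), of e] l(2) by (auto intro: edge_in.intros)
  obtain I1 where I: "\<forall>x\<in>set \<Gamma>'. I1 x = (if x \<in> prems l then J e + \<delta> else J x)" "indexed I1 R"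
    using IH[of "\<lambda>x. if x \<in> prems l then J e + \<delta> else J x"] by blast
  let ?I = "\<lambda>x. if x \<in> edges R then I1 x else J x"
  have "indexed ?I R" using indexed_cong[of lab R ?I I1] s I by (auto simp: struct_def)
  moreover have "index_ok ?I l" using I(1) l(3) e struct_edges[OF s] by (intro ok) auto
  moreover have "\<forall>x\<in>set (e # \<Gamma>). ?I x = J x" using I(1) l(4) e by auto
  ultimately show ?thesis using l(5) by (intro exI[of _ ?I]) (auto split: link.splits)
qed

text \<open>In a cut-free net, the index of the conclusion of a link determines those of its premises, so
  the axiom links are the only constraints on an indexing.\<close>

lemma ex_indexing:
  assumes "sequential M v lab R \<Gamma> g" "pre_wf lab R" "no_cut R"
  shows "\<exists>I. (\<forall>e\<in>set \<Gamma>. I e = J e) \<and> indexed I R"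
  using assms
proof (induction arbitrary: J rule: sequential.induct)
  case (exch R \<Gamma> g \<Delta> s)
  then show ?case using exchange_set[OF exch.hyps(2)] by auto
next
  case (mix0 m)
  then show ?case by auto
next
  case (mix2 m R \<Gamma> g S \<Delta> h)
  have w: "pre_wf lab R" "pre_wf lab S" using pre_wf_unionD[OF mix2.prems(1)] by auto
  have n: "no_cut R" "no_cut S" using mix2.prems by auto
  have d: "edges R \<inter> edges S = {}" using pre_wf_edges_disjoint mix2 by blast
  have s: "struct lab R \<Gamma>" "struct lab S \<Delta>"
    using sequential_correct[OF mix2.hyps(2) w(1) n(1)] sequential_correct[OF mix2.hyps(3) w(2) n(2)] by simp_all
  show ?case by (rule ex_indexing_union[OF mix2.IH(1)[OF w(1) n(1)] mix2.IH(2)[OF w(2) n(2)] s d])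
next
  case (ax a A b)
  then show ?case by (intro exI[of _ J]) auto
next
  case (one c)
  then show ?case by (intro exI[of _ J]) auto
next
  case (bot R \<Gamma> g c)
  have w: "pre_wf lab R" "no_cut R" using pre_wf_insertD[OF bot.prems(1)] bot.prems by auto
  have s: "struct lab R (\<Gamma>)" using sequential_correct[OF bot.hyps(1) w] by simp
  show ?case
    by (rule ex_indexing_insert[OF bot.IH[OF w] s bot.prems(1) bot.hyps(2), of _ _ "0"])
       (use s in \<open>auto simp: struct_def\<close>)
next
  case (tens R a \<Gamma> g S b \<Delta> h e A B c d a' b')
  have wu: "pre_wf lab (R |\<union>| S)" using pre_wf_insertD[OF tens.prems(1)] by simp
  have w: "pre_wf lab R" "pre_wf lab S" using pre_wf_unionD[OF wu] by auto
  have n: "no_cut R" "no_cut S" using tens.prems by auto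
  have d: "edges R \<inter> edges S = {}" using pre_wf_edges_disjoint[OF wu] tens by blast
  have s: "struct lab R (a # \<Gamma>)" "struct lab S (b # \<Delta>)"
    using sequential_correct[OF tens.hyps(1) w(1) n(1)] sequential_correct[OF tens.hyps(2) w(2) n(2)] by simp_all
  have su: "struct lab (R |\<union>| S) ((a # \<Gamma>) @ (b # \<Delta>))" by (rule struct_union[OF s d])
  show ?case
    by (rule ex_indexing_insert[OF ex_indexing_union[OF tens.IH(1)[OF w(1) n(1)] tens.IH(2)[OF w(2) n(2)] s d] su
          tens.prems(1) tens.hyps(4), of _ _ 0])
       (use su in \<open>auto simp: struct_def\<close>)
next
  case (par R a b \<Gamma> g e A B)
  have w: "pre_wf lab R" "no_cut R" using pre_wf_insertD[OF par.prems(1)] par.prems by auto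
  have s: "struct lab R (a # b # \<Gamma>)" using sequential_correct[OF par.hyps(1) w] by simp
  show ?case
    by (rule ex_indexing_insert[OF par.IH[OF w] s par.prems(1) par.hyps(2), of _ _ "0"])
       (use s in \<open>auto simp: struct_def\<close>)
next
  case (flat R a \<Gamma> g e A)
  have w: "pre_wf lab R" "no_cut R" using pre_wf_insertD[OF flat.prems(1)] flat.prems by auto
  have s: "struct lab R (a # \<Gamma>)" using sequential_correct[OF flat.hyps(1) w] by simp
  show ?case
    by (rule ex_indexing_insert[OF flat.IH[OF w] s flat.prems(1) flat.hyps(2), of _ _ "0"])
       (use s in \<open>auto simp: struct_def\<close>)
next
  case (whynot R es \<Gamma> g e A)
  have w: "pre_wf lab R" "no_cut R" using pre_wf_insertD[OF whynot.prems(1)] whynot.prems by auto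
  have s: "struct lab R (es @ \<Gamma>)" using sequential_correct[OF whynot.hyps(1) w] by simp
  show ?case
    by (rule ex_indexing_insert[OF whynot.IH[OF w] s whynot.prems(1) whynot.hyps(2), of _ _ "1"])
       (use s in \<open>auto simp: struct_def fset_of_list.rep_eq\<close>)
next
  case (para R a \<Gamma> g e A)
  have w: "pre_wf lab R" "no_cut R" using pre_wf_insertD[OF para.prems(1)] para.prems by auto
  have s: "struct lab R (a # \<Gamma>)" using sequential_correct[OF para.hyps(1) w] by simp
  show ?case
    by (rule ex_indexing_insert[OF para.IH[OF w] s para.prems(1) para.hyps(2), of _ _ "1"])
       (use s in \<open>auto simp: struct_def\<close>)
next
  case (box R p xs g A e Bs ys c a')
  let ?P = "fset_of_list (zip xs ys)"
  have w: "pre_wf lab R" "edges R \<inter> insert e (snd ` fset ?P) = {}" "no_cut R"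
    using pre_wf_boxD[OF box.prems(1)] box.prems by auto
  have s: "struct lab R (p # xs)" using sequential_correct[OF box.hyps(1) w(1,3)] by simp
  have s': "struct lab {|BoxL R p e ?P|} (e # ys)"
    using sequential_correct[OF sequential.box[OF box.hyps] box.prems] by blast
  have len: "length xs = length ys" using box.hyps by (metis length_map)
  have P: "fset ?P = set (zip xs ys)" by (simp add: fset_of_list.rep_eq)
  have ys: "set ys \<subseteq> snd ` fset ?P" using len by (simp add: P flip: set_map)
  \<comment> \<open>Indices to prescribe inside the box: one more than the conclusion at the premise
    of the of course link, and at the premise of each pax link the index demanded of its
    conclusion.\<close>
  let ?J = "\<lambda>x. if x = p then J e + 1 else J (the (map_of (zip xs ys) x))"
  obtain I1 where I: "\<forall>x\<in>set (p # xs). I1 x = ?J x" "indexed I1 R" using box.IH[OF w(1,3), of ?J] by blast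
  let ?I = "\<lambda>x. if x \<in> edges R then I1 x else J x"
  have "indexed ?I R" using indexed_cong[of lab R ?I I1] s I by (auto simp: struct_def)
  moreover have "?I p = ?I e + 1" using I(1) w(2) struct_edges[OF s] by auto
  moreover have "?I x = ?I y" if "(x, y) \<in> set (zip xs ys)" for x y
  proof -
    have "x \<in> set xs" "x \<noteq> p" using that s set_zip_leftD by (force simp: struct_def)+
    then have "I1 x = J (the (map_of (zip xs ys) x))" using I(1) by simp
    also have "map_of (zip xs ys) x = Some y" using that box.hyps(2) len by (intro map_of_is_SomeI) auto
    finally have "I1 x = J y" by simp
    moreover have "x \<in> edges R" using \<open>x \<in> set xs\<close> struct_edges[OF s] by auto
    moreover have "y \<in> snd ` fset ?P" using that unfolding P by force
    then have "y \<notin> edges R" using w(2) by blast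
    ultimately show ?thesis by simp
  qed
  moreover have "indexed ?I {||}" by (rule indexed_simps)
  ultimately have "indexed ?I {|BoxL R p e ?P|}" unfolding indexed_simps index_ok.simps P link.case by blast
  moreover have "\<forall>x\<in>set (e # ys). ?I x = J x" using w(2) ys by auto
  ultimately show ?case by (intro exI[of _ ?I]) blast
next
  case cut
  then show ?case by simp
qed

section \<open>Swapping steps\<close>

text \<open>Steps pass to a union under a condition on conclusions only; as these never change, the
  condition survives any number of steps.\<close>

lemma swap_step_cns: "swap_step X lab R R' \<Longrightarrow> cns R' = cns R"
proof (induction rule: swap_step.induct)
  case (here R a b a' b' c d)
  then have "R = finsert (ParL a a' c) (R |-| {|ParL a a' c|})" by auto
  then have "cns R = insert c (cns (R |-| {|ParL a a' c|}))" by (metis cns_simps(2) concls.simps(6) insert_is_Un)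
  then show ?case by simp
next
  case (inside S p c P R S')
  then have "R = finsert (BoxL S p c P) (R |-| {|BoxL S p c P|})" by auto
  then have "cns R = insert c (snd ` fset P) \<union> cns (R |-| {|BoxL S p c P|})" by (metis cns_simps(2) concls.simps(10))
  then show ?case by simp
qed

text \<open>The step removes a link. With disjoint conclusions this link cannot also occur in
  \<open>T\<close>, so that the removal commutes with the union.\<close>

lemma swap_step_union:
  assumes "swap_step X lab R R'" "cns R \<inter> cns T = {}"
  shows "swap_step X lab (R |\<union>| T) (R' |\<union>| T)"
  using assms
proof cases
  case (here a b a' b' c d)
  have "ParL a a' c |\<notin>| T" using assms(2) here by (force simp: cns_def)
  then have e: "R' |\<union>| T = finsert (ParL a' a c) ((R |\<union>| T) |-| {|ParL a a' c|})" using here(1) by auto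
  show ?thesis
    unfolding e
  proof (rule swap_step.here)
    show "atomic_axiom X lab (R |\<union>| T) a b" "atomic_axiom X lab (R |\<union>| T) a' b'"
      using here(2,3) by (auto simp: atomic_axiom_def)
    show "ParL a a' c |\<in>| R |\<union>| T" "TensL b b' d |\<in>| R |\<union>| T" using here(4,5) by simp_all
  qed
next
  case (inside S p c P S')
  have "BoxL S p c P |\<notin>| T" using assms(2) inside by (force simp: cns_def)
  then have e: "R' |\<union>| T = finsert (BoxL S' p c P) ((R |\<union>| T) |-| {|BoxL S p c P|})" using inside(1) by auto
  show ?thesis
    unfolding e using inside(2,3) by (intro swap_step.inside) simp_all
qed

text \<open>The flag \<open>b\<close> demands at least one step. \<open>precedes\<close> needs one
  replacement somewhere in the net, so the flags of the parts combine by disjunction.\<close>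

definition swaps :: "nat \<Rightarrow> (edge \<Rightarrow> label) \<Rightarrow> bool \<Rightarrow> link fset \<Rightarrow> link fset \<Rightarrow> bool" where
  "swaps X lab b R R' \<longleftrightarrow> (swap_step X lab)\<^sup>*\<^sup>* R R' \<and> (b \<longrightarrow> (swap_step X lab)\<^sup>+\<^sup>+ R R')"

lemma swaps_refl: "swaps X lab False R R"
  by (simp add: swaps_def)

lemma swaps_step: "swap_step X lab R R' \<Longrightarrow> swaps X lab b R R'"
  by (auto simp: swaps_def)

lemma swaps_trans: "swaps X lab b R S \<Longrightarrow> swaps X lab b' S T \<Longrightarrow> swaps X lab (b \<or> b') R T"
  unfolding swaps_def by (metis rtranclp_trans rtranclp_tranclp_tranclp tranclp_rtranclp_tranclp)

lemma rtranclp_swap_step_cns: "(swap_step X lab)\<^sup>*\<^sup>* R R' \<Longrightarrow> cns R' = cns R"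
  by (induction rule: rtranclp_induct) (auto dest: swap_step_cns)

lemma swaps_union_left:
  assumes "swaps X lab b R R'" "cns R \<inter> cns T = {}"
  shows "swaps X lab b (R |\<union>| T) (R' |\<union>| T)"
proof -
  have 1: "(swap_step X lab)\<^sup>*\<^sup>* (R |\<union>| T) (S |\<union>| T)" if "(swap_step X lab)\<^sup>*\<^sup>* R S" for S
    using that
  proof (induction rule: rtranclp_induct)
    case (step S S')
    then show ?case using swap_step_union[OF step(2), of T] rtranclp_swap_step_cns[OF step(1)] assms(2)
      by (auto intro: rtranclp.rtrancl_into_rtrancl)
  qed auto
  have "(swap_step X lab)\<^sup>+\<^sup>+ (R |\<union>| T) (R' |\<union>| T)" if "(swap_step X lab)\<^sup>+\<^sup>+ R R'"
    using that
  proof cases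
    case r_into_trancl
    then show ?thesis using swap_step_union[OF r_into_trancl assms(2)] by auto
  next
    case (trancl_into_trancl S)
    note step = this
    have r: "(swap_step X lab)\<^sup>*\<^sup>* R S" using step(1) by (rule tranclp_into_rtranclp)
    show ?thesis using 1[OF r] swap_step_union[OF step(2), of T] rtranclp_swap_step_cns[OF r] assms(2)
      by (auto intro: rtranclp_into_tranclp1)
  qed
  then show ?thesis using assms(1) 1 by (auto simp: swaps_def)
qed

lemma swaps_union:
  assumes "swaps X lab b R R'" "swaps X lab b' T T'" "cns R \<inter> cns T = {}"
  shows "swaps X lab (b \<or> b') (R |\<union>| T) (R' |\<union>| T')"
proof (rule swaps_trans)
  show "swaps X lab b (R |\<union>| T) (R' |\<union>| T)" using assms(1,3) by (rule swaps_union_left)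
  have "cns R' = cns R" using assms(1) rtranclp_swap_step_cns by (auto simp: swaps_def)
  then show "swaps X lab b' (R' |\<union>| T) (R' |\<union>| T')"
    using swaps_union_left[OF assms(2), of R'] assms(3) by (simp add: funion_commute Int_commute)
qed

lemma swaps_box:
  assumes "swaps X lab b S S'"
  shows "swaps X lab b {|BoxL S p c P|} {|BoxL S' p c P|}"
proof -
  have st: "swap_step X lab {|BoxL T p c P|} {|BoxL T' p c P|}" if "swap_step X lab T T'" for T T'
    using swap_step.inside[OF _ that, of p c P "{|BoxL T p c P|}"] by simp
  have 1: "(swap_step X lab)\<^sup>*\<^sup>* {|BoxL S p c P|} {|BoxL T p c P|}" if "(swap_step X lab)\<^sup>*\<^sup>* S T" for T
    using that by (induction rule: rtranclp_induct) (auto intro: rtranclp.rtrancl_into_rtrancl st)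
  have "(swap_step X lab)\<^sup>+\<^sup>+ {|BoxL S p c P|} {|BoxL T p c P|}" if "(swap_step X lab)\<^sup>+\<^sup>+ S T" for T
    using that by (induction rule: tranclp_induct) (auto intro: tranclp.intros st)
  then show ?thesis using assms 1 by (auto simp: swaps_def)
qed

section \<open>Expansion of nets\<close>

text \<open>The edge at position \<open>p\<close> (innermost step first) of the expansion of the edge \<open>e\<close>; the name \<open>0\<close>
  is kept free for an additional conclusion.\<close>

definition nm :: "edge \<Rightarrow> nat list \<Rightarrow> edge" where
  "nm e p = Suc (prod_encode (e, list_encode p))"

lemma nm_inject [simp]: "nm e p = nm e' p' \<longleftrightarrow> e = e' \<and> p = p'"
  by (auto simp: nm_def) (metis list_encode_inverse)

lemma nm_nonzero [simp]: "nm e p \<noteq> 0" "0 \<noteq> nm e p"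
  by (simp_all add: nm_def)

primrec substitute :: "nat \<Rightarrow> form \<Rightarrow> form" where
  "substitute X (Atom x) = Tens (Atom X) (Atom X)"
| "substitute X (NAtom x) = Par (NAtom X) (NAtom X)"
| "substitute X One = One"
| "substitute X Bot = Bot"
| "substitute X (Tens A B) = Tens (substitute X A) (substitute X B)"
| "substitute X (Par A B) = Par (substitute X A) (substitute X B)"
| "substitute X (OfCourse A) = OfCourse (substitute X A)"
| "substitute X (WhyNot A) = WhyNot (substitute X A)"
| "substitute X (Para A) = Para (substitute X A)"

lemma substitute_neg: "substitute X (neg A) = neg (substitute X A)"
  by (induction A) auto

fun lsub :: "nat \<Rightarrow> label \<Rightarrow> label" where
  "lsub X (Fm A) = Fm (substitute X A)"
| "lsub X (Flat A) = Flat (substitute X A)"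

text \<open>Under a why not formula, position 0 is the premise of the flat link in the expansion,
  and positions 1 and 2 are the premise and the conclusion of the pax link; hence only 0 carries no
  flat.\<close>

fun child :: "nat \<Rightarrow> label \<Rightarrow> label" where
  "child n (Fm (Tens A B)) = Fm (if n = 0 then A else B)"
| "child n (Fm (Par A B)) = Fm (if n = 0 then A else B)"
| "child n (Fm (OfCourse A)) = Fm A"
| "child n (Fm (WhyNot A)) = (if n = 0 then Fm A else Flat A)"
| "child n (Fm (Para A)) = Fm A"
| "child n l = l"

primrec sublab :: "label \<Rightarrow> nat list \<Rightarrow> label" where
  "sublab l [] = l"
| "sublab l (n # p) = child n (sublab l p)"

text \<open>The reserved edge 0 is the conclusion of the bottom link that later makes a
  one-conclusion net a morphism out of 1.\<close>

definition expand_label :: "nat \<Rightarrow> (edge \<Rightarrow> label) \<Rightarrow> edge \<Rightarrow> label" where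
  "expand_label X lab n = (case n of 0 \<Rightarrow> Fm Bot
     | Suc m \<Rightarrow> (case prod_decode m of (e, c) \<Rightarrow> sublab (lsub X (lab e)) (list_decode c)))"

lemma expand_label_simps [simp]:
  "expand_label X lab 0 = Fm Bot" "expand_label X lab (nm e []) = lsub X (lab e)"
  "expand_label X lab (nm e (n # p)) = child n (expand_label X lab (nm e p))"
  by (simp_all add: expand_label_def nm_def)

text \<open>\<open>expand A \<tau> i j p a b\<close> is the \<open>\<eta>\<close>-expansion, at position \<open>p\<close>, of an axiom link with conclusions
  \<open>a\<close> of type \<open>A\<^sup>\<bottom>\<close> and index \<open>i\<close> and \<open>b\<close> of type \<open>A\<close> and index \<open>j\<close>, with \<open>X \<otimes> X\<close> for the atoms. The
  axiom on an atom becomes \<open>\<gamma>\<^bsub>X,X\<^esub>\<close> rather than \<open>id\<^bsub>X\<otimes>X\<^esub>\<close> if \<open>\<tau>\<close> holds of just one of the indices of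
  its conclusions.\<close>

primrec expand :: "form \<Rightarrow> (int \<Rightarrow> bool) \<Rightarrow> int \<Rightarrow> int \<Rightarrow> nat list \<Rightarrow> edge \<Rightarrow> edge \<Rightarrow> link fset" where
  "expand (Atom x) \<tau> i j p a b =
     finsert (if \<tau> i = \<tau> j then ParL (nm a (0 # p)) (nm a (1 # p)) (nm a p) else ParL (nm a (1 # p)) (nm a (0 # p)) (nm a p))
     (finsert (TensL (nm b (0 # p)) (nm b (1 # p)) (nm b p))
     ({|AxL (nm a (0 # p)) (nm b (0 # p))|} |\<union>| {|AxL (nm a (1 # p)) (nm b (1 # p))|}))"
| "expand (NAtom x) \<tau> i j p a b =
     finsert (if \<tau> i = \<tau> j then ParL (nm b (0 # p)) (nm b (1 # p)) (nm b p) else ParL (nm b (1 # p)) (nm b (0 # p)) (nm b p))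
     (finsert (TensL (nm a (0 # p)) (nm a (1 # p)) (nm a p))
     ({|AxL (nm b (0 # p)) (nm a (0 # p))|} |\<union>| {|AxL (nm b (1 # p)) (nm a (1 # p))|}))"
| "expand One \<tau> i j p a b = {|OneL (nm b p), BotL (nm a p)|}"
| "expand Bot \<tau> i j p a b = {|OneL (nm a p), BotL (nm b p)|}"
| "expand (Tens A B) \<tau> i j p a b =
     finsert (ParL (nm a (0 # p)) (nm a (1 # p)) (nm a p))
     (finsert (TensL (nm b (0 # p)) (nm b (1 # p)) (nm b p))
     (expand A \<tau> i j (0 # p) a b |\<union>| expand B \<tau> i j (1 # p) a b))"
| "expand (Par A B) \<tau> i j p a b =
     finsert (ParL (nm b (0 # p)) (nm b (1 # p)) (nm b p))
     (finsert (TensL (nm a (0 # p)) (nm a (1 # p)) (nm a p))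
     (expand A \<tau> i j (0 # p) a b |\<union>| expand B \<tau> i j (1 # p) a b))"
| "expand (OfCourse A) \<tau> i j p a b =
     {|BoxL (finsert (FlatL (nm a (0 # p)) (nm a (1 # p))) (expand A \<tau> (i + 1) (j + 1) (0 # p) a b))
         (nm b (0 # p)) (nm b p) {|(nm a (1 # p), nm a (2 # p))|},
       WhyNotL {|nm a (2 # p)|} (nm a p)|}"
| "expand (WhyNot A) \<tau> i j p a b =
     {|BoxL (finsert (FlatL (nm b (0 # p)) (nm b (1 # p))) (expand A \<tau> (i + 1) (j + 1) (0 # p) a b))
         (nm a (0 # p)) (nm a p) {|(nm b (1 # p), nm b (2 # p))|},
       WhyNotL {|nm b (2 # p)|} (nm b p)|}"
| "expand (Para A) \<tau> i j p a b =
     finsert (ParaL (nm a (0 # p)) (nm a p)) (finsert (ParaL (nm b (0 # p)) (nm b p))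
     (expand A \<tau> (i + 1) (j + 1) (0 # p) a b))"

text \<open>Negation exchanges the roles of the two conclusions and of their indices, and the test
  whether \<tau> distinguishes the indices is symmetric.\<close>

lemma expand_neg: "expand (neg A) \<tau> j i p b a = expand A \<tau> i j p a b"
  by (induction A arbitrary: i j p) (auto simp: finsert_commute)

text \<open>Atoms, 1, tensor, of course and paragraph suffice when the property is stable under
  negation; \<open>expand_neg\<close> and \<open>prg_neg\<close> provide this stability.\<close>

lemma form_polar_induct:
  assumes "\<And>A. P A \<Longrightarrow> P (neg A)" "\<And>x. P (Atom x)" "P One" "\<And>A B. P A \<Longrightarrow> P B \<Longrightarrow> P (Tens A B)"
    "\<And>A. P A \<Longrightarrow> P (OfCourse A)" "\<And>A. P A \<Longrightarrow> P (Para A)"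
  shows "P A"
proof (induction A)
  case (NAtom x)
  then show ?case using assms(1)[OF assms(2)[of x]] by simp
next
  case Bot
  then show ?case using assms(1)[OF assms(3)] by simp
next
  case (Par A B)
  then show ?case using assms(1)[OF assms(4)[OF assms(1) assms(1)]] by fastforce
next
  case (WhyNot A)
  then show ?case using assms(1)[OF assms(5)[OF assms(1)]] by fastforce
qed (use assms in auto)

section \<open>Edges, well-formedness and axioms of an expanded axiom\<close>

definition below :: "edge set \<Rightarrow> nat list \<Rightarrow> edge set" where
  "below E p = {nm x (r @ p) |x r. x \<in> E}"

lemma below_nm [simp]: "nm x q \<in> below E p \<longleftrightarrow> x \<in> E \<and> (\<exists>r. q = r @ p)"
  by (auto simp: below_def)

lemma below_Cons: "below E (n # p) \<subseteq> below E p"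
proof
  fix e assume "e \<in> below E (n # p)"
  then obtain x r where "e = nm x (r @ n # p)" "x \<in> E" by (auto simp: below_def)
  then have "e = nm x ((r @ [n]) @ p)" "x \<in> E" by simp_all
  then show "e \<in> below E p" unfolding below_def by blast
qed

lemma below_disjoint: "n \<noteq> m \<Longrightarrow> below E (n # p) \<inter> below E (m # p) = {}"
proof -
  assume nm: "n \<noteq> m"
  have "r @ n # p \<noteq> r' @ m # p" for r r'
  proof
    assume e: "r @ n # p = r' @ m # p"
    then have "length r = length r'" by (metis add_right_cancel length_Cons length_append)
    then show False using e nm by simp
  qed
  then show ?thesis unfolding below_def by auto
qed

lemma not_below: "nm x p \<notin> below E (n # p)"
proof
  assume "nm x p \<in> below E (n # p)"
  then obtain r where "p = r @ n # p" by auto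
  then have "length p = length (r @ n # p)" by simp
  then show False by simp
qed

lemma below_mem: "x \<in> E \<Longrightarrow> nm x p \<in> below E p" "x \<in> E \<Longrightarrow> nm x (n # p) \<in> below E p"
  by (auto intro: exI[of _ "[]"] exI[of _ "[n]"])

lemma below_siblings: "n \<noteq> m \<Longrightarrow> nm x (n # p) \<notin> below E (m # p)"
  using below_disjoint[of n m UNIV p] below_mem(1)[of x UNIV "n # p"] by (auto simp: below_def)

lemma edges_expand: "edges (expand A \<tau> i j p a b) \<subseteq> below {a, b} p"
proof (induction A arbitrary: i j p)
  case (Tens A B)
  then show ?case using below_Cons[of "{a, b}" 0 p] below_Cons[of "{a, b}" 1 p]
    by (auto simp: below_mem[of _ "{a, b}"] simp del: below_nm dest!: subsetD[OF Tens(1)] subsetD[OF Tens(2)])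
next
  case (Par A B)
  then show ?case using below_Cons[of "{a, b}" 0 p] below_Cons[of "{a, b}" 1 p]
    by (auto simp: below_mem[of _ "{a, b}"] simp del: below_nm dest!: subsetD[OF Par(1)] subsetD[OF Par(2)])
next
  case (OfCourse A)
  then show ?case using below_Cons[of "{a, b}" 0 p]
    by (auto simp: below_mem[of _ "{a, b}"] simp del: below_nm dest!: subsetD[OF OfCourse])
next
  case (WhyNot A)
  then show ?case using below_Cons[of "{a, b}" 0 p]
    by (auto simp: below_mem[of _ "{a, b}"] simp del: below_nm dest!: subsetD[OF WhyNot])
next
  case (Para A)
  then show ?case using below_Cons[of "{a, b}" 0 p]
    by (auto simp: below_mem[of _ "{a, b}"] simp del: below_nm dest!: subsetD[OF Para])
qed (auto simp: below_mem[of _ "{a, b}"] simp del: below_nm)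

lemma not_edge_expand:
  "nm x p \<notin> edges (expand A \<tau> i j (n # p) a b)"
  "n \<noteq> m \<Longrightarrow> nm x (m # p) \<notin> edges (expand A \<tau> i j (n # p) a b)"
  "x \<notin> {a, b} \<Longrightarrow> nm x q \<notin> edges (expand A \<tau> i j (n # p) a b)"
  "n \<noteq> m \<Longrightarrow> edges (expand A \<tau> i j (n # p) a b) \<inter> edges (expand B \<tau> i' j' (m # p) a b) = {}"
  subgoal using edges_expand[of A \<tau> i j "n # p" a b] not_below[of x p "{a, b}" n] by blast
  subgoal using edges_expand[of A \<tau> i j "n # p" a b] below_siblings[of m n x p "{a, b}"] by blast
  subgoal using edges_expand[of A \<tau> i j "n # p" a b] by (auto simp: below_def)
  subgoal using edges_expand[of A \<tau> i j "n # p" a b] edges_expand[of B \<tau> i' j' "m # p" a b] below_disjoint[of n m "{a, b}" p] by blast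
  done

lemma edge_in_ex: "\<forall>a b. l \<noteq> CutL a b \<Longrightarrow> \<exists>e. edge_in e l"
  by (cases l) auto

lemma no_cut_expand: "no_cut (expand A \<tau> i j p a b)"
  by (induction A arbitrary: i j p) auto

lemma pre_wf_insert: "link_typed lab l \<Longrightarrow> \<forall>S p c P. l \<noteq> BoxL S p c P \<Longrightarrow> pre_wf lab R \<Longrightarrow>
    \<forall>e. edge_in e l \<longrightarrow> e \<notin> edges R \<Longrightarrow> pre_wf lab (finsert l R)"
proof -
  assume a: "link_typed lab l" "\<forall>S p c P. l \<noteq> BoxL S p c P" "pre_wf lab R" "\<forall>e. edge_in e l \<longrightarrow> e \<notin> edges R"
  have "edges {|l|} \<inter> edges R = {}" using a(4) by (auto simp: disjoint_iff)
  then show ?thesis using pre_wf_union[OF pre_wf_single[OF a(1,2)] a(3)] by simp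
qed

lemma pre_wf_expand:
  "expand_label X lab (nm a p) = Fm (neg (substitute X A)) \<Longrightarrow> expand_label X lab (nm b p) = Fm (substitute X A) \<Longrightarrow> a \<noteq> b \<Longrightarrow>
    pre_wf (expand_label X lab) (expand A \<tau> i j p a b)"
proof (induction A arbitrary: i j p a b rule: form_polar_induct)
  case (1 A)
  then show ?case using 1(1)[of b p a j i] by (simp add: substitute_neg expand_neg[of A \<tau> j i, symmetric])
     (metis expand_neg)
next
  case (2 x)
  then show ?case
    by (auto intro!: pre_wf_insert pre_wf_empty)
next
  case 3
  then show ?case by (auto intro!: pre_wf_insert pre_wf_empty)
next
  case (4 A B)
  have "pre_wf (expand_label X lab) (expand A \<tau> i j (0 # p) a b |\<union>| expand B \<tau> i j (1 # p) a b)"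
    using 4 not_edge_expand(4)[of 0 1] by (intro pre_wf_union) auto
  then show ?case using 4(3-5) not_edge_expand(1) by (auto intro!: pre_wf_insert)
next
  case (5 A)
  have "pre_wf (expand_label X lab) (finsert (FlatL (nm a (0 # p)) (nm a (1 # p))) (expand A \<tau> (i + 1) (j + 1) (0 # p) a b))"
    using 5 not_edge_expand(2)[of 0 1] by (intro pre_wf_insert) auto
  then have "pre_wf (expand_label X lab) {|BoxL (finsert (FlatL (nm a (0 # p)) (nm a (1 # p))) (expand A \<tau> (i + 1) (j + 1) (0 # p) a b))
         (nm b (0 # p)) (nm b p) {|(nm a (1 # p), nm a (2 # p))|}|}"
    using 5(2-4) not_edge_expand(1)[of b p A \<tau> "i + 1" "j + 1" 0 a b] not_edge_expand(2)[of 0 2 a p A \<tau> "i + 1" "j + 1" a b]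
    by (intro pre_wf_single_box) auto
  then have "pre_wf (expand_label X lab) (finsert (WhyNotL {|nm a (2 # p)|} (nm a p)) {|BoxL (finsert (FlatL (nm a (0 # p)) (nm a (1 # p))) (expand A \<tau> (i + 1) (j + 1) (0 # p) a b))
         (nm b (0 # p)) (nm b p) {|(nm a (1 # p), nm a (2 # p))|}|})"
    using 5(2-4) not_edge_expand(1)[of a p A \<tau> "i + 1" "j + 1" 0 a b]
    by (intro pre_wf_insert[of _ "WhyNotL {|nm a (2 # p)|} (nm a p)"]) auto
  then show ?case by (simp add: finsert_commute)
next
  case (6 A)
  then show ?case using not_edge_expand(1) by (auto intro!: pre_wf_insert)
qed

lemma axioms_expand:
  "expand_label X lab (nm a p) = Fm (neg (substitute X A)) \<Longrightarrow> expand_label X lab (nm b p) = Fm (substitute X A) \<Longrightarrow>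
    AxL c d \<in> dlinks (expand A \<tau> i j p a b) \<Longrightarrow> expand_label X lab d = Fm (Atom X)"
proof (induction A arbitrary: i j p a b rule: form_polar_induct)
  case (1 A)
  then show ?case using 1(1)[of b p a j i] by (metis expand_neg substitute_neg neg_neg)
next
  case (4 A B)
  from 4(5) have "AxL c d \<in> dlinks (expand A \<tau> i j (0 # p) a b) \<or> AxL c d \<in> dlinks (expand B \<tau> i j (1 # p) a b)" by simp
  then show ?case using 4(1)[of a "0 # p" b i j] 4(2)[of a "1 # p" b i j] 4(3,4) by auto
next
  case (5 A)
  then show ?case using 5(1)[of a "0 # p" b "i + 1" "j + 1"] by auto
next
  case (6 A)
  then show ?case using 6(1)[of a "0 # p" b "i + 1" "j + 1"] by auto
qed (auto split: if_splits)

text \<open>The amounts by which \<open>expand\<close> raises the indices of an axiom on the way to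
  its atoms. Paragraphs count like exponentials, as in an exponential indexing.\<close>

primrec depths :: "form \<Rightarrow> int set" where
  "depths (Atom x) = {0}"
| "depths (NAtom x) = {0}"
| "depths One = {}"
| "depths Bot = {}"
| "depths (Tens A B) = depths A \<union> depths B"
| "depths (Par A B) = depths A \<union> depths B"
| "depths (OfCourse A) = (\<lambda>d. d + 1) ` depths A"
| "depths (WhyNot A) = (\<lambda>d. d + 1) ` depths A"
| "depths (Para A) = (\<lambda>d. d + 1) ` depths A"

lemma depths_neg: "depths (neg A) = depths A"
  by (induction A) auto

lemma depths_atoms: "depths A = {} \<longleftrightarrow> atoms A = {}"
  by (induction A) auto

text \<open>The condition for \<gamma> to appear in the expansion: at the atoms of depth d the two
  ends have the indices i + d and j + d.\<close>

definition bad_axiom :: "form \<Rightarrow> (int \<Rightarrow> bool) \<Rightarrow> int \<Rightarrow> int \<Rightarrow> bool" where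
  "bad_axiom A \<tau> i j \<longleftrightarrow> (\<exists>d\<in>depths A. \<tau> (i + d) \<noteq> \<tau> (j + d))"

lemma bad_axiom_simps [simp]:
  "bad_axiom (Atom x) \<tau> i j \<longleftrightarrow> \<tau> i \<noteq> \<tau> j" "\<not> bad_axiom One \<tau> i j"
  "bad_axiom (Tens A B) \<tau> i j \<longleftrightarrow> bad_axiom A \<tau> i j \<or> bad_axiom B \<tau> i j"
  "bad_axiom (OfCourse A) \<tau> i j \<longleftrightarrow> bad_axiom A \<tau> (i + 1) (j + 1)"
  "bad_axiom (Para A) \<tau> i j \<longleftrightarrow> bad_axiom A \<tau> (i + 1) (j + 1)"
  "bad_axiom (neg A) \<tau> j i \<longleftrightarrow> bad_axiom A \<tau> i j"
  by (auto simp: bad_axiom_def depths_neg ac_simps)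

abbreviation none :: "int \<Rightarrow> bool" where "none \<equiv> \<lambda>_. False"

lemma cns_expand: "cns (expand A \<tau> i j p a b) \<subseteq> below {a, b} p"
  using cns_edges edges_expand by blast

text \<open>Only an atom makes a step of its own, and only if \<tau> separates its two ends.
  Compound formulas place the steps of their parts side by side or in a box.\<close>

lemma swaps_expand:
  "expand_label X lab (nm a p) = Fm (neg (substitute X A)) \<Longrightarrow> expand_label X lab (nm b p) = Fm (substitute X A) \<Longrightarrow> a \<noteq> b \<Longrightarrow>
    swaps X (expand_label X lab) (bad_axiom A \<tau> i j) (expand A none i j p a b) (expand A \<tau> i j p a b)"
proof (induction A arbitrary: i j p a b rule: form_polar_induct)
  case (1 A)
  then have "swaps X (expand_label X lab) (bad_axiom A \<tau> j i) (expand A none j i p b a) (expand A \<tau> j i p b a)"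
    using 1(1)[of b p a j i] by (metis substitute_neg neg_neg)
  then show ?case
    using expand_neg[of A none i j p a b] expand_neg[of A \<tau> i j p a b] by simp
next
  case (2 x)
  show ?case
  proof (cases "\<tau> i = \<tau> j")
    case True
    then show ?thesis using swaps_refl by simp
  next
    case False
    let ?R = "expand (Atom x) none i j p a b"
    have "atomic_axiom X (expand_label X lab) ?R (nm a (0 # p)) (nm b (0 # p))"
      "atomic_axiom X (expand_label X lab) ?R (nm a (1 # p)) (nm b (1 # p))"
      using 2 by (auto simp: atomic_axiom_def)
    then have "swap_step X (expand_label X lab) ?R (finsert (ParL (nm a (1 # p)) (nm a (0 # p)) (nm a p)) (?R |-| {|ParL (nm a (0 # p)) (nm a (1 # p)) (nm a p)|}))"
      by (rule swap_step.here) auto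
    moreover have "finsert (ParL (nm a (1 # p)) (nm a (0 # p)) (nm a p)) (?R |-| {|ParL (nm a (0 # p)) (nm a (1 # p)) (nm a p)|}) =
        expand (Atom x) \<tau> i j p a b"
      using False by auto
    ultimately show ?thesis using swaps_step by metis
  qed
next
  case 3
  then show ?case using swaps_refl by simp
next
  case (4 A B)
  let ?S = "{|ParL (nm a (0 # p)) (nm a (1 # p)) (nm a p), TensL (nm b (0 # p)) (nm b (1 # p)) (nm b p)|}"
  have d: "cns (expand A none i j (0 # p) a b) \<inter> cns (expand B none i j (1 # p) a b) = {}"
    using cns_expand[of A none i j "0 # p" a b] cns_expand[of B none i j "1 # p" a b]
      below_disjoint[OF zero_neq_one, of "{a, b}" p] by blast
  have "swaps X (expand_label X lab) (bad_axiom A \<tau> i j \<or> bad_axiom B \<tau> i j) (expand A none i j (0 # p) a b |\<union>| expand B none i j (1 # p) a b)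
     (expand A \<tau> i j (0 # p) a b |\<union>| expand B \<tau> i j (1 # p) a b)"
    using 4 by (intro swaps_union d) auto
  then have "swaps X (expand_label X lab) (bad_axiom A \<tau> i j \<or> bad_axiom B \<tau> i j)
     ((expand A none i j (0 # p) a b |\<union>| expand B none i j (1 # p) a b) |\<union>| ?S)
     ((expand A \<tau> i j (0 # p) a b |\<union>| expand B \<tau> i j (1 # p) a b) |\<union>| ?S)"
    by (rule swaps_union_left)
       (use cns_expand[of A none i j "0 # p" a b] cns_expand[of B none i j "1 # p" a b] not_below in auto)
  then show ?case by (simp add: funion_commute)
next
  case (5 A)
  let ?S = "{|FlatL (nm a (0 # p)) (nm a (1 # p))|}"
  have "swaps X (expand_label X lab) (bad_axiom A \<tau> (i + 1) (j + 1)) (expand A none (i + 1) (j + 1) (0 # p) a b) (expand A \<tau> (i + 1) (j + 1) (0 # p) a b)"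
    using 5 by auto
  then have "swaps X (expand_label X lab) (bad_axiom A \<tau> (i + 1) (j + 1)) (expand A none (i + 1) (j + 1) (0 # p) a b |\<union>| ?S) (expand A \<tau> (i + 1) (j + 1) (0 # p) a b |\<union>| ?S)"
    by (rule swaps_union_left) (use cns_expand[of A none "i + 1" "j + 1" "0 # p" a b] below_siblings[of 1 0] in auto)
  then have "swaps X (expand_label X lab) (bad_axiom A \<tau> (i + 1) (j + 1))
     ({|BoxL (expand A none (i + 1) (j + 1) (0 # p) a b |\<union>| ?S) (nm b (0 # p)) (nm b p) {|(nm a (1 # p), nm a (2 # p))|}|} |\<union>| {|WhyNotL {|nm a (2 # p)|} (nm a p)|})
     ({|BoxL (expand A \<tau> (i + 1) (j + 1) (0 # p) a b |\<union>| ?S) (nm b (0 # p)) (nm b p) {|(nm a (1 # p), nm a (2 # p))|}|} |\<union>| {|WhyNotL {|nm a (2 # p)|} (nm a p)|})"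
    by (rule swaps_union_left[OF swaps_box]) (use 5(4) in auto)
  then show ?case by (simp add: funion_commute)
next
  case (6 A)
  let ?S = "{|ParaL (nm a (0 # p)) (nm a p), ParaL (nm b (0 # p)) (nm b p)|}"
  have "swaps X (expand_label X lab) (bad_axiom A \<tau> (i + 1) (j + 1)) (expand A none (i + 1) (j + 1) (0 # p) a b) (expand A \<tau> (i + 1) (j + 1) (0 # p) a b)"
    using 6 by auto
  then have "swaps X (expand_label X lab) (bad_axiom A \<tau> (i + 1) (j + 1)) (expand A none (i + 1) (j + 1) (0 # p) a b |\<union>| ?S) (expand A \<tau> (i + 1) (j + 1) (0 # p) a b |\<union>| ?S)"
    by (rule swaps_union_left) (use cns_expand[of A none "i + 1" "j + 1" "0 # p" a b] not_below in auto)
  then show ?case by (simp add: funion_commute)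
qed

text \<open>In a typed net the conclusions of an axiom are never flat; the empty set in that case is
  a dummy value.\<close>

primrec expand_link :: "(int \<Rightarrow> bool) \<Rightarrow> (edge \<Rightarrow> int) \<Rightarrow> (edge \<Rightarrow> label) \<Rightarrow> link \<Rightarrow> link fset" where
  "expand_link \<tau> I lab (AxL a b) = (case lab b of Fm A \<Rightarrow> expand A \<tau> (I a) (I b) [] a b | Flat A \<Rightarrow> {||})"
| "expand_link \<tau> I lab (CutL a b) = {|CutL (nm a []) (nm b [])|}"
| "expand_link \<tau> I lab (OneL c) = {|OneL (nm c [])|}"
| "expand_link \<tau> I lab (BotL c) = {|BotL (nm c [])|}"
| "expand_link \<tau> I lab (TensL a b c) = {|TensL (nm a []) (nm b []) (nm c [])|}"
| "expand_link \<tau> I lab (ParL a b c) = {|ParL (nm a []) (nm b []) (nm c [])|}"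
| "expand_link \<tau> I lab (FlatL a c) = {|FlatL (nm a []) (nm c [])|}"
| "expand_link \<tau> I lab (WhyNotL E c) = {|WhyNotL ((\<lambda>e. nm e []) |`| E) (nm c [])|}"
| "expand_link \<tau> I lab (ParaL a c) = {|ParaL (nm a []) (nm c [])|}"
| "expand_link \<tau> I lab (BoxL S p c P) = {|BoxL (ffUnion (expand_link \<tau> I lab |`| S)) (nm p []) (nm c [])
     (map_prod (\<lambda>e. nm e []) (\<lambda>e. nm e []) |`| P)|}"

definition expand_links :: "(int \<Rightarrow> bool) \<Rightarrow> (edge \<Rightarrow> int) \<Rightarrow> (edge \<Rightarrow> label) \<Rightarrow> link fset \<Rightarrow> link fset" where
  "expand_links \<tau> I lab R = ffUnion (expand_link \<tau> I lab |`| R)"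

lemma expand_links_simps [simp]:
  "expand_links \<tau> I lab {||} = {||}" "expand_links \<tau> I lab (finsert l R) = expand_link \<tau> I lab l |\<union>| expand_links \<tau> I lab R"
  "expand_links \<tau> I lab (R |\<union>| S) = expand_links \<tau> I lab R |\<union>| expand_links \<tau> I lab S"
  by (auto simp: expand_links_def ffUnion_funion_distrib fimage_funion)

lemma expand_link_box [simp]: "expand_link \<tau> I lab (BoxL S p c P) =
    {|BoxL (expand_links \<tau> I lab S) (nm p []) (nm c []) (map_prod (\<lambda>e. nm e []) (\<lambda>e. nm e []) |`| P)|}"
  by (simp add: expand_links_def)

declare expand_link.simps(10) [simp del]

definition fam :: "edge set \<Rightarrow> edge set" where "fam E = {nm x p |x p. x \<in> E}"

lemma fam_nm [simp]: "nm x p \<in> fam E \<longleftrightarrow> x \<in> E"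
  by (auto simp: fam_def)

lemma fam_mono: "E \<subseteq> F \<Longrightarrow> fam E \<subseteq> fam F"
  by (auto simp: fam_def)

lemma fam_disjoint: "E \<inter> F = {} \<Longrightarrow> fam E \<inter> fam F = {}"
  by (auto simp: fam_def)

text \<open>Induction on links meets the content of a box only link by link. The step from links to
  a set of links is therefore separated, to serve both inside the induction and after it; the later
  auxiliary lemmas follow the same pattern.\<close>

lemma edges_expand_links_aux: "(\<And>l. l |\<in>| R \<Longrightarrow> edges (expand_link \<tau> I lab l) \<subseteq> fam {e. edge_in e l}) \<Longrightarrow> edges (expand_links \<tau> I lab R) \<subseteq> fam (edges R)"
proof -
  assume a: "\<And>l. l |\<in>| R \<Longrightarrow> edges (expand_link \<tau> I lab l) \<subseteq> fam {e. edge_in e l}"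
  have "edges (expand_links \<tau> I lab R) = (\<Union>l\<in>fset R. edges (expand_link \<tau> I lab l))"
    by (simp add: expand_links_def edges_ffUnion)
  also have "\<dots> \<subseteq> (\<Union>l\<in>fset R. fam {e. edge_in e l})" using a by blast
  also have "\<dots> \<subseteq> fam (edges R)" by (auto simp: fam_def edges_def)
  finally show ?thesis .
qed

lemma edges_expand_link: "edges (expand_link \<tau> I lab l) \<subseteq> fam {e. edge_in e l}"
proof (induction l)
  case (AxL a b)
  have "below {a, b} [] \<subseteq> fam {e. edge_in e (AxL a b)}" by (auto simp: below_def fam_def)
  then show ?case using edges_expand by (fastforce split: label.splits)
next
  case (BoxL S p c P)
  have "edges (expand_links \<tau> I lab S) \<subseteq> fam (edges S)" using BoxL by (rule edges_expand_links_aux)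
  then have "edges (expand_links \<tau> I lab S) \<subseteq> fam {e. edge_in e (BoxL S p c P)}"
    using fam_mono[of "edges S" "{e. edge_in e (BoxL S p c P)}"] by auto
  then show ?case by (force simp: image_iff)
qed (auto)

lemma edges_expand_links: "edges (expand_links \<tau> I lab R) \<subseteq> fam (edges R)"
  using edges_expand_link by (rule edges_expand_links_aux)

lemma not_edge_expand_links: "e \<notin> edges R \<Longrightarrow> nm e p \<notin> edges (expand_links \<tau> I lab R)"
  using edges_expand_links[of \<tau> I lab R] by auto

lemma no_cut_iff: "no_cut R \<longleftrightarrow> (\<forall>l. l |\<in>| R \<longrightarrow> no_cut {|l|})"
  by (induction R) auto

lemma dlinks_expand_links: "dlinks (expand_links \<tau> I lab R) = (\<Union>l\<in>fset R. dlinks (expand_link \<tau> I lab l))"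
  by (induction R) auto

lemma no_cut_expand_link: "no_cut {|l|} \<Longrightarrow> no_cut (expand_link \<tau> I lab l)"
proof (induction l)
  case (AxL a b)
  then show ?case by (auto simp: no_cut_expand split: label.splits)
next
  case (BoxL S p c P)
  then have "no_cut {|l|}" if "l |\<in>| S" for l using that no_cut_iff[of S] by auto
  then have "no_cut (expand_links \<tau> I lab S)" using BoxL.IH by (auto simp: no_cut_def dlinks_expand_links)
  then show ?case by simp
qed auto

lemma no_cut_expand_links: "no_cut R \<Longrightarrow> no_cut (expand_links \<tau> I lab R)"
  using no_cut_expand_link no_cut_iff[of R] unfolding no_cut_def dlinks_expand_links by blast

text \<open>A common link would provide a common edge, unless it were a cut, the one kind of link
  without conclusions.\<close>

lemma expand_links_disjoint:
  assumes "edges R \<inter> edges S = {}" "no_cut R"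
  shows "expand_links \<tau> I lab R |\<inter>| expand_links \<tau> I lab S = {||}"
proof (rule ccontr)
  assume "expand_links \<tau> I lab R |\<inter>| expand_links \<tau> I lab S \<noteq> {||}"
  then obtain l where l: "l |\<in>| expand_links \<tau> I lab R" "l |\<in>| expand_links \<tau> I lab S" by blast
  have "l \<in> dlinks (expand_links \<tau> I lab R)" using l(1) by (subst dlinks_iff) simp
  then have "\<forall>a b. l \<noteq> CutL a b" using no_cut_expand_links[OF assms(2), of \<tau> I lab] by (auto simp: no_cut_def)
  then obtain e where "edge_in e l" using edge_in_ex by blast
  then have "e \<in> edges (expand_links \<tau> I lab R)" "e \<in> edges (expand_links \<tau> I lab S)" using l by (auto simp: edges_def)
  then show False using edges_expand_links fam_disjoint[OF assms(1)] by blast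
qed

lemma pre_wf_expand_links_aux:
  assumes "\<And>l. l |\<in>| R \<Longrightarrow> pre_wf lab' (expand_link \<tau> I lab l)" "pre_wf lab R"
  shows "pre_wf lab' (expand_links \<tau> I lab R)"
  using assms
proof (induction R)
  case empty
  then show ?case by (simp add: pre_wf_empty)
next
  case (insert l R)
  have "{e. edge_in e l} \<inter> edges R = {}" using pre_wf_insert_edges[OF insert.prems(2) insert.hyps] by blast
  then have "edges (expand_link \<tau> I lab l) \<inter> edges (expand_links \<tau> I lab R) = {}"
    using edges_expand_link[of \<tau> I lab l] edges_expand_links[of \<tau> I lab R] fam_disjoint[of "{e. edge_in e l}" "edges R"] by blast
  then show ?case
    using insert pre_wf_insertD[OF insert.prems(2)] by (auto intro!: pre_wf_union)
qed

lemma lsub_typed: "link_typed lab l \<Longrightarrow> \<forall>a b. l \<noteq> AxL a b \<Longrightarrow> \<forall>a b. l \<noteq> CutL a b \<Longrightarrow> \<forall>S p c P. l \<noteq> BoxL S p c P \<Longrightarrow>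
   pre_wf (expand_label X lab) (expand_link \<tau> I lab l)"
  by (cases l) (auto intro!: pre_wf_single)

lemma pre_wf_expand_link: "pre_wf lab {|l|} \<Longrightarrow> no_cut {|l|} \<Longrightarrow> pre_wf (expand_label X lab) (expand_link \<tau> I lab l)"
proof (induction l)
  case (AxL a b)
  then obtain A where "lab a = Fm (neg A)" "lab b = Fm A" "a \<noteq> b" using pre_wf_insertD by fastforce
  then show ?case by (auto simp: substitute_neg intro!: pre_wf_expand)
next
  case (CutL a b)
  then show ?case by simp
next
  case (BoxL S p c P)
  have w: "pre_wf lab S" "link_typed lab (BoxL S p c P)" "edges S \<inter> insert c (snd ` fset P) = {}"
    using pre_wf_boxD[OF BoxL.prems(1)] by auto
  have "pre_wf (expand_label X lab) (expand_link \<tau> I lab l)" if "l |\<in>| S" for l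
  proof (rule BoxL.IH)
    show "l \<in> fset S" using that .
    show "pre_wf lab {|l|}" using pre_wf_subset[OF w(1)] that by auto
    show "no_cut {|l|}" using BoxL.prems(2) that no_cut_iff[of S] by auto
  qed
  then have s: "pre_wf (expand_label X lab) (expand_links \<tau> I lab S)" using w(1) by (rule pre_wf_expand_links_aux)
  let ?P = "map_prod (\<lambda>e. nm e []) (\<lambda>e. nm e []) |`| P"
  have P: "fset ?P = map_prod (\<lambda>e. nm e []) (\<lambda>e. nm e []) ` fset P" by simp
  have i: "inj_on fst (fset ?P)" "inj_on snd (fset ?P)"
    using w(2) unfolding P link_typed.simps by (auto simp: inj_on_def)
  have "\<forall>(x, y)\<in>fset ?P. \<exists>B. expand_label X lab x = Flat B \<and> expand_label X lab y = Flat B"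
    unfolding P
  proof clarsimp
    fix x y assume "(x, y) |\<in>| P"
    then obtain B where "lab x = Flat B" "lab y = Flat B" using w(2) unfolding link_typed.simps by blast
    then show "\<exists>B. lsub X (lab x) = Flat B \<and> lsub X (lab y) = Flat B" by simp
  qed
  moreover have "\<exists>A. expand_label X lab (nm p []) = Fm A \<and> expand_label X lab (nm c []) = Fm (OfCourse A)"
    using w(2) unfolding link_typed.simps by auto
  ultimately have t: "link_typed (expand_label X lab) (BoxL (expand_links \<tau> I lab S) (nm p []) (nm c []) ?P)"
    using i unfolding link_typed.simps by blast
  have "insert (nm c []) (snd ` fset ?P) \<subseteq> fam (insert c (snd ` fset P))"
    unfolding P by (force simp: image_iff)
  then have "edges (expand_links \<tau> I lab S) \<inter> insert (nm c []) (snd ` fset ?P) = {}"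
    using edges_expand_links[of \<tau> I lab S] fam_disjoint[OF w(3)] by blast
  then show ?case unfolding expand_link_box using t s by (intro pre_wf_single_box)
qed (auto intro!: lsub_typed dest: pre_wf_insertD simp del: link_typed.simps expand_link.simps)

lemma pre_wf_expand_links: "pre_wf lab R \<Longrightarrow> no_cut R \<Longrightarrow> pre_wf (expand_label X lab) (expand_links \<tau> I lab R)"
proof (rule pre_wf_expand_links_aux)
  fix l assume a: "pre_wf lab R" "no_cut R" "l |\<in>| R"
  show "pre_wf (expand_label X lab) (expand_link \<tau> I lab l)"
    using a no_cut_iff[of R] by (intro pre_wf_expand_link pre_wf_subset[OF a(1)]) auto
qed

lemma axioms_expand_link:
  "pre_wf lab {|l|} \<Longrightarrow> AxL c d \<in> dlinks (expand_link \<tau> I lab l) \<Longrightarrow> expand_label X lab d = Fm (Atom X)"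
proof (induction l)
  case (AxL a b)
  then obtain A where A: "lab a = Fm (neg A)" "lab b = Fm A" using pre_wf_insertD by fastforce
  then show ?case using AxL.prems(2) axioms_expand[of X lab a "[]" A b c d \<tau> "I a" "I b"] by (auto simp: substitute_neg)
next
  case (BoxL S p q P)
  have w: "pre_wf lab S" using pre_wf_boxD[OF BoxL.prems(1)] by auto
  from BoxL.prems(2) obtain l where "l |\<in>| S" "AxL c d \<in> dlinks (expand_link \<tau> I lab l)"
    by (auto simp: dlinks_expand_links)
  then show ?case using BoxL.IH pre_wf_subset[OF w, of "{|l|}"] by auto
qed auto

lemma axioms_expand_links:
  "pre_wf lab R \<Longrightarrow> AxL c d \<in> dlinks (expand_links \<tau> I lab R) \<Longrightarrow> expand_label X lab d = Fm (Atom X)"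
proof -
  assume w: "pre_wf lab R" and "AxL c d \<in> dlinks (expand_links \<tau> I lab R)"
  then obtain l where l: "l |\<in>| R" "AxL c d \<in> dlinks (expand_link \<tau> I lab l)" by (auto simp: dlinks_expand_links)
  then show ?thesis using axioms_expand_link[OF pre_wf_subset[OF w, of "{|l|}"]] by auto
qed

definition has_bad_axiom :: "(int \<Rightarrow> bool) \<Rightarrow> (edge \<Rightarrow> int) \<Rightarrow> (edge \<Rightarrow> label) \<Rightarrow> link fset \<Rightarrow> bool" where
  "has_bad_axiom \<tau> I lab R \<longleftrightarrow> (\<exists>a b A. AxL a b \<in> dlinks R \<and> lab b = Fm A \<and> bad_axiom A \<tau> (I a) (I b))"

lemma has_bad_axiom_insert: "has_bad_axiom \<tau> I lab (finsert l R) \<longleftrightarrow> has_bad_axiom \<tau> I lab {|l|} \<or> has_bad_axiom \<tau> I lab R"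
  by (auto simp: has_bad_axiom_def split: link.splits)

lemma has_bad_axiom_simps [simp]:
  "\<not> has_bad_axiom \<tau> I lab {||}"
  "has_bad_axiom \<tau> I lab {|BoxL S p c P|} \<longleftrightarrow> has_bad_axiom \<tau> I lab S"
  by (auto simp: has_bad_axiom_def split: link.splits)

lemma swaps_expand_links_aux:
  assumes "\<And>l. l |\<in>| R \<Longrightarrow> swaps X (expand_label X lab) (has_bad_axiom \<tau> I lab {|l|}) (expand_link none I lab l) (expand_link \<tau> I lab l)" "pre_wf lab R"
  shows "swaps X (expand_label X lab) (has_bad_axiom \<tau> I lab R) (expand_links none I lab R) (expand_links \<tau> I lab R)"
  using assms
proof (induction R)
  case empty
  then show ?case by (simp add: swaps_refl)
next
  case (insert l R)
  have "{e. edge_in e l} \<inter> edges R = {}" using pre_wf_insert_edges[OF insert.prems(2) insert.hyps] by blast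
  then have d: "cns (expand_link none I lab l) \<inter> cns (expand_links none I lab R) = {}"
    using cns_edges[of "expand_link none I lab l"] cns_edges[of "expand_links none I lab R"] edges_expand_link[of none I lab l]
      edges_expand_links[of none I lab R] fam_disjoint[of "{e. edge_in e l}" "edges R"] by blast
  have "swaps X (expand_label X lab) (has_bad_axiom \<tau> I lab {|l|}) (expand_link none I lab l) (expand_link \<tau> I lab l)"
    by (rule insert.prems(1)) simp
  moreover have "swaps X (expand_label X lab) (has_bad_axiom \<tau> I lab R) (expand_links none I lab R) (expand_links \<tau> I lab R)"
    by (rule insert.IH) (use insert.prems(1) pre_wf_insertD[OF insert.prems(2)] in \<open>simp_all only: finsert_iff simp_thms\<close>)
  ultimately show ?case
    unfolding expand_links_simps has_bad_axiom_insert[of _ _ _ l R] using d by (rule swaps_union)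
qed

lemma swaps_expand_link:
  "pre_wf lab {|l|} \<Longrightarrow> swaps X (expand_label X lab) (has_bad_axiom \<tau> I lab {|l|}) (expand_link none I lab l) (expand_link \<tau> I lab l)"
proof (induction l)
  case (AxL a b)
  then obtain A where A: "lab a = Fm (neg A)" "lab b = Fm A" "a \<noteq> b" using pre_wf_insertD by fastforce
  have "has_bad_axiom \<tau> I lab {|AxL a b|} \<longleftrightarrow> bad_axiom A \<tau> (I a) (I b)" using A by (auto simp: has_bad_axiom_def)
  then show ?case using swaps_expand[of X lab a "[]" A b \<tau> "I a" "I b"] A by (auto simp: substitute_neg)
next
  case (BoxL S p q P)
  have w: "pre_wf lab S" using pre_wf_boxD[OF BoxL.prems(1)] by auto
  have "swaps X (expand_label X lab) (has_bad_axiom \<tau> I lab S) (expand_links none I lab S) (expand_links \<tau> I lab S)"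
    by (rule swaps_expand_links_aux[OF BoxL.IH w]) (use pre_wf_subset[OF w] in auto)
  then show ?case by (simp add: swaps_box)
qed (auto simp: has_bad_axiom_def swaps_refl)

lemma swaps_expand_links:
  "pre_wf lab R \<Longrightarrow> swaps X (expand_label X lab) (has_bad_axiom \<tau> I lab R) (expand_links none I lab R) (expand_links \<tau> I lab R)"
proof (rule swaps_expand_links_aux)
  fix l assume a: "pre_wf lab R" "l |\<in>| R"
  show "swaps X (expand_label X lab) (has_bad_axiom \<tau> I lab {|l|}) (expand_link none I lab l) (expand_link \<tau> I lab l)"
    using a(2) by (intro swaps_expand_link pre_wf_subset[OF a(1)]) auto
qed

section \<open>Transfer along expansion\<close>

lemma link_notin: "edge_in e l \<Longrightarrow> e \<notin> edges R \<Longrightarrow> l |\<notin>| R"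
  by (auto simp: edges_def)

lemma no_cut_disjoint:
  assumes "edges R \<inter> edges S = {}" "no_cut R"
  shows "R |\<inter>| S = {||}"
proof (rule ccontr)
  assume "R |\<inter>| S \<noteq> {||}"
  then obtain l where l: "l |\<in>| R" "l |\<in>| S" by blast
  have "l \<in> dlinks R" using l(1) by (subst dlinks_iff) simp
  then have "\<forall>a b. l \<noteq> CutL a b" using assms(2) by (auto simp: no_cut_def)
  then obtain e where "edge_in e l" using edge_in_ex by blast
  then show False using l assms(1) by (auto simp: edges_def)
qed

locale swap_model = model M for M :: "('o, 'a, 'p, 'b) llmodel" +
  fixes \<Xi> :: 'o and X :: nat
  assumes obj_Xi [simp]: "\<Xi> \<in> Obj (lin M)"
begin

text \<open>\<open>v0\<close> is the assignment underlying the default one, \<open>v1\<close> the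
  assignment for which swap-sensitivity is stated. The substitution of X \<otimes> X for atoms leads
  from the one to the other.\<close>

abbreviation v0 :: "nat \<Rightarrow> 'o" where "v0 \<equiv> \<lambda>_. \<Xi> \<otimes> \<Xi>"
abbreviation v1 :: "nat \<Rightarrow> 'o" where "v1 \<equiv> \<lambda>_. \<Xi>"

lemma v01: "\<forall>x. v0 x \<in> ob" "\<forall>x. v1 x \<in> ob"
  by simp_all

definition gam :: "(int \<Rightarrow> bool) \<Rightarrow> int \<Rightarrow> ('o, 'a) arrow" where
  "gam \<tau> i = (if \<tau> i then L.sym \<Xi> \<Xi> else L.ide (\<Xi> \<otimes> \<Xi>))"

text \<open>Needed at negated atoms: these are interpreted by the dual of \<Xi> \<otimes> \<Xi>
  under \<open>v0\<close>, but after substitution by the dual of a tensor of two biduals of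
  \<Xi>.\<close>

definition ddi :: "('o, 'a) arrow" where
  "ddi = L.inverse (dd \<Xi>) \<star> L.inverse (dd \<Xi>)"

text \<open>For \<tau> = \<open>none\<close> this is the plain comparison of the two interpretations
  of a formula; in general it also applies the symmetry at the atoms whose index belongs to
  \<tau>.\<close>

definition phi :: "(int \<Rightarrow> bool) \<Rightarrow> form \<Rightarrow> int \<Rightarrow> ('o, 'a) arrow" where
  "phi \<tau> = induced (gam \<tau>) (\<lambda>i. Dl (gam \<tau> i \<bullet> ddi))"

lemma gam_simps [simp]: "dom (gam \<tau> i) = \<Xi> \<otimes> \<Xi>" "cod (gam \<tau> i) = \<Xi> \<otimes> \<Xi>" "L.iso (gam \<tau> i)" "L.arr (gam \<tau> i)"
  "dom ddi = dual M (dual M \<Xi>) \<otimes> dual M (dual M \<Xi>)" "cod ddi = \<Xi> \<otimes> \<Xi>" "L.iso ddi" "L.arr ddi"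
  by (simp_all add: gam_def ddi_def)

lemma iso_phi [simp]: "L.iso (phi \<tau> A i)"
  unfolding phi_def by (rule iso_induced) simp

lemma arr_phi [simp]: "L.arr (phi \<tau> A i)"
  by (simp add: L.iso_arr)

lemma dom_phi [simp]: "dom (phi \<tau> A i) = obj M v0 A"
  unfolding phi_def by (rule dom_induced) simp

lemma cod_phi [simp]: "cod (phi \<tau> A i) = obj M v1 (substitute X A)"
  unfolding phi_def by (induction A arbitrary: i) simp_all

lemma phi_simps:
  "phi \<tau> One i = L.ide (Unit (lin M))" "phi \<tau> Bot i = L.ide bt"
  "phi \<tau> (Tens A B) i = phi \<tau> A i \<star> phi \<tau> B i"
  "phi \<tau> (Par A B) i = Dl (Dl (phi \<tau> A i) \<star> Dl (phi \<tau> B i))"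
  "phi \<tau> (OfCourse A) i = bng (phi \<tau> A (i + 1))"
  "phi \<tau> (WhyNot A) i = Dl (bng (Dl (phi \<tau> A (i + 1))))"
  "phi \<tau> (Para A) i = phi \<tau> A (i + 1)"
  "phi \<tau> (Atom x) i = gam \<tau> i" "phi \<tau> (NAtom x) i = Dl (gam \<tau> i \<bullet> ddi)"
  by (simp_all add: phi_def)

lemma nprg_atom: "nprg v1 (Atom x) = dd \<Xi>"
  by (simp add: prg_simps dd_def)

text \<open>The number of symmetries in this composite is 0 or 2, and the symmetry is an involution.
  This parity explains why \<open>expand\<close> inserts \<gamma> if exactly one end of an axiom has
  its index in \<tau>.\<close>

lemma gam_gam: "gam \<tau> j \<bullet> (if \<tau> i = \<tau> j then L.ide (\<Xi> \<otimes> \<Xi>) else L.sym \<Xi> \<Xi>) \<bullet> gam \<tau> i = L.ide (\<Xi> \<otimes> \<Xi>)"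
  by (simp add: gam_def)

lemma pos_ide: "d \<in> ob \<Longrightarrow> pos d (L.ide d) = evl d \<bullet> L.sym d (dual M d)"
  by (simp add: pos_def)

lemma nprg_nat:
  assumes "L.arr q" "dom q = obj M v1 (substitute X A) \<otimes> obj M v1 (neg (substitute X A))" "cod q = bt"
    "prg v0 A = q \<bullet> (phi \<tau> A i \<star> phi \<tau> (neg A) j)"
  shows "nprg v0 A = Dl (phi \<tau> (neg A) j) \<bullet> nam (obj M v1 (substitute X A)) (obj M v1 (neg (substitute X A))) q \<bullet> phi \<tau> A i"
  using nam_nat[of q "phi \<tau> A i" "phi \<tau> (neg A) j"] assms by (simp add: substitute_neg)

text \<open>The isomorphisms at the two ends of an axiom are absorbed, atom by atom, by the choice
  between identity and symmetry. With equal indices the arrow \<open>q\<close> is the pairing itself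
  and hence does not depend on \<tau>, which is what membership in L3 will be used for.\<close>

lemma axiom_expansion:
  "expand_label X lab (nm a p) = Fm (neg (substitute X A)) \<Longrightarrow> expand_label X lab (nm b p) = Fm (substitute X A) \<Longrightarrow> a \<noteq> b \<Longrightarrow>
    \<exists>q. sq2 v1 (expand_label X lab) (expand A \<tau> i j p a b) (nm a p) (nm b p) q \<and>
      prg v0 A = q \<bullet> (phi \<tau> A i \<star> phi \<tau> (neg A) j) \<and> (i = j \<longrightarrow> q = prg v1 (substitute X A))"
proof (induction A arbitrary: i j p a b rule: form_polar_induct)
  case (1 A)
  have l: "expand_label X lab (nm b p) = Fm (neg (substitute X A))" "expand_label X lab (nm a p) = Fm (substitute X A)"
    using 1 by (simp_all add: substitute_neg)
  obtain q where q: "sq2 v1 (expand_label X lab) (expand A \<tau> j i p b a) (nm b p) (nm a p) q"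
    "prg v0 A = q \<bullet> (phi \<tau> A j \<star> phi \<tau> (neg A) i)" "j = i \<longrightarrow> q = prg v1 (substitute X A)"
    using 1(1)[OF l(1) l(2)] 1(4) by blast
  let ?y = "obj M v1 (substitute X A)" and ?y' = "obj M v1 (neg (substitute X A))"
  have a: "L.arr q" "dom q = ?y \<otimes> ?y'" "cod q = bt" using q(1) l by (simp_all add: sq2_def[OF v01(2)])
  have "sq2 v1 (expand_label X lab) (expand (neg A) \<tau> i j p a b) (nm a p) (nm b p) (q \<bullet> L.sym ?y' ?y)"
    using sq2_sym[OF v01(2) q(1)] l expand_neg[of A \<tau> i j p a b] by simp
  moreover have "prg v0 (neg A) = (q \<bullet> L.sym ?y' ?y) \<bullet> (phi \<tau> (neg A) i \<star> phi \<tau> (neg (neg A)) j)"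
    using a q(2) by (simp add: prg_neg L.sym_nat substitute_neg)
  moreover have "i = j \<longrightarrow> q \<bullet> L.sym ?y' ?y = prg v1 (substitute X (neg A))"
    using q(3) by (simp add: prg_neg substitute_neg)
  ultimately show ?case by blast
next
  case (2 x)
  let ?a0 = "nm a (0 # p)" and ?a1 = "nm a (1 # p)" and ?b0 = "nm b (0 # p)" and ?b1 = "nm b (1 # p)"
  let ?l = "expand_label X lab"
  have l: "?l ?a0 = Fm (neg (Atom X))" "?l ?a1 = Fm (neg (Atom X))" "?l ?b0 = Fm (Atom X)" "?l ?b1 = Fm (Atom X)"
    using 2 by simp_all
  let ?u = "prg v1 (Atom X)" and ?tw = "if \<tau> i = \<tau> j then L.ide (\<Xi> \<otimes> \<Xi>) else L.sym \<Xi> \<Xi>"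
  let ?d = "dual M (dual M \<Xi>) \<otimes> dual M (dual M \<Xi>)"
  let ?q = "pos ?d ((dd \<Xi> \<star> dd \<Xi>) \<bullet> ?tw)"
  have s: "sq2 v1 ?l {|AxL ?a0 ?b0|} ?a0 ?b0 ?u" "sq2 v1 ?l {|AxL ?a1 ?b1|} ?a1 ?b1 ?u"
    using sq2_ax[OF v01(2), of ?l ?a0 "Atom X" ?b0, OF l(1,3)] sq2_ax[OF v01(2), of ?l ?a1 "Atom X" ?b1, OF l(2,4)] .
  have dd: "nam \<Xi> (dual M \<Xi>) ?u = dd \<Xi>" using nprg_atom by simp
  have "sq2 v1 ?l (expand (Atom x) \<tau> i j p a b) (nm a p) (nm b p) ?q"
  proof (cases "\<tau> i = \<tau> j")
    case True
    then show ?thesis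
      using sq2_tens[OF v01(2) s, of "nm b p" "Atom X" "Atom X" "nm a p"] l 2 dd by (simp add: L.iso_arr)
  next
    case False
    then show ?thesis
      using sq2_tens_swapped[OF v01(2) s, of "nm b p" "Atom X" "Atom X" "nm a p"] l 2 dd by (simp add: L.iso_arr)
  qed
  moreover have "prg v0 (Atom x) = ?q \<bullet> (phi \<tau> (Atom x) i \<star> phi \<tau> (neg (Atom x)) j)"
  proof -
    \<comment> \<open>The negated end of the axiom carries the transpose of \<open>?H\<close>. By
      \<open>pos_rel\<close> it acts after the name instead, where \<open>ddi\<close> cancels the
      arrows into the biduals and \<open>gam_gam\<close> the remaining symmetries.\<close>
    let ?H = "gam \<tau> j \<bullet> ddi" and ?n = "(dd \<Xi> \<star> dd \<Xi>) \<bullet> ?tw"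
    have tw: "L.arr ?tw" "dom ?tw = \<Xi> \<otimes> \<Xi>" "cod ?tw = \<Xi> \<otimes> \<Xi>" by simp_all
    have di: "ddi \<bullet> (dd \<Xi> \<star> dd \<Xi>) = L.ide (\<Xi> \<otimes> \<Xi>)" by (simp add: ddi_def L.tn_cmp L.iso_arr)
    have "?H \<bullet> ?n \<bullet> gam \<tau> i = gam \<tau> j \<bullet> (ddi \<bullet> (dd \<Xi> \<star> dd \<Xi>)) \<bullet> ?tw \<bullet> gam \<tau> i"
      using tw by (simp add: L.iso_arr del: if_split)
    also have "\<dots> = L.ide (\<Xi> \<otimes> \<Xi>)" unfolding di using tw gam_gam[of \<tau> j i] by (simp del: if_split)
    finally have h: "?H \<bullet> ?n \<bullet> gam \<tau> i = L.ide (\<Xi> \<otimes> \<Xi>)" .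
    have "pos (cod ?H) (?H \<bullet> ?n \<bullet> gam \<tau> i) = pos (dom ?H) ?n \<bullet> (gam \<tau> i \<star> Dl ?H)"
      using tw by (intro pos_rel) (simp_all add: L.iso_arr del: if_split)
    then show ?thesis unfolding h by (simp add: pos_ide prg_simps phi_simps del: if_split)
  qed
  moreover have "i = j \<longrightarrow> ?q = prg v1 (substitute X (Atom x))"
    using dd by (simp add: prg_simps(5) L.iso_arr)
  ultimately show ?case by blast
next
  case 3
  then show ?case
    using sq2_one[OF v01(2), of "expand_label X lab" "nm a p" "nm b p"] by (auto simp: prg_simps phi_simps)
next
  case (4 A B)
  let ?l = "expand_label X lab"
  let ?R = "expand A \<tau> i j (0 # p) a b" and ?S = "expand B \<tau> i j (1 # p) a b"
  have l: "?l (nm a (0 # p)) = Fm (neg (substitute X A))" "?l (nm b (0 # p)) = Fm (substitute X A)"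
    "?l (nm a (1 # p)) = Fm (neg (substitute X B))" "?l (nm b (1 # p)) = Fm (substitute X B)"
    using 4 by simp_all
  obtain q where q: "sq2 v1 ?l ?R (nm a (0 # p)) (nm b (0 # p)) q"
    "prg v0 A = q \<bullet> (phi \<tau> A i \<star> phi \<tau> (neg A) j)" "i = j \<longrightarrow> q = prg v1 (substitute X A)"
    using 4(1)[OF l(1,2) 4(5)] by blast
  obtain r where r: "sq2 v1 ?l ?S (nm a (1 # p)) (nm b (1 # p)) r"
    "prg v0 B = r \<bullet> (phi \<tau> B i \<star> phi \<tau> (neg B) j)" "i = j \<longrightarrow> r = prg v1 (substitute X B)"
    using 4(2)[OF l(3,4) 4(5)] by blast
  let ?a = "obj M v1 (substitute X A)" and ?a' = "obj M v1 (neg (substitute X A))" and ?b = "obj M v1 (substitute X B)" and ?b' = "obj M v1 (neg (substitute X B))"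
  have aq: "L.arr q" "dom q = ?a \<otimes> ?a'" "cod q = bt" using q(1) l by (simp_all add: sq2_def[OF v01(2)])
  have ar: "L.arr r" "dom r = ?b \<otimes> ?b'" "cod r = bt" using r(1) l by (simp_all add: sq2_def[OF v01(2)])
  let ?n = "nam ?a ?a' q \<star> nam ?b ?b' r" and ?d = "dual M ?a' \<otimes> dual M ?b'"
  have d: "?R |\<inter>| ?S = {||}" by (intro no_cut_disjoint no_cut_expand not_edge_expand(4)) simp
  have "sq2 v1 ?l (expand (Tens A B) \<tau> i j p a b) (nm a p) (nm b p) (pos ?d ?n)"
    using sq2_tens[OF v01(2) q(1) r(1) d, of "nm b p" "substitute X A" "substitute X B" "nm a p"] l 4(3,4)
      link_notin[of "nm b p" _ "?R |\<union>| ?S"] link_notin[of "nm a p" _ "?R |\<union>| ?S"] not_edge_expand(1)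
    by simp
  moreover have "prg v0 (Tens A B) = pos ?d ?n \<bullet> (phi \<tau> (Tens A B) i \<star> phi \<tau> (neg (Tens A B)) j)"
  proof -
    let ?H = "Dl (phi \<tau> (neg A) j) \<star> Dl (phi \<tau> (neg B) j)"
    have "nprg v0 A \<star> nprg v0 B = ?H \<bullet> ?n \<bullet> (phi \<tau> A i \<star> phi \<tau> B i)"
      using nprg_nat[OF aq q(2)] nprg_nat[OF ar r(2)] aq ar by (simp add: L.merge substitute_neg)
    moreover have "pos (cod ?H) (?H \<bullet> ?n \<bullet> (phi \<tau> A i \<star> phi \<tau> B i)) = pos (dom ?H) ?n \<bullet> ((phi \<tau> A i \<star> phi \<tau> B i) \<star> Dl ?H)"
      using aq ar by (intro pos_rel) (simp_all add: substitute_neg)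
    ultimately show ?thesis by (simp add: prg_simps phi_simps substitute_neg)
  qed
  moreover have "i = j \<longrightarrow> pos ?d ?n = prg v1 (substitute X (Tens A B))"
    using q(3) r(3) by (simp add: prg_simps)
  ultimately show ?case by blast
next
  case (5 A)
  let ?l = "expand_label X lab"
  let ?R = "expand A \<tau> (i + 1) (j + 1) (0 # p) a b"
  have l: "?l (nm a (0 # p)) = Fm (neg (substitute X A))" "?l (nm b (0 # p)) = Fm (substitute X A)"
    "?l (nm a (1 # p)) = Flat (neg (substitute X A))" "?l (nm a (2 # p)) = Flat (neg (substitute X A))"
    using 5 by simp_all
  obtain q where q: "sq2 v1 ?l ?R (nm a (0 # p)) (nm b (0 # p)) q"
    "prg v0 A = q \<bullet> (phi \<tau> A (i + 1) \<star> phi \<tau> (neg A) (j + 1))" "i = j \<longrightarrow> q = prg v1 (substitute X A)"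
    using 5(1)[OF l(1,2) 5(4), of "i + 1" "j + 1"] by auto
  let ?a = "obj M v1 (substitute X A)" and ?a' = "obj M v1 (neg (substitute X A))"
  have aq: "L.arr q" "dom q = ?a \<otimes> ?a'" "cod q = bt" using q(1) l by (simp_all add: sq2_def[OF v01(2)])
  let ?n = "nam ?a ?a' q" and ?d = "bang M (dual M ?a')"
  have "sq2 v1 ?l (expand (OfCourse A) \<tau> i j p a b) (nm a p) (nm b p) (pos ?d (bng ?n))"
    using sq2_ofcourse[OF v01(2) q(1), of "substitute X A" "nm a (1 # p)" "nm a (2 # p)" "nm a p" "nm b p"] l 5(2,3)
      link_notin[of "nm a (1 # p)" _ ?R] not_edge_expand(2)[of 0 1]
    by simp
  moreover have "prg v0 (OfCourse A) = pos ?d (bng ?n) \<bullet> (phi \<tau> (OfCourse A) i \<star> phi \<tau> (neg (OfCourse A)) j)"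
  proof -
    let ?H = "bng (Dl (phi \<tau> (neg A) (j + 1)))" and ?f = "bng (phi \<tau> A (i + 1))"
    have "bng (nprg v0 A) = ?H \<bullet> bng ?n \<bullet> ?f"
      using nprg_nat[OF aq q(2)] aq by (simp add: bng_cmp substitute_neg)
    moreover have "pos (cod ?H) (?H \<bullet> bng ?n \<bullet> ?f) = pos (dom ?H) (bng ?n) \<bullet> (?f \<star> Dl ?H)"
      using aq by (intro pos_rel) (simp_all add: substitute_neg)
    ultimately show ?thesis by (simp add: prg_simps phi_simps substitute_neg)
  qed
  moreover have "i = j \<longrightarrow> pos ?d (bng ?n) = prg v1 (substitute X (OfCourse A))"
    using q(3) by (simp add: prg_simps)
  ultimately show ?case by blast
next
  case (6 A)
  let ?l = "expand_label X lab"
  let ?R = "expand A \<tau> (i + 1) (j + 1) (0 # p) a b"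
  have l: "?l (nm a (0 # p)) = Fm (neg (substitute X A))" "?l (nm b (0 # p)) = Fm (substitute X A)"
    using 6 by simp_all
  obtain q where q: "sq2 v1 ?l ?R (nm a (0 # p)) (nm b (0 # p)) q"
    "prg v0 A = q \<bullet> (phi \<tau> A (i + 1) \<star> phi \<tau> (neg A) (j + 1))" "i = j \<longrightarrow> q = prg v1 (substitute X A)"
    using 6(1)[OF l(1,2) 6(4), of "i + 1" "j + 1"] by auto
  have "sq2 v1 ?l (expand (Para A) \<tau> i j p a b) (nm a p) (nm b p) q"
    using sq2_para[OF v01(2) q(1), of "substitute X A" "nm a p" "nm b p"] l 6(2-4)
      link_notin[of "nm a p" _ ?R] link_notin[of "nm b p" _ ?R] not_edge_expand(1)
    by simp
  then show ?case using q(2,3) by (auto simp: prg_simps phi_simps)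
qed

context
  fixes lab :: "edge \<Rightarrow> label" and I :: "edge \<Rightarrow> int"
begin

abbreviation xl :: "edge \<Rightarrow> label" where "xl \<equiv> expand_label X lab"
abbreviation n0 :: "edge \<Rightarrow> edge" where "n0 \<equiv> \<lambda>e. nm e []"

text \<open>The negation appears because contexts are interpreted by the negations of the
  conclusions. A flat edge keeps the index of the premise of its flat link: the index drops by 1
  only at the why not link, where \<open>phi\<close> makes up for it.\<close>

definition edge_iso :: "(int \<Rightarrow> bool) \<Rightarrow> edge \<Rightarrow> ('o, 'a) arrow" where
  "edge_iso \<tau> e = (case lab e of Fm A \<Rightarrow> phi \<tau> (neg A) (I e) | Flat A \<Rightarrow> bng (phi \<tau> (neg A) (I e)))"

lemma edge_iso_simps [simp]: "L.arr (edge_iso \<tau> e)" "L.iso (edge_iso \<tau> e)" "dom (edge_iso \<tau> e) = neg_obj M v0 (lab e)" "cod (edge_iso \<tau> e) = neg_obj M v1 (xl (n0 e))"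
  by (auto simp: edge_iso_def substitute_neg split: label.splits)

definition context_iso :: "(int \<Rightarrow> bool) \<Rightarrow> edge list \<Rightarrow> ('o, 'a) arrow" where
  "context_iso \<tau> \<Gamma> = L.tlist (map (edge_iso \<tau>) \<Gamma>)"

lemma maps_edge_iso: "map dom (map (edge_iso \<tau>) \<Gamma>) = negs M v0 lab \<Gamma>" "map cod (map (edge_iso \<tau>) \<Gamma>) = negs M v1 xl (map n0 \<Gamma>)"
  by simp_all

lemma context_iso_simps [simp]: "L.arr (context_iso \<tau> \<Gamma>)" "L.iso (context_iso \<tau> \<Gamma>)" "dom (context_iso \<tau> \<Gamma>) = tl v0 lab \<Gamma>" "cod (context_iso \<tau> \<Gamma>) = tl v1 xl (map n0 \<Gamma>)"
proof -
  show "L.arr (context_iso \<tau> \<Gamma>)" "L.iso (context_iso \<tau> \<Gamma>)" unfolding context_iso_def by (auto intro!: L.arr_tlist L.iso_tlist)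
  show "dom (context_iso \<tau> \<Gamma>) = tl v0 lab \<Gamma>" unfolding context_iso_def L.tlist_dom_cod(1) maps_edge_iso(1) ..
  show "cod (context_iso \<tau> \<Gamma>) = tl v1 xl (map n0 \<Gamma>)" unfolding context_iso_def L.tlist_dom_cod(2) maps_edge_iso(2) ..
qed

lemma context_iso_Cons: "context_iso \<tau> (e # \<Gamma>) = edge_iso \<tau> e \<star> context_iso \<tau> \<Gamma>" "context_iso \<tau> [] = L.ide (Unit (lin M))"
  by (simp_all add: context_iso_def)

definition good_axioms :: "link fset \<Rightarrow> bool" where
  "good_axioms R \<longleftrightarrow> (\<forall>a b. AxL a b \<in> dlinks R \<longrightarrow> I a = I b)"

lemma good_axioms_simps: "good_axioms (R |\<union>| S) \<longleftrightarrow> good_axioms R \<and> good_axioms S" "good_axioms (finsert l R) \<Longrightarrow> good_axioms R"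
  "good_axioms {|BoxL S p c P|} \<Longrightarrow> good_axioms S"
  by (auto simp: good_axioms_def)

text \<open>\<open>t\<close>, and for every \<open>\<tau>\<close> the arrow \<open>G \<tau>\<close>, interpret parallel sequentializations of \<open>R\<close> and of its
  expansions, which are related by the isomorphisms \<open>context_iso \<tau>\<close>.\<close>

definition transfers :: "link fset \<Rightarrow> edge list \<Rightarrow> ('o, 'a) arrow \<Rightarrow> ((int \<Rightarrow> bool) \<Rightarrow> ('o, 'a) arrow) \<Rightarrow> bool" where
  "transfers R \<Gamma> t G \<longleftrightarrow> sq v0 lab R \<Gamma> t \<and> (\<forall>\<tau>. sq v1 xl (expand_links \<tau> I lab R) (map n0 \<Gamma>) (G \<tau>) \<and>
     t = G \<tau> \<bullet> context_iso \<tau> \<Gamma> \<and> (good_axioms R \<longrightarrow> G \<tau> = G none))"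

lemma trfD: "transfers R \<Gamma> t G \<Longrightarrow> sq v0 lab R \<Gamma> t" "transfers R \<Gamma> t G \<Longrightarrow> sq v1 xl (expand_links \<tau> I lab R) (map n0 \<Gamma>) (G \<tau>)"
  "transfers R \<Gamma> t G \<Longrightarrow> t = G \<tau> \<bullet> context_iso \<tau> \<Gamma>" "transfers R \<Gamma> t G \<Longrightarrow> good_axioms R \<Longrightarrow> G \<tau> = G none"
  unfolding transfers_def by blast+

lemma trfI: "sq v0 lab R \<Gamma> t \<Longrightarrow> (\<And>\<tau>. sq v1 xl (expand_links \<tau> I lab R) (map n0 \<Gamma>) (G \<tau>)) \<Longrightarrow>
  (\<And>\<tau>. t = G \<tau> \<bullet> context_iso \<tau> \<Gamma>) \<Longrightarrow> (\<And>\<tau>. good_axioms R \<Longrightarrow> G \<tau> = G none) \<Longrightarrow> transfers R \<Gamma> t G"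
  unfolding transfers_def by blast

lemma trfT: assumes "transfers R \<Gamma> t G" shows "L.arr t" "dom t = tl v0 lab \<Gamma>" "cod t = bt"
  "L.arr (G \<tau>)" "dom (G \<tau>) = tl v1 xl (map n0 \<Gamma>)" "cod (G \<tau>) = bt"
  using sqD[OF trfD(1)[OF assms]] sqD[OF trfD(2)[OF assms]] by simp_all

section \<open>Transfer through the individual rules\<close>

lemma transfers_exch:
  assumes T: "transfers R \<Gamma> t G" and s: "exchange (lin M) (\<lambda>e. neg_obj M v0 (lab e)) \<Delta> \<Gamma> s"
  shows "\<exists>G'. transfers R \<Delta> (t \<bullet> Arrow (tl v0 lab \<Delta>) s (tl v0 lab \<Gamma>)) G'"
proof -
  let ?s = "Arrow (tl v0 lab \<Delta>) s (tl v0 lab \<Gamma>)"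
  obtain s' where s': "exchange (lin M) (\<lambda>e. neg_obj M v1 (xl e)) (map n0 \<Delta>) (map n0 \<Gamma>) s'"
    "\<And>\<tau>. Arrow (tl v1 xl (map n0 \<Delta>)) s' (tl v1 xl (map n0 \<Gamma>)) \<bullet> L.tlist (map (edge_iso \<tau>) \<Delta>) = L.tlist (map (edge_iso \<tau>) \<Gamma>) \<bullet> ?s"
    using L.exchange_nat[OF s, of edge_iso "\<lambda>e. neg_obj M v1 (xl e)" n0] by auto
  let ?s' = "Arrow (tl v1 xl (map n0 \<Delta>)) s' (tl v1 xl (map n0 \<Gamma>))"
  have a: "L.arr ?s" "L.arr ?s'"
    using L.exchange_arr[OF s] L.exchange_arr[OF s'(1)] by simp_all
  show ?thesis
  proof (intro exI trfI)
    show "sq v0 lab R \<Delta> (t \<bullet> ?s)" by (rule sq_exch[OF v01(1) trfD(1)[OF T] s])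
    show "sq v1 xl (expand_links \<tau> I lab R) (map n0 \<Delta>) (G \<tau> \<bullet> ?s')" for \<tau> by (rule sq_exch[OF v01(2) trfD(2)[OF T] s'(1)])
    show "t \<bullet> ?s = (G \<tau> \<bullet> ?s') \<bullet> context_iso \<tau> \<Delta>" for \<tau>
    proof -
      have "(G \<tau> \<bullet> ?s') \<bullet> context_iso \<tau> \<Delta> = G \<tau> \<bullet> (?s' \<bullet> context_iso \<tau> \<Delta>)"
        using a trfT[OF T] by (intro L.cmp_assoc) simp_all
      also have "\<dots> = G \<tau> \<bullet> (context_iso \<tau> \<Gamma> \<bullet> ?s)" using s'(2)[of \<tau>] by (simp only: context_iso_def)
      also have "\<dots> = (G \<tau> \<bullet> context_iso \<tau> \<Gamma>) \<bullet> ?s"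
        using a trfT[OF T] by (intro L.cmp_assoc[symmetric]) simp_all
      finally show ?thesis using trfD(3)[OF T, of \<tau>] by simp
    qed
    show "G \<tau> \<bullet> ?s' = G none \<bullet> ?s'" if "good_axioms R" for \<tau> using trfD(4)[OF T that, of \<tau>] by simp
  qed
qed

lemma transfers_mix2:
  assumes "Mix M = Some m" and T: "transfers R \<Gamma> t G" and U: "transfers S \<Delta> u H" and d: "R |\<inter>| S = {||}" "edges R \<inter> edges S = {}" "no_cut R"
  shows "\<exists>G'. transfers (R |\<union>| S) (\<Gamma> @ \<Delta>) (mix_op m (negs M v0 lab \<Gamma>) (negs M v0 lab \<Delta>) t u) G'"
proof (intro exI trfI)
  show "sq v0 lab (R |\<union>| S) (\<Gamma> @ \<Delta>) (mix_op m (negs M v0 lab \<Gamma>) (negs M v0 lab \<Delta>) t u)"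
    by (rule sq_mix2[OF v01(1) assms(1) trfD(1)[OF T] trfD(1)[OF U] d(1)])
  let ?G = "\<lambda>\<tau>. mix_op m (negs M v1 xl (map n0 \<Gamma>)) (negs M v1 xl (map n0 \<Delta>)) (G \<tau>) (H \<tau>)"
  show "sq v1 xl (expand_links \<tau> I lab (R |\<union>| S)) (map n0 (\<Gamma> @ \<Delta>)) (?G \<tau>)" for \<tau>
    using sq_mix2[OF v01(2) assms(1) trfD(2)[OF T] trfD(2)[OF U] expand_links_disjoint[OF d(2,3)], of \<tau>] by simp
  show "mix_op m (negs M v0 lab \<Gamma>) (negs M v0 lab \<Delta>) t u = ?G \<tau> \<bullet> context_iso \<tau> (\<Gamma> @ \<Delta>)" for \<tau>
    using mix_op_nat[OF assms(1), of "G \<tau>" "H \<tau>" "map (edge_iso \<tau>) \<Gamma>" "map (edge_iso \<tau>) \<Delta>", folded context_iso_def]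
      trfT[OF T] trfT[OF U] trfD(3)[OF T, of \<tau>] trfD(3)[OF U, of \<tau>]
    unfolding maps_edge_iso context_iso_def[of _ "\<Gamma> @ \<Delta>"] by simp
  show "?G \<tau> = ?G none" if "good_axioms (R |\<union>| S)" for \<tau>
    using that trfD(4)[OF T, of \<tau>] trfD(4)[OF U, of \<tau>] by (simp add: good_axioms_simps(1))
qed

text \<open>The only rule at which \<tau> changes the expanded net, and so the only source of a
  dependence of \<open>G\<close> on \<tau>. Agreement of the indices removes it by the last clause
  of \<open>axiom_expansion\<close>.\<close>

lemma transfers_ax:
  assumes l: "lab a = Fm (neg A)" "lab b = Fm A" and ab: "a \<noteq> b"
  shows "\<exists>G. transfers {|AxL a b|} [a, b] (prg v0 A \<bullet> (L.ide (obj M v0 A) \<star> L.runit (obj M v0 (neg A)))) G"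
proof -
  have "\<forall>\<tau>. \<exists>q. sq2 v1 xl (expand A \<tau> (I a) (I b) [] a b) (n0 a) (n0 b) q \<and>
      prg v0 A = q \<bullet> (phi \<tau> A (I a) \<star> phi \<tau> (neg A) (I b)) \<and> (I a = I b \<longrightarrow> q = prg v1 (substitute X A))"
    using axiom_expansion[of lab a "[]" A b _ "I a" "I b"] l ab by (simp add: substitute_neg)
  then obtain Q where Q: "\<And>\<tau>. sq2 v1 xl (expand A \<tau> (I a) (I b) [] a b) (n0 a) (n0 b) (Q \<tau>)"
    "\<And>\<tau>. prg v0 A = Q \<tau> \<bullet> (phi \<tau> A (I a) \<star> phi \<tau> (neg A) (I b))" "\<And>\<tau>. I a = I b \<Longrightarrow> Q \<tau> = prg v1 (substitute X A)"
    by metis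
  let ?y = "obj M v1 (substitute X A)" and ?y' = "obj M v1 (neg (substitute X A))"
  have aQ: "L.arr (Q \<tau>)" "dom (Q \<tau>) = ?y \<otimes> ?y'" "cod (Q \<tau>) = bt" for \<tau>
    using Q(1)[of \<tau>] l by (simp_all add: sq2_def[OF v01(2)] substitute_neg)
  show ?thesis
  proof (intro exI trfI)
    let ?G = "\<lambda>\<tau>. Q \<tau> \<bullet> (L.ide ?y \<star> L.runit ?y')"
    show "sq v0 lab {|AxL a b|} [a, b] (prg v0 A \<bullet> (L.ide (obj M v0 A) \<star> L.runit (obj M v0 (neg A))))"
      by (rule sq_ax[OF v01(1) l])
    show "sq v1 xl (expand_links \<tau> I lab {|AxL a b|}) (map n0 [a, b]) (?G \<tau>)" for \<tau>
      using Q(1)[of \<tau>] l by (simp add: sq2_def[OF v01(2)] substitute_neg)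
    show "prg v0 A \<bullet> (L.ide (obj M v0 A) \<star> L.runit (obj M v0 (neg A))) = ?G \<tau> \<bullet> context_iso \<tau> [a, b]" for \<tau>
    proof -
      have p: "context_iso \<tau> [a, b] = phi \<tau> A (I a) \<star> (phi \<tau> (neg A) (I b) \<star> L.ide (Unit (lin M)))"
        using l by (simp add: context_iso_Cons edge_iso_def)
      show ?thesis
        unfolding p using aQ[of \<tau>] Q(2)[of \<tau>] by (simp add: L.tn_cmp L.runit_nat substitute_neg)
    qed
    show "?G \<tau> = ?G none" if "good_axioms {|AxL a b|}" for \<tau>
      using that Q(3)[of \<tau>] Q(3)[of none] by (simp add: good_axioms_def)
  qed
qed

lemma transfers_one: "lab c = Fm One \<Longrightarrow> transfers {|OneL c|} [c] (L.runit bt) (\<lambda>_. L.runit bt)"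
proof (rule trfI)
  assume l: "lab c = Fm One"
  show "sq v0 lab {|OneL c|} [c] (L.runit bt)" using sq_one[OF v01(1), of lab c, OF l] .
  show "sq v1 xl (expand_links \<tau> I lab {|OneL c|}) (map n0 [c]) (L.runit bt)" for \<tau>
    using sq_one[OF v01(2), of xl "n0 c"] l by simp
  show "L.runit bt = L.runit bt \<bullet> context_iso \<tau> [c]" for \<tau> using l by (simp add: context_iso_Cons edge_iso_def phi_simps)
qed simp

lemma transfers_bot:
  assumes T: "transfers R \<Gamma> t G" and c: "c \<notin> edges R" "lab c = Fm Bot"
  shows "\<exists>G'. transfers (finsert (BotL c) R) (c # \<Gamma>) (t \<bullet> L.lunit (tl v0 lab \<Gamma>)) G'"
proof (intro exI trfI)
  let ?G = "\<lambda>\<tau>. G \<tau> \<bullet> L.lunit (tl v1 xl (map n0 \<Gamma>))"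
  show "sq v0 lab (finsert (BotL c) R) (c # \<Gamma>) (t \<bullet> L.lunit (tl v0 lab \<Gamma>))"
    by (rule sq_bot[OF v01(1) trfD(1)[OF T] _ c(2)]) (rule link_notin[OF _ c(1)], simp)
  show "sq v1 xl (expand_links \<tau> I lab (finsert (BotL c) R)) (map n0 (c # \<Gamma>)) (?G \<tau>)" for \<tau>
    using sq_bot[OF v01(2) trfD(2)[OF T, of \<tau>], of "n0 c"] c link_notin[OF _ not_edge_expand_links[OF c(1)], of "[]"] by simp
  show "t \<bullet> L.lunit (tl v0 lab \<Gamma>) = ?G \<tau> \<bullet> context_iso \<tau> (c # \<Gamma>)" for \<tau>
    using trfT[OF T] trfD(3)[OF T, of \<tau>] c(2) L.lunit_nat[of "context_iso \<tau> \<Gamma>"]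
    by (simp add: context_iso_Cons edge_iso_def phi_simps)
  show "?G \<tau> = ?G none" if "good_axioms (finsert (BotL c) R)" for \<tau>
    using trfD(4)[OF T good_axioms_simps(2)[OF that], of \<tau>] by simp
qed

lemma transfers_tens:
  assumes T: "transfers R (a # \<Gamma>) t G" and U: "transfers S (b # \<Delta>) u H" and d: "R |\<inter>| S = {||}" "edges R \<inter> edges S = {}" "no_cut R"
    and e: "e \<notin> edges (R |\<union>| S)" and l: "lab a = Fm A" "lab b = Fm B" "lab e = Fm (Tens A B)"
    and i: "I a = I e" "I b = I e"
  shows "\<exists>G'. transfers (finsert (TensL a b e) (R |\<union>| S)) (e # \<Gamma> @ \<Delta>)
    (tens_op (obj M v0 (neg A)) (obj M v0 (neg B)) (negs M v0 lab \<Gamma>) (negs M v0 lab \<Delta>) t u) G'"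
proof (intro exI trfI)
  show "sq v0 lab (finsert (TensL a b e) (R |\<union>| S)) (e # \<Gamma> @ \<Delta>)
    (tens_op (obj M v0 (neg A)) (obj M v0 (neg B)) (negs M v0 lab \<Gamma>) (negs M v0 lab \<Delta>) t u)"
    by (rule sq_tens[OF v01(1) trfD(1)[OF T] trfD(1)[OF U] d(1) _ l]) (rule link_notin[OF _ e], simp)
  let ?G = "\<lambda>\<tau>. tens_op (obj M v1 (neg (substitute X A))) (obj M v1 (neg (substitute X B))) (negs M v1 xl (map n0 \<Gamma>)) (negs M v1 xl (map n0 \<Delta>)) (G \<tau>) (H \<tau>)"
  have T': "sq v1 xl (expand_links \<tau> I lab R) (n0 a # map n0 \<Gamma>) (G \<tau>)" "sq v1 xl (expand_links \<tau> I lab S) (n0 b # map n0 \<Delta>) (H \<tau>)" for \<tau>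
    using trfD(2)[OF T, of \<tau>] trfD(2)[OF U, of \<tau>] by simp_all
  have e': "TensL (n0 a) (n0 b) (n0 e) |\<notin>| expand_links \<tau> I lab R |\<union>| expand_links \<tau> I lab S" for \<tau>
    using link_notin[OF _ not_edge_expand_links[OF e], of "[]"] by simp
  show "sq v1 xl (expand_links \<tau> I lab (finsert (TensL a b e) (R |\<union>| S))) (map n0 (e # \<Gamma> @ \<Delta>)) (?G \<tau>)" for \<tau>
    using sq_tens[OF v01(2) T'[of \<tau>] expand_links_disjoint[OF d(2,3)] e', of "substitute X A" "substitute X B"] l by simp
  show "tens_op (obj M v0 (neg A)) (obj M v0 (neg B)) (negs M v0 lab \<Gamma>) (negs M v0 lab \<Delta>) t u = ?G \<tau> \<bullet> context_iso \<tau> (e # \<Gamma> @ \<Delta>)" for \<tau>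
  proof -
    let ?h = "phi \<tau> (neg A) (I e)" and ?k = "phi \<tau> (neg B) (I e)"
    have p: "context_iso \<tau> (a # \<Gamma>) = ?h \<star> context_iso \<tau> \<Gamma>" "context_iso \<tau> (b # \<Delta>) = ?k \<star> context_iso \<tau> \<Delta>" "context_iso \<tau> (e # \<Gamma> @ \<Delta>) = Dl (Dl ?h \<star> Dl ?k) \<star> context_iso \<tau> (\<Gamma> @ \<Delta>)"
      using l i by (simp_all add: context_iso_Cons edge_iso_def phi_simps)
    have tu: "t = G \<tau> \<bullet> (?h \<star> context_iso \<tau> \<Gamma>)" "u = H \<tau> \<bullet> (?k \<star> context_iso \<tau> \<Delta>)"
      using trfD(3)[OF T, of \<tau>] trfD(3)[OF U, of \<tau>] unfolding p by simp_all
    have "tens_op (dom ?h) (dom ?k) (map dom (map (edge_iso \<tau>) \<Gamma>)) (map dom (map (edge_iso \<tau>) \<Delta>)) (G \<tau> \<bullet> (?h \<star> L.tlist (map (edge_iso \<tau>) \<Gamma>))) (H \<tau> \<bullet> (?k \<star> L.tlist (map (edge_iso \<tau>) \<Delta>))) =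
      tens_op (cod ?h) (cod ?k) (map cod (map (edge_iso \<tau>) \<Gamma>)) (map cod (map (edge_iso \<tau>) \<Delta>)) (G \<tau>) (H \<tau>) \<bullet> (Dl (Dl ?h \<star> Dl ?k) \<star> L.tlist (map (edge_iso \<tau>) \<Gamma> @ map (edge_iso \<tau>) \<Delta>))"
      using trfT[OF T] trfT[OF U] l
      by (intro tens_op_nat) (auto simp: substitute_neg comp_def)
    then show ?thesis
      unfolding p maps_edge_iso dom_phi cod_phi substitute_neg tu by (simp only: context_iso_def map_append)
  qed
  show "?G \<tau> = ?G none" if "good_axioms (finsert (TensL a b e) (R |\<union>| S))" for \<tau>
    using good_axioms_simps(2)[OF that] trfD(4)[OF T, of \<tau>] trfD(4)[OF U, of \<tau>] by (simp add: good_axioms_simps(1))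
qed

lemma transfers_par:
  assumes T: "transfers R (a # b # \<Gamma>) t G" and e: "e \<notin> edges R" and l: "lab a = Fm A" "lab b = Fm B" "lab e = Fm (Par A B)"
    and i: "I a = I e" "I b = I e"
  shows "\<exists>G'. transfers (finsert (ParL a b e) R) (e # \<Gamma>) (t \<bullet> L.assoc (obj M v0 (neg A)) (obj M v0 (neg B)) (tl v0 lab \<Gamma>)) G'"
proof (intro exI trfI)
  show "sq v0 lab (finsert (ParL a b e) R) (e # \<Gamma>) (t \<bullet> L.assoc (obj M v0 (neg A)) (obj M v0 (neg B)) (tl v0 lab \<Gamma>))"
    by (rule sq_par[OF v01(1) trfD(1)[OF T] _ l]) (rule link_notin[OF _ e], simp)
  let ?G = "\<lambda>\<tau>. G \<tau> \<bullet> L.assoc (obj M v1 (neg (substitute X A))) (obj M v1 (neg (substitute X B))) (tl v1 xl (map n0 \<Gamma>))"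
  have T': "sq v1 xl (expand_links \<tau> I lab R) (n0 a # n0 b # map n0 \<Gamma>) (G \<tau>)" for \<tau>
    using trfD(2)[OF T, of \<tau>] by simp
  show "sq v1 xl (expand_links \<tau> I lab (finsert (ParL a b e) R)) (map n0 (e # \<Gamma>)) (?G \<tau>)" for \<tau>
    using sq_par[OF v01(2) T'[of \<tau>], of "n0 e" "substitute X A" "substitute X B"] l link_notin[OF _ not_edge_expand_links[OF e], of "[]"] by simp
  show "t \<bullet> L.assoc (obj M v0 (neg A)) (obj M v0 (neg B)) (tl v0 lab \<Gamma>) = ?G \<tau> \<bullet> context_iso \<tau> (e # \<Gamma>)" for \<tau>
  proof -
    let ?h = "phi \<tau> (neg A) (I e)" and ?k = "phi \<tau> (neg B) (I e)"
    have p: "context_iso \<tau> (a # b # \<Gamma>) = ?h \<star> (?k \<star> context_iso \<tau> \<Gamma>)" "context_iso \<tau> (e # \<Gamma>) = (?h \<star> ?k) \<star> context_iso \<tau> \<Gamma>"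
      using l i by (simp_all add: context_iso_Cons edge_iso_def phi_simps)
    show ?thesis
      using trfD(3)[OF T, of \<tau>] trfT[OF T] l unfolding p
      by (simp add: L.assoc_nat substitute_neg)
  qed
  show "?G \<tau> = ?G none" if "good_axioms (finsert (ParL a b e) R)" for \<tau>
    using trfD(4)[OF T good_axioms_simps(2)[OF that], of \<tau>] by simp
qed

lemma transfers_flat:
  assumes T: "transfers R (a # \<Gamma>) t G" and e: "e \<notin> edges R" and l: "lab a = Fm A" "lab e = Flat A" and i: "I a = I e"
  shows "\<exists>G'. transfers (finsert (FlatL a e) R) (e # \<Gamma>) (t \<bullet> (eps (obj M v0 (neg A)) \<star> L.ide (tl v0 lab \<Gamma>))) G'"
proof (intro exI trfI)
  show "sq v0 lab (finsert (FlatL a e) R) (e # \<Gamma>) (t \<bullet> (eps (obj M v0 (neg A)) \<star> L.ide (tl v0 lab \<Gamma>)))"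
    by (rule sq_flat[OF v01(1) trfD(1)[OF T] _ l]) (rule link_notin[OF _ e], simp)
  let ?G = "\<lambda>\<tau>. G \<tau> \<bullet> (eps (obj M v1 (neg (substitute X A))) \<star> L.ide (tl v1 xl (map n0 \<Gamma>)))"
  have T': "sq v1 xl (expand_links \<tau> I lab R) (n0 a # map n0 \<Gamma>) (G \<tau>)" for \<tau>
    using trfD(2)[OF T, of \<tau>] by simp
  show "sq v1 xl (expand_links \<tau> I lab (finsert (FlatL a e) R)) (map n0 (e # \<Gamma>)) (?G \<tau>)" for \<tau>
    using sq_flat[OF v01(2) T'[of \<tau>], of "n0 e" "substitute X A"] l link_notin[OF _ not_edge_expand_links[OF e], of "[]"] by simp
  show "t \<bullet> (eps (obj M v0 (neg A)) \<star> L.ide (tl v0 lab \<Gamma>)) = ?G \<tau> \<bullet> context_iso \<tau> (e # \<Gamma>)" for \<tau>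
  proof -
    let ?h = "phi \<tau> (neg A) (I e)"
    have p: "context_iso \<tau> (a # \<Gamma>) = ?h \<star> context_iso \<tau> \<Gamma>" "context_iso \<tau> (e # \<Gamma>) = bng ?h \<star> context_iso \<tau> \<Gamma>"
      using l i by (simp_all add: context_iso_Cons edge_iso_def)
    show ?thesis
      using trfD(3)[OF T, of \<tau>] trfT[OF T] l unfolding p
      by (simp add: L.tn_cmp eps_nat substitute_neg)
  qed
  show "?G \<tau> = ?G none" if "good_axioms (finsert (FlatL a e) R)" for \<tau>
    using trfD(4)[OF T good_axioms_simps(2)[OF that], of \<tau>] by simp
qed

text \<open>All premises have the same label and, by the indexing, the same index. They therefore
  carry one common isomorphism, as the naturality of duplication requires.\<close>

lemma transfers_whynot:
  assumes T: "transfers R (es @ \<Gamma>) t G" and e: "e \<notin> edges R" and es: "distinct es" "\<forall>x\<in>set es. lab x = Flat A"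
    and l: "lab e = Fm (WhyNot A)" and i: "\<forall>x\<in>set es. I x = I e + 1"
  shows "\<exists>G'. transfers (finsert (WhyNotL (fset_of_list es) e) R) (e # \<Gamma>) (t \<bullet> copy (obj M v0 (neg A)) (tl v0 lab \<Gamma>) (length es)) G'"
proof (intro exI trfI)
  show "sq v0 lab (finsert (WhyNotL (fset_of_list es) e) R) (e # \<Gamma>) (t \<bullet> copy (obj M v0 (neg A)) (tl v0 lab \<Gamma>) (length es))"
    by (rule sq_whynot[OF v01(1) trfD(1)[OF T] _ es l]) (rule link_notin[OF _ e], simp)
  let ?G = "\<lambda>\<tau>. G \<tau> \<bullet> copy (obj M v1 (neg (substitute X A))) (tl v1 xl (map n0 \<Gamma>)) (length es)"
  have T': "sq v1 xl (expand_links \<tau> I lab R) (map n0 es @ map n0 \<Gamma>) (G \<tau>)" for \<tau>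
    using trfD(2)[OF T, of \<tau>] by simp
  have W: "WhyNotL (fset_of_list (map n0 es)) (n0 e) |\<notin>| expand_links \<tau> I lab R" for \<tau>
    using link_notin[OF _ not_edge_expand_links[OF e], of "[]"] by simp
  show "sq v1 xl (expand_links \<tau> I lab (finsert (WhyNotL (fset_of_list es) e) R)) (map n0 (e # \<Gamma>)) (?G \<tau>)" for \<tau>
    using sq_whynot[OF v01(2) T'[of \<tau>] W, of "substitute X A"] l es by (simp add: distinct_map inj_on_def)
  show "t \<bullet> copy (obj M v0 (neg A)) (tl v0 lab \<Gamma>) (length es) = ?G \<tau> \<bullet> context_iso \<tau> (e # \<Gamma>)" for \<tau>
  proof -
    let ?h = "phi \<tau> (neg A) (I e + 1)" and ?n = "length es"
    have p: "context_iso \<tau> (e # \<Gamma>) = bng ?h \<star> context_iso \<tau> \<Gamma>" using l by (simp add: context_iso_Cons edge_iso_def phi_simps)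
    have "map (edge_iso \<tau>) es = replicate ?n (bng ?h)" using es(2) i by (auto simp: edge_iso_def intro!: map_replicate_const[THEN trans[rotated]] simp flip: map_replicate_const)
    then have p': "context_iso \<tau> (es @ \<Gamma>) = L.tlist (replicate ?n (bng ?h) @ map (edge_iso \<tau>) \<Gamma>)" by (simp add: context_iso_def)
    have D: "dom (G \<tau>) = cod (context_iso \<tau> (es @ \<Gamma>))" using trfT[OF T] by simp
    have N: "copy (cod ?h) (tens_list (lin M) (map cod (map (edge_iso \<tau>) \<Gamma>))) ?n \<bullet> (bng ?h \<star> L.tlist (map (edge_iso \<tau>) \<Gamma>)) =
      L.tlist (replicate ?n (bng ?h) @ map (edge_iso \<tau>) \<Gamma>) \<bullet> copy (dom ?h) (tens_list (lin M) (map dom (map (edge_iso \<tau>) \<Gamma>))) ?n"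
      by (rule copy_nat) auto
    then have N': "copy (obj M v1 (neg (substitute X A))) (tl v1 xl (map n0 \<Gamma>)) ?n \<bullet> (bng ?h \<star> context_iso \<tau> \<Gamma>) = context_iso \<tau> (es @ \<Gamma>) \<bullet> copy (obj M v0 (neg A)) (tl v0 lab \<Gamma>) ?n"
      unfolding maps_edge_iso dom_phi cod_phi substitute_neg p'[symmetric] context_iso_def[symmetric] .
    have c: "L.arr (copy (obj M v1 (neg (substitute X A))) (tl v1 xl (map n0 \<Gamma>)) ?n)" "L.arr (copy (obj M v0 (neg A)) (tl v0 lab \<Gamma>) ?n)"
      by (auto intro!: arr_copy L.obj_tens_list)
    have cc: "cod (copy (obj M v1 (neg (substitute X A))) (tl v1 xl (map n0 \<Gamma>)) ?n) = cod (context_iso \<tau> (es @ \<Gamma>))"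
      using arg_cong[OF N', of cod] by simp
    have cd: "cod (copy (obj M v0 (neg A)) (tl v0 lab \<Gamma>) ?n) = dom (context_iso \<tau> (es @ \<Gamma>))"
      using negs_flat[OF v01(1) es(2), of \<Gamma>] by simp
    have "?G \<tau> \<bullet> context_iso \<tau> (e # \<Gamma>) = G \<tau> \<bullet> (copy (obj M v1 (neg (substitute X A))) (tl v1 xl (map n0 \<Gamma>)) ?n \<bullet> (bng ?h \<star> context_iso \<tau> \<Gamma>))"
      unfolding p using trfT[OF T] c cc D by (intro L.cmp_assoc) (auto simp: substitute_neg)
    also have "\<dots> = (G \<tau> \<bullet> context_iso \<tau> (es @ \<Gamma>)) \<bullet> copy (obj M v0 (neg A)) (tl v0 lab \<Gamma>) ?n"
      unfolding N' using trfT[OF T] c cd D by (intro L.cmp_assoc[symmetric]) auto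
    finally show ?thesis using trfD(3)[OF T, of \<tau>] by simp
  qed
  show "?G \<tau> = ?G none" if "good_axioms (finsert (WhyNotL (fset_of_list es) e) R)" for \<tau>
    using trfD(4)[OF T good_axioms_simps(2)[OF that], of \<tau>] by simp
qed

text \<open>The arrow stays the same because the isomorphism on \<open>Para A\<close> at index
  \<open>I e\<close> is that on \<open>A\<close> at \<open>I e + 1\<close>, the index of the
  premise.\<close>

lemma transfers_para:
  assumes T: "transfers R (a # \<Gamma>) t G" and e: "e \<notin> edges R" and l: "lab a = Fm A" "lab e = Fm (Para A)" and i: "I a = I e + 1"
  shows "transfers (finsert (ParaL a e) R) (e # \<Gamma>) t G"
proof (rule trfI)
  show "sq v0 lab (finsert (ParaL a e) R) (e # \<Gamma>) t"
    by (rule sq_para[OF v01(1) trfD(1)[OF T] _ l]) (rule link_notin[OF _ e], simp)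
  have T': "sq v1 xl (expand_links \<tau> I lab R) (n0 a # map n0 \<Gamma>) (G \<tau>)" for \<tau>
    using trfD(2)[OF T, of \<tau>] by simp
  show "sq v1 xl (expand_links \<tau> I lab (finsert (ParaL a e) R)) (map n0 (e # \<Gamma>)) (G \<tau>)" for \<tau>
    using sq_para[OF v01(2) T'[of \<tau>], of "n0 e" "substitute X A"] l link_notin[OF _ not_edge_expand_links[OF e], of "[]"] by simp
  have "context_iso \<tau> (a # \<Gamma>) = context_iso \<tau> (e # \<Gamma>)" for \<tau> using l i by (simp add: context_iso_Cons edge_iso_def phi_simps)
  then show "t = G \<tau> \<bullet> context_iso \<tau> (e # \<Gamma>)" for \<tau> using trfD(3)[OF T, of \<tau>] by simp
  show "G \<tau> = G none" if "good_axioms (finsert (ParaL a e) R)" for \<tau>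
    using trfD(4)[OF T good_axioms_simps(2)[OF that], of \<tau>] .
qed

lemma transfers_box:
  assumes T: "transfers R (p # xs) t G" and xs: "distinct xs" and l: "lab p = Fm A" "lab e = Fm (OfCourse A)"
    "map lab xs = map Flat Bs" "map lab ys = map Flat Bs" and i: "I p = I e + 1" "map I xs = map I ys"
  shows "\<exists>G'. transfers {|BoxL R p e (fset_of_list (zip xs ys))|} (e # ys) (box_op (obj M v0 (neg A)) (map (\<lambda>B. obj M v0 (neg B)) Bs) t) G'"
proof (intro exI trfI)
  show "sq v0 lab {|BoxL R p e (fset_of_list (zip xs ys))|} (e # ys) (box_op (obj M v0 (neg A)) (map (\<lambda>B. obj M v0 (neg B)) Bs) t)"
    by (rule sq_box[OF v01(1) trfD(1)[OF T] xs l])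
  let ?Cs = "map (substitute X) Bs"
  let ?G = "\<lambda>\<tau>. box_op (obj M v1 (neg (substitute X A))) (map (\<lambda>B. obj M v1 (neg B)) ?Cs) (G \<tau>)"
  have T': "sq v1 xl (expand_links \<tau> I lab R) (n0 p # map n0 xs) (G \<tau>)" for \<tau>
    using trfD(2)[OF T, of \<tau>] by simp
  have lx: "map xl (map n0 zs) = map Flat ?Cs" if "map lab zs = map Flat Bs" for zs
  proof -
    have "map (lsub X) (map lab zs) = map (lsub X) (map Flat Bs)" using that by simp
    then show ?thesis by (simp add: comp_def)
  qed
  have P: "map_prod n0 n0 |`| fset_of_list (zip xs ys) = fset_of_list (zip (map n0 xs) (map n0 ys))"
    by (simp add: zip_map_map fset_of_list_map map_prod_def)
  show "sq v1 xl (expand_links \<tau> I lab {|BoxL R p e (fset_of_list (zip xs ys))|}) (map n0 (e # ys)) (?G \<tau>)" for \<tau>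
    using sq_box[OF v01(2) T'[of \<tau>] _ _ _ lx[OF l(3)] lx[OF l(4)], of "substitute X A" "n0 e"] xs l(1,2)
    by (simp add: P distinct_map inj_on_def)
  have len: "length xs = length Bs" "length ys = length Bs" using l(3,4) by (metis length_map)+
  show "box_op (obj M v0 (neg A)) (map (\<lambda>B. obj M v0 (neg B)) Bs) t = ?G \<tau> \<bullet> context_iso \<tau> (e # ys)" for \<tau>
  proof -
    let ?h = "phi \<tau> (neg A) (I e + 1)"
    \<comment> \<open>One list serves both the premises and the conclusions of the pax links: their
      labels and indices agree, so promotion is natural with the same arrows on either side.\<close>
    define ts where "ts = map (\<lambda>(B, x). phi \<tau> (neg B) (I x)) (zip Bs xs)"
    have nth: "lab (xs ! k) = Flat (Bs ! k)" "lab (ys ! k) = Flat (Bs ! k)" "I (xs ! k) = I (ys ! k)" if "k < length Bs" for k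
      using that len arg_cong[OF l(3), of "\<lambda>z. z ! k"] arg_cong[OF l(4), of "\<lambda>z. z ! k"] arg_cong[OF i(2), of "\<lambda>z. z ! k"] by simp_all
    have m: "map (edge_iso \<tau>) xs = map bng ts" "map (edge_iso \<tau>) ys = map bng ts"
      using len nth by (auto intro!: nth_equalityI simp: ts_def edge_iso_def)
    have dc: "map dom ts = map (\<lambda>B. obj M v0 (neg B)) Bs" "map cod ts = map (\<lambda>B. obj M v1 (neg B)) ?Cs"
      using len by (auto intro!: nth_equalityI simp: ts_def substitute_neg)
    have ar: "\<forall>x\<in>set ts. L.arr x" by (auto simp: ts_def)
    have p: "context_iso \<tau> (p # xs) = ?h \<star> L.tlist (map bng ts)" "context_iso \<tau> (e # ys) = Dl (bng (Dl ?h)) \<star> L.tlist (map bng ts)"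
      using l i m by (simp_all add: context_iso_Cons edge_iso_def[of _ p] edge_iso_def[of _ e] phi_simps) (simp_all add: context_iso_def)
    have t: "t = G \<tau> \<bullet> (?h \<star> L.tlist (map bng ts))" using trfD(3)[OF T, of \<tau>] unfolding p .
    have "dom (G \<tau>) = cod (context_iso \<tau> (p # xs))" using trfT[OF T] by simp
    then have D: "dom (G \<tau>) = cod ?h \<otimes> cod (L.tlist (map bng ts))" unfolding p by simp
    have "box_op (dom ?h) (map dom ts) (G \<tau> \<bullet> (?h \<star> L.tlist (map bng ts))) = box_op (cod ?h) (map cod ts) (G \<tau>) \<bullet> (Dl (bng (Dl ?h)) \<star> L.tlist (map bng ts))"
      using trfT[OF T] D ar by (intro box_op_nat) simp_all
    then show ?thesis unfolding p t[symmetric] dc dom_phi cod_phi substitute_neg .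
  qed
  show "?G \<tau> = ?G none" if "good_axioms {|BoxL R p e (fset_of_list (zip xs ys))|}" for \<tau>
    using trfD(4)[OF T good_axioms_simps(3)[OF that], of \<tau>] by simp
qed

text \<open>Every rule other than the axiom is replayed with the same operation for each \<tau>. The
  conditions of \<open>indexed\<close> enter as the agreement between the isomorphism at a
  conclusion and those at the premises.\<close>

lemma transfer:
  assumes "sequential M v0 lab R \<Gamma> g" "pre_wf lab R" "no_cut R" "indexed I R"
  shows "\<exists>t G. raw t = g \<and> transfers R \<Gamma> t G"
  using assms
proof (induction rule: sequential.induct)
  case (exch R \<Gamma> g \<Delta> s)
  then obtain t G where t: "raw t = g" "transfers R \<Gamma> t G" by blast
  show ?case using transfers_exch[OF t(2) exch.hyps(2)] t(1) by (force simp: L.raw_simps)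
next
  case (mix0 m)
  have "transfers {||} [] (Arrow (Unit (lin M)) m bt) (\<lambda>_. Arrow (Unit (lin M)) m bt)"
    using sq_mix0[OF v01(1) mix0.hyps, of lab] sq_mix0[OF v01(2) mix0.hyps, of xl] iso_mix[OF mix0.hyps]
    by (intro trfI) (simp_all add: context_iso_Cons L.iso_arr)
  then show ?case by force
next
  case (mix2 m R \<Gamma> g S \<Delta> h)
  have w: "pre_wf lab R" "pre_wf lab S" using pre_wf_unionD[OF mix2.prems(1)] by auto
  have d: "edges R \<inter> edges S = {}" using pre_wf_edges_disjoint[OF mix2.prems(1) mix2.hyps(4)] .
  obtain t G u H where tu: "raw t = g" "transfers R \<Gamma> t G" "raw u = h" "transfers S \<Delta> u H"
    using mix2.IH w mix2.prems by auto
  have "raw (mix_op m (negs M v0 lab \<Gamma>) (negs M v0 lab \<Delta>) t u) = (RUnit (lin M) bt \<cdot>\<^bsub>lin M\<^esub>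
        (Id (lin M) bt \<odot>\<^bsub>lin M\<^esub> iso_inv (lin M) (Unit (lin M)) bt m)) \<cdot>\<^bsub>lin M\<^esub>
      (g \<odot>\<^bsub>lin M\<^esub> h) \<cdot>\<^bsub>lin M\<^esub> split_tens (lin M) (negs M v0 lab \<Gamma>) (negs M v0 lab \<Delta>)"
    using tu by (simp add: mix_op_def L.raw_simps L.raw_split)
  then show ?case using transfers_mix2[OF mix2.hyps(1) tu(2,4) mix2.hyps(4) d] mix2.prems by auto
next
  case (ax a A b)
  have "a \<noteq> b" using pre_wf_insertD[OF ax.prems(1)] by simp
  moreover have "raw (prg v0 A) = pairing M v0 A" by (simp add: prg_def)
  ultimately show ?case using transfers_ax[OF ax.hyps] by (force simp: L.raw_simps)
next
  case (one c)
  then show ?case using transfers_one[OF one.hyps] by (force simp: L.raw_simps)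
next
  case (bot R \<Gamma> g c)
  then obtain t G where t: "raw t = g" "transfers R \<Gamma> t G" using pre_wf_insertD[OF bot.prems(1)] by auto
  have "c \<notin> edges R" using pre_wf_insert_edges[OF bot.prems(1) bot.hyps(2)] by simp
  from transfers_bot[OF t(2) this bot.hyps(3)] show ?case using t(1) by (force simp: L.raw_simps)
next
  case (tens R a \<Gamma> g S b \<Delta> h e A B c d a' b')
  have wu: "pre_wf lab (R |\<union>| S)" using pre_wf_insertD[OF tens.prems(1)] by simp
  have w: "pre_wf lab R" "pre_wf lab S" using pre_wf_unionD[OF wu] by auto
  have d: "edges R \<inter> edges S = {}" using pre_wf_edges_disjoint[OF wu tens.hyps(3)] .
  obtain t G u H where tu: "raw t = g" "transfers R (a # \<Gamma>) t G" "raw u = h" "transfers S (b # \<Delta>) u H"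
    using tens.IH w tens.prems by auto
  have e: "e \<notin> edges (R |\<union>| S)" using pre_wf_insert_edges[OF tens.prems(1) tens.hyps(4)] by simp
  have "raw (tens_op (obj M v0 (neg A)) (obj M v0 (neg B)) (negs M v0 lab \<Gamma>) (negs M v0 lab \<Delta>) t u) =
     ev M (dual M a' \<otimes>\<^bsub>lin M\<^esub> dual M b') \<cdot>\<^bsub>lin M\<^esub>
      (Id (lin M) (dual M (dual M a' \<otimes>\<^bsub>lin M\<^esub> dual M b')) \<odot>\<^bsub>lin M\<^esub>
       ((name M c a' (g \<cdot>\<^bsub>lin M\<^esub> Sym (lin M) c a') \<odot>\<^bsub>lin M\<^esub>
         name M d b' (h \<cdot>\<^bsub>lin M\<^esub> Sym (lin M) d b')) \<cdot>\<^bsub>lin M\<^esub>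
        split_tens (lin M) (negs M v0 lab \<Gamma>) (negs M v0 lab \<Delta>)))"
    using tu tens.hyps by (simp add: tens_op_def ngt_def L.raw_simps closed_raw L.raw_split)
  then show ?case
    using transfers_tens[OF tu(2,4) tens.hyps(3) d _ e tens.hyps(5-7)] tens.prems by auto
next
  case (par R a b \<Gamma> g e A B)
  then obtain t G where t: "raw t = g" "transfers R (a # b # \<Gamma>) t G" using pre_wf_insertD[OF par.prems(1)] by auto
  have "e \<notin> edges R" using pre_wf_insert_edges[OF par.prems(1) par.hyps(2)] by simp
  from transfers_par[OF t(2) this par.hyps(3-5)] show ?case using t(1) par.prems by (force simp: L.raw_simps)
next
  case (flat R a \<Gamma> g e A)
  then obtain t G where t: "raw t = g" "transfers R (a # \<Gamma>) t G" using pre_wf_insertD[OF flat.prems(1)] by auto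
  have "e \<notin> edges R" using pre_wf_insert_edges[OF flat.prems(1) flat.hyps(2)] by simp
  from transfers_flat[OF t(2) this flat.hyps(3-4)] show ?case
    using t(1) flat.prems by (force simp: L.raw_simps eps_def)
next
  case (whynot R es \<Gamma> g e A)
  then obtain t G where t: "raw t = g" "transfers R (es @ \<Gamma>) t G" using pre_wf_insertD[OF whynot.prems(1)] by auto
  have "e \<notin> edges R" using pre_wf_insert_edges[OF whynot.prems(1) whynot.hyps(2)] by simp
  from transfers_whynot[OF t(2) this whynot.hyps(3-5)] show ?case
    using t(1) whynot.prems by (force simp: L.raw_simps raw_copy fset_of_list.rep_eq)
next
  case (para R a \<Gamma> g e A)
  then obtain t G where t: "raw t = g" "transfers R (a # \<Gamma>) t G" using pre_wf_insertD[OF para.prems(1)] by auto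
  have "e \<notin> edges R" using pre_wf_insert_edges[OF para.prems(1) para.hyps(2)] by simp
  from transfers_para[OF t(2) this para.hyps(3-4)] show ?case using t(1) para.prems by auto
next
  case (box R p xs g A e Bs ys c a')
  have w: "pre_wf lab R" using pre_wf_boxD[OF box.prems(1)] by simp
  obtain t G where t: "raw t = g" "transfers R (p # xs) t G" using box.IH[OF w] box.prems by auto
  have len: "length xs = length ys" using box.hyps by (metis length_map)
  have i: "I p = I e + 1" "\<forall>(x, y)\<in>set (zip xs ys). I x = I y"
    using box.prems(3) by (simp_all add: fset_of_list.rep_eq)
  have "map I xs = map I ys"
  proof (rule nth_equalityI)
    fix k assume "k < length (map I xs)"
    moreover from this have "(xs ! k, ys ! k) \<in> set (zip xs ys)" using len by (auto simp: set_zip)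
    then have "I (xs ! k) = I (ys ! k)" using i(2) by blast
    ultimately show "map I xs ! k = map I ys ! k" using len by simp
  qed (use len in simp)
  from transfers_box[OF t(2) box.hyps(2-6) i(1) this] show ?case
    using t(1) box.hyps(7,8) negs_Flat[OF v01(1) box.hyps(5)]
    by (force simp: box_op_def ngt_def L.raw_simps closed_raw raw_bng raw_distr)
next
  case cut
  then show ?case by simp
qed

end

end

section \<open>Equivariance and indexing\<close>

lemma dlinks_typed: "pre_wf lab R \<Longrightarrow> l \<in> dlinks R \<Longrightarrow> link_typed lab l"
proof (induction rule: pre_wf.induct)
  case (1 R)
  from 1(4) show ?case
  proof (subst (asm) dlinks_iff, elim disjE exE conjE)
    assume "l |\<in>| R"
    then show ?thesis using 1(1) by blast
  next
    fix S p c P assume "BoxL S p c P |\<in>| R" "l \<in> dlinks S"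
    then show ?thesis using 1(3) by blast
  qed
qed

text \<open>The conditions only compare indices, so an indexing can be normalized to 0 at the
  conclusion.\<close>

lemma index_ok_shift: "index_ok I l \<Longrightarrow> index_ok (\<lambda>e. I e - c) l"
  by (cases l) auto

context swap_model
begin

text \<open>The k-th involution as seen by a formula placed at index i: the symmetry acts at the
  atoms whose index is k.\<close>

definition involution :: "int \<Rightarrow> form \<Rightarrow> int \<Rightarrow> ('o, 'a) arrow" where
  "involution k = induced (gam (\<lambda>i. i = k)) (\<lambda>i. Dl (gam (\<lambda>i. i = k) i))"

lemma involution_simps [simp]: "L.arr (involution k A i)" "dom (involution k A i) = obj M v0 A" "cod (involution k A i) = obj M v0 A"
  by (simp_all add: involution_def arr_induced dom_induced cod_induced)

text \<open>Here the involution of the model becomes a swap in the net: following it by the plain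
  comparison gives the comparison for \<tau> = {k}.\<close>

lemma phi_involution: "phi none A i \<bullet> involution k A i = phi (\<lambda>i. i = k) A i"
proof -
  have "gam none i \<bullet> t = t" if "L.arr t" "cod t = \<Xi> \<otimes> \<Xi>" for i t using that by (simp add: gam_def)
  moreover have "Dl (gam none i \<bullet> ddi) \<bullet> Dl (gam (\<lambda>i. i = k) i) = Dl (gam (\<lambda>i. i = k) i \<bullet> ddi)" for i
    using calculation[of ddi] by (simp flip: Dl_cmp)
  ultimately show ?thesis
    unfolding phi_def involution_def by (subst induced_cmp[where s = "\<Xi> \<otimes> \<Xi>"]) simp_all
qed

section \<open>Interpretation in the category of involutions\<close>

lemma dual_Inv:
  assumes "L.arr t" "dom t = fst x" "cod t = fst x" "raw t = snd x k"
  shows "snd (dual (Inv M) x) k = raw (Dl t)"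
proof -
  obtain a s where x: "x = (a, s)" by (cases x)
  have [simp]: "a \<in> ob" using assms x L.arr_obj by force
  \<comment> \<open>The leading identity is the involution of \<bottom>, which occurs in the
    involution of an internal hom.\<close>
  have "raw (Dl t) = Cur M (Imp M a bt) a bt (raw (L.ide bt \<bullet> evl a \<bullet> (L.ide (dual M a) \<star> t)))"
  proof -
    have "L.ide bt \<bullet> evl a \<bullet> (L.ide (dual M a) \<star> t) = evl a \<bullet> (L.ide (dual M a) \<star> t)"
      using assms x by (intro L.ide_cmp) auto
    then show ?thesis using assms x by (simp only: Dl_def closed_raw name_def fst_conv) (simp add: dual_def)
  qed
  then show ?thesis
    using assms x by (simp add: dual_def Inv_def L.raw_simps closed_raw ev_def)
qed

lemma fst_dual_Inv: "fst (dual (Inv M) x) = dual M (fst x)"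
  by (cases x) (simp add: dual_def Inv_def)

lemma tens_Inv: "fst (Ten (lin (Inv M)) x y) = fst x \<otimes> fst y"
  "raw t = snd x k \<Longrightarrow> raw u = snd y k \<Longrightarrow> snd (Ten (lin (Inv M)) x y) k = raw (t \<star> u)"
  by (cases x; cases y; simp add: Inv_def Inv_cat_def L.raw_simps)+

lemma bang_Inv: "fst (bang (Inv M) x) = bang M (fst x)"
  "raw t = snd x k \<Longrightarrow> snd (bang (Inv M) x) k = raw (bng t)"
  by (cases x; simp add: Inv_def bang_def raw_bng banga_def)+

text \<open>The paragraph shifts a family by one, which is to replace i by i + 1 in k - i. In
  \<open>plus_form A\<close> it accompanies every exponential, so that the shift at an atom is its
  exponential depth.\<close>

lemma default_obj_involution:
  "fst (default_obj M \<Xi> (plus_form A)) = obj M v0 A \<and>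
   (\<forall>k i. snd (default_obj M \<Xi> (plus_form A)) (k - i) = raw (involution k A i))"
proof -
  have f: "fst (default_obj M \<Xi> (plus_form B)) = obj M v0 B" for B
    using fst_default_obj_plus[of M \<Xi> B] by (simp add: default_assignment_def)
  have "snd (default_obj M \<Xi> (plus_form A)) (k - i) = raw (involution k A i)" for k i
  proof (induction A arbitrary: i)
    case (Atom x)
    then show ?case by (simp add: default_obj_def default_assignment_def involution_def gam_def L.raw_simps)
  next
    case (NAtom x)
    have "snd (dual (Inv M) (default_assignment M \<Xi> x)) (k - i) = raw (Dl (gam (\<lambda>i. i = k) i))"
      by (rule dual_Inv) (auto simp: default_assignment_def gam_def L.raw_simps)
    then show ?case by (simp add: default_obj_def involution_def)
  next
    case One
    then show ?case by (simp add: default_obj_def Inv_def Inv_cat_def involution_def L.raw_simps)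
  next
    case Bot
    then show ?case by (simp add: default_obj_def Inv_def involution_def L.raw_simps)
  next
    case (Tens A B)
    then show ?case using tens_Inv(2)[of "involution k A i" _ "k - i" "involution k B i"]
      by (simp add: default_obj_def) (simp add: involution_def)
  next
    case (Par A B)
    let ?x = "default_obj M \<Xi> (plus_form A)" and ?y = "default_obj M \<Xi> (plus_form B)"
    have "snd (dual (Inv M) ?x) (k - i) = raw (Dl (involution k A i))" "snd (dual (Inv M) ?y) (k - i) = raw (Dl (involution k B i))"
      using Par f by (auto intro!: dual_Inv)
    then have "snd (Ten (lin (Inv M)) (dual (Inv M) ?x) (dual (Inv M) ?y)) (k - i) = raw (Dl (involution k A i) \<star> Dl (involution k B i))"
      by (intro tens_Inv(2)) simp_all
    then have "snd (dual (Inv M) (Ten (lin (Inv M)) (dual (Inv M) ?x) (dual (Inv M) ?y))) (k - i) = raw (Dl (Dl (involution k A i) \<star> Dl (involution k B i)))"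
      using f by (intro dual_Inv) (simp_all add: tens_Inv fst_dual_Inv)
    then show ?case by (simp add: default_obj_def involution_def)
  next
    case (OfCourse A)
    let ?x = "default_obj M \<Xi> (plus_form A)"
    have "snd (para_Inv ?x) (k - i) = raw (involution k A (i + 1))"
      using OfCourse[of "i + 1"] by (simp add: para_Inv_def case_prod_beta algebra_simps)
    then have "snd (bang (Inv M) (para_Inv ?x)) (k - i) = raw (bng (involution k A (i + 1)))"
      by (intro bang_Inv(2)) simp
    then show ?case by (simp add: default_obj_def involution_def)
  next
    case (WhyNot A)
    let ?x = "default_obj M \<Xi> (plus_form A)"
    have fp: "fst (para_Inv ?x) = obj M v0 A" using f by (simp add: para_Inv_def case_prod_beta)
    have "snd (para_Inv ?x) (k - i) = raw (involution k A (i + 1))"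
      using WhyNot[of "i + 1"] by (simp add: para_Inv_def case_prod_beta algebra_simps)
    then have "snd (dual (Inv M) (para_Inv ?x)) (k - i) = raw (Dl (involution k A (i + 1)))"
      using fp by (intro dual_Inv) simp_all
    then have "snd (bang (Inv M) (dual (Inv M) (para_Inv ?x))) (k - i) = raw (bng (Dl (involution k A (i + 1))))"
      by (intro bang_Inv(2)) simp
    then have "snd (dual (Inv M) (bang (Inv M) (dual (Inv M) (para_Inv ?x)))) (k - i) = raw (Dl (bng (Dl (involution k A (i + 1)))))"
      using fp by (intro dual_Inv) (simp_all add: bang_Inv fst_dual_Inv)
    then show ?case by (simp add: default_obj_def involution_def)
  next
    case (Para A)
    have "snd (para_Inv (default_obj M \<Xi> (plus_form A))) (k - i) = raw (involution k A (i + 1))"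
      using Para[of "i + 1"] by (simp add: para_Inv_def case_prod_beta algebra_simps)
    then show ?case by (simp add: default_obj_def involution_def)
  qed
  then show ?thesis using f by blast
qed

lemma prg_phi: "prg v0 A = prg v1 (substitute X A) \<bullet> (phi \<tau> A i \<star> phi \<tau> (neg A) i)"
  \<comment> \<open>A single axiom with the conclusions 0 and 1, labelled for this purpose. Both
    ends get the index i, so \<open>q\<close> is the pairing of the substituted formula.\<close>
  using axiom_expansion[of "\<lambda>e. if e = 0 then Fm (neg A) else Fm A" 0 "[]" A 1 \<tau> i i] by (auto simp: substitute_neg)

text \<open>The involutions of the unit are identities, so equivariance of an arrow out of it
  amounts to invariance under those of the target.\<close>

lemma morphism_iff:
  assumes F: "L.arr F" "dom F = Unit (lin M)" "cod F = obj M v0 A"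
  shows "raw F \<in> Hom (lin (Inv M)) (Unit (lin (Inv M))) (default_obj M \<Xi> (plus_form A)) \<longleftrightarrow> (\<forall>k. involution k A 0 \<bullet> F = F)"
proof -
  obtain a s where d: "default_obj M \<Xi> (plus_form A) = (a, s)" by fastforce
  have a: "a = obj M v0 A" "s k = raw (involution k A 0)" for k
    using default_obj_involution[of A, unfolded d, THEN conjunct1] default_obj_involution[of A, unfolded d, THEN conjunct2, rule_format, of k 0] by simp_all
  have h: "raw F \<in> Hom (lin M) (Unit (lin M)) (obj M v0 A)" using F by (simp add: L.arr_def del: L.arr_obj)
  have "raw F \<in> Hom (lin (Inv M)) (Unit (lin (Inv M))) (default_obj M \<Xi> (plus_form A)) \<longleftrightarrow>
      (\<forall>k. raw (involution k A 0 \<bullet> F \<bullet> L.ide (Unit (lin M))) = raw F)"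
    using h by (simp add: d Inv_def Inv_cat_def a L.raw_simps)
  also have "\<dots> \<longleftrightarrow> (\<forall>k. involution k A 0 \<bullet> F = F)"
  proof -
    have "raw (involution k A 0 \<bullet> F) = raw F \<longleftrightarrow> involution k A 0 \<bullet> F = F" for k
      using F by (auto intro!: L.arrow_eqI)
    then show ?thesis using F by simp
  qed
  finally show ?thesis .
qed

text \<open>\<open>F\<close> is the arrow from 1 obtained by transposing t. The isomorphism on the
  negated formula enters transposed both in the name of t (\<open>nam_sym_nat\<close>) and in the
  name of the pairing (\<open>prg_phi\<close>); being invertible it is cancelled, and only
  \<open>phi\<close> on the formula itself remains.\<close>

lemma transposed:
  assumes T: "transfers lab I R [c] t G" and l: "lab c = Fm A" and i: "I c = 0"
  defines "F \<equiv> L.inverse (nprg v0 A) \<bullet> nam (Unit (lin M)) (obj M v0 (neg A)) (t \<bullet> L.sym (Unit (lin M)) (obj M v0 (neg A)))"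
  shows "L.arr F" "dom F = Unit (lin M)" "cod F = obj M v0 A"
    "nprg v1 (substitute X A) \<bullet> phi \<tau> A 0 \<bullet> F =
     nam (Unit (lin M)) (obj M v1 (neg (substitute X A))) (G \<tau> \<bullet> L.sym (Unit (lin M)) (obj M v1 (neg (substitute X A))))"
proof -
  let ?e = "Unit (lin M)" and ?a' = "obj M v0 (neg A)" and ?y' = "obj M v1 (neg (substitute X A))"
  have t: "L.arr t" "dom t = ?a' \<otimes> ?e" "cod t = bt" "L.arr (G \<tau>)" "dom (G \<tau>) = ?y' \<otimes> ?e" "cod (G \<tau>) = bt" for \<tau>
    using trfT[OF T] l by (simp_all add: substitute_neg)
  have P: "L.iso (nprg v0 A)" by (rule iso_nprg) simp
  have N: "L.arr (nam ?e ?a' (t \<bullet> L.sym ?e ?a'))" using t by simp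
  show F: "L.arr F" "dom F = ?e" "cod F = obj M v0 A" using P N by (simp_all add: F_def)
  let ?h = "phi \<tau> (neg A) 0"
  have "t = G \<tau> \<bullet> (?h \<star> L.ide ?e)"
    using trfD(3)[OF T, of \<tau>] l i by (simp add: context_iso_Cons edge_iso_def)
  then have 1: "nam ?e ?a' (t \<bullet> L.sym ?e ?a') = Dl ?h \<bullet> nam ?e ?y' (G \<tau> \<bullet> L.sym ?e ?y')"
    using nam_sym_nat[of "G \<tau>" ?h "L.ide ?e"] t by (simp add: substitute_neg)
  have 2: "nprg v0 A = Dl ?h \<bullet> nprg v1 (substitute X A) \<bullet> phi \<tau> A 0"
    using nprg_nat[OF _ _ _ prg_phi[of A \<tau> 0]] by simp
  have "Dl ?h \<bullet> (nprg v1 (substitute X A) \<bullet> phi \<tau> A 0 \<bullet> F) = nprg v0 A \<bullet> F"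
    unfolding 2 using F by (simp add: substitute_neg)
  also have "\<dots> = Dl ?h \<bullet> nam ?e ?y' (G \<tau> \<bullet> L.sym ?e ?y')"
    unfolding 1[symmetric] using P N by (simp add: F_def)
  finally show "nprg v1 (substitute X A) \<bullet> phi \<tau> A 0 \<bullet> F = nam ?e ?y' (G \<tau> \<bullet> L.sym ?e ?y')"
    by (rule L.iso_mono[rotated 5]) (use F t in \<open>simp_all add: substitute_neg\<close>)
qed

text \<open>The fixed-point equation is transported along invertible or injective operations: the
  plain comparison, the name of the pairing, currying and a symmetry.\<close>

lemma involution_fixed_iff:
  assumes T: "transfers lab I R [c] t G" and l: "lab c = Fm A" and i: "I c = 0"
  defines "F \<equiv> L.inverse (nprg v0 A) \<bullet> nam (Unit (lin M)) (obj M v0 (neg A)) (t \<bullet> L.sym (Unit (lin M)) (obj M v0 (neg A)))"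
  shows "involution k A 0 \<bullet> F = F \<longleftrightarrow> G (\<lambda>i. i = k) = G none"
proof -
  let ?\<tau> = "\<lambda>i. i = k" and ?e = "Unit (lin M)" and ?y' = "obj M v1 (neg (substitute X A))"
  note X = transposed[OF T l i, folded F_def]
  have G: "L.arr (G \<tau>)" "dom (G \<tau>) = ?y' \<otimes> ?e" "cod (G \<tau>) = bt" for \<tau>
    using trfT[OF T] l by (simp_all add: substitute_neg)
  have P: "L.iso (nprg v1 (substitute X A))" by (rule iso_nprg) simp
  have s: "phi ?\<tau> A 0 \<bullet> F = phi none A 0 \<bullet> (involution k A 0 \<bullet> F)"
    using X(1-3) by (simp flip: phi_involution)
  have "involution k A 0 \<bullet> F = F \<longleftrightarrow> phi ?\<tau> A 0 \<bullet> F = phi none A 0 \<bullet> F"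
    unfolding s using X(1-3) L.iso_mono[OF iso_phi[of none A 0], of "involution k A 0 \<bullet> F" F] by auto
  also have "\<dots> \<longleftrightarrow> nprg v1 (substitute X A) \<bullet> phi ?\<tau> A 0 \<bullet> F = nprg v1 (substitute X A) \<bullet> phi none A 0 \<bullet> F"
    using X(1-3) L.iso_mono[OF P, of "phi ?\<tau> A 0 \<bullet> F" "phi none A 0 \<bullet> F"] by auto
  also have "\<dots> \<longleftrightarrow> G ?\<tau> \<bullet> L.sym ?e ?y' = G none \<bullet> L.sym ?e ?y'"
    unfolding X(4) using nam_inject[of ?e ?y' "G ?\<tau> \<bullet> L.sym ?e ?y'" "G none \<bullet> L.sym ?e ?y'"] G by auto
  also have "\<dots> \<longleftrightarrow> G ?\<tau> = G none"
    using L.iso_epi[of "L.sym ?e ?y'" "G ?\<tau>" "G none"] G by auto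
  finally show ?thesis .
qed

text \<open>With equal arrows, the expansion and a net preceding it would share an interpretation.
  Swap-sensitivity requires morphisms of the syntactic category; a bottom link on the reserved edge
  0 provides the conclusion dual to 1.\<close>

lemma unsound_swaps:
  assumes S: "swap_sensitive M \<Xi> X" and T: "transfers lab I R [c] t G" and l: "lab c = Fm A"
    and w: "pre_wf lab R" "no_cut R" and b: "has_bad_axiom \<tau> I lab R"
  shows "G \<tau> \<noteq> G none"
proof
  assume eq: "G \<tau> = G none"
  let ?l = "expand_label X lab" and ?c = "nm c []" and ?R = "\<lambda>\<tau>. finsert (BotL 0) (expand_links \<tau> I lab R)"
  let ?\<pi> = "\<lambda>\<tau>. \<lparr>links = ?R \<tau>, label = ?l\<rparr>"
  have z: "0 \<notin> edges (expand_links \<tau> I lab R)" for \<tau> using edges_expand_links[of \<tau> I lab R] by (auto simp: fam_def)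
  have s: "sq v1 ?l (?R \<tau>) [0, ?c] (G \<tau> \<bullet> L.lunit (tl v1 ?l [?c]))" for \<tau>
    using sq_bot[OF v01(2) trfD(2)[OF T, of \<tau>], of 0] link_notin[OF _ z, of "BotL 0" \<tau>] by simp
  have p: "pre_wf ?l (?R none)"
    by (rule pre_wf_insert) (use pre_wf_expand_links[OF w] z in auto)
  have n: "no_cut (?R none)" using no_cut_expand_links[OF w(2)] by simp
  \<comment> \<open>No property of switchings is carried over from \<open>R\<close>: the expanded
    net comes with a sequentialization, which makes it correct.\<close>
  have c: "struct ?l (?R none) [0, ?c]" "acyclic_levels (?R none)"
    using sequential_correct[OF sqD(1)[OF s] p n] by auto
  have cc: "conclusions (?R none) = {0, ?c}" using c by (simp add: struct_def)
  have lf: "\<forall>e\<in>conclusions (?R none). \<exists>B. ?l e = Fm B" unfolding cc using l by simp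
  have PN: "PN_morphism (?\<pi> none) One (substitute X A) 0 ?c"
    unfolding PN_morphism_def
  proof (intro conjI)
    show "DR_net (?\<pi> none)"
      using c lf unfolding DR_net_def is_net_def by (simp add: struct_def acyclic_levels_def acyclic_level_def)
    show "cut_free (?\<pi> none)" using n by (simp add: cut_free_def all_links_dlinks no_cut_def)
    show "eta_expanded (?\<pi> none)"
      using axioms_expand_links[OF w(1)] by (auto simp: eta_expanded_def all_links_dlinks)
    show "conclusions (links (?\<pi> none)) = {0, ?c}" using cc by simp
  qed (use l in simp_all)
  have "swaps X ?l True (expand_links none I lab R |\<union>| {|BotL 0|}) (expand_links \<tau> I lab R |\<union>| {|BotL 0|})"
    using swaps_expand_links[OF w(1), of X \<tau> I] b cns_edges[of "expand_links none I lab R"] z[of none]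
    by (intro swaps_union_left) auto
  then have pr: "precedes X (?\<pi> \<tau>) (?\<pi> none)"
    by (simp add: precedes_def swaps_def)
  \<comment> \<open>The rule for the bottom link and the transposition treat both arrows alike, so
    equal arrows give a common interpretation.\<close>
  have "\<exists>f. interprets_morphism M v1 (?\<pi> none) One (substitute X A) 0 ?c f \<and> interprets_morphism M v1 (?\<pi> \<tau>) One (substitute X A) 0 ?c f"
    unfolding interprets_morphism_def using sqD(1)[OF s[of none]] sqD(1)[OF s[of \<tau>]] eq by auto
  then show False using S PN pr unfolding swap_sensitive_def by blast
qed

end

theorem mainTheorem16:
  fixes M :: "('o, 'a, 'p, 'b) llmodel" and \<Xi> :: 'o and X :: nat
    and \<pi> :: net and A :: form and f :: 'a
  assumes "is_model M" and "swap_sensitive M \<Xi> X"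
    and "DR_net \<pi>" and "cut_free \<pi>" and "has_conclusion \<pi> A"
    and "\<forall>a b B. AxL a b \<in> all_links \<pi> \<longrightarrow> label \<pi> b = Fm B \<longrightarrow> atoms B \<noteq> {}"
    and "default_interprets M \<Xi> \<pi> A f"
  shows "in_L3 \<pi> \<longleftrightarrow> f \<in> Hom (lin (Inv M)) (Unit (lin (Inv M))) (default_obj M \<Xi> (plus_form A))"
proof -
  interpret swap_model M \<Xi> X
    using assms(1,2) by unfold_locales (auto simp: swap_sensitive_def)
  let ?R = "links \<pi>" and ?l = "label \<pi>"
  obtain c g where c: "conclusions ?R = {c}" "?l c = Fm A" "sequential M v0 ?l ?R [c] g"
    and f: "f = transp M v0 A (Unit (lin M)) (g \<cdot>\<^bsub>lin M\<^esub> Sym (lin M) (Unit (lin M)) (obj M v0 (neg A)))"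
    using assms(7) by (auto simp: default_interprets_def interprets_def default_assignment_def)
  have w: "pre_wf ?l ?R" using assms(3) by (auto simp: DR_net_def is_net_def intro: well_formed_pre_wf)
  have n: "no_cut ?R" using assms(4) by (simp add: cut_free_def no_cut_def all_links_dlinks)
  \<comment> \<open>The arrow f is fixed, whereas the expanded nets depend on an indexing; the two
    directions apply this to different indexings.\<close>
  have F: "\<exists>t G. transfers ?l I ?R [c] t G \<and> f = raw (L.inverse (nprg v0 A) \<bullet>
      nam (Unit (lin M)) (obj M v0 (neg A)) (t \<bullet> L.sym (Unit (lin M)) (obj M v0 (neg A))))" if ok: "indexed I ?R" for I
  proof -
    obtain t G where t: "raw t = g" "transfers ?l I ?R [c] t G" using transfer[OF c(3) w n ok] by blast
    have "raw (prg v0 A) = pairing M v0 A" by (simp add: prg_def)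
    then show ?thesis
      by (intro exI[of _ t] exI[of _ G] conjI) (use t f in \<open>simp_all add: transp_def Let_def L.raw_simps closed_raw\<close>)
  qed
  show ?thesis
  proof
    assume "in_L3 \<pi>"
    then obtain I0 where I0: "\<forall>l\<in>dlinks ?R. index_ok I0 l"
      by (auto simp: in_L3_def exponential_indexing_def all_links_dlinks)
    \<comment> \<open>Index 0 at the conclusion, to match \<open>involution k A 0\<close>.\<close>
    define I where "I = (\<lambda>e. I0 e - I0 c)"
    have I: "\<forall>l\<in>dlinks ?R. index_ok I l" "I c = 0" using I0 index_ok_shift by (auto simp: I_def)
    then have "indexed I ?R" "good_axioms I ?R" by (auto simp: indexed_def good_axioms_def)
    then obtain t G where t: "transfers ?l I ?R [c] t G" and ft: "f = raw (L.inverse (nprg v0 A) \<bullet>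
      nam (Unit (lin M)) (obj M v0 (neg A)) (t \<bullet> L.sym (Unit (lin M)) (obj M v0 (neg A))))"
      using F by blast
    show "f \<in> Hom (lin (Inv M)) (Unit (lin (Inv M))) (default_obj M \<Xi> (plus_form A))"
      unfolding ft morphism_iff[OF transposed(1-3)[OF t c(2) I(2)]] involution_fixed_iff[OF t c(2) I(2)]
      using trfD(4)[OF t \<open>good_axioms I ?R\<close>] by blast
  next
    assume h: "f \<in> Hom (lin (Inv M)) (Unit (lin (Inv M))) (default_obj M \<Xi> (plus_form A))"
    \<comment> \<open>This indexing exists for every cut-free sequentialized net; membership in L3
      is the question whether it also fits the axioms.\<close>
    obtain I where I: "I c = 0" "indexed I ?R" using ex_indexing[OF c(3) w n, of "\<lambda>_. 0"] by auto
    obtain t G where t: "transfers ?l I ?R [c] t G" and ft: "f = raw (L.inverse (nprg v0 A) \<bullet>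
      nam (Unit (lin M)) (obj M v0 (neg A)) (t \<bullet> L.sym (Unit (lin M)) (obj M v0 (neg A))))"
      using F[OF I(2)] by blast
    \<comment> \<open>Each single involution contributes one equation, for \<tau> = {k}; one
      well-chosen k will be enough.\<close>
    have eq: "G (\<lambda>i. i = k) = G none" for k
      using h unfolding ft morphism_iff[OF transposed(1-3)[OF t c(2) I(1)]] involution_fixed_iff[OF t c(2) I(1)] by blast
    have "I a = I b" if ab: "AxL a b \<in> dlinks ?R" for a b
    proof (rule ccontr)
      assume neq: "I a \<noteq> I b"
      obtain B where B: "?l b = Fm B" using dlinks_typed[OF w ab] by auto
      \<comment> \<open>Only at an atom can different indices of the two conclusions show up as a
        swap.\<close>
      then have "depths B \<noteq> {}" using assms(6) ab by (auto simp: depths_atoms all_links_dlinks)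
      then obtain d where d: "d \<in> depths B" by blast
      \<comment> \<open>At an atom of depth d the ends have the indices \<open>I a + d\<close> and
        \<open>I b + d\<close>; this \<tau> contains the second and, as the two differ, not the
        first.\<close>
      let ?\<tau> = "\<lambda>i. i = I b + d"
      have "bad_axiom B ?\<tau> (I a) (I b)" using d neq by (auto simp: bad_axiom_def)
      then have "has_bad_axiom ?\<tau> I ?l ?R" using ab B by (auto simp: has_bad_axiom_def)
      then show False using unsound_swaps[OF assms(2) t c(2) w n] eq by blast
    qed
    then have "index_ok I l" if "l \<in> dlinks ?R" for l
      using that I(2) by (cases "\<exists>a b. l = AxL a b") (auto simp: indexed_def)
    then have "exponential_indexing \<pi> I"
      using c(1) by (simp add: exponential_indexing_def all_links_dlinks)
    then show "in_L3 \<pi>" using assms(3) by (auto simp: in_L3_def)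
  qed
qed

end
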